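(* Let $\Bbbk$ be a field of characteristic zero, let $n\ge2$, $I_n=\{1,\dots,n\}$, let $p:I_n\to\mathbb{Z}_2$ be any function, and $p_{ij}:=p(i)+p(j)$. Let $\Bbbk[q^{\pm1},\mathbf{q}^{\pm1}]$ be the Laurent polynomial ring in $q$ and multiparameters $q_{i,j}$ described in the context, $\Bbbk(q,\mathbf{q})$ its field of fractions, and $q_s:=q^{(-1)^{p(s)}}$ for $s\in I_n$. (a) There exists a unique $\Bbbk[q^{\pm1},\mathbf{q}^{\pm1}]$-superbialgebra $F_{\mathbf{q}}^{\mathrm{int}}[ML_n^p]$ such that: (a.1) it is generated by $\{x_{ij}\mid i,j\in I_n\}$, with parity $|x_{ij}|=p_{ij}$, subject to the relations $$x_{ij}^2=0\quad(p_{ij}=\bar1),$$ $$x_{ij}x_{ik}=(-1)^{p_{ij}p_{ik}}\,q_i\,q_{j,k}^{-1}\,x_{ik}x_{ij}\quad(j<k),$$ $$x_{ij}x_{hj}=(-1)^{p_{ij}p_{hj}}\,q_j\,q_{i,h}\,x_{hj}x_{ij}\quad(i<h),$$ $$x_{ij}x_{hk}=(-1)^{p_{ij}p_{hk}}\,q_{i,h}\,q_{j,k}^{-1}\,x_{hk}x_{ij}\quad(i<h,\ j>k),$$ $$x_{ij}x_{hk}=(-1)^{p_{ij}p_{hk}}\,q_{i,h}\,q_{j,k}^{-1}\,x_{hk}x_{ij}+(-1)^{p_{ij}p_{ik}}\,(q_i-q_i^{-1})\,q_{j,k}^{-1}\,x_{ik}x_{hj}\quad(i<h,\ j<k);$$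 (a.2) its coproduct and counit are given on generators by $$\Delta(x_{ij})=\sum_{a=1}^n(-1)^{p_{ia}p_{aj}}\,x_{ia}\otimes x_{aj},\qquad\epsilon(x_{ij})=\delta_{ij}\qquad\forall\,i,j\in I_n.$$ (b) Let $F_{\mathbf{q}}[ML_n^p]:=\Bbbk(q,\mathbf{q})\otimes_{\Bbbk[q^{\pm1},\mathbf{q}^{\pm1}]}F_{\mathbf{q}}^{\mathrm{int}}[ML_n^p]$. Then the analogue of (a) holds with $\Bbbk(q,\mathbf{q})$ replacing $\Bbbk[q^{\pm1},\mathbf{q}^{\pm1}]$ and $F_{\mathbf{q}}[ML_n^p]$ replacing $F_{\mathbf{q}}^{\mathrm{int}}[ML_n^p]$.
   Context: "Super" means $\mathbb{Z}_2$-graded, with $\mathbb{Z}_2=\{\bar0,\bar1\}$; tensor products of superalgebras have product $(a\otimes b)(c\otimes d)=(-1)^{|b||c|}ac\otimes bd$, and in a superbialgebra $\Delta$ and $\epsilon$ are morphisms of superalgebras. Parameters: $q$ and $q_{i,j}$ ($1\le i<j\le n$) are independent indeterminates, and the matrix $\mathbf{q}=(q_{i,j})_{i,j\in I_n}$ is multiplicatively antisymmetric, i.e. $q_{i,i}:=1$ and $q_{j,i}:=q_{i,j}^{-1}$ for $i<j$. Then $\Bbbk[q^{\pm1},\mathbf{q}^{\pm1}]$ is the $\Bbbk$-algebra of Laurent polynomials in $q$ and the $q_{i,j}$ ($i<j$), with field of fractions $\Bbbk(q,\mathbf{q})$. Single-index symbols $q_s$ denote $q^{(-1)^{p(s)}}$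 and are not to be confused with $q_{i,j}$. *)

theory Defs
  imports
    "HOL-Algebra.Algebra"
    "HOL-Algebra.Algebraic_Closure_Type"
    "HOL-Library.Poly_Mapping"
    "HOL-Library.Cardinality"
    "HOL-Library.Z2"
    "HOL-Computational_Algebra.Fraction_Field"
begin

section \<open>Laurent polynomials in the multiparameters\<close>

text \<open>
  The index set \<open>I_n\<close> is a finite linearly ordered type \<open>'n\<close>. The indeterminates are \<open>q\<close>
  (encoded as \<open>None\<close>) and \<open>q_{i,j}\<close> for \<open>i < j\<close> (encoded as \<open>Some (i, j)\<close>).
\<close>

typedef (overloaded) ('n :: linorder) qvar = "insert None {Some (i, j) | i j :: 'n. i < j}"
  by blast

text \<open>The order on the indeterminates is only needed by the library to see that Laurent
  polynomials form an integral domain.\<close>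

instantiation qvar :: (linorder) linorder
begin

definition less_eq_qvar :: "'a qvar \<Rightarrow> 'a qvar \<Rightarrow> bool" where
  "x \<le> y \<longleftrightarrow> (case (Rep_qvar x, Rep_qvar y) of
     (None, _) \<Rightarrow> True
   | (Some _, None) \<Rightarrow> False
   | (Some (i, j), Some (h, k)) \<Rightarrow> i < h \<or> i = h \<and> j \<le> k)"

definition less_qvar :: "'a qvar \<Rightarrow> 'a qvar \<Rightarrow> bool" where
  "x < y \<longleftrightarrow> x \<le> y \<and> \<not> y \<le> (x :: 'a qvar)"

instance
proof
  fix x y z :: "'a qvar"
  show "x < y \<longleftrightarrow> x \<le> y \<and> \<not> y \<le> x"
    by (rule less_qvar_def)
  show "x \<le> x" "x \<le> y \<or> y \<le> x"
    by (auto simp: less_eq_qvar_def split: option.splits prod.splits)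
  show "x \<le> z" if "x \<le> y" "y \<le> z"
    using that by (auto simp: less_eq_qvar_def split: option.splits prod.splits)
  show "x = y" if "x \<le> y" "y \<le> x"
    using that by (auto simp: less_eq_qvar_def simp flip: Rep_qvar_inject
        split: option.splits prod.splits)
qed

end

text \<open>The ring \<open>k[q^{\<plusminus>1}, q_{i,j}^{\<plusminus>1}]\<close> is the group algebra over \<open>k\<close> of the free abelian
  group (written additively) on the indeterminates.\<close>

type_synonym ('n, 'k) laurent = "('n qvar \<Rightarrow>\<^sub>0 int) \<Rightarrow>\<^sub>0 'k"

definition laurent_var :: "'n::linorder qvar \<Rightarrow> int \<Rightarrow> ('n, 'k::field) laurent" where
  "laurent_var v e = Poly_Mapping.single (Poly_Mapping.single v e) 1"

definition q_par :: "('n::linorder, 'k::field) laurent" where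
  "q_par = laurent_var (Abs_qvar None) 1"

definition qij_par :: "'n::linorder \<Rightarrow> 'n \<Rightarrow> ('n, 'k::field) laurent" where
  "qij_par i j =
    (if i < j then laurent_var (Abs_qvar (Some (i, j))) 1
     else if j < i then laurent_var (Abs_qvar (Some (j, i))) (-1)
     else 1)"

definition laurent_ring :: "('n::linorder, 'k::field) laurent ring" where
  "laurent_ring = ring_of_type_algebra"

definition laurent_field :: "('n::linorder, 'k::field) laurent fract ring" where
  "laurent_field = ring_of_type_algebra"

definition laurent_incl :: "('n::linorder, 'k::field) laurent \<Rightarrow> ('n, 'k) laurent fract" where
  "laurent_incl f = Fract f 1"


section \<open>Free modules and free algebras\<close>

text \<open>For modules the ring fields \<open>mult\<close> and \<open>one\<close> of the record are irrelevant.\<close>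

definition free_module :: "('r, 'm) ring_scheme \<Rightarrow> 'x set \<Rightarrow> ('r, 'x \<Rightarrow> 'r) module" where
  "free_module R G =
    \<lparr>carrier = {f. (\<forall>x. f x \<in> carrier R) \<and> (\<forall>x. x \<notin> G \<longrightarrow> f x = \<zero>\<^bsub>R\<^esub>) \<and>
      finite {x. f x \<noteq> \<zero>\<^bsub>R\<^esub>}},
     monoid.mult = undefined, one = undefined,
     ring.zero = (\<lambda>_. \<zero>\<^bsub>R\<^esub>), add = (\<lambda>f g x. f x \<oplus>\<^bsub>R\<^esub> g x),
     module.smult = (\<lambda>r f x. r \<otimes>\<^bsub>R\<^esub> f x)\<rparr>"

definition basis_elt :: "('r, 'm) ring_scheme \<Rightarrow> 'x \<Rightarrow> 'x \<Rightarrow> 'r" where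
  "basis_elt R x = (\<lambda>y. if y = x then \<one>\<^bsub>R\<^esub> else \<zero>\<^bsub>R\<^esub>)"

definition lin_ext ::
  "('r, 'm) ring_scheme \<Rightarrow> ('r, 'a, 'l) module_scheme \<Rightarrow> ('x \<Rightarrow> 'a) \<Rightarrow> ('x \<Rightarrow> 'r) \<Rightarrow> 'a" where
  "lin_ext R M h f = (\<Oplus>\<^bsub>M\<^esub>x\<in>{x. f x \<noteq> \<zero>\<^bsub>R\<^esub>}. f x \<odot>\<^bsub>M\<^esub> h x)"

definition free_algebra :: "('r, 'm) ring_scheme \<Rightarrow> 'x set \<Rightarrow> ('r, 'x list \<Rightarrow> 'r) module" where
  "free_algebra R G = (free_module R (lists G))
    \<lparr>monoid.mult := (\<lambda>f g w. \<Oplus>\<^bsub>R\<^esub>i\<in>{..length w}. f (take i w) \<otimes>\<^bsub>R\<^esub> g (drop i w)),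
     one := basis_elt R []\<rparr>"

text \<open>The algebra homomorphism from the free algebra that sends the generator \<open>i\<close> to \<open>x i\<close>.\<close>

definition free_eval ::
  "('r, 'm) ring_scheme \<Rightarrow> ('r, 'a, 'l) module_scheme \<Rightarrow> ('x \<Rightarrow> 'a) \<Rightarrow> ('x list \<Rightarrow> 'r) \<Rightarrow> 'a" where
  "free_eval R A x = lin_ext R A (\<lambda>w. foldr (\<lambda>i a. x i \<otimes>\<^bsub>A\<^esub> a) w \<one>\<^bsub>A\<^esub>)"

text \<open>\<open>A\<close> is generated by the \<open>x i\<close>, \<open>i \<in> G\<close>, subject to the relations \<open>l = r\<close> for
  \<open>(l, r) \<in> rels\<close>.\<close>

definition presented_by ::
  "('r, 'm) ring_scheme \<Rightarrow> ('r, 'a, 'l) module_scheme \<Rightarrow> 'x set \<Rightarrow> ('x \<Rightarrow> 'a)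
    \<Rightarrow> (('x list \<Rightarrow> 'r) \<times> ('x list \<Rightarrow> 'r)) set \<Rightarrow> bool" where
  "presented_by R A G x rels \<longleftrightarrow>
    (let F = free_algebra R G in
      x ` G \<subseteq> carrier A \<and>
      free_eval R A x ` carrier F = carrier A \<and>
      a_kernel F A (free_eval R A x) = genideal F {l \<ominus>\<^bsub>F\<^esub> r | l r. (l, r) \<in> rels})"


section \<open>Tensor products of modules\<close>

definition tensor_free ::
  "('r, 'm) ring_scheme \<Rightarrow> ('r, 'a, 'l) module_scheme \<Rightarrow> ('r, 'b, 'k) module_scheme
    \<Rightarrow> ('r, 'a \<times> 'b \<Rightarrow> 'r) module" where
  "tensor_free R A B = free_module R (carrier A \<times> carrier B)"

definition tensor_null ::
  "('r, 'm) ring_scheme \<Rightarrow> ('r, 'a, 'l) module_scheme \<Rightarrow> ('r, 'b, 'k) module_scheme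
    \<Rightarrow> ('a \<times> 'b \<Rightarrow> 'r) set" where
  "tensor_null R A B =
    (let P = tensor_free R A B; e = (\<lambda>a b. basis_elt R (a, b)) in
      (\<lambda>H. submodule H R P) hull
       ({e (a \<oplus>\<^bsub>A\<^esub> a') b \<ominus>\<^bsub>P\<^esub> (e a b \<oplus>\<^bsub>P\<^esub> e a' b) | a a' b.
           a \<in> carrier A \<and> a' \<in> carrier A \<and> b \<in> carrier B} \<union>
        {e a (b \<oplus>\<^bsub>B\<^esub> b') \<ominus>\<^bsub>P\<^esub> (e a b \<oplus>\<^bsub>P\<^esub> e a b') | a b b'.
           a \<in> carrier A \<and> b \<in> carrier B \<and> b' \<in> carrier B} \<union>
        {e (r \<odot>\<^bsub>A\<^esub> a) b \<ominus>\<^bsub>P\<^esub> r \<odot>\<^bsub>P\<^esub> e a b | r a b.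
           r \<in> carrier R \<and> a \<in> carrier A \<and> b \<in> carrier B} \<union>
        {e a (r \<odot>\<^bsub>B\<^esub> b) \<ominus>\<^bsub>P\<^esub> r \<odot>\<^bsub>P\<^esub> e a b | r a b.
           r \<in> carrier R \<and> a \<in> carrier A \<and> b \<in> carrier B}))"

definition tensor_module ::
  "('r, 'm) ring_scheme \<Rightarrow> ('r, 'a, 'l) module_scheme \<Rightarrow> ('r, 'b, 'k) module_scheme
    \<Rightarrow> ('r, ('a \<times> 'b \<Rightarrow> 'r) set) module" where
  "tensor_module R A B =
    (let P = tensor_free R A B; N = tensor_null R A B in
      \<lparr>carrier = a_rcosets\<^bsub>P\<^esub> N,
       monoid.mult = undefined, one = undefined,
       ring.zero = N, add = set_add P,
       module.smult = (\<lambda>r U. \<Union>f\<in>U. N +>\<^bsub>P\<^esub> (r \<odot>\<^bsub>P\<^esub> f))\<rparr>)"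

definition tens ::
  "('r, 'm) ring_scheme \<Rightarrow> ('r, 'a, 'l) module_scheme \<Rightarrow> ('r, 'b, 'k) module_scheme
    \<Rightarrow> 'a \<Rightarrow> 'b \<Rightarrow> ('a \<times> 'b \<Rightarrow> 'r) set" where
  "tens R A B a b = tensor_null R A B +>\<^bsub>tensor_free R A B\<^esub> basis_elt R (a, b)"

text \<open>For \<open>R\<close>-bilinear \<open>h\<close> into \<open>M\<close>, this is the \<open>R\<close>-linear map \<open>a \<otimes> b \<mapsto> h (a, b)\<close>; the value
  does not depend on the chosen representative. It is only used for bilinear \<open>h\<close>.\<close>

definition tens_lift ::
  "('r, 'm) ring_scheme \<Rightarrow> ('r, 'c, 'l) module_scheme \<Rightarrow> ('a \<times> 'b \<Rightarrow> 'c)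
    \<Rightarrow> ('a \<times> 'b \<Rightarrow> 'r) set \<Rightarrow> 'c" where
  "tens_lift R M h U = lin_ext R M h (SOME f. f \<in> U)"

text \<open>\<open>tens_map R C D f g\<close> is the map \<open>f \<otimes> g\<close> with values in \<open>C \<otimes> D\<close>. It carries no sign: all
  maps occurring here are even.\<close>

definition tens_map ::
  "('r, 'm) ring_scheme \<Rightarrow> ('r, 'c, 'l) module_scheme \<Rightarrow> ('r, 'd, 'k) module_scheme
    \<Rightarrow> ('a \<Rightarrow> 'c) \<Rightarrow> ('b \<Rightarrow> 'd) \<Rightarrow> ('a \<times> 'b \<Rightarrow> 'r) set \<Rightarrow> ('c \<times> 'd \<Rightarrow> 'r) set" where
  "tens_map R C D f g =
    tens_lift R (tensor_module R C D) (\<lambda>(a, b). tens R C D (f a) (g b))"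

text \<open>The canonical map from \<open>(A \<otimes> B) \<otimes> C\<close> to \<open>A \<otimes> (B \<otimes> C)\<close>.\<close>

definition tens_assoc ::
  "('r, 'm) ring_scheme \<Rightarrow> ('r, 'a, 'k) module_scheme \<Rightarrow> ('r, 'b, 'l) module_scheme
    \<Rightarrow> ('r, 'c, 'o) module_scheme
    \<Rightarrow> (('a \<times> 'b \<Rightarrow> 'r) set \<times> 'c \<Rightarrow> 'r) set \<Rightarrow> ('a \<times> ('b \<times> 'c \<Rightarrow> 'r) set \<Rightarrow> 'r) set" where
  "tens_assoc R A B C =
    (let BC = tensor_module R B C; T = tensor_module R A BC in
      tens_lift R T
        (\<lambda>(t, c). tens_lift R T (\<lambda>(a, b). tens R A BC a (tens R B C b c)) t))"


section \<open>Superalgebras\<close>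

record ('r, 'a) superalg = "('r, 'a) module" +
  part :: "bit \<Rightarrow> 'a set"

locale superalgebra = R?: cring R + module R A + A?: ring A
  for R :: "('r, 'm) ring_scheme" (structure)
    and A :: "('r, 'a, 'l) superalg_scheme" (structure) +
  assumes smult_mult_left:
      "\<lbrakk>r \<in> carrier R; x \<in> carrier A; y \<in> carrier A\<rbrakk> \<Longrightarrow>
        (r \<odot>\<^bsub>A\<^esub> x) \<otimes>\<^bsub>A\<^esub> y = r \<odot>\<^bsub>A\<^esub> (x \<otimes>\<^bsub>A\<^esub> y)"
    and smult_mult_right:
      "\<lbrakk>r \<in> carrier R; x \<in> carrier A; y \<in> carrier A\<rbrakk> \<Longrightarrow>
        x \<otimes>\<^bsub>A\<^esub> (r \<odot>\<^bsub>A\<^esub> y) = r \<odot>\<^bsub>A\<^esub> (x \<otimes>\<^bsub>A\<^esub> y)"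
    and part_submodule: "submodule (part A s) R A"
    and part_direct_sum:
      "x \<in> carrier A \<Longrightarrow> \<exists>!c. c \<in> part A 0 \<times> part A 1 \<and> x = fst c \<oplus>\<^bsub>A\<^esub> snd c"
    and part_one: "\<one>\<^bsub>A\<^esub> \<in> part A 0"
    and part_mult: "\<lbrakk>x \<in> part A s; y \<in> part A t\<rbrakk> \<Longrightarrow> x \<otimes>\<^bsub>A\<^esub> y \<in> part A (s + t)"

text \<open>The homogeneous component of parity \<open>s\<close>; the other parity is \<open>s + 1\<close>.\<close>

definition component :: "('r, 'a, 'l) superalg_scheme \<Rightarrow> bit \<Rightarrow> 'a \<Rightarrow> 'a" where
  "component A s x = (THE u. u \<in> part A s \<and> (\<exists>v\<in>part A (s + 1). x = u \<oplus>\<^bsub>A\<^esub> v))"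

definition parity_sign :: "('r, 'm) ring_scheme \<Rightarrow> bit \<Rightarrow> 'r" where
  "parity_sign R s = (if s = 0 then \<one>\<^bsub>R\<^esub> else \<ominus>\<^bsub>R\<^esub> \<one>\<^bsub>R\<^esub>)"

definition superalg_hom ::
  "('r, 'm) ring_scheme \<Rightarrow> ('r, 'a, 'k) superalg_scheme \<Rightarrow> ('r, 'b, 'l) superalg_scheme
    \<Rightarrow> ('a \<Rightarrow> 'b) set" where
  "superalg_hom R A B =
    {f \<in> ring_hom A B.
      (\<forall>r\<in>carrier R. \<forall>x\<in>carrier A. f (r \<odot>\<^bsub>A\<^esub> x) = r \<odot>\<^bsub>B\<^esub> f x) \<and>
      (\<forall>s. f ` part A s \<subseteq> part B s)}"

text \<open>The product below extends \<open>(a \<otimes> b) (c \<otimes> d) = (-1)^{|b||c|} ac \<otimes> bd\<close> from homogeneous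
  \<open>b\<close>, \<open>c\<close> to all elements; \<open>s\<close> and \<open>t\<close> are the parities of the components of \<open>b\<close> and \<open>c\<close>.\<close>

definition tensor_superalg ::
  "('r, 'm) ring_scheme \<Rightarrow> ('r, 'a, 'k) superalg_scheme \<Rightarrow> ('r, 'b, 'l) superalg_scheme
    \<Rightarrow> ('r, ('a \<times> 'b \<Rightarrow> 'r) set) superalg" where
  "tensor_superalg R A B =
    (let T = tensor_module R A B in
      \<lparr>carrier = carrier T,
       monoid.mult = (\<lambda>U V. tens_lift R T (\<lambda>(a, b). tens_lift R T (\<lambda>(c, d).
          \<Oplus>\<^bsub>T\<^esub>s\<in>UNIV. \<Oplus>\<^bsub>T\<^esub>t\<in>UNIV. parity_sign R (s * t) \<odot>\<^bsub>T\<^esub>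
            tens R A B (a \<otimes>\<^bsub>A\<^esub> component A t c) (component B s b \<otimes>\<^bsub>B\<^esub> d)) V) U),
       one = tens R A B \<one>\<^bsub>A\<^esub> \<one>\<^bsub>B\<^esub>,
       ring.zero = ring.zero T, add = add T, module.smult = module.smult T,
       part = (\<lambda>s. (\<lambda>H. submodule H R T) hull
          {tens R A B a b | a b t u. a \<in> part A t \<and> b \<in> part B u \<and> t + u = s})\<rparr>)"

text \<open>A ring \<open>S\<close>, concentrated in even degree, as a superalgebra over the source of a ring
  homomorphism \<open>\<phi>\<close> into \<open>S\<close>.\<close>

definition ring_superalg :: "('r \<Rightarrow> 's) \<Rightarrow> ('s, 'm) ring_scheme \<Rightarrow> ('r, 's) superalg" where
  "ring_superalg \<phi> S =
    \<lparr>carrier = carrier S, monoid.mult = monoid.mult S, one = one S,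
     ring.zero = ring.zero S, add = add S,
     module.smult = (\<lambda>r s. \<phi> r \<otimes>\<^bsub>S\<^esub> s),
     part = (\<lambda>s. if s = 0 then carrier S else {\<zero>\<^bsub>S\<^esub>})\<rparr>"


section \<open>Superbialgebras\<close>

record ('r, 'a) superbialg = "('r, 'a) superalg" +
  coproduct :: "'a \<Rightarrow> ('a \<times> 'a \<Rightarrow> 'r) set"
  counit :: "'a \<Rightarrow> 'r"

locale superbialgebra = superalgebra R A
  for R :: "('r, 'm) ring_scheme" (structure)
    and A :: "('r, 'a, 'l) superbialg_scheme" (structure) +
  assumes coproduct_hom: "coproduct A \<in> superalg_hom R A (tensor_superalg R A A)"
    and counit_hom: "counit A \<in> superalg_hom R A (ring_superalg id R)"
    and coassoc:
      "x \<in> carrier A \<Longrightarrow>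
        tens_assoc R A A A
          (tens_map R (tensor_module R A A) A (coproduct A) id (coproduct A x)) =
        tens_map R A (tensor_module R A A) id (coproduct A) (coproduct A x)"
    and counit_left:
      "x \<in> carrier A \<Longrightarrow>
        tens_lift R A (\<lambda>(a, b). counit A a \<odot>\<^bsub>A\<^esub> b) (coproduct A x) = x"
    and counit_right:
      "x \<in> carrier A \<Longrightarrow>
        tens_lift R A (\<lambda>(a, b). counit A b \<odot>\<^bsub>A\<^esub> a) (coproduct A x) = x"

definition superbialg_iso ::
  "('r, 'm) ring_scheme \<Rightarrow> ('r, 'a, 'k) superbialg_scheme \<Rightarrow> ('r, 'b, 'l) superbialg_scheme
    \<Rightarrow> ('a \<Rightarrow> 'b) set" where
  "superbialg_iso R A B =
    {f \<in> superalg_hom R A B.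
      bij_betw f (carrier A) (carrier B) \<and>
      (\<forall>x\<in>carrier A. coproduct B (f x) = tens_map R B B f f (coproduct A x)) \<and>
      (\<forall>x\<in>carrier A. counit B (f x) = counit A x)}"


section \<open>Extension of scalars\<close>

definition restrict_scalars ::
  "('r \<Rightarrow> 's) \<Rightarrow> ('s, 'a, 'm) module_scheme \<Rightarrow> ('r, 'a) module" where
  "restrict_scalars \<phi> M =
    \<lparr>carrier = carrier M, monoid.mult = monoid.mult M, one = one M,
     ring.zero = ring.zero M, add = add M,
     module.smult = (\<lambda>r. module.smult M (\<phi> r))\<rparr>"

definition ext_superalg ::
  "('r, 'm) ring_scheme \<Rightarrow> ('s, 'l) ring_scheme \<Rightarrow> ('r \<Rightarrow> 's)
    \<Rightarrow> ('r, 'a, 'k) superalg_scheme \<Rightarrow> ('s, ('s \<times> 'a \<Rightarrow> 'r) set) superalg" where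
  "ext_superalg R S \<phi> A =
    (let S' = ring_superalg \<phi> S; T = tensor_superalg R S' A in
      \<lparr>carrier = carrier T, monoid.mult = monoid.mult T, one = one T,
       ring.zero = ring.zero T, add = add T,
       module.smult = (\<lambda>s. tens_lift R T (\<lambda>(k, a). tens R S' A (s \<otimes>\<^bsub>S\<^esub> k) a)),
       part = part T\<rparr>)"

text \<open>The superbialgebra \<open>S \<otimes>_R A\<close> over \<open>S\<close>. Its coproduct sends \<open>k \<otimes> a\<close> to
  \<open>\<Sum> k ((1 \<otimes> a') \<otimes> (1 \<otimes> a''))\<close>, where \<open>\<Sum> a' \<otimes> a''\<close> is the coproduct of \<open>a\<close>, and its counit
  sends \<open>k \<otimes> a\<close> to \<open>k \<phi>(\<epsilon>(a))\<close>.\<close>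

definition ext_superbialg ::
  "('r, 'm) ring_scheme \<Rightarrow> ('s, 'l) ring_scheme \<Rightarrow> ('r \<Rightarrow> 's)
    \<Rightarrow> ('r, 'a, 'k) superbialg_scheme \<Rightarrow> ('s, ('s \<times> 'a \<Rightarrow> 'r) set) superbialg" where
  "ext_superbialg R S \<phi> A =
    (let S' = ring_superalg \<phi> S;
         B = ext_superalg R S \<phi> A;
         BB = tensor_module S B B;
         i = tens R S' A \<one>\<^bsub>S\<^esub>
     in
      \<lparr>carrier = carrier B, monoid.mult = monoid.mult B, one = one B,
       ring.zero = ring.zero B, add = add B,
       module.smult = module.smult B, part = part B,
       coproduct = tens_lift R (restrict_scalars \<phi> BB)
         (\<lambda>(k, a). tens_lift R (restrict_scalars \<phi> BB)
            (\<lambda>(c, d). k \<odot>\<^bsub>BB\<^esub> tens S B B (i c) (i d)) (coproduct A a)),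
       counit = tens_lift R S' (\<lambda>(k, a). k \<otimes>\<^bsub>S\<^esub> \<phi> (counit A a))\<rparr>)"


section \<open>Multiparameter quantum supermatrices\<close>

definition pdeg :: "('n \<Rightarrow> bit) \<Rightarrow> 'n \<Rightarrow> 'n \<Rightarrow> bit" where
  "pdeg p i j = p i + p j"

definition q_single :: "('r, 'm) ring_scheme \<Rightarrow> ('n \<Rightarrow> bit) \<Rightarrow> 'r \<Rightarrow> 'n \<Rightarrow> 'r" where
  "q_single R p q s = (if p s = 0 then q else inv\<^bsub>R\<^esub> q)"

definition qmat_relations ::
  "('r, 'm) ring_scheme \<Rightarrow> ('n::linorder \<Rightarrow> bit) \<Rightarrow> 'r \<Rightarrow> ('n \<Rightarrow> 'n \<Rightarrow> 'r)
    \<Rightarrow> ((('n \<times> 'n) list \<Rightarrow> 'r) \<times> (('n \<times> 'n) list \<Rightarrow> 'r)) set" where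
  "qmat_relations R p q Q =
    (let F = free_algebra R UNIV;
         g = (\<lambda>i j. basis_elt R [(i, j)]);
         d = pdeg p;
         sg = parity_sign R;
         qs = q_single R p q
     in
      {(g i j \<otimes>\<^bsub>F\<^esub> g i j, \<zero>\<^bsub>F\<^esub>) | i j. d i j = 1} \<union>
      {(g i j \<otimes>\<^bsub>F\<^esub> g i k,
        (sg (d i j * d i k) \<otimes>\<^bsub>R\<^esub> qs i \<otimes>\<^bsub>R\<^esub> inv\<^bsub>R\<^esub> Q j k) \<odot>\<^bsub>F\<^esub> (g i k \<otimes>\<^bsub>F\<^esub> g i j))
        | i j k. j < k} \<union>
      {(g i j \<otimes>\<^bsub>F\<^esub> g h j,
        (sg (d i j * d h j) \<otimes>\<^bsub>R\<^esub> qs j \<otimes>\<^bsub>R\<^esub> Q i h) \<odot>\<^bsub>F\<^esub> (g h j \<otimes>\<^bsub>F\<^esub> g i j))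
        | i h j. i < h} \<union>
      {(g i j \<otimes>\<^bsub>F\<^esub> g h k,
        (sg (d i j * d h k) \<otimes>\<^bsub>R\<^esub> Q i h \<otimes>\<^bsub>R\<^esub> inv\<^bsub>R\<^esub> Q j k) \<odot>\<^bsub>F\<^esub> (g h k \<otimes>\<^bsub>F\<^esub> g i j))
        | i h j k. i < h \<and> k < j} \<union>
      {(g i j \<otimes>\<^bsub>F\<^esub> g h k,
        (sg (d i j * d h k) \<otimes>\<^bsub>R\<^esub> Q i h \<otimes>\<^bsub>R\<^esub> inv\<^bsub>R\<^esub> Q j k) \<odot>\<^bsub>F\<^esub> (g h k \<otimes>\<^bsub>F\<^esub> g i j) \<oplus>\<^bsub>F\<^esub>
        (sg (d i j * d i k) \<otimes>\<^bsub>R\<^esub> (qs i \<ominus>\<^bsub>R\<^esub> inv\<^bsub>R\<^esub> qs i) \<otimes>\<^bsub>R\<^esub> inv\<^bsub>R\<^esub> Q j k) \<odot>\<^bsub>F\<^esub>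
          (g i k \<otimes>\<^bsub>F\<^esub> g h j))
        | i h j k. i < h \<and> j < k})"

text \<open>\<open>A\<close> is an \<open>R\<close>-superbialgebra presented by the above relations, with generators \<open>x (i, j)\<close> and
  parameters \<open>q\<close> and \<open>Q i j\<close> in \<open>R\<close>.\<close>

locale qmat_superbialgebra = superbialgebra R A
  for R :: "('r, 'm) ring_scheme" (structure)
    and p :: "'n::{finite,linorder} \<Rightarrow> bit"
    and q :: 'r
    and Q :: "'n \<Rightarrow> 'n \<Rightarrow> 'r"
    and A :: "('r, 'a, 'l) superbialg_scheme" (structure)
    and x :: "'n \<times> 'n \<Rightarrow> 'a" +
  assumes presentation: "presented_by R A UNIV x (qmat_relations R p q Q)"
    and gen_parity: "x (i, j) \<in> part A (pdeg p i j)"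
    and gen_coproduct:
      "coproduct A (x (i, j)) =
        (\<Oplus>\<^bsub>tensor_module R A A\<^esub>a\<in>UNIV.
           parity_sign R (pdeg p i a * pdeg p a j) \<odot>\<^bsub>tensor_module R A A\<^esub>
             tens R A A (x (i, a)) (x (a, j)))"
    and gen_counit: "counit A (x (i, j)) = (if i = j then \<one>\<^bsub>R\<^esub> else \<zero>\<^bsub>R\<^esub>)"

end

theory Submission
  imports Defs
begin

text \<open>
  Every algebra with this presentation receives a unique homomorphism for each solution of the
  defining relations, so the coproduct and the counit exist as soon as the elements
  \<open>\<Sum>\<^sub>a \<plusminus> x_{ia} \<otimes> x_{aj}\<close> and the scalars \<open>\<delta>_{ij}\<close> satisfy the relations. For the former, a product of two
  such elements is a double sum over \<open>(a, b)\<close>. Each relation already holds between the summands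
  for \<open>(a, b)\<close> and \<open>(b, a)\<close>: after both tensor factors are written in two
  quadratic monomials, it becomes at most four scalar identities in \<open>q\<close>, the \<open>q_{i,j}\<close> and the
  parities of six indices. Coassociativity, counitality and uniqueness are equalities of
  homomorphisms, hence can be read off on generators.

  For the extension of scalars, the kernel of the evaluation map must not be larger than the ideal of
  relations over the big ring. The algebra presented over the big ring is, by restriction of scalars,
  a solution of the relations over the small ring; the resulting homomorphism
  extends to \<open>S \<otimes>\<^sub>R A\<close> and detects the kernel. No property of localisations is used, only a ring
  homomorphism.
\<close>

section \<open>Linear and bilinear maps\<close>

text \<open>A tensor product is a set of cosets, maps out of it pick a representative, and its
  homogeneous parts are hulls, so an element of given parity is in general not a pure tensor.
  Identities are therefore proved on pure tensors and carried further because equalizers of linear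
  maps, and preimages of submodules, are submodules. The same module also occurs under several
  record types (\<open>tensor_module\<close>, \<open>tensor_superalg\<close>, extended records),
  which is why \<open>same_module\<close>, \<open>same_algebra\<close> and
  \<open>same_superalg\<close> exist. The presented algebra has a grading only because its relations
  are homogeneous: the generated ideal then contains the components of its elements. The pairs
  \<open>(a, b)\<close> and \<open>(b, a)\<close> do not mix with others, since rewriting a
  quadratic monomial never changes its set of rows or its set of columns. The inverse of
  \<open>q\<close> is a named element \<open>q'\<close> and the inverse of \<open>Q i j\<close> is
  \<open>Q j i\<close>; scalar identities are thus polynomial and hold over any commutative ring
  containing such elements, so that one argument serves both the Laurent ring and its fraction
  field.\<close>

definition module_map ::
  "('r, 'm) ring_scheme \<Rightarrow> ('r, 'a, 'l) module_scheme \<Rightarrow> ('r, 'b, 'k) module_scheme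
    \<Rightarrow> ('a \<Rightarrow> 'b) \<Rightarrow> bool" where
  "module_map R M N f \<longleftrightarrow> f \<in> carrier M \<rightarrow> carrier N \<and>
     (\<forall>x\<in>carrier M. \<forall>y\<in>carrier M. f (x \<oplus>\<^bsub>M\<^esub> y) = f x \<oplus>\<^bsub>N\<^esub> f y) \<and>
     (\<forall>r\<in>carrier R. \<forall>x\<in>carrier M. f (r \<odot>\<^bsub>M\<^esub> x) = r \<odot>\<^bsub>N\<^esub> f x)"

lemma module_mapI:
  assumes "\<And>x. x \<in> carrier M \<Longrightarrow> f x \<in> carrier N"
    and "\<And>x y. x \<in> carrier M \<Longrightarrow> y \<in> carrier M \<Longrightarrow> f (x \<oplus>\<^bsub>M\<^esub> y) = f x \<oplus>\<^bsub>N\<^esub> f y"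
    and "\<And>r x. r \<in> carrier R \<Longrightarrow> x \<in> carrier M \<Longrightarrow> f (r \<odot>\<^bsub>M\<^esub> x) = r \<odot>\<^bsub>N\<^esub> f x"
  shows "module_map R M N f"
  using assms by (auto simp: module_map_def)

lemma module_map_closed: "module_map R M N f \<Longrightarrow> x \<in> carrier M \<Longrightarrow> f x \<in> carrier N"
  by (auto simp: module_map_def)

lemma module_map_add:
  "module_map R M N f \<Longrightarrow> x \<in> carrier M \<Longrightarrow> y \<in> carrier M \<Longrightarrow> f (x \<oplus>\<^bsub>M\<^esub> y) = f x \<oplus>\<^bsub>N\<^esub> f y"
  by (auto simp: module_map_def)

lemma module_map_smult:
  "module_map R M N f \<Longrightarrow> r \<in> carrier R \<Longrightarrow> x \<in> carrier M \<Longrightarrow> f (r \<odot>\<^bsub>M\<^esub> x) = r \<odot>\<^bsub>N\<^esub> f x"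
  by (auto simp: module_map_def)

lemma module_map_zero:
  assumes "module_map R M N f" "module R M" "module R N"
  shows "f \<zero>\<^bsub>M\<^esub> = \<zero>\<^bsub>N\<^esub>"
proof -
  interpret M: module R M by fact
  interpret N: module R N by fact
  have "f (\<zero>\<^bsub>R\<^esub> \<odot>\<^bsub>M\<^esub> \<zero>\<^bsub>M\<^esub>) = \<zero>\<^bsub>R\<^esub> \<odot>\<^bsub>N\<^esub> f \<zero>\<^bsub>M\<^esub>"
    using module_map_smult[OF assms(1)] by blast
  then show ?thesis
    using module_map_closed[OF assms(1), of "\<zero>\<^bsub>M\<^esub>"] by simp
qed

text \<open>Negation becomes a scalar multiple, so the two equational clauses of
  \<open>module_map\<close> already give compatibility with differences.\<close>

lemma (in module) a_inv_eq_smult: "x \<in> carrier M \<Longrightarrow> \<ominus>\<^bsub>M\<^esub> x = (\<ominus> \<one>) \<odot>\<^bsub>M\<^esub> x"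
  by (simp add: smult_l_minus)

lemma (in module) minus_eq_zero_iff:
  "x \<in> carrier M \<Longrightarrow> y \<in> carrier M \<Longrightarrow> x \<ominus>\<^bsub>M\<^esub> y = \<zero>\<^bsub>M\<^esub> \<longleftrightarrow> x = y"
  using M.add.inv_closed M.add.inv_solve_right[of "\<zero>\<^bsub>M\<^esub>" x y]
  by (auto simp: a_minus_def a_inv_def[symmetric])

lemma module_map_minus:
  assumes "module_map R M N f" "module R M" "module R N" "x \<in> carrier M" "y \<in> carrier M"
  shows "f (x \<ominus>\<^bsub>M\<^esub> y) = f x \<ominus>\<^bsub>N\<^esub> f y"
proof -
  interpret M: module R M by fact
  interpret N: module R N by fact
  show ?thesis
    using assms(4,5)
    by (simp add: a_minus_def M.a_inv_eq_smult N.a_inv_eq_smult module_map_closed[OF assms(1)]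
        module_map_add[OF assms(1)] module_map_smult[OF assms(1)])
qed

lemma module_map_finsum:
  assumes "module_map R M N f" "module R M" "module R N" "g \<in> I \<rightarrow> carrier M"
  shows "f (\<Oplus>\<^bsub>M\<^esub>i\<in>I. g i) = (\<Oplus>\<^bsub>N\<^esub>i\<in>I. f (g i))"
proof -
  interpret M: module R M by fact
  interpret N: module R N by fact
  show ?thesis
  proof (cases "finite I")
    case True
    then show ?thesis using assms(4)
    proof (induction I)
      case empty
      then show ?case by (simp add: module_map_zero[OF assms(1-3)])
    next
      case (insert i I)
      have g: "g i \<in> carrier M" "g \<in> I \<rightarrow> carrier M" using insert by auto
      have fg: "(\<lambda>i. f (g i)) \<in> I \<rightarrow> carrier N"
        using g module_map_closed[OF assms(1)] by auto
      show ?case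
        using insert g fg
        by (simp add: module_map_add[OF assms(1)] module_map_closed[OF assms(1)])
    qed
  next
    case False
    then show ?thesis by (simp add: module_map_zero[OF assms(1-3)])
  qed
qed

lemma module_map_comp:
  "module_map R M N f \<Longrightarrow> module_map R N L g \<Longrightarrow> module_map R M L (\<lambda>x. g (f x))"
  by (auto simp: module_map_def Pi_iff)

lemma module_map_id: "module_map R M M (\<lambda>x. x)"
  by (auto simp: module_map_def)

text \<open>Lifts to tensor products are known only on carriers. Linearity is moved between
  functions that agree there and may differ elsewhere.\<close>

lemma module_map_cong:
  assumes "module R M" "\<And>x. x \<in> carrier M \<Longrightarrow> f x = g x"
  shows "module_map R M N f \<longleftrightarrow> module_map R M N g"
proof -
  interpret M: module R M by fact
  show ?thesis unfolding module_map_def using assms(2) by (simp add: Pi_iff)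
qed

lemma module_map_const_zero:
  assumes "module R N"
  shows "module_map R M N (\<lambda>_. \<zero>\<^bsub>N\<^esub>)"
proof -
  interpret N: module R N by fact
  show ?thesis by (auto simp: module_map_def)
qed

lemma module_map_sum:
  assumes "module_map R M N f" "module_map R M N g" "module R N"
  shows "module_map R M N (\<lambda>x. f x \<oplus>\<^bsub>N\<^esub> g x)"
proof -
  interpret N: module R N by fact
  show ?thesis
    using assms(1,2)
    by (intro module_mapI)
      (auto simp: module_map_closed module_map_add module_map_smult N.a_ac N.smult_r_distr)
qed

lemma module_map_finsum_fun:
  assumes "\<And>i. i \<in> I \<Longrightarrow> module_map R M N (f i)" "module R N" "module R M"
  shows "module_map R M N (\<lambda>x. \<Oplus>\<^bsub>N\<^esub>i\<in>I. f i x)"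
proof -
  interpret N: module R N by fact
  have "module_map R M N (\<lambda>x. \<Oplus>\<^bsub>N\<^esub>i\<in>I. f i x)" if "finite I"
    using that assms(1)
  proof (induction I)
    case empty
    then show ?case by (simp add: module_map_const_zero assms(2))
  next
    case (insert i I)
    have "module_map R M N (\<lambda>x. f i x \<oplus>\<^bsub>N\<^esub> (\<Oplus>\<^bsub>N\<^esub>i\<in>I. f i x))"
      using insert by (intro module_map_sum assms(2)) auto
    moreover have "(\<Oplus>\<^bsub>N\<^esub>i\<in>insert i I. f i x) = f i x \<oplus>\<^bsub>N\<^esub> (\<Oplus>\<^bsub>N\<^esub>i\<in>I. f i x)"
      if "x \<in> carrier M" for x
      using insert that by (intro N.finsum_insert) (auto intro: module_map_closed)
    ultimately show ?case by (subst module_map_cong[OF assms(3)])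
  qed
  then show ?thesis
    by (cases "finite I") (simp_all add: module_map_const_zero assms(2))
qed

lemma module_map_scale:
  assumes "module_map R M N f" "module R N" "r \<in> carrier R"
  shows "module_map R M N (\<lambda>x. r \<odot>\<^bsub>N\<^esub> f x)"
proof -
  interpret N: module R N by fact
  show ?thesis
    using assms(1,3)
    by (intro module_mapI)
      (auto simp: module_map_closed module_map_add module_map_smult N.smult_r_distr
        N.R.m_comm simp flip: N.smult_assoc1)
qed

text \<open>\<open>N'\<close> is the base ring regarded as a module over itself under an arbitrary
  record type. The case in view is \<open>ring_superalg id R\<close>, the codomain of a counit,
  whose values act as scalars.\<close>

lemma module_map_scale_by:
  fixes N' :: "('r, 'r, 'z) module_scheme"
  assumes "module R N" "y \<in> carrier N" and f: "module_map R M N' f"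
    and N': "carrier N' = carrier R" "add N' = add R" "\<And>r s. r \<odot>\<^bsub>N'\<^esub> s = r \<otimes>\<^bsub>R\<^esub> s"
  shows "module_map R M N (\<lambda>x. f x \<odot>\<^bsub>N\<^esub> y)"
proof -
  interpret N: module R N by fact
  have "f x \<in> carrier R" if "x \<in> carrier M" for x
    using module_map_closed[OF f that] N'(1) by simp
  then show ?thesis
    using assms(2) N'
    by (intro module_mapI)
      (auto simp: N.smult_l_distr N.smult_assoc1 module_map_add[OF f] module_map_smult[OF f])
qed

text \<open>Compares records that may differ in further fields, such as \<open>tensor_module\<close>
  and \<open>tensor_superalg\<close>. The operations are equal as functions, not only on the
  carrier, which makes sums, lifts and tensor products literally equal.\<close>

definition same_module ::
  "('r, 'a, 'l) module_scheme \<Rightarrow> ('r, 'a, 'k) module_scheme \<Rightarrow> bool" where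
  "same_module M N \<longleftrightarrow> carrier M = carrier N \<and> \<zero>\<^bsub>M\<^esub> = \<zero>\<^bsub>N\<^esub> \<and>
    add M = add N \<and> module.smult M = module.smult N"

lemma same_module_sym: "same_module M N \<Longrightarrow> same_module N M"
  by (simp add: same_module_def)

lemma same_module_finsum: "same_module M N \<Longrightarrow> finsum M f I = finsum N f I"
  by (simp add: same_module_def finsum_def finprod_def)

lemma same_module_a_minus: "same_module M N \<Longrightarrow> x \<ominus>\<^bsub>M\<^esub> y = x \<ominus>\<^bsub>N\<^esub> y"
  by (simp add: same_module_def a_minus_def a_inv_def m_inv_def)

lemma same_module_module:
  assumes "same_module M N" "module R M"
  shows "module R N"
proof -
  interpret M: module R M by fact
  have N: "carrier N = carrier M" "\<zero>\<^bsub>N\<^esub> = \<zero>\<^bsub>M\<^esub>" "add N = add M" "module.smult N = module.smult M"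
    using assms(1) by (auto simp: same_module_def)
  have "\<exists>y\<in>carrier M. y \<oplus>\<^bsub>M\<^esub> x = \<zero>\<^bsub>M\<^esub>" if "x \<in> carrier M" for x
    using that M.l_neg M.a_inv_closed by blast
  then have "abelian_group N"
    by (intro abelian_groupI) (auto simp: N M.a_ac)
  then show ?thesis
    by (intro moduleI M.R.is_cring)
      (auto simp: N M.smult_l_distr M.smult_r_distr M.smult_assoc1)
qed

lemma same_module_map:
  "same_module M M' \<Longrightarrow> same_module N N' \<Longrightarrow> module_map R M N f \<longleftrightarrow> module_map R M' N' f"
  by (simp add: same_module_def module_map_def)

lemma same_module_submodule:
  "same_module M N \<Longrightarrow> submodule H R M \<longleftrightarrow> submodule H R N"
  unfolding same_module_def submodule_def submodule_axioms_def subgroup_def m_inv_def by simp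

lemma same_module_lin_ext: "same_module M N \<Longrightarrow> lin_ext R M h = lin_ext R N h"
  unfolding lin_ext_def fun_eq_iff
  by (simp add: same_module_finsum) (simp add: same_module_def)

lemma same_module_tens_lift: "same_module M N \<Longrightarrow> tens_lift R M h = tens_lift R N h"
  by (simp add: tens_lift_def fun_eq_iff same_module_lin_ext)

text \<open>The argument is a pair because \<open>tens_lift\<close> extends functions on
  \<open>carrier A \<times> carrier B\<close>, the index set of the basis of
  \<open>tensor_free\<close>.\<close>

definition bilinear_map ::
  "('r, 'm) ring_scheme \<Rightarrow> ('r, 'a, 'l) module_scheme \<Rightarrow> ('r, 'b, 'k) module_scheme
    \<Rightarrow> ('r, 'c, 'o) module_scheme \<Rightarrow> ('a \<times> 'b \<Rightarrow> 'c) \<Rightarrow> bool" where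
  "bilinear_map R A B M h \<longleftrightarrow>
    (\<forall>b\<in>carrier B. module_map R A M (\<lambda>a. h (a, b))) \<and>
    (\<forall>a\<in>carrier A. module_map R B M (\<lambda>b. h (a, b)))"

lemma bilinear_mapI:
  "(\<And>b. b \<in> carrier B \<Longrightarrow> module_map R A M (\<lambda>a. h (a, b))) \<Longrightarrow>
   (\<And>a. a \<in> carrier A \<Longrightarrow> module_map R B M (\<lambda>b. h (a, b))) \<Longrightarrow> bilinear_map R A B M h"
  by (simp add: bilinear_map_def)

lemma bilinear_mapD:
  assumes "bilinear_map R A B M h"
  shows "b \<in> carrier B \<Longrightarrow> module_map R A M (\<lambda>a. h (a, b))"
    and "a \<in> carrier A \<Longrightarrow> module_map R B M (\<lambda>b. h (a, b))"
  using assms by (simp_all add: bilinear_map_def)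

lemma bilinear_map_closed:
  "bilinear_map R A B M h \<Longrightarrow> a \<in> carrier A \<Longrightarrow> b \<in> carrier B \<Longrightarrow> h (a, b) \<in> carrier M"
  by (auto simp: bilinear_map_def module_map_def)

section \<open>Free modules\<close>

lemma free_module_simps:
  "carrier (free_module R G) = {f. (\<forall>x. f x \<in> carrier R) \<and> (\<forall>x. x \<notin> G \<longrightarrow> f x = \<zero>\<^bsub>R\<^esub>) \<and>
      finite {x. f x \<noteq> \<zero>\<^bsub>R\<^esub>}}"
  "\<zero>\<^bsub>free_module R G\<^esub> = (\<lambda>_. \<zero>\<^bsub>R\<^esub>)"
  "f \<oplus>\<^bsub>free_module R G\<^esub> g = (\<lambda>x. f x \<oplus>\<^bsub>R\<^esub> g x)"
  "r \<odot>\<^bsub>free_module R G\<^esub> f = (\<lambda>x. r \<otimes>\<^bsub>R\<^esub> f x)"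
  by (simp_all add: free_module_def)

context cring
begin

lemma free_module_module: "module R (free_module R G)"
proof (intro moduleI is_cring abelian_groupI)
  fix f g assume f: "f \<in> carrier (free_module R G)" and g: "g \<in> carrier (free_module R G)"
  have "{x. f x \<oplus> g x \<noteq> \<zero>} \<subseteq> {x. f x \<noteq> \<zero>} \<union> {x. g x \<noteq> \<zero>}"
    using f g by (auto simp: free_module_simps)
  then show "f \<oplus>\<^bsub>free_module R G\<^esub> g \<in> carrier (free_module R G)"
    using f g by (auto simp: free_module_simps intro: finite_subset)
next
  fix f assume f: "f \<in> carrier (free_module R G)"
  have "{x. \<ominus> f x \<noteq> \<zero>} \<subseteq> {x. f x \<noteq> \<zero>}"
    using f by (auto simp: free_module_simps)
  then show "\<exists>g\<in>carrier (free_module R G). g \<oplus>\<^bsub>free_module R G\<^esub> f = \<zero>\<^bsub>free_module R G\<^esub>"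
    using f by (intro bexI[of _ "\<lambda>x. \<ominus> f x"]) (auto simp: free_module_simps l_neg intro: finite_subset)
next
  fix r f assume r: "r \<in> carrier R" and f: "f \<in> carrier (free_module R G)"
  have "{x. r \<otimes> f x \<noteq> \<zero>} \<subseteq> {x. f x \<noteq> \<zero>}"
    using f r by (auto simp: free_module_simps)
  then show "r \<odot>\<^bsub>free_module R G\<^esub> f \<in> carrier (free_module R G)"
    using f r by (auto simp: free_module_simps intro: finite_subset)
qed (auto simp: free_module_simps a_ac l_distr r_distr m_assoc)

lemma basis_elt_closed: "x \<in> G \<Longrightarrow> basis_elt R x \<in> carrier (free_module R G)"
  by (auto simp: free_module_simps basis_elt_def intro: finite_subset[of _ "{x}"])

text \<open>Induction over a finite set containing the support. The scalar case is restricted to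
  multiples of basis elements, since each coefficient is removed in one piece.\<close>

lemma free_module_induct [consumes 1, case_names zero add smult]:
  assumes f: "f \<in> carrier (free_module R G)"
    and zero: "P \<zero>\<^bsub>free_module R G\<^esub>"
    and add: "\<And>f g. f \<in> carrier (free_module R G) \<Longrightarrow> g \<in> carrier (free_module R G) \<Longrightarrow>
      P f \<Longrightarrow> P g \<Longrightarrow> P (f \<oplus>\<^bsub>free_module R G\<^esub> g)"
    and smult: "\<And>r x. r \<in> carrier R \<Longrightarrow> x \<in> G \<Longrightarrow> P (r \<odot>\<^bsub>free_module R G\<^esub> basis_elt R x)"
  shows "P f"
proof -
  interpret F: module R "free_module R G" by (rule free_module_module)
  have "\<forall>f\<in>carrier (free_module R G). {x. f x \<noteq> \<zero>} \<subseteq> S \<longrightarrow> P f" if "finite S" for S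
    using that
  proof (induction S)
    case empty
    then show ?case
    proof (intro ballI impI)
      fix f assume "f \<in> carrier (free_module R G)" "{x. f x \<noteq> \<zero>} \<subseteq> {}"
      then have "f = \<zero>\<^bsub>free_module R G\<^esub>" by (auto simp: free_module_simps)
      then show "P f" using zero by simp
    qed
  next
    case (insert x S)
    show ?case
    proof (intro ballI impI)
      fix f assume f: "f \<in> carrier (free_module R G)" "{x. f x \<noteq> \<zero>} \<subseteq> insert x S"
      \<comment> \<open>Deleting the coefficient at \<open>x\<close> moves the support into
        \<open>S\<close>. What is removed is \<open>f x\<close> times the basis element, or nothing
        when \<open>x\<close> lies outside \<open>G\<close>.\<close>
      let ?g = "f(x := \<zero>)"
      have g: "?g \<in> carrier (free_module R G)"
        using f(1) by (auto simp: free_module_simps intro: finite_subset[of _ "{x. f x \<noteq> \<zero>}"])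
      have "P ?g"
      proof -
        have "{y. ?g y \<noteq> \<zero>} \<subseteq> S" using f(2) by auto
        then show ?thesis using insert.IH g by blast
      qed
      show "P f"
      proof (cases "x \<in> G")
        case True
        have "f = ?g \<oplus>\<^bsub>free_module R G\<^esub> (f x \<odot>\<^bsub>free_module R G\<^esub> basis_elt R x)"
          using f(1) by (auto simp: free_module_simps basis_elt_def)
        moreover have "f x \<in> carrier R" using f(1) by (auto simp: free_module_simps)
        ultimately show ?thesis
          using add[OF g _ \<open>P ?g\<close> smult[of "f x" x]] True basis_elt_closed[OF True] by auto
      next
        case False
        then have "?g = f" using f(1) by (auto simp: free_module_simps)
        then show ?thesis using \<open>P ?g\<close> by simp
      qed
    qed
  qed
  then show ?thesis
    using f by (auto simp: free_module_simps)
qed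

lemma module_map_free_eq:
  assumes "module_map R (free_module R G) M f" "module_map R (free_module R G) M g" "module R M"
    and "\<And>x. x \<in> G \<Longrightarrow> f (basis_elt R x) = g (basis_elt R x)"
    and "u \<in> carrier (free_module R G)"
  shows "f u = g u"
  using assms(5)
proof (induction rule: free_module_induct)
  case zero
  then show ?case
    using assms(1-3) free_module_module by (metis module_map_zero)
next
  case (add f g)
  then show ?case using assms(1,2) by (simp add: module_map_add)
next
  case (smult r x)
  then show ?case using assms(1,2,4) by (simp add: module_map_smult basis_elt_closed)
qed

end

context module
begin

text \<open>\<open>lin_ext\<close> sums over the support, which changes with the argument. A common
  finite superset lets the sums for \<open>f\<close>, for \<open>g\<close> and for their sum be
  compared term by term.\<close>

lemma lin_ext_superset:
  assumes "\<And>x. f x \<in> carrier R" "finite S" "{x. f x \<noteq> \<zero>} \<subseteq> S" "h \<in> S \<rightarrow> carrier M"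
  shows "lin_ext R M h f = (\<Oplus>\<^bsub>M\<^esub>x\<in>S. f x \<odot>\<^bsub>M\<^esub> h x)"
  unfolding lin_ext_def
  using assms by (intro M.add.finprod_mono_neutral_cong_left) (auto simp: Pi_iff)

lemma lin_ext_module_map:
  assumes h: "h \<in> G \<rightarrow> carrier M"
  shows "module_map R (free_module R G) M (lin_ext R M h)"
proof (rule module_mapI)
  fix f assume f: "f \<in> carrier (free_module R G)"
  then have "{x. f x \<noteq> \<zero>} \<subseteq> G" by (auto simp: free_module_simps)
  then show "lin_ext R M h f \<in> carrier M"
    using f h unfolding lin_ext_def
    by (intro M.finsum_closed) (auto simp: free_module_simps)
  fix g assume g: "g \<in> carrier (free_module R G)"
  let ?S = "{x. f x \<noteq> \<zero>} \<union> {x. g x \<noteq> \<zero>}"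
  have S: "?S \<subseteq> G" using f g by (auto simp: free_module_simps)
  have fin: "finite ?S" using f g by (auto simp: free_module_simps)
  have hS: "h \<in> ?S \<rightarrow> carrier M" using h S by auto
  have fc: "f x \<in> carrier R" "g x \<in> carrier R" for x using f g by (auto simp: free_module_simps)
  have "lin_ext R M h (f \<oplus>\<^bsub>free_module R G\<^esub> g) = (\<Oplus>\<^bsub>M\<^esub>x\<in>?S. (f x \<oplus> g x) \<odot>\<^bsub>M\<^esub> h x)"
    unfolding free_module_simps using fin hS fc
    by (intro lin_ext_superset) auto
  also have "\<dots> = (\<Oplus>\<^bsub>M\<^esub>x\<in>?S. f x \<odot>\<^bsub>M\<^esub> h x \<oplus>\<^bsub>M\<^esub> g x \<odot>\<^bsub>M\<^esub> h x)"
    using hS fc by (intro M.finsum_cong') (auto simp: smult_l_distr Pi_iff)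
  also have "\<dots> = (\<Oplus>\<^bsub>M\<^esub>x\<in>?S. f x \<odot>\<^bsub>M\<^esub> h x) \<oplus>\<^bsub>M\<^esub> (\<Oplus>\<^bsub>M\<^esub>x\<in>?S. g x \<odot>\<^bsub>M\<^esub> h x)"
    using hS fc by (intro M.finsum_addf) (auto simp: Pi_iff)
  finally show "lin_ext R M h (f \<oplus>\<^bsub>free_module R G\<^esub> g) = lin_ext R M h f \<oplus>\<^bsub>M\<^esub> lin_ext R M h g"
    using fin hS fc by (simp add: lin_ext_superset[where S = ?S])
next
  fix r f assume r: "r \<in> carrier R" and f: "f \<in> carrier (free_module R G)"
  let ?S = "{x. f x \<noteq> \<zero>}"
  have fin: "finite ?S" using f by (auto simp: free_module_simps)
  have hS: "h \<in> ?S \<rightarrow> carrier M" using h f by (auto simp: free_module_simps)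
  have fc: "f x \<in> carrier R" for x using f by (auto simp: free_module_simps)
  have "lin_ext R M h (r \<odot>\<^bsub>free_module R G\<^esub> f) = (\<Oplus>\<^bsub>M\<^esub>x\<in>?S. (r \<otimes> f x) \<odot>\<^bsub>M\<^esub> h x)"
    unfolding free_module_simps using fin hS fc r
    by (intro lin_ext_superset) auto
  also have "\<dots> = (\<Oplus>\<^bsub>M\<^esub>x\<in>?S. r \<odot>\<^bsub>M\<^esub> (f x \<odot>\<^bsub>M\<^esub> h x))"
    using hS fc r by (intro M.finsum_cong') (auto simp: smult_assoc1 Pi_iff)
  also have "\<dots> = r \<odot>\<^bsub>M\<^esub> lin_ext R M h f"
    unfolding lin_ext_def using hS fc r fin by (intro finsum_smult_ldistr[symmetric]) (auto simp: Pi_iff)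
  finally show "lin_ext R M h (r \<odot>\<^bsub>free_module R G\<^esub> f) = r \<odot>\<^bsub>M\<^esub> lin_ext R M h f" .
qed

lemma lin_ext_basis_elt:
  assumes "h x \<in> carrier M"
  shows "lin_ext R M h (basis_elt R x) = h x"
proof -
  have "lin_ext R M h (basis_elt R x) = (\<Oplus>\<^bsub>M\<^esub>y\<in>{x}. basis_elt R x y \<odot>\<^bsub>M\<^esub> h y)"
    using assms by (intro lin_ext_superset) (auto simp: basis_elt_def)
  then show ?thesis using assms by (simp add: basis_elt_def)
qed

end

section \<open>Quotient modules\<close>

text \<open>The hull is the intersection of all submodules containing \<open>Y\<close>. By
  \<open>assms\<close> the carrier is one of them, which keeps the intersection inside the
  module.\<close>

lemma (in module) submodule_hull:
  assumes "Y \<subseteq> carrier M"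
  shows "submodule ((\<lambda>H. submodule H R M) hull Y) R M"
proof -
  have iff: "x \<in> (\<lambda>H. submodule H R M) hull Y \<longleftrightarrow> (\<forall>H. submodule H R M \<longrightarrow> Y \<subseteq> H \<longrightarrow> x \<in> H)" for x
    unfolding hull_def by blast
  show ?thesis
  proof (rule submoduleI)
    show "(\<lambda>H. submodule H R M) hull Y \<subseteq> carrier M"
      by (rule hull_minimal) (rule assms, rule carrier_is_submodule)
    show "\<zero>\<^bsub>M\<^esub> \<in> (\<lambda>H. submodule H R M) hull Y"
      unfolding iff by (simp add: submodule_def subgroup_def)
    show "\<ominus>\<^bsub>M\<^esub> a \<in> (\<lambda>H. submodule H R M) hull Y"
      if "a \<in> (\<lambda>H. submodule H R M) hull Y" for a
      using that submoduleE(3) unfolding iff by blast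
    show "a \<oplus>\<^bsub>M\<^esub> b \<in> (\<lambda>H. submodule H R M) hull Y"
      if "a \<in> (\<lambda>H. submodule H R M) hull Y" "b \<in> (\<lambda>H. submodule H R M) hull Y" for a b
      using that submoduleE(5) unfolding iff by blast
    show "r \<odot>\<^bsub>M\<^esub> a \<in> (\<lambda>H. submodule H R M) hull Y"
      if "r \<in> carrier R" "a \<in> (\<lambda>H. submodule H R M) hull Y" for r a
      using that submoduleE(4) unfolding iff by blast
  qed
qed

lemma (in module) submoduleI':
  assumes "H \<subseteq> carrier M" "\<zero>\<^bsub>M\<^esub> \<in> H"
    and "\<And>a b. \<lbrakk>a \<in> H; b \<in> H\<rbrakk> \<Longrightarrow> a \<oplus>\<^bsub>M\<^esub> b \<in> H"
    and "\<And>a x. \<lbrakk>a \<in> carrier R; x \<in> H\<rbrakk> \<Longrightarrow> a \<odot>\<^bsub>M\<^esub> x \<in> H"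
  shows "submodule H R M"
  using assms by (intro submoduleI) (auto simp: a_inv_eq_smult subset_iff)

lemma (in module) submodule_zero: "submodule H R M \<Longrightarrow> \<zero>\<^bsub>M\<^esub> \<in> H"
  by (auto simp: submodule_def subgroup_def)

text \<open>Applied to hulls: an identity between two linear maps that holds on generators holds on
  all they span, because its solutions form a submodule.\<close>

lemma submodule_equalizer:
  assumes "module_map R M N f" "module_map R M N g" "module R M" "module R N"
  shows "submodule {x \<in> carrier M. f x = g x} R M"
proof -
  interpret M: module R M by fact
  interpret N: module R N by fact
  show ?thesis
    by (intro M.submoduleI')
      (auto simp: module_map_zero[OF assms(1,3,4)] module_map_zero[OF assms(2,3,4)]
        module_map_add[OF assms(1)] module_map_smult[OF assms(1)]
        module_map_add[OF assms(2)] module_map_smult[OF assms(2)])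
qed

text \<open>The companion of \<open>submodule_equalizer\<close> for membership claims, such as a
  linear map respecting parity.\<close>

lemma submodule_module_map_vimage:
  assumes "module_map R M N f" "module R M" "module R N" "submodule H R N"
  shows "submodule {x \<in> carrier M. f x \<in> H} R M"
proof -
  interpret M: module R M by fact
  interpret N: module R N by fact
  show ?thesis
    using N.submoduleE[OF assms(4)] N.submodule_zero[OF assms(4)]
    by (intro M.submoduleI')
      (auto simp: module_map_zero[OF assms(1-3)] module_map_add[OF assms(1)] module_map_smult[OF assms(1)])
qed

text \<open>The record in the body of \<open>tensor_module\<close>, abstracted over the submodule;
  \<open>tensor_module_eq\<close> identifies the two. For a submodule \<open>N\<close> the union in
  the scalar action collapses to one coset.\<close>

definition quot_module ::
  "('r, 'a, 'l) module_scheme \<Rightarrow> 'a set \<Rightarrow> ('r, 'a set) module" where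
  "quot_module P N =
      \<lparr>carrier = a_rcosets\<^bsub>P\<^esub> N,
       monoid.mult = undefined, one = undefined,
       ring.zero = N, add = set_add P,
       module.smult = (\<lambda>r U. \<Union>f\<in>U. N +>\<^bsub>P\<^esub> (r \<odot>\<^bsub>P\<^esub> f))\<rparr>"

context module
begin

context
  fixes N assumes N: "submodule N R M"
begin

lemma submodule_abelian_subgroup: "abelian_subgroup N M"
  using N by (intro abelian_subgroupI3 additive_subgroupI M.abelian_group_axioms) (auto simp: submodule_def)

interpretation N: abelian_subgroup N M by (rule submodule_abelian_subgroup)

lemma coset_eq_iff:
  assumes "x \<in> carrier M" "y \<in> carrier M"
  shows "N +>\<^bsub>M\<^esub> x = N +>\<^bsub>M\<^esub> y \<longleftrightarrow> x \<ominus>\<^bsub>M\<^esub> y \<in> N"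
proof
  assume "N +>\<^bsub>M\<^esub> x = N +>\<^bsub>M\<^esub> y"
  then have "x \<in> N +>\<^bsub>M\<^esub> y" using N.a_rcos_self assms by blast
  then show "x \<ominus>\<^bsub>M\<^esub> y \<in> N" using N.a_rcos_module_imp assms by (simp add: a_minus_def)
next
  assume "x \<ominus>\<^bsub>M\<^esub> y \<in> N"
  then have "x \<in> N +>\<^bsub>M\<^esub> y" using N.a_rcos_module_rev assms by (simp add: a_minus_def)
  then show "N +>\<^bsub>M\<^esub> x = N +>\<^bsub>M\<^esub> y" using N.a_repr_independence' assms by blast
qed

lemma coset_eq_zero_iff:
  assumes "x \<in> carrier M"
  shows "N +>\<^bsub>M\<^esub> x = N \<longleftrightarrow> x \<in> N"
  using N.a_rcos_const N.a_rcos_self assms by blast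

lemma quot_module_carrier: "carrier (quot_module M N) = (+>\<^bsub>M\<^esub>) N ` carrier M"
  by (auto simp: quot_module_def A_RCOSETS_def')

text \<open>If \<open>y\<close> is another representative of the coset of \<open>x\<close>, then
  \<open>y - x\<close> lies in \<open>N\<close> and so does its multiple by \<open>r\<close>. All
  cosets in the union that defines the scalar action are therefore equal.\<close>

lemma quot_module_map: "module_map R M (quot_module M N) ((+>\<^bsub>M\<^esub>) N)"
proof (rule module_mapI)
  fix r x assume r: "r \<in> carrier R" and x: "x \<in> carrier M"
  have "N +>\<^bsub>M\<^esub> (r \<odot>\<^bsub>M\<^esub> y) = N +>\<^bsub>M\<^esub> (r \<odot>\<^bsub>M\<^esub> x)" if y: "y \<in> N +>\<^bsub>M\<^esub> x" for y
  proof -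
    have yc: "y \<in> carrier M" using y N.a_elemrcos_carrier x by blast
    have "y \<ominus>\<^bsub>M\<^esub> x \<in> N" using y N.a_rcos_module_imp x by (simp add: a_minus_def)
    then have "r \<odot>\<^bsub>M\<^esub> (y \<ominus>\<^bsub>M\<^esub> x) \<in> N" using r submoduleE(4)[OF N] by blast
    then have "r \<odot>\<^bsub>M\<^esub> y \<ominus>\<^bsub>M\<^esub> r \<odot>\<^bsub>M\<^esub> x \<in> N"
      using r x yc by (simp add: a_minus_def smult_r_distr smult_r_minus)
    then show ?thesis using coset_eq_iff r x yc by simp
  qed
  moreover have "N +>\<^bsub>M\<^esub> x \<noteq> {}" using N.a_rcos_self x by blast
  ultimately have "(\<Union>y\<in>N +>\<^bsub>M\<^esub> x. N +>\<^bsub>M\<^esub> (r \<odot>\<^bsub>M\<^esub> y)) = N +>\<^bsub>M\<^esub> (r \<odot>\<^bsub>M\<^esub> x)"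
    by blast
  then show "N +>\<^bsub>M\<^esub> (r \<odot>\<^bsub>M\<^esub> x) = r \<odot>\<^bsub>quot_module M N\<^esub> (N +>\<^bsub>M\<^esub> x)"
    by (simp add: quot_module_def)
qed (auto simp: quot_module_def N.a_rcos_sum M.a_rcosetsI[OF N.a_subset])

lemma quot_module_module: "module R (quot_module M N)"
proof (intro moduleI R.is_cring)
  have zero: "\<zero>\<^bsub>quot_module M N\<^esub> = N +>\<^bsub>M\<^esub> \<zero>\<^bsub>M\<^esub>"
    using coset_eq_zero_iff[of "\<zero>\<^bsub>M\<^esub>"] submodule_zero[OF N] by (simp add: quot_module_def)
  show "abelian_group (quot_module M N)"
  proof (rule abelian_groupI)
    show "\<exists>y\<in>carrier (quot_module M N). y \<oplus>\<^bsub>quot_module M N\<^esub> x = \<zero>\<^bsub>quot_module M N\<^esub>"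
      if "x \<in> carrier (quot_module M N)" for x
    proof -
      from that obtain u where u: "u \<in> carrier M" "x = N +>\<^bsub>M\<^esub> u" by (auto simp: quot_module_carrier)
      have "(N +>\<^bsub>M\<^esub> (\<ominus>\<^bsub>M\<^esub> u)) \<oplus>\<^bsub>quot_module M N\<^esub> x = \<zero>\<^bsub>quot_module M N\<^esub>"
        using u by (simp add: M.l_neg zero flip: module_map_add[OF quot_module_map])
      then show ?thesis using u by (auto simp: quot_module_carrier)
    qed
  qed (auto simp: quot_module_carrier zero M.a_ac simp flip: module_map_add[OF quot_module_map])
qed (auto simp: quot_module_carrier smult_l_distr smult_r_distr smult_assoc1
      simp flip: module_map_add[OF quot_module_map] module_map_smult[OF quot_module_map])

end

end

section \<open>Tensor products of modules\<close>

lemma bilinear_map_precomp: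
  assumes "bilinear_map R A B M h" "module_map R A' A f" "module_map R B' B g"
  shows "bilinear_map R A' B' M (\<lambda>(a, b). h (f a, g b))"
proof (rule bilinear_mapI)
  show "module_map R A' M (\<lambda>a. case (a, b) of (a, b) \<Rightarrow> h (f a, g b))" if "b \<in> carrier B'" for b
    using module_map_comp[OF assms(2) bilinear_mapD(1)[OF assms(1) module_map_closed[OF assms(3) that]]]
    by simp
  show "module_map R B' M (\<lambda>b. case (a, b) of (a, b) \<Rightarrow> h (f a, g b))" if "a \<in> carrier A'" for a
    using module_map_comp[OF assms(3) bilinear_mapD(2)[OF assms(1) module_map_closed[OF assms(2) that]]]
    by simp
qed

lemma same_module_tensor_null:
  "same_module A A' \<Longrightarrow> same_module B B' \<Longrightarrow> tensor_null R A B = tensor_null R A' B'"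
  by (simp add: same_module_def tensor_null_def tensor_free_def)

lemma same_module_tensor_module:
  "same_module A A' \<Longrightarrow> same_module B B' \<Longrightarrow> tensor_module R A B = tensor_module R A' B'"
  by (simp add: tensor_module_def same_module_tensor_null tensor_free_def)
    (simp add: same_module_def)

lemma same_module_tens:
  "same_module A A' \<Longrightarrow> same_module B B' \<Longrightarrow> tens R A B = tens R A' B'"
  by (simp add: tens_def same_module_tensor_null tensor_free_def fun_eq_iff)
    (simp add: same_module_def)

lemma tensor_module_eq: "tensor_module R A B = quot_module (tensor_free R A B) (tensor_null R A B)"
  by (simp add: tensor_module_def quot_module_def Let_def)

context
  fixes R :: "('r, 'm) ring_scheme" (structure)
    and A :: "('r, 'a, 'l) module_scheme" and B :: "('r, 'b, 'k) module_scheme"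
  assumes A: "module R A" and B: "module R B"
begin

interpretation A: module R A by (rule A)
interpretation B: module R B by (rule B)
interpretation P: module R "tensor_free R A B"
  unfolding tensor_free_def by (rule A.R.free_module_module)

lemma tensor_basis_closed:
  "a \<in> carrier A \<Longrightarrow> b \<in> carrier B \<Longrightarrow> basis_elt R (a, b) \<in> carrier (tensor_free R A B)"
  unfolding tensor_free_def by (rule A.R.basis_elt_closed) simp

lemma tensor_null_submodule: "submodule (tensor_null R A B) R (tensor_free R A B)"
  unfolding tensor_null_def Let_def
  by (rule P.submodule_hull) (auto intro!: P.M.minus_closed P.smult_closed P.M.a_closed tensor_basis_closed)

lemma tensor_module_module: "module R (tensor_module R A B)"
  unfolding tensor_module_eq by (rule P.quot_module_module[OF tensor_null_submodule])

interpretation T: module R "tensor_module R A B" by (rule tensor_module_module)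

lemma tensor_class_map:
  "module_map R (tensor_free R A B) (tensor_module R A B)
    ((+>\<^bsub>tensor_free R A B\<^esub>) (tensor_null R A B))"
  unfolding tensor_module_eq by (rule P.quot_module_map[OF tensor_null_submodule])

lemma tens_closed:
  "a \<in> carrier A \<Longrightarrow> b \<in> carrier B \<Longrightarrow> tens R A B a b \<in> carrier (tensor_module R A B)"
  unfolding tens_def by (rule module_map_closed[OF tensor_class_map tensor_basis_closed])

lemma tens_eqI:
  assumes "u \<in> carrier (tensor_free R A B)" "v \<in> carrier (tensor_free R A B)"
    and "u \<ominus>\<^bsub>tensor_free R A B\<^esub> v \<in> tensor_null R A B"
  shows "tensor_null R A B +>\<^bsub>tensor_free R A B\<^esub> u = tensor_null R A B +>\<^bsub>tensor_free R A B\<^esub> v"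
  using P.coset_eq_iff[OF tensor_null_submodule] assms by blast

lemma tensor_null_generators:
  assumes "a \<in> carrier A" "a' \<in> carrier A" "b \<in> carrier B" "b' \<in> carrier B" "r \<in> carrier R"
  defines "P \<equiv> tensor_free R A B" and "e \<equiv> (\<lambda>a b. basis_elt R (a, b))"
  shows "e (a \<oplus>\<^bsub>A\<^esub> a') b \<ominus>\<^bsub>P\<^esub> (e a b \<oplus>\<^bsub>P\<^esub> e a' b) \<in> tensor_null R A B"
    and "e a (b \<oplus>\<^bsub>B\<^esub> b') \<ominus>\<^bsub>P\<^esub> (e a b \<oplus>\<^bsub>P\<^esub> e a b') \<in> tensor_null R A B"
    and "e (r \<odot>\<^bsub>A\<^esub> a) b \<ominus>\<^bsub>P\<^esub> r \<odot>\<^bsub>P\<^esub> e a b \<in> tensor_null R A B"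
    and "e a (r \<odot>\<^bsub>B\<^esub> b) \<ominus>\<^bsub>P\<^esub> r \<odot>\<^bsub>P\<^esub> e a b \<in> tensor_null R A B"
  using assms(1-5) unfolding tensor_null_def Let_def P_def e_def by (blast intro: hull_inc)+

lemma tens_add_smult:
  shows "\<lbrakk>a \<in> carrier A; a' \<in> carrier A; b \<in> carrier B\<rbrakk> \<Longrightarrow>
      tens R A B (a \<oplus>\<^bsub>A\<^esub> a') b = tens R A B a b \<oplus>\<^bsub>tensor_module R A B\<^esub> tens R A B a' b"
    and "\<lbrakk>a \<in> carrier A; b \<in> carrier B; b' \<in> carrier B\<rbrakk> \<Longrightarrow>
      tens R A B a (b \<oplus>\<^bsub>B\<^esub> b') = tens R A B a b \<oplus>\<^bsub>tensor_module R A B\<^esub> tens R A B a b'"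
    and "\<lbrakk>r \<in> carrier R; a \<in> carrier A; b \<in> carrier B\<rbrakk> \<Longrightarrow>
      tens R A B (r \<odot>\<^bsub>A\<^esub> a) b = r \<odot>\<^bsub>tensor_module R A B\<^esub> tens R A B a b"
    and "\<lbrakk>r \<in> carrier R; a \<in> carrier A; b \<in> carrier B\<rbrakk> \<Longrightarrow>
      tens R A B a (r \<odot>\<^bsub>B\<^esub> b) = r \<odot>\<^bsub>tensor_module R A B\<^esub> tens R A B a b"
  using tensor_basis_closed tensor_null_generators[of a a' b b \<one>]
    tensor_null_generators[of a a b b' \<one>] tensor_null_generators[of a a b b r]
  by (simp_all add: tens_def tens_eqI
      flip: module_map_add[OF tensor_class_map] module_map_smult[OF tensor_class_map])

lemma tens_bilinear: "bilinear_map R A B (tensor_module R A B) (\<lambda>(a, b). tens R A B a b)"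
  by (intro bilinear_mapI module_mapI) (auto simp: tens_closed tens_add_smult)

lemma tens_map_left: "b \<in> carrier B \<Longrightarrow> module_map R A (tensor_module R A B) (\<lambda>a. tens R A B a b)"
  using bilinear_mapD(1)[OF tens_bilinear] by simp

lemma tens_map_right: "a \<in> carrier A \<Longrightarrow> module_map R B (tensor_module R A B) (tens R A B a)"
  using bilinear_mapD(2)[OF tens_bilinear] by simp

text \<open>Scalars are absorbed into the left factor and zero is the tensor of two zeros, so sums
  of pure tensors exhaust the tensor product.\<close>

lemma tensor_induct [consumes 1, case_names tens add]:
  assumes t: "t \<in> carrier (tensor_module R A B)"
    and tens: "\<And>a b. a \<in> carrier A \<Longrightarrow> b \<in> carrier B \<Longrightarrow> P (tens R A B a b)"
    and add: "\<And>t u. t \<in> carrier (tensor_module R A B) \<Longrightarrow> u \<in> carrier (tensor_module R A B) \<Longrightarrow>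
      P t \<Longrightarrow> P u \<Longrightarrow> P (t \<oplus>\<^bsub>tensor_module R A B\<^esub> u)"
  shows "P t"
proof -
  obtain f where f: "f \<in> carrier (free_module R (carrier A \<times> carrier B))"
    and tf: "t = tensor_null R A B +>\<^bsub>tensor_free R A B\<^esub> f"
    using t unfolding tensor_module_eq P.quot_module_carrier[OF tensor_null_submodule]
    by (auto simp: tensor_free_def)
  have "P (tensor_null R A B +>\<^bsub>tensor_free R A B\<^esub> f)"
    using f
  proof (induction rule: A.R.free_module_induct)
    case zero
    have "tens R A B \<zero>\<^bsub>A\<^esub> \<zero>\<^bsub>B\<^esub> = \<zero>\<^bsub>tensor_module R A B\<^esub>"
      by (rule module_map_zero[OF tens_map_left A tensor_module_module]) simp
    then show ?case
      using tens[of "\<zero>\<^bsub>A\<^esub>" "\<zero>\<^bsub>B\<^esub>"]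
        module_map_zero[OF tensor_class_map P.module_axioms tensor_module_module]
      by (simp add: tensor_free_def)
  next
    case (add f g)
    then show ?case
      using module_map_add[OF tensor_class_map, of f g] module_map_closed[OF tensor_class_map]
        assms(3)
      by (simp add: tensor_free_def)
  next
    case (smult r p)
    then obtain a b where p: "p = (a, b)" "a \<in> carrier A" "b \<in> carrier B" by auto
    then have "r \<odot>\<^bsub>tensor_module R A B\<^esub> tens R A B a b = tens R A B (r \<odot>\<^bsub>A\<^esub> a) b"
      using module_map_smult[OF tens_map_left] smult by simp
    then show ?case
      using module_map_smult[OF tensor_class_map, of r "basis_elt R p"] p smult tens[of "r \<odot>\<^bsub>A\<^esub> a" b]
      by (simp add: tens_def tensor_basis_closed) (simp add: tensor_free_def)
  qed
  then show ?thesis by (simp add: tf)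
qed

lemma tensor_map_eq:
  assumes "module_map R (tensor_module R A B) M f" "module_map R (tensor_module R A B) M g"
    and "\<And>a b. a \<in> carrier A \<Longrightarrow> b \<in> carrier B \<Longrightarrow> f (tens R A B a b) = g (tens R A B a b)"
    and "t \<in> carrier (tensor_module R A B)"
  shows "f t = g t"
  using assms(4)
  by (induction rule: tensor_induct) (auto simp: assms(3) module_map_add[OF assms(1)] module_map_add[OF assms(2)])

context
  fixes M :: "('r, 'c, 'o) module_scheme" and h
  assumes M: "module R M" and h: "bilinear_map R A B M h"
begin

interpretation M: module R M by (rule M)

lemma lin_ext_bilinear_map: "module_map R (tensor_free R A B) M (lin_ext R M h)"
  unfolding tensor_free_def using bilinear_map_closed[OF h] by (intro M.lin_ext_module_map) auto

text \<open>The kernel of the linear extension is a submodule, and bilinearity puts the four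
  families of generators of \<open>tensor_null\<close> into it. This is the well-definedness of
  every map out of a tensor product.\<close>

lemma lin_ext_tensor_null:
  assumes "u \<in> tensor_null R A B"
  shows "lin_ext R M h u = \<zero>\<^bsub>M\<^esub>"
proof -
  have e: "lin_ext R M h (basis_elt R (a, b)) = h (a, b)" if "a \<in> carrier A" "b \<in> carrier B" for a b
    using bilinear_map_closed[OF h] that by (intro M.lin_ext_basis_elt) auto
  note L = lin_ext_bilinear_map
  let ?K = "{u \<in> carrier (tensor_free R A B). lin_ext R M h u = \<zero>\<^bsub>M\<^esub>}"
  have K: "submodule ?K R (tensor_free R A B)"
    by (rule submodule_equalizer[OF L module_map_const_zero[OF M] P.module_axioms M])
  have lins: "\<lbrakk>a \<in> carrier A; a' \<in> carrier A; b \<in> carrier B\<rbrakk> \<Longrightarrow>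
      h (a \<oplus>\<^bsub>A\<^esub> a', b) = h (a, b) \<oplus>\<^bsub>M\<^esub> h (a', b)"
    "\<lbrakk>a \<in> carrier A; b \<in> carrier B; b' \<in> carrier B\<rbrakk> \<Longrightarrow>
      h (a, b \<oplus>\<^bsub>B\<^esub> b') = h (a, b) \<oplus>\<^bsub>M\<^esub> h (a, b')"
    "\<lbrakk>r \<in> carrier R; a \<in> carrier A; b \<in> carrier B\<rbrakk> \<Longrightarrow> h (r \<odot>\<^bsub>A\<^esub> a, b) = r \<odot>\<^bsub>M\<^esub> h (a, b)"
    "\<lbrakk>r \<in> carrier R; a \<in> carrier A; b \<in> carrier B\<rbrakk> \<Longrightarrow> h (a, r \<odot>\<^bsub>B\<^esub> b) = r \<odot>\<^bsub>M\<^esub> h (a, b)" for a a' b b' r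
    using bilinear_mapD(1)[OF h] bilinear_mapD(2)[OF h] by (auto simp: module_map_def)
  note [simp] = module_map_minus[OF L P.module_axioms M] module_map_add[OF L] module_map_smult[OF L]
    e tensor_basis_closed M.minus_eq_zero_iff bilinear_map_closed[OF h]
  have "tensor_null R A B \<subseteq> ?K"
    unfolding tensor_null_def Let_def
    by (rule hull_minimal) (use K in \<open>auto simp: lins\<close>)
  then show ?thesis using assms by auto
qed

text \<open>\<open>tens_lift\<close> evaluates at a representative chosen by \<open>SOME\<close>.
  Two representatives differ by an element of \<open>tensor_null\<close>, on which the extension
  vanishes.\<close>

lemma tens_lift_class:
  assumes "f \<in> carrier (tensor_free R A B)"
  shows "tens_lift R M h (tensor_null R A B +>\<^bsub>tensor_free R A B\<^esub> f) = lin_ext R M h f"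
proof -
  let ?C = "tensor_null R A B +>\<^bsub>tensor_free R A B\<^esub> f"
  interpret N: abelian_subgroup "tensor_null R A B" "tensor_free R A B"
    by (rule P.submodule_abelian_subgroup[OF tensor_null_submodule])
  define g where "g = (SOME f. f \<in> ?C)"
  have "f \<in> ?C" using N.a_rcos_self assms by blast
  then have g: "g \<in> ?C" unfolding g_def by (rule someI[where P = "\<lambda>f. f \<in> ?C"])
  then have gc: "g \<in> carrier (tensor_free R A B)" using N.a_elemrcos_carrier assms by blast
  have "g \<ominus>\<^bsub>tensor_free R A B\<^esub> f \<in> tensor_null R A B"
    using N.a_rcos_module_imp[OF assms g] by (simp add: a_minus_def)
  then have "lin_ext R M h g \<ominus>\<^bsub>M\<^esub> lin_ext R M h f = \<zero>\<^bsub>M\<^esub>"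
    using lin_ext_tensor_null module_map_minus[OF lin_ext_bilinear_map P.module_axioms M gc assms] by simp
  then show ?thesis
    using module_map_closed[OF lin_ext_bilinear_map] assms gc
    by (simp add: tens_lift_def M.minus_eq_zero_iff flip: g_def)
qed

lemma tens_lift_tens:
  assumes "a \<in> carrier A" "b \<in> carrier B"
  shows "tens_lift R M h (tens R A B a b) = h (a, b)"
  using assms tens_lift_class[OF tensor_basis_closed[OF assms]] bilinear_map_closed[OF h]
  by (simp add: tens_def M.lin_ext_basis_elt)

lemma tens_lift_map: "module_map R (tensor_module R A B) M (tens_lift R M h)"
proof (rule module_mapI)
  note car = P.quot_module_carrier[OF tensor_null_submodule, folded tensor_module_eq]
  show "tens_lift R M h x \<in> carrier M" if "x \<in> carrier (tensor_module R A B)" for x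
    using that module_map_closed[OF lin_ext_bilinear_map] by (auto simp: car tens_lift_class)
  show "tens_lift R M h (x \<oplus>\<^bsub>tensor_module R A B\<^esub> y) = tens_lift R M h x \<oplus>\<^bsub>M\<^esub> tens_lift R M h y"
    if "x \<in> carrier (tensor_module R A B)" "y \<in> carrier (tensor_module R A B)" for x y
    using that
    by (auto simp: car tens_lift_class module_map_add[OF lin_ext_bilinear_map]
        simp flip: module_map_add[OF tensor_class_map])
  show "tens_lift R M h (r \<odot>\<^bsub>tensor_module R A B\<^esub> x) = r \<odot>\<^bsub>M\<^esub> tens_lift R M h x"
    if "r \<in> carrier R" "x \<in> carrier (tensor_module R A B)" for r x
    using that
    by (auto simp: car tens_lift_class module_map_smult[OF lin_ext_bilinear_map]
        simp flip: module_map_smult[OF tensor_class_map])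
qed

end

text \<open>Linearity in a parameter is checked on pure tensors, where the lift is computed by
  \<open>tens_lift_tens\<close>, and passes to sums. It is what makes iterated lifts
  bilinear.\<close>

lemma tens_lift_param:
  assumes M: "module R M" and C: "module R C"
    and h: "\<And>c. c \<in> carrier C \<Longrightarrow> bilinear_map R A B M (h c)"
    and hc: "\<And>a b. a \<in> carrier A \<Longrightarrow> b \<in> carrier B \<Longrightarrow> module_map R C M (\<lambda>c. h c (a, b))"
    and t: "t \<in> carrier (tensor_module R A B)"
  shows "module_map R C M (\<lambda>c. tens_lift R M (h c) t)"
  using t
proof (induction rule: tensor_induct)
  case (tens a b)
  then show ?case
    using hc[OF tens] h by (subst module_map_cong[OF C]) (auto simp: tens_lift_tens[OF M h])
next
  case (add t u)
  then have "module_map R C M (\<lambda>c. tens_lift R M (h c) t \<oplus>\<^bsub>M\<^esub> tens_lift R M (h c) u)"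
    by (intro module_map_sum M)
  then show ?case
    using add by (subst module_map_cong[OF C]) (auto simp: module_map_add[OF tens_lift_map[OF M h]])
qed

end

text \<open>A map of four arguments, bilinear in the first two and in the last two, lifts in two
  stages. The product on a tensor product of superalgebras has this form.\<close>

lemma tens_lift2:
  assumes mods: "module R A" "module R B" "module R C" "module R D" "module R M"
    and h1: "\<And>a b. a \<in> carrier A \<Longrightarrow> b \<in> carrier B \<Longrightarrow> bilinear_map R C D M (h (a, b))"
    and h2: "\<And>c d. c \<in> carrier C \<Longrightarrow> d \<in> carrier D \<Longrightarrow> bilinear_map R A B M (\<lambda>p. h p (c, d))"
  shows "bilinear_map R (tensor_module R A B) (tensor_module R C D) M
      (\<lambda>(U, V). tens_lift R M (\<lambda>p. tens_lift R M (h p) V) U)" (is ?bil)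
    and "\<lbrakk>a \<in> carrier A; b \<in> carrier B; c \<in> carrier C; d \<in> carrier D\<rbrakk> \<Longrightarrow>
      tens_lift R M (\<lambda>p. tens_lift R M (h p) (tens R C D c d)) (tens R A B a b) = h (a, b) (c, d)"
proof -
  note AB = mods(1,2) and CD = mods(3,4) and M = mods(5)
  have inner: "bilinear_map R A B M (\<lambda>p. tens_lift R M (h p) V)"
    if V: "V \<in> carrier (tensor_module R C D)" for V
  proof (rule bilinear_mapI)
    show "module_map R A M (\<lambda>a. tens_lift R M (h (a, b)) V)" if b: "b \<in> carrier B" for b
      using h1 b bilinear_mapD(1)[OF h2] V
      by (intro tens_lift_param[OF CD M, where h = "\<lambda>a. h (a, b)"] mods) auto
    show "module_map R B M (\<lambda>b. tens_lift R M (h (a, b)) V)" if a: "a \<in> carrier A" for a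
      using h1 a bilinear_mapD(2)[OF h2] V
      by (intro tens_lift_param[OF CD M, where h = "\<lambda>b. h (a, b)"] mods) auto
  qed
  show ?bil
  proof (rule bilinear_mapI)
    show "module_map R (tensor_module R A B) M (\<lambda>a. case (a, V) of
        (U, V) \<Rightarrow> tens_lift R M (\<lambda>p. tens_lift R M (h p) V) U)"
      if V: "V \<in> carrier (tensor_module R C D)" for V
      using tens_lift_map[OF AB M inner[OF V]] by simp
    show "module_map R (tensor_module R C D) M (\<lambda>b. case (U, b) of
        (U, V) \<Rightarrow> tens_lift R M (\<lambda>p. tens_lift R M (h p) V) U)"
      if U: "U \<in> carrier (tensor_module R A B)" for U
      using tens_lift_param[OF AB M tensor_module_module[OF CD] inner tens_lift_map[OF CD M h1] U]
      by simp
  qed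
  assume el: "a \<in> carrier A" "b \<in> carrier B" "c \<in> carrier C" "d \<in> carrier D"
  show "tens_lift R M (\<lambda>p. tens_lift R M (h p) (tens R C D c d)) (tens R A B a b) = h (a, b) (c, d)"
    using el tens_lift_tens[OF AB M inner[OF tens_closed[OF CD el(3,4)]] el(1,2)]
      tens_lift_tens[OF CD M h1[OF el(1,2)] el(3,4)] by simp
qed

lemma tens_map_bilinear:
  assumes "module R C" "module R D" "module_map R A C f" "module_map R B D g"
  shows "bilinear_map R A B (tensor_module R C D) (\<lambda>(a, b). tens R C D (f a) (g b))"
  using bilinear_map_precomp[OF tens_bilinear[OF assms(1,2)] assms(3,4)] by simp

lemma tens_map_map:
  assumes "module R A" "module R B" "module R C" "module R D" "module_map R A C f" "module_map R B D g"
  shows "module_map R (tensor_module R A B) (tensor_module R C D) (tens_map R C D f g)"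
  unfolding tens_map_def using assms tens_map_bilinear[OF assms(3-6)]
  by (intro tens_lift_map tensor_module_module)

lemma tens_map_tens:
  assumes "module R A" "module R B" "module R C" "module R D" "module_map R A C f" "module_map R B D g"
    and "a \<in> carrier A" "b \<in> carrier B"
  shows "tens_map R C D f g (tens R A B a b) = tens R C D (f a) (g b)"
  unfolding tens_map_def
  using tens_lift_tens[OF assms(1,2) tensor_module_module[OF assms(3,4)] tens_map_bilinear[OF assms(3-6)] assms(7,8)]
  by simp

text \<open>The inner lift depends linearly on \<open>c\<close> by \<open>tens_lift_param\<close>.
  Hence the outer lift is again taken of a bilinear map, and its value on pure tensors is computed
  in two steps.\<close>

lemma tens_assoc:
  assumes mods: "module R A" "module R B" "module R C"
  defines "AB \<equiv> tensor_module R A B" and "BC \<equiv> tensor_module R B C"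
  shows "module_map R (tensor_module R AB C) (tensor_module R A BC) (tens_assoc R A B C)" (is ?map)
    and "\<lbrakk>a \<in> carrier A; b \<in> carrier B; c \<in> carrier C\<rbrakk> \<Longrightarrow>
      tens_assoc R A B C (tens R AB C (tens R A B a b) c) = tens R A BC a (tens R B C b c)"
proof -
  have BC: "module R BC" and AB: "module R AB"
    unfolding AB_def BC_def by (rule tensor_module_module mods)+
  have T: "module R (tensor_module R A BC)" by (rule tensor_module_module[OF mods(1) BC])
  have in1: "bilinear_map R A B (tensor_module R A BC) (\<lambda>(a, b). tens R A BC a (tens R B C b c))"
    if "c \<in> carrier C" for c
    using tens_map_bilinear[OF mods(1) BC module_map_id tens_map_left[OF mods(2,3) that, folded BC_def]] by simp
  have out: "bilinear_map R AB C (tensor_module R A BC)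
      (\<lambda>(t, c). tens_lift R (tensor_module R A BC) (\<lambda>(a, b). tens R A BC a (tens R B C b c)) t)"
  proof (rule bilinear_mapI)
    show "module_map R AB (tensor_module R A BC) (\<lambda>a. case (a, c) of (t, c) \<Rightarrow>
        tens_lift R (tensor_module R A BC) (\<lambda>(a, b). tens R A BC a (tens R B C b c)) t)"
      if "c \<in> carrier C" for c
      using tens_lift_map[OF mods(1,2) T in1[OF that]] by (simp add: AB_def)
    have "module_map R C (tensor_module R A BC)
        (\<lambda>c. (\<lambda>(a, b). tens R A BC a (tens R B C b c)) (a, b))"
      if "a \<in> carrier A" "b \<in> carrier B" for a b
      using module_map_comp[OF tens_map_right[OF mods(2,3) that(2), folded BC_def]
          tens_map_right[OF mods(1) BC that(1)]] by simp
    then show "module_map R C (tensor_module R A BC) (\<lambda>c. case (t, c) of (t, c) \<Rightarrow>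
        tens_lift R (tensor_module R A BC) (\<lambda>(a, b). tens R A BC a (tens R B C b c)) t)"
      if "t \<in> carrier AB" for t
      using tens_lift_param[OF mods(1,2) T mods(3) in1 _ that[unfolded AB_def]] by simp
  qed
  show ?map
    unfolding tens_assoc_def Let_def using tens_lift_map[OF AB mods(3) T out] by (simp add: BC_def)
  assume el: "a \<in> carrier A" "b \<in> carrier B" "c \<in> carrier C"
  show "tens_assoc R A B C (tens R AB C (tens R A B a b) c) = tens R A BC a (tens R B C b c)"
    unfolding tens_assoc_def Let_def
    using tens_lift_tens[OF AB mods(3) T out tens_closed[OF mods(1,2) el(1,2), folded AB_def] el(3)]
      tens_lift_tens[OF mods(1,2) T in1[OF el(3)] el(1,2)]
    by (simp add: BC_def)
qed

section \<open>Algebras and superalgebras\<close>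

text \<open>Otherwise the simplifier turns sums and products of parities into bitwise operations.\<close>

declare add_bit_eq_xor [simp del] mult_bit_eq_and [simp del]

text \<open>\<open>superalgebra\<close> without its grading. Free algebras and restrictions of
  scalars carry no \<open>part\<close> field, yet evaluation and presentations must apply to them as
  well.\<close>

locale assoc_algebra = R?: cring R + module R A + A?: ring A
  for R :: "('r, 'm) ring_scheme" (structure)
    and A :: "('r, 'a, 'l) module_scheme" (structure) +
  assumes smult_mult_left:
      "\<lbrakk>r \<in> carrier R; x \<in> carrier A; y \<in> carrier A\<rbrakk> \<Longrightarrow>
        (r \<odot>\<^bsub>A\<^esub> x) \<otimes>\<^bsub>A\<^esub> y = r \<odot>\<^bsub>A\<^esub> (x \<otimes>\<^bsub>A\<^esub> y)"
    and smult_mult_right: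
      "\<lbrakk>r \<in> carrier R; x \<in> carrier A; y \<in> carrier A\<rbrakk> \<Longrightarrow>
        x \<otimes>\<^bsub>A\<^esub> (r \<odot>\<^bsub>A\<^esub> y) = r \<odot>\<^bsub>A\<^esub> (x \<otimes>\<^bsub>A\<^esub> y)"

lemma (in superalgebra) assoc_algebra: "assoc_algebra R A"
  by unfold_locales (simp_all add: smult_mult_left smult_mult_right)

context assoc_algebra
begin

lemma mult_map_left: "y \<in> carrier A \<Longrightarrow> module_map R A A (\<lambda>x. x \<otimes>\<^bsub>A\<^esub> y)"
  by (intro module_mapI) (auto simp: A.l_distr smult_mult_left)

lemma mult_map_right: "x \<in> carrier A \<Longrightarrow> module_map R A A (\<lambda>y. x \<otimes>\<^bsub>A\<^esub> y)"
  by (intro module_mapI) (auto simp: A.r_distr smult_mult_right)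

lemma mult_bilinear: "bilinear_map R A A A (\<lambda>(x, y). x \<otimes>\<^bsub>A\<^esub> y)"
  by (intro bilinear_mapI) (auto simp: mult_map_left mult_map_right)

lemma module_ax: "module R A" ..

end

text \<open>Bilinearity of the product packs distributivity and compatibility with scalars into one
  hypothesis, in the form in which lifts to tensor products deliver it.\<close>

lemma assoc_algebraI:
  assumes "module R A" "bilinear_map R A A A (\<lambda>(x, y). x \<otimes>\<^bsub>A\<^esub> y)"
    and "\<And>x y z. \<lbrakk>x \<in> carrier A; y \<in> carrier A; z \<in> carrier A\<rbrakk> \<Longrightarrow>
      (x \<otimes>\<^bsub>A\<^esub> y) \<otimes>\<^bsub>A\<^esub> z = x \<otimes>\<^bsub>A\<^esub> (y \<otimes>\<^bsub>A\<^esub> z)"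
    and "\<one>\<^bsub>A\<^esub> \<in> carrier A"
    and "\<And>x. x \<in> carrier A \<Longrightarrow> \<one>\<^bsub>A\<^esub> \<otimes>\<^bsub>A\<^esub> x = x"
    and "\<And>x. x \<in> carrier A \<Longrightarrow> x \<otimes>\<^bsub>A\<^esub> \<one>\<^bsub>A\<^esub> = x"
  shows "assoc_algebra R A"
proof -
  interpret A: module R A by fact
  have L: "module_map R A A (\<lambda>x. x \<otimes>\<^bsub>A\<^esub> y)" and Rt: "module_map R A A (\<lambda>x. y \<otimes>\<^bsub>A\<^esub> x)"
    if "y \<in> carrier A" for y
    using bilinear_mapD[OF assms(2)] that by simp_all
  show ?thesis
    by unfold_locales
      (auto simp: assms(3-6) module_map_closed[OF L] module_map_add[OF L] module_map_add[OF Rt]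
        module_map_smult[OF L] module_map_smult[OF Rt])
qed

text \<open>\<open>superalg_hom\<close> without parity, as a predicate. The universal property of a
  presentation yields only algebra maps; their parity is established separately.\<close>

definition alg_hom ::
  "('r, 'm) ring_scheme \<Rightarrow> ('r, 'a, 'k) module_scheme \<Rightarrow> ('r, 'b, 'l) module_scheme
    \<Rightarrow> ('a \<Rightarrow> 'b) \<Rightarrow> bool" where
  "alg_hom R A B f \<longleftrightarrow> module_map R A B f \<and> f \<one>\<^bsub>A\<^esub> = \<one>\<^bsub>B\<^esub> \<and>
    (\<forall>x\<in>carrier A. \<forall>y\<in>carrier A. f (x \<otimes>\<^bsub>A\<^esub> y) = f x \<otimes>\<^bsub>B\<^esub> f y)"

lemma alg_homI:
  "\<lbrakk>module_map R A B f; f \<one>\<^bsub>A\<^esub> = \<one>\<^bsub>B\<^esub>;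
    \<And>x y. \<lbrakk>x \<in> carrier A; y \<in> carrier A\<rbrakk> \<Longrightarrow> f (x \<otimes>\<^bsub>A\<^esub> y) = f x \<otimes>\<^bsub>B\<^esub> f y\<rbrakk> \<Longrightarrow> alg_hom R A B f"
  by (simp add: alg_hom_def)

lemma alg_hom_map: "alg_hom R A B f \<Longrightarrow> module_map R A B f"
  by (simp add: alg_hom_def)

lemma alg_hom_one: "alg_hom R A B f \<Longrightarrow> f \<one>\<^bsub>A\<^esub> = \<one>\<^bsub>B\<^esub>"
  by (simp add: alg_hom_def)

lemma alg_hom_mult:
  "alg_hom R A B f \<Longrightarrow> x \<in> carrier A \<Longrightarrow> y \<in> carrier A \<Longrightarrow> f (x \<otimes>\<^bsub>A\<^esub> y) = f x \<otimes>\<^bsub>B\<^esub> f y"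
  by (simp add: alg_hom_def)

lemma alg_hom_comp: "alg_hom R A B f \<Longrightarrow> alg_hom R B C g \<Longrightarrow> alg_hom R A C (\<lambda>x. g (f x))"
  by (intro alg_homI module_map_comp[of R A B f C g])
    (simp_all add: alg_hom_map alg_hom_one alg_hom_mult module_map_closed[OF alg_hom_map])

lemma superalg_hom_iff:
  "f \<in> superalg_hom R A B \<longleftrightarrow> alg_hom R A B f \<and> (\<forall>s. f ` part A s \<subseteq> part B s)"
  by (auto simp: superalg_hom_def alg_hom_def module_map_def ring_hom_def)

lemma superalg_homI:
  "alg_hom R A B f \<Longrightarrow> (\<And>s x. x \<in> part A s \<Longrightarrow> f x \<in> part B s) \<Longrightarrow> f \<in> superalg_hom R A B"
  by (auto simp: superalg_hom_iff)

lemma superalg_hom_alg: "f \<in> superalg_hom R A B \<Longrightarrow> alg_hom R A B f"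
  by (simp add: superalg_hom_iff)

lemma superalg_hom_map: "f \<in> superalg_hom R A B \<Longrightarrow> module_map R A B f"
  by (simp add: superalg_hom_iff alg_hom_map)

lemma superalg_hom_part: "f \<in> superalg_hom R A B \<Longrightarrow> x \<in> part A s \<Longrightarrow> f x \<in> part B s"
  by (auto simp: superalg_hom_iff)

lemma superalg_hom_comp:
  assumes f: "f \<in> superalg_hom R A B" and g: "g \<in> superalg_hom R B C"
  shows "(\<lambda>x. g (f x)) \<in> superalg_hom R A C"
  by (intro superalg_homI alg_hom_comp[OF superalg_hom_alg[OF f] superalg_hom_alg[OF g]])
    (rule superalg_hom_part[OF g superalg_hom_part[OF f]])

lemma superalg_hom_id: "(\<lambda>x. x) \<in> superalg_hom R A A"
  by (simp add: superalg_hom_iff alg_hom_def module_map_id)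

lemma bit_cases: "(s::bit) = 0 \<or> s = 1"
  by (cases s) auto

lemma bit_add_self [simp]: "(s::bit) + s = 0"
  by (cases s) simp_all

lemma bit_add_left_self [simp]: "(s::bit) + (s + t) = t"
  by (simp flip: add.assoc)

lemma (in abelian_monoid) finsum_bit:
  assumes "f 0 \<in> carrier G" "f (1::bit) \<in> carrier G"
  shows "(\<Oplus>s\<in>UNIV. f s) = f 0 \<oplus> f 1"
proof -
  have U: "(UNIV :: bit set) = {0, 1}" using bit_cases by auto
  show ?thesis unfolding U using assms by simp
qed

context cring
begin

lemma parity_sign_closed [simp, intro]: "parity_sign R s \<in> carrier R"
  by (simp add: parity_sign_def)

lemma parity_sign_0 [simp]: "parity_sign R 0 = \<one>"
  by (simp add: parity_sign_def)

lemma parity_sign_add: "parity_sign R (s + t) = parity_sign R s \<otimes> parity_sign R t"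
  by (cases s; cases t) (simp_all add: parity_sign_def l_minus r_minus)

end

section \<open>Decomposition into homogeneous components\<close>

context superalgebra
begin

lemma part_closed: "x \<in> part A s \<Longrightarrow> x \<in> carrier A"
  using submoduleE(1)[OF part_submodule] by blast

lemma part_zero: "\<zero>\<^bsub>A\<^esub> \<in> part A s"
  using submodule_zero[OF part_submodule] .

lemma part_add: "x \<in> part A s \<Longrightarrow> y \<in> part A s \<Longrightarrow> x \<oplus>\<^bsub>A\<^esub> y \<in> part A s"
  using submoduleE(5)[OF part_submodule] .

lemma part_smult: "r \<in> carrier R \<Longrightarrow> x \<in> part A s \<Longrightarrow> r \<odot>\<^bsub>A\<^esub> x \<in> part A s"
  using submoduleE(4)[OF part_submodule] .

lemma part_decomp:
  assumes "x \<in> carrier A"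
  obtains u v where "u \<in> part A s" "v \<in> part A (s + 1)" "x = u \<oplus>\<^bsub>A\<^esub> v"
proof -
  obtain u v where uv: "u \<in> part A 0" "v \<in> part A 1" "x = u \<oplus>\<^bsub>A\<^esub> v"
    using part_direct_sum[OF assms] by (metis mem_Times_iff)
  then have "x = v \<oplus>\<^bsub>A\<^esub> u" using M.a_comm part_closed by blast
  with uv show ?thesis using that[of u v] that[of v u] by (cases s) simp_all
qed

text \<open>\<open>part_direct_sum\<close> fixes the order even, odd. For \<open>s = 1\<close> the
  two summands are exchanged first.\<close>

lemma part_decomp_unique:
  assumes "u \<in> part A s" "v \<in> part A (s + 1)" "u' \<in> part A s" "v' \<in> part A (s + 1)"
    and "u \<oplus>\<^bsub>A\<^esub> v = u' \<oplus>\<^bsub>A\<^esub> v'"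
  shows "u = u'" and "v = v'"
proof -
  have *: "u = u' \<and> v = v'" if "u \<in> part A 0" "v \<in> part A 1" "u' \<in> part A 0" "v' \<in> part A 1"
    "u \<oplus>\<^bsub>A\<^esub> v = u' \<oplus>\<^bsub>A\<^esub> v'" for u v u' v'
  proof -
    have "\<exists>!c. c \<in> part A 0 \<times> part A 1 \<and> u \<oplus>\<^bsub>A\<^esub> v = fst c \<oplus>\<^bsub>A\<^esub> snd c"
      using that by (intro part_direct_sum M.a_closed part_closed)
    moreover have "(u, v) \<in> part A 0 \<times> part A 1 \<and> u \<oplus>\<^bsub>A\<^esub> v = fst (u, v) \<oplus>\<^bsub>A\<^esub> snd (u, v)"
      "(u', v') \<in> part A 0 \<times> part A 1 \<and> u \<oplus>\<^bsub>A\<^esub> v = fst (u', v') \<oplus>\<^bsub>A\<^esub> snd (u', v')"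
      using that by simp_all
    ultimately have "(u, v) = (u', v')" by blast
    then show ?thesis by simp
  qed
  have "u = u' \<and> v = v'"
  proof (cases "s = 0")
    case True
    then show ?thesis using * assms by simp
  next
    case False
    then have "s = 1" using bit_cases by blast
    then have "v \<oplus>\<^bsub>A\<^esub> u = v' \<oplus>\<^bsub>A\<^esub> u'" using assms M.a_comm part_closed by metis
    then show ?thesis using *[of v u v' u'] assms \<open>s = 1\<close> by simp
  qed
  then show "u = u'" "v = v'" by simp_all
qed

lemma component_eqI:
  assumes "u \<in> part A s" "v \<in> part A (s + 1)"
  shows "component A s (u \<oplus>\<^bsub>A\<^esub> v) = u"
  unfolding component_def
  using assms part_decomp_unique(1) by (intro the_equality) blast+

lemma component_part: "x \<in> carrier A \<Longrightarrow> component A s x \<in> part A s"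
  by (rule part_decomp[of x s]) (simp_all add: component_eqI)

lemma component_same: "x \<in> part A s \<Longrightarrow> component A s x = x"
  using component_eqI[of x s "\<zero>\<^bsub>A\<^esub>"] part_zero part_closed by simp

lemma component_other: "x \<in> part A t \<Longrightarrow> s \<noteq> t \<Longrightarrow> component A s x = \<zero>\<^bsub>A\<^esub>"
proof -
  assume x: "x \<in> part A t" and "s \<noteq> t"
  then have "t = s + 1" using bit_cases[of s] bit_cases[of t] by auto
  then show ?thesis using component_eqI[of "\<zero>\<^bsub>A\<^esub>" s x] part_zero part_closed x by simp
qed

lemma component_map: "module_map R A A (component A s)"
proof (rule module_mapI)
  show "component A s x \<in> carrier A" if "x \<in> carrier A" for x
    using component_part part_closed that by blast
  show "component A s (x \<oplus>\<^bsub>A\<^esub> y) = component A s x \<oplus>\<^bsub>A\<^esub> component A s y"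
    if xy: "x \<in> carrier A" "y \<in> carrier A" for x y
  proof -
    obtain u v u' v' where uv: "u \<in> part A s" "v \<in> part A (s + 1)" "x = u \<oplus>\<^bsub>A\<^esub> v"
      "u' \<in> part A s" "v' \<in> part A (s + 1)" "y = u' \<oplus>\<^bsub>A\<^esub> v'"
      using part_decomp xy by metis
    then have "x \<oplus>\<^bsub>A\<^esub> y = (u \<oplus>\<^bsub>A\<^esub> u') \<oplus>\<^bsub>A\<^esub> (v \<oplus>\<^bsub>A\<^esub> v')"
      by (simp add: part_closed M.a_ac)
    then show ?thesis using uv component_eqI part_add by simp
  qed
  show "component A s (r \<odot>\<^bsub>A\<^esub> x) = r \<odot>\<^bsub>A\<^esub> component A s x"
    if rx: "r \<in> carrier R" "x \<in> carrier A" for r x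
  proof -
    obtain u v where uv: "u \<in> part A s" "v \<in> part A (s + 1)" "x = u \<oplus>\<^bsub>A\<^esub> v"
      using part_decomp rx(2) by metis
    then have "r \<odot>\<^bsub>A\<^esub> x = r \<odot>\<^bsub>A\<^esub> u \<oplus>\<^bsub>A\<^esub> r \<odot>\<^bsub>A\<^esub> v"
      using rx by (simp add: part_closed smult_r_distr)
    then show ?thesis using uv component_eqI part_smult rx by simp
  qed
qed

lemma component_sum: "x \<in> carrier A \<Longrightarrow> component A 0 x \<oplus>\<^bsub>A\<^esub> component A 1 x = x"
proof -
  assume "x \<in> carrier A"
  then obtain u v where uv: "u \<in> part A 0" "v \<in> part A (0 + 1)" "x = u \<oplus>\<^bsub>A\<^esub> v"
    by (rule part_decomp)
  moreover have "x = v \<oplus>\<^bsub>A\<^esub> u" using uv M.a_comm part_closed by blast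
  ultimately show ?thesis using component_eqI[of u 0 v] component_eqI[of v 1 u] by simp
qed

lemma homogeneous_induct [consumes 1, case_names hom add]:
  assumes "x \<in> carrier A"
    and "\<And>x s. x \<in> part A s \<Longrightarrow> P x"
    and "\<And>x y. x \<in> carrier A \<Longrightarrow> y \<in> carrier A \<Longrightarrow> P x \<Longrightarrow> P y \<Longrightarrow> P (x \<oplus>\<^bsub>A\<^esub> y)"
  shows "P x"
  using assms component_sum component_part part_closed by metis

lemma module_ax: "module R A" ..

end

text \<open>The usual criterion for a direct sum: unique decomposition is replaced by existence
  together with trivial intersection of the two parts.\<close>

lemma superalgebraI:
  assumes "assoc_algebra R A" and sub: "\<And>s. submodule (part A s) R A"
    and dec: "\<And>x. x \<in> carrier A \<Longrightarrow> \<exists>u\<in>part A 0. \<exists>v\<in>part A 1. x = u \<oplus>\<^bsub>A\<^esub> v"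
    and int: "part A 0 \<inter> part A 1 \<subseteq> {\<zero>\<^bsub>A\<^esub>}"
    and one: "\<one>\<^bsub>A\<^esub> \<in> part A 0"
    and mult: "\<And>x y s t. x \<in> part A s \<Longrightarrow> y \<in> part A t \<Longrightarrow> x \<otimes>\<^bsub>A\<^esub> y \<in> part A (s + t)"
  shows "superalgebra R A"
proof -
  interpret A: assoc_algebra R A by fact
  have cl: "x \<in> carrier A" if "x \<in> part A s" for x s
    using A.submoduleE(1)[OF sub] that by blast
  show ?thesis
  proof (intro superalgebra.intro superalgebra_axioms.intro A.R.is_cring A.module_ax A.A.ring_axioms)
    fix x assume "x \<in> carrier A"
    then obtain u v where uv: "u \<in> part A 0" "v \<in> part A 1" "x = u \<oplus>\<^bsub>A\<^esub> v" using dec by blast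
    show "\<exists>!c. c \<in> part A 0 \<times> part A 1 \<and> x = fst c \<oplus>\<^bsub>A\<^esub> snd c"
    proof (rule ex1I[of _ "(u, v)"])
      show "(u, v) \<in> part A 0 \<times> part A 1 \<and> x = fst (u, v) \<oplus>\<^bsub>A\<^esub> snd (u, v)" using uv by simp
      fix c assume c: "c \<in> part A 0 \<times> part A 1 \<and> x = fst c \<oplus>\<^bsub>A\<^esub> snd c"
      have cc: "u \<in> carrier A" "v \<in> carrier A" "fst c \<in> carrier A" "snd c \<in> carrier A"
        using cl c uv by auto
      have "u \<oplus>\<^bsub>A\<^esub> v = fst c \<oplus>\<^bsub>A\<^esub> snd c" using c uv by simp
      \<comment> \<open>The difference of two decompositions of \<open>x\<close> lies in both
        parts.\<close>
      then have "u \<ominus>\<^bsub>A\<^esub> fst c = snd c \<ominus>\<^bsub>A\<^esub> v"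
        using cc by (metis A.M.add.inv_solve_right A.M.a_closed A.M.a_comm A.M.add.m_assoc A.M.minus_closed a_inv_def a_minus_def A.M.add.inv_closed)
      moreover have "u \<ominus>\<^bsub>A\<^esub> fst c \<in> part A 0" "snd c \<ominus>\<^bsub>A\<^esub> v \<in> part A 1"
        using c uv A.submoduleE(3,5)[OF sub] by (auto simp: a_minus_def)
      ultimately have "u \<ominus>\<^bsub>A\<^esub> fst c = \<zero>\<^bsub>A\<^esub>" "snd c \<ominus>\<^bsub>A\<^esub> v = \<zero>\<^bsub>A\<^esub>"
        using int by auto
      then show "c = (u, v)" using cc A.minus_eq_zero_iff by (cases c) auto
    qed
  qed (use A.smult_mult_left A.smult_mult_right one mult sub in auto)
qed

section \<open>Tensor products of superalgebras\<close>

lemma same_module_tensor_superalg: "same_module (tensor_superalg R A B) (tensor_module R A B)"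
  by (simp add: same_module_def tensor_superalg_def Let_def)

lemma tensor_superalg_simps:
  "carrier (tensor_superalg R A B) = carrier (tensor_module R A B)"
  "\<zero>\<^bsub>tensor_superalg R A B\<^esub> = \<zero>\<^bsub>tensor_module R A B\<^esub>"
  "add (tensor_superalg R A B) = add (tensor_module R A B)"
  "module.smult (tensor_superalg R A B) = module.smult (tensor_module R A B)"
  "\<one>\<^bsub>tensor_superalg R A B\<^esub> = tens R A B \<one>\<^bsub>A\<^esub> \<one>\<^bsub>B\<^esub>"
  "part (tensor_superalg R A B) s = (\<lambda>H. submodule H R (tensor_module R A B)) hull
          {tens R A B a b | a b t u. a \<in> part A t \<and> b \<in> part B u \<and> t + u = s}"
  by (simp_all add: tensor_superalg_def Let_def)

context
  fixes R :: "('r, 'm) ring_scheme" (structure)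
    and A :: "('r, 'a, 'l) superalg_scheme" and B :: "('r, 'b, 'k) superalg_scheme"
  assumes A: "superalgebra R A" and B: "superalgebra R B"
begin

interpretation A: superalgebra R A by (rule A)
interpretation B: superalgebra R B by (rule B)

private abbreviation (input) "TAB \<equiv> tensor_module R A B"
private abbreviation (input) "SAB \<equiv> tensor_superalg R A B"

interpretation T: module R TAB by (rule tensor_module_module[OF A.module_ax B.module_ax])

lemmas tmod = A.module_ax B.module_ax

lemma tensor_superalg_module: "module R SAB"
  using same_module_module[OF same_module_sym[OF same_module_tensor_superalg] T.module_axioms] .

lemma tens_zero [simp]:
  "b \<in> carrier B \<Longrightarrow> tens R A B \<zero>\<^bsub>A\<^esub> b = \<zero>\<^bsub>TAB\<^esub>"
  "a \<in> carrier A \<Longrightarrow> tens R A B a \<zero>\<^bsub>B\<^esub> = \<zero>\<^bsub>TAB\<^esub>"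
  using module_map_zero[OF tens_map_left[OF tmod] A.module_ax T.module_axioms]
    module_map_zero[OF tens_map_right[OF tmod] B.module_ax T.module_axioms] by auto

text \<open>Splitting both factors into components reduces everything to pure tensors with
  homogeneous factors, where the sign rule is a closed formula.\<close>

lemma tensor_homogeneous_induct [consumes 1, case_names tens add]:
  assumes "x \<in> carrier TAB"
    and "\<And>a b s t. a \<in> part A s \<Longrightarrow> b \<in> part B t \<Longrightarrow> P (tens R A B a b)"
    and "\<And>x y. x \<in> carrier TAB \<Longrightarrow> y \<in> carrier TAB \<Longrightarrow> P x \<Longrightarrow> P y \<Longrightarrow> P (x \<oplus>\<^bsub>TAB\<^esub> y)"
  shows "P x"
  using assms(1)
proof (induction rule: tensor_induct[OF tmod, consumes 1, case_names tens add])
  case (tens a b)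
  note b = tens(2)
  from tens(1) show ?case
  proof (induction rule: A.homogeneous_induct)
    case (hom a s)
    from b show ?case
    proof (induction rule: B.homogeneous_induct)
      case (hom b t)
      then show ?case using assms(2) \<open>a \<in> part A s\<close> by blast
    next
      case (add b b')
      then show ?case
        using assms(3) tens_closed[OF tmod] A.part_closed[OF hom] by (simp add: tens_add_smult[OF tmod])
    qed
  next
    case (add a a')
    then show ?case
      using assms(3) tens_closed[OF tmod] b by (simp add: tens_add_smult[OF tmod])
  qed
next
  case (add t u)
  then show ?case using assms(3) by blast
qed

text \<open>The four-argument map behind the product is linear in each argument, so it lifts by
  \<open>tens_lift2\<close>. Only the two inner factors enter the sign, which is why
  \<open>a\<close> and \<open>d\<close> range over the whole carriers.\<close>

lemma tensor_mult_maps: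
  shows "bilinear_map R SAB SAB SAB (\<lambda>(x, y). x \<otimes>\<^bsub>SAB\<^esub> y)"
    and "\<lbrakk>a \<in> carrier A; b \<in> part B s; c \<in> part A t; d \<in> carrier B\<rbrakk> \<Longrightarrow>
      tens R A B a b \<otimes>\<^bsub>SAB\<^esub> tens R A B c d =
      parity_sign R (s * t) \<odot>\<^bsub>TAB\<^esub> tens R A B (a \<otimes>\<^bsub>A\<^esub> c) (b \<otimes>\<^bsub>B\<^esub> d)"
proof -
  let ?h = "\<lambda>(a, b) (c, d). \<Oplus>\<^bsub>TAB\<^esub>s\<in>UNIV. \<Oplus>\<^bsub>TAB\<^esub>t\<in>UNIV. parity_sign R (s * t) \<odot>\<^bsub>TAB\<^esub>
            tens R A B (a \<otimes>\<^bsub>A\<^esub> component A t c) (component B s b \<otimes>\<^bsub>B\<^esub> d)"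
  have mult: "(\<lambda>(x, y). x \<otimes>\<^bsub>SAB\<^esub> y) =
      (\<lambda>(U, V). tens_lift R TAB (\<lambda>p. tens_lift R TAB (?h p) V) U)"
    by (simp add: tensor_superalg_def Let_def fun_eq_iff case_prod_unfold)
  note maps = module_map_comp[OF _ tens_map_left[OF tmod]] module_map_comp[OF _ tens_map_right[OF tmod]]
  have compA: "module_map R A A (\<lambda>c. a \<otimes>\<^bsub>A\<^esub> component A t c)" "module_map R A A (\<lambda>a. a \<otimes>\<^bsub>A\<^esub> component A t a')"
    if "a \<in> carrier A" "a' \<in> carrier A" for a a' t
    using that A.component_map[of t] assoc_algebra.mult_map_right[OF A.assoc_algebra]
      assoc_algebra.mult_map_left[OF A.assoc_algebra] module_map_closed[OF A.component_map]
    by (auto intro: module_map_comp)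
  have compB: "module_map R B B (\<lambda>b. component B s b \<otimes>\<^bsub>B\<^esub> d)" "module_map R B B (\<lambda>d. component B s b \<otimes>\<^bsub>B\<^esub> d)"
    if "b \<in> carrier B" "d \<in> carrier B" for b d s
    using that B.component_map[of s] assoc_algebra.mult_map_right[OF B.assoc_algebra]
      assoc_algebra.mult_map_left[OF B.assoc_algebra] module_map_closed[OF B.component_map]
      module_map_comp[OF B.component_map assoc_algebra.mult_map_left[OF B.assoc_algebra]]
    by auto
  have h1: "bilinear_map R A B TAB (?h (a, b))" if "a \<in> carrier A" "b \<in> carrier B" for a b
    using that compA compB module_map_closed[OF compA(1)] module_map_closed[OF compB(1)]
    by (auto intro!: bilinear_mapI module_map_finsum_fun module_map_scale maps T.module_axioms tmod)
  have h2: "bilinear_map R A B TAB (\<lambda>p. ?h p (c, d))" if "c \<in> carrier A" "d \<in> carrier B" for c d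
    using that compA compB module_map_closed[OF compA(1)] module_map_closed[OF compB(1)]
    by (auto intro!: bilinear_mapI module_map_finsum_fun module_map_scale maps T.module_axioms tmod)
  have "bilinear_map R TAB TAB TAB (\<lambda>(x, y). x \<otimes>\<^bsub>SAB\<^esub> y)"
    unfolding mult by (rule tens_lift2(1)[OF tmod tmod T.module_axioms h1 h2])
  then show "bilinear_map R SAB SAB SAB (\<lambda>(x, y). x \<otimes>\<^bsub>SAB\<^esub> y)"
    by (simp add: bilinear_map_def tensor_superalg_simps module_map_def)
  assume el: "a \<in> carrier A" "b \<in> part B s" "c \<in> part A t" "d \<in> carrier B"
  have bc: "b \<in> carrier B" "c \<in> carrier A" using el A.part_closed B.part_closed by auto
  have "tens R A B a b \<otimes>\<^bsub>SAB\<^esub> tens R A B c d = ?h (a, b) (c, d)"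
    using fun_cong[OF mult, of "(tens R A B a b, tens R A B c d)"]
      tens_lift2(2)[OF tmod tmod T.module_axioms h1 h2 el(1) bc el(4)] by simp
  \<comment> \<open>A homogeneous element is its own component in one parity and has component zero
    in the other, so one of the four terms survives.\<close>
  also have "\<dots> = (\<Oplus>\<^bsub>TAB\<^esub>s'\<in>UNIV. \<Oplus>\<^bsub>TAB\<^esub>t'\<in>UNIV. parity_sign R (s' * t') \<odot>\<^bsub>TAB\<^esub>
            tens R A B (a \<otimes>\<^bsub>A\<^esub> (if t' = t then c else \<zero>\<^bsub>A\<^esub>)) ((if s' = s then b else \<zero>\<^bsub>B\<^esub>) \<otimes>\<^bsub>B\<^esub> d))"
  proof -
    have "component A t' c = (if t' = t then c else \<zero>\<^bsub>A\<^esub>)" for t'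
      using A.component_same A.component_other el by auto
    moreover have "component B s' b = (if s' = s then b else \<zero>\<^bsub>B\<^esub>)" for s'
      using B.component_same B.component_other el by auto
    ultimately show ?thesis by simp
  qed
  also have "\<dots> = parity_sign R (s * t) \<odot>\<^bsub>TAB\<^esub> tens R A B (a \<otimes>\<^bsub>A\<^esub> c) (b \<otimes>\<^bsub>B\<^esub> d)"
    using el bc tens_closed[OF tmod]
    by (cases s; cases t) (simp_all add: T.finsum_bit)
  finally show "tens R A B a b \<otimes>\<^bsub>SAB\<^esub> tens R A B c d =
      parity_sign R (s * t) \<odot>\<^bsub>TAB\<^esub> tens R A B (a \<otimes>\<^bsub>A\<^esub> c) (b \<otimes>\<^bsub>B\<^esub> d)" .
qed

lemma tensor_mult_map_left: "y \<in> carrier TAB \<Longrightarrow> module_map R TAB TAB (\<lambda>x. x \<otimes>\<^bsub>SAB\<^esub> y)"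
  and tensor_mult_map_right: "x \<in> carrier TAB \<Longrightarrow> module_map R TAB TAB (\<lambda>y. x \<otimes>\<^bsub>SAB\<^esub> y)"
  using bilinear_mapD[OF tensor_mult_maps(1)]
  by (simp_all add: tensor_superalg_simps module_map_def)

lemmas tensor_mult_linear [simp] =
  module_map_closed[OF tensor_mult_map_left] module_map_add[OF tensor_mult_map_left]
  module_map_smult[OF tensor_mult_map_left] module_map_add[OF tensor_mult_map_right]
  module_map_smult[OF tensor_mult_map_right]

lemma tensor_superalg_assoc_algebra: "assoc_algebra R SAB"
proof (rule assoc_algebraI[OF tensor_superalg_module tensor_mult_maps(1)], unfold tensor_superalg_simps)
  note [simp] = tens_closed[OF tmod] A.part_closed B.part_closed tensor_mult_maps(2)
  show "(x \<otimes>\<^bsub>SAB\<^esub> y) \<otimes>\<^bsub>SAB\<^esub> z = x \<otimes>\<^bsub>SAB\<^esub> (y \<otimes>\<^bsub>SAB\<^esub> z)"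
    if "x \<in> carrier TAB" "y \<in> carrier TAB" "z \<in> carrier TAB" for x y z
    using that(1)
  proof (induction rule: tensor_homogeneous_induct)
    case (tens a b sa sb)
    note x = this
    from that(2) show ?case
    proof (induction rule: tensor_homogeneous_induct)
      case (tens c d sc sd)
      note y = this
      from that(3) show ?case
      proof (induction rule: tensor_homogeneous_induct)
        case (tens e f se sf)
        \<comment> \<open>The parities needed for the outer products. The two bracketings carry the
          exponents \<open>sb * sc + (sb + sd) * se\<close> and
          \<open>sd * se + sb * (sc + se)\<close>, which agree.\<close>
        have ce: "c \<otimes>\<^bsub>A\<^esub> e \<in> part A (sc + se)" "b \<otimes>\<^bsub>B\<^esub> d \<in> part B (sb + sd)"
          using A.part_mult B.part_mult x y tens by auto
        show ?case
          using x y tens ce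
            tensor_mult_maps(2)[OF _ ce(2) tens(1), of "a \<otimes>\<^bsub>A\<^esub> c" f]
            tensor_mult_maps(2)[OF _ x(2) ce(1), of a "d \<otimes>\<^bsub>B\<^esub> f"]
          by (simp add: A.A.m_assoc B.A.m_assoc distrib_left distrib_right add_ac
              flip: T.smult_assoc1 A.parity_sign_add)
      next
        case (add u v)
        then show ?case using x y by simp
      qed
    next
      case (add u v)
      then show ?case using x that by simp
    qed
  next
    case (add u v)
    then show ?case using that by simp
  qed
  show "tens R A B \<one>\<^bsub>A\<^esub> \<one>\<^bsub>B\<^esub> \<in> carrier TAB" by simp
  show "tens R A B \<one>\<^bsub>A\<^esub> \<one>\<^bsub>B\<^esub> \<otimes>\<^bsub>SAB\<^esub> x = x" if "x \<in> carrier TAB" for x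
    using that
  proof (induction rule: tensor_homogeneous_induct)
    case (tens a b s t)
    then show ?case using tensor_mult_maps(2)[OF _ B.part_one tens(1), of "\<one>\<^bsub>A\<^esub>" b] by simp
  qed simp
  show "x \<otimes>\<^bsub>SAB\<^esub> tens R A B \<one>\<^bsub>A\<^esub> \<one>\<^bsub>B\<^esub> = x" if "x \<in> carrier TAB" for x
    using that
  proof (induction rule: tensor_homogeneous_induct)
    case (tens a b s t)
    then show ?case using tensor_mult_maps(2)[OF _ tens(2) A.part_one, of a "\<one>\<^bsub>B\<^esub>"] by simp
  qed simp
qed

lemma tensor_part_generators:
  "{tens R A B a b | a b t u. a \<in> part A t \<and> b \<in> part B u \<and> t + u = s} \<subseteq> carrier TAB"
  using tens_closed[OF tmod] A.part_closed B.part_closed by blast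

lemma tensor_part_submodule: "submodule (part SAB s) R TAB"
  unfolding tensor_superalg_simps by (rule T.submodule_hull[OF tensor_part_generators])

lemma tensor_part_tens: "a \<in> part A s \<Longrightarrow> b \<in> part B t \<Longrightarrow> tens R A B a b \<in> part SAB (s + t)"
  unfolding tensor_superalg_simps by (rule hull_inc) blast

lemma tensor_part_subset:
  assumes "submodule H R TAB" "\<And>a b t u. a \<in> part A t \<Longrightarrow> b \<in> part B u \<Longrightarrow> t + u = s \<Longrightarrow> tens R A B a b \<in> H"
  shows "part SAB s \<subseteq> H"
  unfolding tensor_superalg_simps by (rule hull_minimal) (use assms in auto)

lemma tensor_superalg_superalgebra: "superalgebra R SAB"
proof (rule superalgebraI[OF tensor_superalg_assoc_algebra])
  note [simp] = tens_closed[OF tmod] A.part_closed B.part_closed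
  interpret TS: assoc_algebra R SAB by (rule tensor_superalg_assoc_algebra)
  show sub: "submodule (part SAB s) R SAB" for s
    using tensor_part_submodule same_module_submodule[OF same_module_tensor_superalg] by blast
  show "\<one>\<^bsub>SAB\<^esub> \<in> part SAB 0"
    using tensor_part_tens[OF A.part_one B.part_one] by (simp add: tensor_superalg_simps(5))
  have "\<exists>u\<in>part SAB 0. \<exists>v\<in>part SAB 1. x = u \<oplus>\<^bsub>TAB\<^esub> v" if "x \<in> carrier TAB" for x
    using that
  proof (induction rule: tensor_homogeneous_induct)
    case (tens a b s t)
    have "tens R A B a b \<in> part SAB (s + t)" using tens tensor_part_tens by blast
    moreover have "tens R A B a b = tens R A B a b \<oplus>\<^bsub>TAB\<^esub> \<zero>\<^bsub>TAB\<^esub>" "tens R A B a b = \<zero>\<^bsub>TAB\<^esub> \<oplus>\<^bsub>TAB\<^esub> tens R A B a b"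
      using tens by simp_all
    ultimately show ?case
      using bit_cases[of "s + t"] T.submodule_zero[OF tensor_part_submodule] by metis
  next
    case (add x y)
    then obtain u v u' v' where uv: "u \<in> part SAB 0" "v \<in> part SAB 1" "x = u \<oplus>\<^bsub>TAB\<^esub> v"
      "u' \<in> part SAB 0" "v' \<in> part SAB 1" "y = u' \<oplus>\<^bsub>TAB\<^esub> v'" by blast
    then have "u \<in> carrier TAB" "v \<in> carrier TAB" "u' \<in> carrier TAB" "v' \<in> carrier TAB"
      using T.submoduleE(1)[OF tensor_part_submodule] by blast+
    then have "x \<oplus>\<^bsub>TAB\<^esub> y = (u \<oplus>\<^bsub>TAB\<^esub> u') \<oplus>\<^bsub>TAB\<^esub> (v \<oplus>\<^bsub>TAB\<^esub> v')"
      using uv by (simp add: T.M.a_ac)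
    then show ?case using uv T.submoduleE(5)[OF tensor_part_submodule] by blast
  qed
  then show "\<exists>u\<in>part SAB 0. \<exists>v\<in>part SAB 1. x = u \<oplus>\<^bsub>SAB\<^esub> v" if "x \<in> carrier SAB" for x
    using that by (simp add: tensor_superalg_simps(1-4))
  show "part SAB 0 \<inter> part SAB 1 \<subseteq> {\<zero>\<^bsub>SAB\<^esub>}"
  proof -
    \<comment> \<open>The projection onto the even part, whose terms are even with even and odd with
      odd. It fixes \<open>part SAB 0\<close> and kills \<open>part SAB 1\<close>, so an element of
      both is zero.\<close>
    let ?h = "\<lambda>(a, b). tens R A B (component A 0 a) (component B 0 b) \<oplus>\<^bsub>TAB\<^esub>
      tens R A B (component A 1 a) (component B 1 b)"
    have c: "a \<in> carrier A \<Longrightarrow> component A s a \<in> carrier A"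
      "b \<in> carrier B \<Longrightarrow> component B s b \<in> carrier B" for a b s
      using A.component_part B.component_part A.part_closed B.part_closed by blast+
    have h: "bilinear_map R A B TAB ?h"
      using c by (auto intro!: bilinear_mapI module_map_sum T.module_axioms
          module_map_comp[OF A.component_map tens_map_left[OF tmod]]
          module_map_comp[OF B.component_map tens_map_right[OF tmod]])
    note L = tens_lift_map[OF tmod T.module_axioms h]
    have v: "tens_lift R TAB ?h (tens R A B a b) = (if t + u = 0 then tens R A B a b else \<zero>\<^bsub>TAB\<^esub>)"
      if "a \<in> part A t" "b \<in> part B u" for a b t u
      using that bit_cases[of t] bit_cases[of u]
      by (auto simp: tens_lift_tens[OF tmod T.module_axioms h] A.component_same A.component_other
          B.component_same B.component_other)
    have "part SAB 0 \<subseteq> {x \<in> carrier TAB. tens_lift R TAB ?h x = x}"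
      by (rule tensor_part_subset[OF submodule_equalizer[OF L module_map_id T.module_axioms T.module_axioms]])
        (auto simp: v)
    moreover have "part SAB 1 \<subseteq> {x \<in> carrier TAB. tens_lift R TAB ?h x = \<zero>\<^bsub>TAB\<^esub>}"
      by (rule tensor_part_subset[OF submodule_equalizer[OF L module_map_const_zero[OF T.module_axioms]
              T.module_axioms T.module_axioms]])
        (auto simp: v)
    ultimately show ?thesis by (auto simp: tensor_superalg_simps(2))
  qed
  show "x \<otimes>\<^bsub>SAB\<^esub> y \<in> part SAB (s + t)" if x: "x \<in> part SAB s" and y: "y \<in> part SAB t" for x y s t
  proof -
    \<comment> \<open>One factor at a time: with a homogeneous pure tensor fixed on the left, the
      admissible right factors form a submodule that contains the generators. Afterwards the left
      factor is released in the same way.\<close>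
    have 1: "part SAB t \<subseteq> {y \<in> carrier TAB. tens R A B a b \<otimes>\<^bsub>SAB\<^esub> y \<in> part SAB (s + t)}"
      if ab: "a \<in> part A s1" "b \<in> part B s2" "s1 + s2 = s" for a b s1 s2
    proof (rule tensor_part_subset)
      show "submodule {y \<in> carrier TAB. tens R A B a b \<otimes>\<^bsub>SAB\<^esub> y \<in> part SAB (s + t)} R TAB"
        using ab by (intro submodule_module_map_vimage[OF tensor_mult_map_right T.module_axioms
              T.module_axioms tensor_part_submodule]) simp
      show "tens R A B c d \<in> {y \<in> carrier TAB. tens R A B a b \<otimes>\<^bsub>SAB\<^esub> y \<in> part SAB (s + t)}"
        if cd: "c \<in> part A t1" "d \<in> part B t2" "t1 + t2 = t" for c d t1 t2
      proof -
        have "tens R A B (a \<otimes>\<^bsub>A\<^esub> c) (b \<otimes>\<^bsub>B\<^esub> d) \<in> part SAB ((s1 + t1) + (s2 + t2))"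
          using ab cd A.part_mult B.part_mult by (intro tensor_part_tens)
        moreover have "(s1 + t1) + (s2 + t2) = s + t" using ab cd by (simp add: add_ac flip: ab(3) cd(3))
        ultimately show ?thesis
          using ab cd T.submoduleE(4)[OF tensor_part_submodule]
          by (simp add: tensor_mult_maps(2)[where s = s2 and t = t1])
      qed
    qed
    have yc: "y \<in> carrier TAB" using y T.submoduleE(1)[OF tensor_part_submodule] by blast
    have "part SAB s \<subseteq> {x \<in> carrier TAB. x \<otimes>\<^bsub>SAB\<^esub> y \<in> part SAB (s + t)}"
    proof (rule tensor_part_subset)
      show "submodule {x \<in> carrier TAB. x \<otimes>\<^bsub>SAB\<^esub> y \<in> part SAB (s + t)} R TAB"
        using yc by (intro submodule_module_map_vimage[OF tensor_mult_map_left T.module_axioms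
              T.module_axioms tensor_part_submodule]) simp
      show "tens R A B a b \<in> {x \<in> carrier TAB. x \<otimes>\<^bsub>SAB\<^esub> y \<in> part SAB (s + t)}"
        if ab: "a \<in> part A s1" "b \<in> part B s2" "s1 + s2 = s" for a b s1 s2
        using 1[OF ab] y ab by auto
    qed
    then show ?thesis using x by auto
  qed
qed

end

section \<open>Homomorphisms from tensor products\<close>

text \<open>Additivity extends multiplicativity from homogeneous pure tensors; hypothesis
  \<open>mult\<close> is the image of the sign rule under \<open>L\<close>.\<close>

lemma tensor_alg_homI:
  assumes A: "superalgebra R A" and B: "superalgebra R B" and M: "assoc_algebra R M"
    and L: "module_map R (tensor_module R A B) M L"
    and one: "L (tens R A B \<one>\<^bsub>A\<^esub> \<one>\<^bsub>B\<^esub>) = \<one>\<^bsub>M\<^esub>"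
    and mult: "\<And>a b c d s t u v. \<lbrakk>a \<in> part A s; b \<in> part B t; c \<in> part A u; d \<in> part B v\<rbrakk> \<Longrightarrow>
      L (tens R A B a b) \<otimes>\<^bsub>M\<^esub> L (tens R A B c d) =
      parity_sign R (t * u) \<odot>\<^bsub>M\<^esub> L (tens R A B (a \<otimes>\<^bsub>A\<^esub> c) (b \<otimes>\<^bsub>B\<^esub> d))"
  shows "alg_hom R (tensor_superalg R A B) M L"
proof (rule alg_homI)
  interpret A: superalgebra R A by fact
  interpret B: superalgebra R B by fact
  interpret M: assoc_algebra R M by fact
  note tmod = A.module_ax B.module_ax
  note [simp] = tens_closed[OF tmod] A.part_closed B.part_closed tensor_mult_linear[OF A B]
    module_map_add[OF L] module_map_smult[OF L] module_map_closed[OF L]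
  interpret T: module R "tensor_module R A B" by (rule tensor_module_module[OF tmod])
  show "module_map R (tensor_superalg R A B) M L"
    using L by (simp add: module_map_def tensor_superalg_simps)
  show "L \<one>\<^bsub>tensor_superalg R A B\<^esub> = \<one>\<^bsub>M\<^esub>" by (simp add: one tensor_superalg_simps)
  have "L (x \<otimes>\<^bsub>tensor_superalg R A B\<^esub> y) = L x \<otimes>\<^bsub>M\<^esub> L y"
    if "x \<in> carrier (tensor_module R A B)" "y \<in> carrier (tensor_module R A B)" for x y
    using that(1)
  proof (induction rule: tensor_homogeneous_induct[OF A B, consumes 1, case_names tens add])
    case (tens a b s t)
    note x = this
    from that(2) show ?case
    proof (induction rule: tensor_homogeneous_induct[OF A B, consumes 1, case_names tens add])
      case (tens c d u v)
      then show ?case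
        using x mult[OF x tens] tensor_mult_maps(2)[OF A B _ x(2) tens(1), of a d] by simp
    next
      case (add y z)
      then show ?case using x by (simp add: M.A.r_distr)
    qed
  next
    case (add y z)
    then show ?case using that(2) by (simp add: M.A.l_distr)
  qed
  then show "L (x \<otimes>\<^bsub>tensor_superalg R A B\<^esub> y) = L x \<otimes>\<^bsub>M\<^esub> L y"
    if "x \<in> carrier (tensor_superalg R A B)" "y \<in> carrier (tensor_superalg R A B)" for x y
    using that by (simp add: tensor_superalg_simps)
qed

lemma tensor_superalg_homI:
  assumes A: "superalgebra R A" and B: "superalgebra R B" and M: "superalgebra R M"
    and L: "module_map R (tensor_module R A B) M L"
    and one: "L (tens R A B \<one>\<^bsub>A\<^esub> \<one>\<^bsub>B\<^esub>) = \<one>\<^bsub>M\<^esub>"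
    and mult: "\<And>a b c d s t u v. \<lbrakk>a \<in> part A s; b \<in> part B t; c \<in> part A u; d \<in> part B v\<rbrakk> \<Longrightarrow>
      L (tens R A B a b) \<otimes>\<^bsub>M\<^esub> L (tens R A B c d) =
      parity_sign R (t * u) \<odot>\<^bsub>M\<^esub> L (tens R A B (a \<otimes>\<^bsub>A\<^esub> c) (b \<otimes>\<^bsub>B\<^esub> d))"
    and part: "\<And>a b s t. \<lbrakk>a \<in> part A s; b \<in> part B t\<rbrakk> \<Longrightarrow> L (tens R A B a b) \<in> part M (s + t)"
  shows "L \<in> superalg_hom R (tensor_superalg R A B) M"
proof (rule superalg_homI)
  interpret A: superalgebra R A by fact
  interpret B: superalgebra R B by fact
  interpret M: superalgebra R M by fact
  note tmod = A.module_ax B.module_ax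
  show "alg_hom R (tensor_superalg R A B) M L"
    by (rule tensor_alg_homI[OF A B M.assoc_algebra L one mult])
  have "part (tensor_superalg R A B) s \<subseteq> {x \<in> carrier (tensor_module R A B). L x \<in> part M s}" for s
    using part
    by (intro tensor_part_subset[OF A B] submodule_module_map_vimage[OF L tensor_module_module[OF tmod] M.module_ax M.part_submodule])
      (auto simp: tens_closed[OF tmod] A.part_closed B.part_closed)
  then show "L x \<in> part M s" if "x \<in> part (tensor_superalg R A B) s" for x s
    using that by blast
qed

text \<open>Even maps preserve the parities of the two inner factors, so the products before and
  after mapping carry the same sign.\<close>

lemma tens_map_superalg_hom:
  assumes A: "superalgebra R A" and B: "superalgebra R B" and C: "superalgebra R C" and D: "superalgebra R D"
    and f: "f \<in> superalg_hom R A C" and g: "g \<in> superalg_hom R B D"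
  shows "tens_map R C D f g \<in> superalg_hom R (tensor_superalg R A B) (tensor_superalg R C D)"
proof -
  interpret A: superalgebra R A by fact
  interpret B: superalgebra R B by fact
  interpret C: superalgebra R C by fact
  interpret D: superalgebra R D by fact
  note mods = A.module_ax B.module_ax C.module_ax D.module_ax superalg_hom_map[OF f] superalg_hom_map[OF g]
  note [simp] = A.part_closed B.part_closed C.part_closed D.part_closed tens_map_tens[OF mods]
    module_map_closed[OF superalg_hom_map[OF f]] module_map_closed[OF superalg_hom_map[OF g]]
    alg_hom_mult[OF superalg_hom_alg[OF f]] alg_hom_mult[OF superalg_hom_alg[OF g]]
    alg_hom_one[OF superalg_hom_alg[OF f]] alg_hom_one[OF superalg_hom_alg[OF g]]
  show ?thesis
  proof (rule tensor_superalg_homI[OF A B tensor_superalg_superalgebra[OF C D]])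
    show "module_map R (tensor_module R A B) (tensor_superalg R C D) (tens_map R C D f g)"
      using tens_map_map[OF mods] by (simp add: module_map_def tensor_superalg_simps)
    show "tens_map R C D f g (tens R A B \<one>\<^bsub>A\<^esub> \<one>\<^bsub>B\<^esub>) = \<one>\<^bsub>tensor_superalg R C D\<^esub>"
      by (simp add: tensor_superalg_simps)
    fix a b s t assume ab: "a \<in> part A s" "b \<in> part B t"
    then show "tens_map R C D f g (tens R A B a b) \<in> part (tensor_superalg R C D) (s + t)"
      by (simp add: tensor_part_tens[OF C D] superalg_hom_part[OF f] superalg_hom_part[OF g])
    fix c d u v assume cd: "c \<in> part A u" "d \<in> part B v"
    show "tens_map R C D f g (tens R A B a b) \<otimes>\<^bsub>tensor_superalg R C D\<^esub> tens_map R C D f g (tens R A B c d) =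
      parity_sign R (t * u) \<odot>\<^bsub>tensor_superalg R C D\<^esub>
        tens_map R C D f g (tens R A B (a \<otimes>\<^bsub>A\<^esub> c) (b \<otimes>\<^bsub>B\<^esub> d))"
      using ab cd
      by (simp add: tensor_mult_maps(2)[OF C D _ superalg_hom_part[OF g ab(2)] superalg_hom_part[OF f cd(1)]]
          tensor_superalg_simps(4))
  qed
qed

text \<open>A homogeneous element of \<open>tensor_superalg R A B\<close> is a combination of pure
  tensors. Multiplicativity is checked on pure tensors and extended in one argument at a time, by
  equalizers of the linear maps collected in \<open>maps\<close>.\<close>

lemma tens_assoc_superalg_hom:
  assumes A: "superalgebra R A" and B: "superalgebra R B" and C: "superalgebra R C"
  shows "tens_assoc R A B C \<in> superalg_hom R (tensor_superalg R (tensor_superalg R A B) C)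
    (tensor_superalg R A (tensor_superalg R B C))"
proof -
  interpret A: superalgebra R A by fact
  interpret B: superalgebra R B by fact
  interpret C: superalgebra R C by fact
  let ?AB = "tensor_superalg R A B" and ?BC = "tensor_superalg R B C"
  let ?TAB = "tensor_module R A B" and ?TBC = "tensor_module R B C"
  have AB: "superalgebra R ?AB" and BC: "superalgebra R ?BC"
    by (rule tensor_superalg_superalgebra A B C)+
  interpret AB: superalgebra R ?AB by (rule AB)
  interpret BC: superalgebra R ?BC by (rule BC)
  note ABC' = tensor_superalg_superalgebra[OF A BC]
  interpret ABC': superalgebra R "tensor_superalg R A ?BC" by (rule ABC')
  interpret ABCa: assoc_algebra R "tensor_superalg R A ?BC" by (rule ABC'.assoc_algebra)
  note mods = A.module_ax B.module_ax C.module_ax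
  have sm: "same_module M M" for M :: "('z1, 'z2, 'z3) module_scheme" by (simp add: same_module_def)
  note sAB = same_module_tensor_superalg[of R A B] and sBC = same_module_tensor_superalg[of R B C]
  note [simp] = same_module_tensor_module[OF sAB sm] same_module_tensor_module[OF sm sBC]
    same_module_tens[OF sAB sm] same_module_tens[OF sm sBC]
  note as = tens_assoc[OF mods]
  have as1: "module_map R (tensor_module R ?AB C) (tensor_superalg R A ?BC) (tens_assoc R A B C)"
    using as(1) by (simp add: module_map_def tensor_superalg_simps)
  have as2: "tens_assoc R A B C (tens R ?AB C (tens R A B a b) c) = tens R A ?BC a (tens R B C b c)"
    if "a \<in> carrier A" "b \<in> carrier B" "c \<in> carrier C" for a b c
    using as(2) that by simp
  note [simp] = A.part_closed B.part_closed C.part_closed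
    tens_closed[OF A.module_ax B.module_ax] tens_closed[OF B.module_ax C.module_ax]
  interpret TAB: module R ?TAB by (rule tensor_module_module[OF mods(1,2)])
  have cAB: "x \<in> carrier ?TAB" if "x \<in> part ?AB s" for x s
    using AB.part_closed[OF that] by (simp add: tensor_superalg_simps(1))
  let ?L = "tens_assoc R A B C" and ?M = "tensor_superalg R A ?BC"
  have Lmap: "module_map R ?TAB ?M (\<lambda>a. ?L (tens R ?AB C a b))" if "b \<in> carrier C" for b
  proof -
    have "module_map R ?AB ?M (\<lambda>a. ?L (tens R ?AB C a b))"
      by (rule module_map_comp[OF tens_map_left[OF AB.module_ax C.module_ax that] as1])
    then show ?thesis by (simp add: module_map_def tensor_superalg_simps(1-4))
  qed
  show ?thesis
  proof (rule tensor_superalg_homI[OF AB C ABC' as1])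
    show "?L (tens R ?AB C \<one>\<^bsub>?AB\<^esub> \<one>\<^bsub>C\<^esub>) = \<one>\<^bsub>?M\<^esub>"
      using as2 by (simp add: tensor_superalg_simps(5) del: same_module_tens[OF sAB sm] same_module_tens[OF sm sBC])
    fix a b s t assume a: "a \<in> part ?AB s" and b: "b \<in> part C t"
    have "part ?AB s \<subseteq> {a \<in> carrier ?TAB. ?L (tens R ?AB C a b) \<in> part ?M (s + t)}"
    proof (rule tensor_part_subset[OF A B])
      show "submodule {a \<in> carrier ?TAB. ?L (tens R ?AB C a b) \<in> part ?M (s + t)} R ?TAB"
        using b by (intro submodule_module_map_vimage[OF Lmap TAB.module_axioms ABC'.module_ax ABC'.part_submodule]) simp
      show "tens R A B a1 a2 \<in> {a \<in> carrier ?TAB. ?L (tens R ?AB C a b) \<in> part ?M (s + t)}"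
        if "a1 \<in> part A s1" "a2 \<in> part B s2" "s1 + s2 = s" for a1 a2 s1 s2
        using that b tensor_part_tens[OF A BC that(1) tensor_part_tens[OF B C that(2) b]]
        by (simp add: as2 add.assoc[symmetric] del: same_module_tens[OF sAB sm] same_module_tens[OF sm sBC])
    qed
    then show "?L (tens R ?AB C a b) \<in> part ?M (s + t)" using a by blast
    fix c d u v assume c: "c \<in> part ?AB u" and d: "d \<in> part C v"
    have bd: "b \<in> carrier C" "d \<in> carrier C" "b \<otimes>\<^bsub>C\<^esub> d \<in> carrier C" using b d by simp_all
    have maps: "module_map R ?TAB ?M (\<lambda>c. ?L (tens R ?AB C a b) \<otimes>\<^bsub>?M\<^esub> ?L (tens R ?AB C c d))"
      "module_map R ?TAB ?M (\<lambda>a. ?L (tens R ?AB C a b) \<otimes>\<^bsub>?M\<^esub> ?L (tens R ?AB C c d))"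
      "module_map R ?TAB ?M (\<lambda>c. parity_sign R (t * u) \<odot>\<^bsub>?M\<^esub> ?L (tens R ?AB C (a \<otimes>\<^bsub>?AB\<^esub> c) (b \<otimes>\<^bsub>C\<^esub> d)))"
      "module_map R ?TAB ?M (\<lambda>a. parity_sign R (t * u) \<odot>\<^bsub>?M\<^esub> ?L (tens R ?AB C (a \<otimes>\<^bsub>?AB\<^esub> c) (b \<otimes>\<^bsub>C\<^esub> d)))"
      if "a \<in> carrier ?TAB" "c \<in> carrier ?TAB" for a c
    proof -
      have cl: "?L (tens R ?AB C a b) \<in> carrier ?M" "?L (tens R ?AB C c d) \<in> carrier ?M"
        using module_map_closed[OF Lmap] bd that by auto
      show "module_map R ?TAB ?M (\<lambda>c. ?L (tens R ?AB C a b) \<otimes>\<^bsub>?M\<^esub> ?L (tens R ?AB C c d))"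
        by (rule module_map_comp[OF Lmap[OF bd(2)] ABCa.mult_map_right[OF cl(1)]])
      show "module_map R ?TAB ?M (\<lambda>a. ?L (tens R ?AB C a b) \<otimes>\<^bsub>?M\<^esub> ?L (tens R ?AB C c d))"
        by (rule module_map_comp[OF Lmap[OF bd(1)] ABCa.mult_map_left[OF cl(2)]])
      show "module_map R ?TAB ?M (\<lambda>c. parity_sign R (t * u) \<odot>\<^bsub>?M\<^esub> ?L (tens R ?AB C (a \<otimes>\<^bsub>?AB\<^esub> c) (b \<otimes>\<^bsub>C\<^esub> d)))"
        by (rule module_map_scale[OF module_map_comp[OF tensor_mult_map_right[OF A B that(1)] Lmap[OF bd(3)]]
              ABC'.module_ax A.parity_sign_closed])
      show "module_map R ?TAB ?M (\<lambda>a. parity_sign R (t * u) \<odot>\<^bsub>?M\<^esub> ?L (tens R ?AB C (a \<otimes>\<^bsub>?AB\<^esub> c) (b \<otimes>\<^bsub>C\<^esub> d)))"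
        by (rule module_map_scale[OF module_map_comp[OF tensor_mult_map_left[OF A B that(2)] Lmap[OF bd(3)]]
              ABC'.module_ax A.parity_sign_closed])
    qed
    have pure: "?L (tens R ?AB C (tens R A B a1 a2) b) \<otimes>\<^bsub>?M\<^esub> ?L (tens R ?AB C (tens R A B c1 c2) d) =
      parity_sign R (t * u) \<odot>\<^bsub>?M\<^esub> ?L (tens R ?AB C (tens R A B a1 a2 \<otimes>\<^bsub>?AB\<^esub> tens R A B c1 c2) (b \<otimes>\<^bsub>C\<^esub> d))"
      if e: "a1 \<in> part A s1" "a2 \<in> part B s2" "c1 \<in> part A u1" "c2 \<in> part B u2" "u1 + u2 = u"
      for a1 a2 c1 c2 s1 s2 u1 u2
    proof -
      have ab: "tens R B C a2 b \<in> part ?BC (s2 + t)" using tensor_part_tens[OF B C] e b by blast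
      have cd: "tens R B C c2 d \<in> part ?BC (u2 + v)" using tensor_part_tens[OF B C] e d by blast
      have c1: "tens R B C (a2 \<otimes>\<^bsub>B\<^esub> c2) (b \<otimes>\<^bsub>C\<^esub> d) \<in> carrier ?BC"
        using e b d by (simp add: tensor_superalg_simps(1))
      have c2: "tens R A ?BC (a1 \<otimes>\<^bsub>A\<^esub> c1) (tens R B C (a2 \<otimes>\<^bsub>B\<^esub> c2) (b \<otimes>\<^bsub>C\<^esub> d)) \<in> carrier (tensor_module R A ?BC)"
        using tens_closed[OF A.module_ax BC.module_ax _ c1, of "a1 \<otimes>\<^bsub>A\<^esub> c1"] e by simp
      note del = same_module_tens[OF sAB sm] same_module_tens[OF sm sBC] same_module_tensor_module[OF sAB sm] same_module_tensor_module[OF sm sBC]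
      have T: "module R (tensor_module R A ?BC)" using tensor_module_module[OF A.module_ax BC.module_ax] .
      have 1: "tens R A ?BC (a1 \<otimes>\<^bsub>A\<^esub> c1) (r \<odot>\<^bsub>?TBC\<^esub> tens R B C (a2 \<otimes>\<^bsub>B\<^esub> c2) (b \<otimes>\<^bsub>C\<^esub> d)) =
        r \<odot>\<^bsub>tensor_module R A ?BC\<^esub> tens R A ?BC (a1 \<otimes>\<^bsub>A\<^esub> c1) (tens R B C (a2 \<otimes>\<^bsub>B\<^esub> c2) (b \<otimes>\<^bsub>C\<^esub> d))"
        if "r \<in> carrier R" for r
        using module_map_smult[OF tens_map_right[OF A.module_ax BC.module_ax] that c1, of "a1 \<otimes>\<^bsub>A\<^esub> c1"] e
        by (simp add: tensor_superalg_simps(4) del: del)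
      have "?L (tens R ?AB C (tens R A B a1 a2) b) \<otimes>\<^bsub>?M\<^esub> ?L (tens R ?AB C (tens R A B c1 c2) d) =
        tens R A ?BC a1 (tens R B C a2 b) \<otimes>\<^bsub>?M\<^esub> tens R A ?BC c1 (tens R B C c2 d)"
        using e b d by (simp add: as2 del: del)
      also have "\<dots> = parity_sign R ((s2 + t) * u1) \<odot>\<^bsub>tensor_module R A ?BC\<^esub>
          tens R A ?BC (a1 \<otimes>\<^bsub>A\<^esub> c1) (tens R B C a2 b \<otimes>\<^bsub>?BC\<^esub> tens R B C c2 d)"
        using e by (intro tensor_mult_maps(2)[OF A BC _ ab e(3) BC.part_closed[OF cd]]) simp
      also have "tens R B C a2 b \<otimes>\<^bsub>?BC\<^esub> tens R B C c2 d =
          parity_sign R (t * u2) \<odot>\<^bsub>?TBC\<^esub> tens R B C (a2 \<otimes>\<^bsub>B\<^esub> c2) (b \<otimes>\<^bsub>C\<^esub> d)"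
        using e d by (intro tensor_mult_maps(2)[OF B C _ b e(4)]) simp_all
      also have "parity_sign R ((s2 + t) * u1) \<odot>\<^bsub>tensor_module R A ?BC\<^esub> tens R A ?BC (a1 \<otimes>\<^bsub>A\<^esub> c1) \<dots> =
         (parity_sign R ((s2 + t) * u1 + t * u2)) \<odot>\<^bsub>tensor_module R A ?BC\<^esub>
           tens R A ?BC (a1 \<otimes>\<^bsub>A\<^esub> c1) (tens R B C (a2 \<otimes>\<^bsub>B\<^esub> c2) (b \<otimes>\<^bsub>C\<^esub> d))"
        using 1 module.smult_assoc1[OF T _ _ c2]
        by (simp add: A.parity_sign_add del: del)
      \<comment> \<open>Moving \<open>b\<close> past \<open>c1\<close> and \<open>c2\<close> costs
        \<open>t * u\<close>, since \<open>u = u1 + u2\<close>, and moving \<open>a2\<close> past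
        \<open>c1\<close> costs \<open>s2 * u1\<close>. Both bracketings make the same
        crossings.\<close>
      also have "(s2 + t) * u1 + t * u2 = t * u + s2 * u1"
        unfolding e(5)[symmetric] by (simp add: distrib_left distrib_right add_ac)
      also have "parity_sign R \<dots> \<odot>\<^bsub>tensor_module R A ?BC\<^esub>
           tens R A ?BC (a1 \<otimes>\<^bsub>A\<^esub> c1) (tens R B C (a2 \<otimes>\<^bsub>B\<^esub> c2) (b \<otimes>\<^bsub>C\<^esub> d)) =
        parity_sign R (t * u) \<odot>\<^bsub>?M\<^esub> (parity_sign R (s2 * u1) \<odot>\<^bsub>?M\<^esub>
          ?L (tens R ?AB C (tens R A B (a1 \<otimes>\<^bsub>A\<^esub> c1) (a2 \<otimes>\<^bsub>B\<^esub> c2)) (b \<otimes>\<^bsub>C\<^esub> d)))"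
        using e b d module.smult_assoc1[OF T _ _ c2]
        by (simp add: A.parity_sign_add as2 tensor_superalg_simps(4) del: del)
      also have "parity_sign R (s2 * u1) \<odot>\<^bsub>?M\<^esub>
          ?L (tens R ?AB C (tens R A B (a1 \<otimes>\<^bsub>A\<^esub> c1) (a2 \<otimes>\<^bsub>B\<^esub> c2)) (b \<otimes>\<^bsub>C\<^esub> d)) =
          ?L (tens R ?AB C (tens R A B a1 a2 \<otimes>\<^bsub>?AB\<^esub> tens R A B c1 c2) (b \<otimes>\<^bsub>C\<^esub> d))"
        using e module_map_smult[OF Lmap[OF bd(3)], of "parity_sign R (s2 * u1)" "tens R A B (a1 \<otimes>\<^bsub>A\<^esub> c1) (a2 \<otimes>\<^bsub>B\<^esub> c2)"]
        by (simp add: tensor_mult_maps(2)[OF A B _ e(2,3)] del: del)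
      finally show ?thesis .
    qed
    \<comment> \<open>The right factor \<open>c\<close> becomes an arbitrary element of parity
      \<open>u\<close>; the inclusion after this block frees the left factor.\<close>
    have pc: "?L (tens R ?AB C (tens R A B a1 a2) b) \<otimes>\<^bsub>?M\<^esub> ?L (tens R ?AB C c d) =
      parity_sign R (t * u) \<odot>\<^bsub>?M\<^esub> ?L (tens R ?AB C (tens R A B a1 a2 \<otimes>\<^bsub>?AB\<^esub> c) (b \<otimes>\<^bsub>C\<^esub> d))"
      if e: "a1 \<in> part A s1" "a2 \<in> part B s2" for a1 a2 s1 s2
    proof -
      let ?a = "tens R A B a1 a2"
      have a: "?a \<in> carrier ?TAB" using e by simp
      have "part ?AB u \<subseteq> {c \<in> carrier ?TAB. ?L (tens R ?AB C ?a b) \<otimes>\<^bsub>?M\<^esub> ?L (tens R ?AB C c d) =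
        parity_sign R (t * u) \<odot>\<^bsub>?M\<^esub> ?L (tens R ?AB C (?a \<otimes>\<^bsub>?AB\<^esub> c) (b \<otimes>\<^bsub>C\<^esub> d))}"
        using pure[OF e]
        by (intro tensor_part_subset[OF A B submodule_equalizer[OF maps(1)[OF a a] maps(3)[OF a a] TAB.module_axioms ABC'.module_ax]]) auto
      then show ?thesis using c by blast
    qed
    have "part ?AB s \<subseteq> {a \<in> carrier ?TAB. ?L (tens R ?AB C a b) \<otimes>\<^bsub>?M\<^esub> ?L (tens R ?AB C c d) =
        parity_sign R (t * u) \<odot>\<^bsub>?M\<^esub> ?L (tens R ?AB C (a \<otimes>\<^bsub>?AB\<^esub> c) (b \<otimes>\<^bsub>C\<^esub> d))}"
      using pc cAB[OF c]
      by (intro tensor_part_subset[OF A B submodule_equalizer[OF maps(2) maps(4) TAB.module_axioms ABC'.module_ax]]) auto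
    then show "?L (tens R ?AB C a b) \<otimes>\<^bsub>?M\<^esub> ?L (tens R ?AB C c d) =
        parity_sign R (t * u) \<odot>\<^bsub>?M\<^esub> ?L (tens R ?AB C (a \<otimes>\<^bsub>?AB\<^esub> c) (b \<otimes>\<^bsub>C\<^esub> d))"
      using a by blast
  qed
qed

lemma ring_superalg_simps:
  "carrier (ring_superalg \<phi> S) = carrier S" "\<zero>\<^bsub>ring_superalg \<phi> S\<^esub> = \<zero>\<^bsub>S\<^esub>"
  "add (ring_superalg \<phi> S) = add S" "r \<odot>\<^bsub>ring_superalg \<phi> S\<^esub> x = \<phi> r \<otimes>\<^bsub>S\<^esub> x"
  "monoid.mult (ring_superalg \<phi> S) = monoid.mult S" "\<one>\<^bsub>ring_superalg \<phi> S\<^esub> = \<one>\<^bsub>S\<^esub>"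
  "part (ring_superalg \<phi> S) s = (if s = 0 then carrier S else {\<zero>\<^bsub>S\<^esub>})"
  by (simp_all add: ring_superalg_def)

lemma ring_superalg_superalgebra:
  assumes R: "cring R" and S: "cring S" and \<phi>: "\<phi> \<in> ring_hom R S"
  shows "superalgebra R (ring_superalg \<phi> S)"
proof (rule superalgebraI)
  interpret R: cring R by fact
  interpret S: cring S by fact
  note [simp] = ring_hom_closed[OF \<phi>] ring_hom_add[OF \<phi>] ring_hom_mult[OF \<phi>] ring_hom_one[OF \<phi>]
  let ?A = "ring_superalg \<phi> S"
  have "abelian_group ?A"
    by (rule abelian_groupI) (auto simp: ring_superalg_simps S.a_ac intro: S.l_neg)
  then have "module R ?A"
    by (intro moduleI R) (auto simp: ring_superalg_simps S.l_distr S.r_distr S.m_assoc)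
  then show alg: "assoc_algebra R ?A"
    by (intro assoc_algebraI bilinear_mapI module_mapI)
      (auto simp: ring_superalg_simps S.l_distr S.r_distr S.m_ac)
  interpret A: assoc_algebra R ?A by (rule alg)
  show "submodule (part ?A s) R ?A" for s
    by (rule A.submoduleI') (auto simp: ring_superalg_simps split: if_splits)
  show "\<exists>u\<in>part ?A 0. \<exists>v\<in>part ?A 1. x = u \<oplus>\<^bsub>?A\<^esub> v" if "x \<in> carrier ?A" for x
    using that by (auto simp: ring_superalg_simps)
  show "x \<otimes>\<^bsub>?A\<^esub> y \<in> part ?A (s + t)" if "x \<in> part ?A s" "y \<in> part ?A t" for x y s t
    using that by (cases s; cases t) (auto simp: ring_superalg_simps)
qed (auto simp: ring_superalg_simps cring.cring_simprules[OF S])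

text \<open>The odd part of the target of \<open>e\<close> is zero, so \<open>e\<close> vanishes on
  odd elements. Whenever the sign could be nontrivial, one of the scalars involved is therefore
  zero.\<close>

lemma counit_maps:
  assumes A: "superalgebra R A" and e: "e \<in> superalg_hom R A (ring_superalg id R)"
  defines "l \<equiv> tens_lift R A (\<lambda>(a, b). e a \<odot>\<^bsub>A\<^esub> b)" and "r \<equiv> tens_lift R A (\<lambda>(a, b). e b \<odot>\<^bsub>A\<^esub> a)"
  shows "l \<in> superalg_hom R (tensor_superalg R A A) A" "r \<in> superalg_hom R (tensor_superalg R A A) A"
    and "\<lbrakk>a \<in> carrier A; b \<in> carrier A\<rbrakk> \<Longrightarrow> l (tens R A A a b) = e a \<odot>\<^bsub>A\<^esub> b"
    and "\<lbrakk>a \<in> carrier A; b \<in> carrier A\<rbrakk> \<Longrightarrow> r (tens R A A a b) = e b \<odot>\<^bsub>A\<^esub> a"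
    and "module_map R (tensor_module R A A) A l" "module_map R (tensor_module R A A) A r"
proof -
  interpret A: superalgebra R A by fact
  note mods = A.module_ax A.module_ax A.module_ax
  have emap: "module_map R A (ring_superalg id R) e" by (rule superalg_hom_map[OF e])
  have ecl: "e a \<in> carrier R" if "a \<in> carrier A" for a
    using module_map_closed[OF emap that] by (simp add: ring_superalg_simps)
  have eodd: "e a = \<zero>\<^bsub>R\<^esub>" if "a \<in> part A 1" for a
    using superalg_hom_part[OF e that] by (simp add: ring_superalg_simps)
  have eone: "e \<one>\<^bsub>A\<^esub> = \<one>\<^bsub>R\<^esub>" using alg_hom_one[OF superalg_hom_alg[OF e]] by (simp add: ring_superalg_simps)
  have emult: "e (a \<otimes>\<^bsub>A\<^esub> b) = e a \<otimes>\<^bsub>R\<^esub> e b" if "a \<in> carrier A" "b \<in> carrier A" for a b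
    using alg_hom_mult[OF superalg_hom_alg[OF e] that] by (simp add: ring_superalg_simps)
  have scale: "module_map R A A (\<lambda>a. e a \<odot>\<^bsub>A\<^esub> y)" "module_map R A A (\<lambda>b. e y \<odot>\<^bsub>A\<^esub> b)"
    if "y \<in> carrier A" for y
    using that ecl by (auto intro!: module_map_scale_by[OF A.module_ax that emap] module_map_scale[OF module_map_id A.module_ax]
        simp: ring_superalg_simps)
  have bl: "bilinear_map R A A A (\<lambda>(a, b). e a \<odot>\<^bsub>A\<^esub> b)" and br: "bilinear_map R A A A (\<lambda>(a, b). e b \<odot>\<^bsub>A\<^esub> a)"
    using scale by (auto intro!: bilinear_mapI)
  show lt: "\<And>a b. \<lbrakk>a \<in> carrier A; b \<in> carrier A\<rbrakk> \<Longrightarrow> l (tens R A A a b) = e a \<odot>\<^bsub>A\<^esub> b"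
    and rt: "\<And>a b. \<lbrakk>a \<in> carrier A; b \<in> carrier A\<rbrakk> \<Longrightarrow> r (tens R A A a b) = e b \<odot>\<^bsub>A\<^esub> a"
    unfolding l_def r_def using tens_lift_tens[OF mods bl] tens_lift_tens[OF mods br] by auto
  show lm: "module_map R (tensor_module R A A) A l" and rm: "module_map R (tensor_module R A A) A r"
    unfolding l_def r_def by (rule tens_lift_map[OF mods bl] tens_lift_map[OF mods br])+
  note [simp] = lt rt eone emult A.part_closed ecl A.smult_mult_left A.smult_mult_right
  have ce: "e a \<otimes>\<^bsub>R\<^esub> (e c \<otimes>\<^bsub>R\<^esub> k) = e c \<otimes>\<^bsub>R\<^esub> (e a \<otimes>\<^bsub>R\<^esub> k)" if "a \<in> carrier A" "c \<in> carrier A" "k \<in> carrier R" for a c k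
    using that by (simp add: A.R.m_lcomm)
  show "l \<in> superalg_hom R (tensor_superalg R A A) A"
  proof (rule tensor_superalg_homI[OF A A A lm])
    fix a b s t assume ab: "a \<in> part A s" "b \<in> part A t"
    then show "l (tens R A A a b) \<in> part A (s + t)"
      by (cases s) (simp_all add: A.part_smult eodd A.part_zero)
    fix c d u v assume cd: "c \<in> part A u" "d \<in> part A v"
    show "l (tens R A A a b) \<otimes>\<^bsub>A\<^esub> l (tens R A A c d) =
       parity_sign R (t * u) \<odot>\<^bsub>A\<^esub> l (tens R A A (a \<otimes>\<^bsub>A\<^esub> c) (b \<otimes>\<^bsub>A\<^esub> d))"
      using ab cd
      by (cases u) (simp_all add: eodd A.R.m_comm flip: A.smult_assoc1)
  qed simp
  show "r \<in> superalg_hom R (tensor_superalg R A A) A"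
  proof (rule tensor_superalg_homI[OF A A A rm])
    fix a b s t assume ab: "a \<in> part A s" "b \<in> part A t"
    then show "r (tens R A A a b) \<in> part A (s + t)"
      by (cases t) (simp_all add: A.part_smult eodd A.part_zero)
    fix c d u v assume cd: "c \<in> part A u" "d \<in> part A v"
    show "r (tens R A A a b) \<otimes>\<^bsub>A\<^esub> r (tens R A A c d) =
       parity_sign R (t * u) \<odot>\<^bsub>A\<^esub> r (tens R A A (a \<otimes>\<^bsub>A\<^esub> c) (b \<otimes>\<^bsub>A\<^esub> d))"
      using ab cd
      by (cases t) (simp_all add: eodd A.R.m_comm flip: A.smult_assoc1)
  qed simp
qed

section \<open>Free algebras\<close>

lemma same_module_free_algebra: "same_module (free_algebra R G) (free_module R (lists G))"
  by (simp add: same_module_def free_algebra_def)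

lemma free_algebra_simps:
  "carrier (free_algebra R G) = carrier (free_module R (lists G))"
  "\<zero>\<^bsub>free_algebra R G\<^esub> = \<zero>\<^bsub>free_module R (lists G)\<^esub>"
  "add (free_algebra R G) = add (free_module R (lists G))"
  "module.smult (free_algebra R G) = module.smult (free_module R (lists G))"
  "\<one>\<^bsub>free_algebra R G\<^esub> = basis_elt R []"
  by (simp_all add: free_algebra_def)

lemma free_algebra_mult:
  "f \<otimes>\<^bsub>free_algebra R G\<^esub> g = (\<lambda>w. \<Oplus>\<^bsub>R\<^esub>i\<in>{..length w}. f (take i w) \<otimes>\<^bsub>R\<^esub> g (drop i w))"
  by (simp add: free_algebra_def)

context cring
begin

lemma free_module_value_closed: "f \<in> carrier (free_module R G) \<Longrightarrow> f w \<in> carrier R"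
  by (simp add: free_module_simps)

text \<open>A word contributes only if it splits into one word from each support, which leaves the
  finite set of concatenations.\<close>

lemma free_algebra_mult_closed:
  assumes f: "f \<in> carrier (free_module R (lists G))" and g: "g \<in> carrier (free_module R (lists G))"
  shows "f \<otimes>\<^bsub>free_algebra R G\<^esub> g \<in> carrier (free_module R (lists G))"
proof -
  note [simp] = free_module_value_closed[OF f] free_module_value_closed[OF g]
  let ?S = "(\<lambda>(u, v). u @ v) ` ({w. f w \<noteq> \<zero>} \<times> {w. g w \<noteq> \<zero>})"
  have z: "(f \<otimes>\<^bsub>free_algebra R G\<^esub> g) w = \<zero>" if "w \<notin> ?S" for w
  proof -
    have "f (take i w) \<otimes> g (drop i w) = \<zero>" for i
    proof (rule ccontr)
      assume "f (take i w) \<otimes> g (drop i w) \<noteq> \<zero>"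
      then have "(take i w, drop i w) \<in> {w. f w \<noteq> \<zero>} \<times> {w. g w \<noteq> \<zero>}" by auto
      then have "take i w @ drop i w \<in> ?S" by blast
      then show False using that by simp
    qed
    then show ?thesis by (simp add: free_algebra_mult)
  qed
  have "finite ?S" using f g by (simp add: free_module_simps)
  moreover have "?S \<subseteq> lists G" using f g by (fastforce simp: free_module_simps)
  moreover have "(f \<otimes>\<^bsub>free_algebra R G\<^esub> g) w \<in> carrier R" for w
    unfolding free_algebra_mult by (rule finsum_closed) auto
  moreover have "{w. (f \<otimes>\<^bsub>free_algebra R G\<^esub> g) w \<noteq> \<zero>} \<subseteq> ?S" using z by blast
  moreover have "(f \<otimes>\<^bsub>free_algebra R G\<^esub> g) w = \<zero>" if "w \<notin> lists G" for w
    using z that \<open>?S \<subseteq> lists G\<close> by blast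
  ultimately show ?thesis
    unfolding free_module_simps using finite_subset by blast
qed

lemma free_algebra_mult_bilinear:
  fixes G :: "'x set"
  defines "F \<equiv> free_module R (lists G)"
  shows "bilinear_map R F F F (\<lambda>(f, g). f \<otimes>\<^bsub>free_algebra R G\<^esub> g)"
proof -
  note [simp] = free_module_value_closed[of _ "lists G", folded F_def]
  have "(f \<oplus>\<^bsub>F\<^esub> g) \<otimes>\<^bsub>free_algebra R G\<^esub> h =
      f \<otimes>\<^bsub>free_algebra R G\<^esub> h \<oplus>\<^bsub>F\<^esub> g \<otimes>\<^bsub>free_algebra R G\<^esub> h"
    "h \<otimes>\<^bsub>free_algebra R G\<^esub> (f \<oplus>\<^bsub>F\<^esub> g) =
      h \<otimes>\<^bsub>free_algebra R G\<^esub> f \<oplus>\<^bsub>F\<^esub> h \<otimes>\<^bsub>free_algebra R G\<^esub> g"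
    if "f \<in> carrier F" "g \<in> carrier F" "h \<in> carrier F" for f g h
    using that
    by (simp_all add: F_def[THEN meta_eq_to_obj_eq, THEN arg_cong[where f = add]] free_algebra_mult
        free_module_simps l_distr r_distr fun_eq_iff finsum_addf)
  moreover have "(r \<odot>\<^bsub>F\<^esub> f) \<otimes>\<^bsub>free_algebra R G\<^esub> h = r \<odot>\<^bsub>F\<^esub> (f \<otimes>\<^bsub>free_algebra R G\<^esub> h)"
    "h \<otimes>\<^bsub>free_algebra R G\<^esub> (r \<odot>\<^bsub>F\<^esub> f) = r \<odot>\<^bsub>F\<^esub> (h \<otimes>\<^bsub>free_algebra R G\<^esub> f)"
    if "r \<in> carrier R" "f \<in> carrier F" "h \<in> carrier F" for r f h
    using that
    by (simp_all add: F_def[THEN meta_eq_to_obj_eq, THEN arg_cong[where f = module.smult]] free_algebra_mult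
        free_module_simps m_assoc m_lcomm fun_eq_iff finsum_rdistr)
  moreover have "f \<otimes>\<^bsub>free_algebra R G\<^esub> g \<in> carrier F" if "f \<in> carrier F" "g \<in> carrier F" for f g
    using that by (simp add: F_def free_algebra_mult_closed)
  ultimately show ?thesis
    by (intro bilinear_mapI module_mapI) simp_all
qed

text \<open>Of all ways to cut \<open>w\<close>, only the cut after \<open>length u\<close> letters
  can match \<open>u\<close> on the left.\<close>

lemma basis_elt_mult:
  "basis_elt R u \<otimes>\<^bsub>free_algebra R G\<^esub> basis_elt R v = basis_elt R (u @ v)"
proof
  fix w
  have "(basis_elt R u \<otimes>\<^bsub>free_algebra R G\<^esub> basis_elt R v) w =
      (\<Oplus>i\<in>{..length w}. if length u = i then basis_elt R (u @ v) w else \<zero>)"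
    unfolding free_algebra_mult
  proof (rule finsum_cong')
    fix i assume i: "i \<in> {..length w}"
    have "w = u @ v \<longleftrightarrow> take i w = u \<and> drop i w = v" if "length u = i"
      using that by (metis append_eq_conv_conj append_take_drop_id)
    moreover have "take i w \<noteq> u" if "length u \<noteq> i" using i that by auto
    ultimately show "basis_elt R u (take i w) \<otimes> basis_elt R v (drop i w) =
        (if length u = i then basis_elt R (u @ v) w else \<zero>)"
      by (auto simp: basis_elt_def)
  qed (auto simp: basis_elt_def)
  also have "\<dots> = basis_elt R (u @ v) w"
  proof (cases "w = u @ v")
    case True
    then show ?thesis
      by (intro finsum_singleton) (auto simp: basis_elt_def)
  next
    case False
    then have "basis_elt R (u @ v) w = \<zero>" by (simp add: basis_elt_def)
    then show ?thesis by (simp cong: if_cong)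
  qed
  finally show "(basis_elt R u \<otimes>\<^bsub>free_algebra R G\<^esub> basis_elt R v) w = basis_elt R (u @ v) w" .
qed

text \<open>The laws are linear in each argument, so associativity comes down to that of
  concatenation of words.\<close>

lemma free_algebra_assoc_algebra: "assoc_algebra R (free_algebra R G)"
proof -
  let ?F = "free_module R (lists G)" and ?A = "free_algebra R G"
  interpret F: module R ?F by (rule free_module_module)
  have L: "module_map R ?F ?F (\<lambda>f. f \<otimes>\<^bsub>?A\<^esub> g)" and Rt: "module_map R ?F ?F (\<lambda>f. g \<otimes>\<^bsub>?A\<^esub> f)"
    if "g \<in> carrier ?F" for g
    using bilinear_mapD[OF free_algebra_mult_bilinear] that by simp_all
  note zero = module_map_zero[OF L F.module_axioms F.module_axioms]
    module_map_zero[OF Rt F.module_axioms F.module_axioms]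
  note [simp] = free_algebra_mult_closed zero module_map_add[OF L] module_map_smult[OF L]
    module_map_add[OF Rt] module_map_smult[OF Rt] basis_elt_closed basis_elt_mult
  have assoc: "(f \<otimes>\<^bsub>?A\<^esub> g) \<otimes>\<^bsub>?A\<^esub> h = f \<otimes>\<^bsub>?A\<^esub> (g \<otimes>\<^bsub>?A\<^esub> h)"
    if "f \<in> carrier ?F" "g \<in> carrier ?F" "h \<in> carrier ?F" for f g h
    using that(1)
  proof (induction rule: free_module_induct)
    case (smult r u)
    note u = this
    from that(2) show ?case
    proof (induction rule: free_module_induct)
      case (smult s v)
      note v = this
      from that(3) show ?case
        by (induction rule: free_module_induct) (use u v in simp_all)
    qed (use u that in simp_all)
  qed (use that in simp_all)
  have one: "basis_elt R [] \<otimes>\<^bsub>?A\<^esub> f = f" "f \<otimes>\<^bsub>?A\<^esub> basis_elt R [] = f" if "f \<in> carrier ?F" for f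
    using that by (induction rule: free_module_induct) simp_all
  show ?thesis
    by (rule assoc_algebraI)
      (use same_module_module[OF same_module_sym[OF same_module_free_algebra] F.module_axioms]
        free_algebra_mult_bilinear[of G] assoc one in
        \<open>simp_all add: free_algebra_simps bilinear_map_def module_map_def\<close>)
qed

end

lemma (in assoc_algebra) word_prod_closed:
  "x ` G \<subseteq> carrier A \<Longrightarrow> w \<in> lists G \<Longrightarrow> foldr (\<lambda>i a. x i \<otimes>\<^bsub>A\<^esub> a) w \<one>\<^bsub>A\<^esub> \<in> carrier A"
  by (induction w) auto

lemma (in assoc_algebra) word_prod_append:
  "x ` G \<subseteq> carrier A \<Longrightarrow> u \<in> lists G \<Longrightarrow> v \<in> lists G \<Longrightarrow>
    foldr (\<lambda>i a. x i \<otimes>\<^bsub>A\<^esub> a) (u @ v) \<one>\<^bsub>A\<^esub> =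
    foldr (\<lambda>i a. x i \<otimes>\<^bsub>A\<^esub> a) u \<one>\<^bsub>A\<^esub> \<otimes>\<^bsub>A\<^esub> foldr (\<lambda>i a. x i \<otimes>\<^bsub>A\<^esub> a) v \<one>\<^bsub>A\<^esub>"
proof (induction u)
  case Nil
  then show ?case using word_prod_closed[of x G v] by simp
next
  case (Cons i u)
  then have "x i \<in> carrier A" "u \<in> lists G" by auto
  then show ?case using Cons word_prod_closed[of x G] by (simp add: A.m_assoc)
qed

section \<open>Evaluation of noncommutative polynomials\<close>

context
  fixes R :: "('r, 'm) ring_scheme" (structure) and A :: "('r, 'a, 'l) module_scheme"
    and x :: "'x \<Rightarrow> 'a" and G
  assumes A: "assoc_algebra R A" and x: "x ` G \<subseteq> carrier A"
begin

interpretation A: assoc_algebra R A by (rule A)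
interpretation FM: module R "free_module R (lists G)" by (rule A.R.free_module_module)
interpretation F: assoc_algebra R "free_algebra R G" by (rule A.R.free_algebra_assoc_algebra)

lemma free_eval_map: "module_map R (free_module R (lists G)) A (free_eval R A x)"
  unfolding free_eval_def using A.word_prod_closed[OF x] by (intro A.lin_ext_module_map) auto

lemma free_eval_basis:
  "w \<in> lists G \<Longrightarrow> free_eval R A x (basis_elt R w) = foldr (\<lambda>i a. x i \<otimes>\<^bsub>A\<^esub> a) w \<one>\<^bsub>A\<^esub>"
  unfolding free_eval_def using A.word_prod_closed[OF x] by (intro A.lin_ext_basis_elt)

lemma free_eval_alg_hom: "alg_hom R (free_algebra R G) A (free_eval R A x)"
proof (rule alg_homI)
  show "module_map R (free_algebra R G) A (free_eval R A x)"
    using free_eval_map by (simp add: module_map_def free_algebra_simps)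
  show "free_eval R A x \<one>\<^bsub>free_algebra R G\<^esub> = \<one>\<^bsub>A\<^esub>"
    by (simp add: free_algebra_simps free_eval_basis)
  note E = free_eval_map
  note B = bilinear_mapD[OF F.mult_bilinear, unfolded prod.case]
  note [simp] = module_map_add[OF E] module_map_smult[OF E] module_map_closed[OF E]
    module_map_zero[OF E FM.module_axioms A.module_axioms]
    A.R.basis_elt_closed A.R.basis_elt_mult free_eval_basis A.word_prod_append[OF x]
    A.word_prod_closed[OF x] A.smult_mult_left A.smult_mult_right A.A.l_distr A.A.r_distr
    F.A.l_distr[unfolded free_algebra_simps] F.A.r_distr[unfolded free_algebra_simps]
    F.smult_mult_left[unfolded free_algebra_simps] F.smult_mult_right[unfolded free_algebra_simps]
    F.A.l_null[unfolded free_algebra_simps] F.A.r_null[unfolded free_algebra_simps]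
    F.A.m_closed[unfolded free_algebra_simps]
  note [simp del] = foldr_append
  fix f g assume "f \<in> carrier (free_algebra R G)" "g \<in> carrier (free_algebra R G)"
  then have fg: "f \<in> carrier (free_module R (lists G))" "g \<in> carrier (free_module R (lists G))"
    by (simp_all add: free_algebra_simps)
  from fg(1) show "free_eval R A x (f \<otimes>\<^bsub>free_algebra R G\<^esub> g) = free_eval R A x f \<otimes>\<^bsub>A\<^esub> free_eval R A x g"
  proof (induction rule: A.R.free_module_induct)
    case (smult r u)
    note u = this
    from fg(2) show ?case
      by (induction rule: A.R.free_module_induct) (use u in simp_all)
  qed (use fg in simp_all)
qed

lemma free_eval_gen: "i \<in> G \<Longrightarrow> free_eval R A x (basis_elt R [i]) = x i"
  using x by (auto simp: free_eval_basis)

lemma free_eval_mult_gen: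
  "i \<in> G \<Longrightarrow> j \<in> G \<Longrightarrow>
    free_eval R A x (basis_elt R [i] \<otimes>\<^bsub>free_algebra R G\<^esub> basis_elt R [j]) = x i \<otimes>\<^bsub>A\<^esub> x j"
  by (subst alg_hom_mult[OF free_eval_alg_hom])
    (simp_all add: free_eval_gen free_algebra_simps A.R.basis_elt_closed)

text \<open>Both sides are linear in \<open>u\<close> and agree on words, where \<open>f\<close> is
  applied letter by letter.\<close>

lemma alg_hom_free_eval:
  assumes B: "assoc_algebra R B" and f: "alg_hom R A B f" and u: "u \<in> carrier (free_algebra R G)"
  shows "f (free_eval R A x u) = free_eval R B (\<lambda>i. f (x i)) u"
proof -
  interpret B: assoc_algebra R B by (rule B)
  have fx: "(\<lambda>i. f (x i)) ` G \<subseteq> carrier B"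
    using x module_map_closed[OF alg_hom_map[OF f]] by auto
  have word: "f (foldr (\<lambda>i a. x i \<otimes>\<^bsub>A\<^esub> a) w \<one>\<^bsub>A\<^esub>) = foldr (\<lambda>i a. f (x i) \<otimes>\<^bsub>B\<^esub> a) w \<one>\<^bsub>B\<^esub>"
    if "w \<in> lists G" for w
    using that
  proof (induction w)
    case (Cons i w)
    then have "x i \<in> carrier A" "w \<in> lists G" using x by auto
    then show ?case
      using Cons A.word_prod_closed[OF x, of w] by (simp add: alg_hom_mult[OF f])
  qed (simp add: alg_hom_one[OF f])
  have EB: "module_map R (free_module R (lists G)) B (free_eval R B (\<lambda>i. f (x i)))"
    unfolding free_eval_def using B.word_prod_closed[OF fx] by (intro B.lin_ext_module_map) auto
  show ?thesis
  proof (rule A.R.module_map_free_eq[OF module_map_comp[OF free_eval_map alg_hom_map[OF f]] EB B.module_axioms])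
    show "u \<in> carrier (free_module R (lists G))" using u by (simp add: free_algebra_simps)
    fix w assume w: "w \<in> lists G"
    have "free_eval R B (\<lambda>i. f (x i)) (basis_elt R w) = foldr (\<lambda>i a. f (x i) \<otimes>\<^bsub>B\<^esub> a) w \<one>\<^bsub>B\<^esub>"
      unfolding free_eval_def using B.word_prod_closed[OF fx w] by (intro B.lin_ext_basis_elt)
    then show "f (free_eval R A x (basis_elt R w)) = free_eval R B (\<lambda>i. f (x i)) (basis_elt R w)"
      using w by (simp add: free_eval_basis word)
  qed
qed

end

text \<open>Together with \<open>alg_hom_free_eval\<close> this shows that evaluation in a quotient
  of the free algebra, at the classes of the generators, is the projection.\<close>

lemma free_eval_gen_id:
  fixes u :: "'x list \<Rightarrow> 'r"
  assumes R: "cring R" and u: "u \<in> carrier (free_algebra R G)"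
  shows "free_eval R (free_algebra R G) (\<lambda>i. basis_elt R [i]) u = u"
proof -
  interpret R: cring R by fact
  interpret F: assoc_algebra R "free_algebra R G" by (rule R.free_algebra_assoc_algebra)
  have g: "(\<lambda>i. basis_elt R [i]) ` G \<subseteq> carrier (free_algebra R G)"
    by (auto simp: free_algebra_simps intro!: R.basis_elt_closed)
  have w: "foldr (\<lambda>i a. basis_elt R [i] \<otimes>\<^bsub>free_algebra R G\<^esub> a) w \<one>\<^bsub>free_algebra R G\<^esub> = basis_elt R w"
    for w :: "'x list"
    by (induction w) (simp_all add: free_algebra_simps R.basis_elt_mult)
  show ?thesis
  proof (rule R.module_map_free_eq[where g = "\<lambda>u. u"])
    show "module_map R (free_module R (lists G)) (free_algebra R G)
        (free_eval R (free_algebra R G) (\<lambda>i. basis_elt R [i]))"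
      by (rule free_eval_map[OF F.assoc_algebra_axioms g])
    show "module_map R (free_module R (lists G)) (free_algebra R G) (\<lambda>u. u)"
      by (simp add: module_map_def free_algebra_simps)
    show "module R (free_algebra R G)" by (rule F.module_axioms)
    show "u \<in> carrier (free_module R (lists G))" using u by (simp add: free_algebra_simps)
  qed (simp add: free_eval_basis[OF F.assoc_algebra_axioms g] w)
qed

section \<open>Presentations\<close>

lemma alg_hom_kernel_ideal:
  assumes "assoc_algebra R A" "assoc_algebra R B" and f: "alg_hom R A B f"
  shows "ideal {x \<in> carrier A. f x = \<zero>\<^bsub>B\<^esub>} A"
proof -
  interpret A: assoc_algebra R A by fact
  interpret B: assoc_algebra R B by fact
  note fm = alg_hom_map[OF f]
  note [simp] = alg_hom_mult[OF f] module_map_closed[OF fm] module_map_add[OF fm]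
    module_map_zero[OF fm A.module_axioms B.module_axioms]
  show ?thesis
  proof (rule idealI[OF A.A.ring_axioms])
    show "subgroup {x \<in> carrier A. f x = \<zero>\<^bsub>B\<^esub>} (add_monoid A)"
      using submodule_equalizer[OF fm module_map_const_zero[OF B.module_axioms] A.module_axioms B.module_axioms]
      by (simp add: submodule_def)
  qed auto
qed

definition satisfies ::
  "('r, 'm) ring_scheme \<Rightarrow> ('r, 'a, 'l) module_scheme \<Rightarrow> ('x \<Rightarrow> 'a)
    \<Rightarrow> (('x list \<Rightarrow> 'r) \<times> ('x list \<Rightarrow> 'r)) set \<Rightarrow> bool" where
  "satisfies R A x rels \<longleftrightarrow> (\<forall>(l, r)\<in>rels. free_eval R A x l = free_eval R A x r)"

lemma presented_byD:
  assumes "presented_by R A G x rels"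
  shows "x ` G \<subseteq> carrier A"
    and "a \<in> carrier A \<Longrightarrow> \<exists>u\<in>carrier (free_algebra R G). a = free_eval R A x u"
    and "{u \<in> carrier (free_algebra R G). free_eval R A x u = \<zero>\<^bsub>A\<^esub>} =
      genideal (free_algebra R G) {l \<ominus>\<^bsub>free_algebra R G\<^esub> r | l r. (l, r) \<in> rels}"
  using assms unfolding presented_by_def Let_def a_kernel_def' by auto

lemma presented_byI:
  assumes "x ` G \<subseteq> carrier A"
    and "\<And>u. u \<in> carrier (free_algebra R G) \<Longrightarrow> free_eval R A x u \<in> carrier A"
    and "\<And>a. a \<in> carrier A \<Longrightarrow> \<exists>u\<in>carrier (free_algebra R G). a = free_eval R A x u"
    and "{u \<in> carrier (free_algebra R G). free_eval R A x u = \<zero>\<^bsub>A\<^esub>} =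
      genideal (free_algebra R G) {l \<ominus>\<^bsub>free_algebra R G\<^esub> r | l r. (l, r) \<in> rels}"
  shows "presented_by R A G x rels"
  using assms unfolding presented_by_def Let_def a_kernel_def' by (auto simp: image_iff)

context
  fixes R :: "('r, 'm) ring_scheme" (structure) and G :: "'x set"
    and rels :: "(('x list \<Rightarrow> 'r) \<times> ('x list \<Rightarrow> 'r)) set"
  assumes rels: "rels \<subseteq> carrier (free_algebra R G) \<times> carrier (free_algebra R G)"
begin

lemma relators_closed:
  assumes "cring R"
  shows "{l \<ominus>\<^bsub>free_algebra R G\<^esub> r | l r. (l, r) \<in> rels} \<subseteq> carrier (free_algebra R G)"
proof -
  interpret R: cring R by fact
  interpret F: assoc_algebra R "free_algebra R G" by (rule R.free_algebra_assoc_algebra)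
  show ?thesis using rels by auto
qed

text \<open>The kernel of evaluation is an ideal, so it contains the generated ideal as soon as it
  contains the relators.\<close>

lemma satisfies_iff:
  assumes A: "assoc_algebra R A" and x: "x ` G \<subseteq> carrier A"
  shows "satisfies R A x rels \<longleftrightarrow>
    genideal (free_algebra R G) {l \<ominus>\<^bsub>free_algebra R G\<^esub> r | l r. (l, r) \<in> rels} \<subseteq>
    {u \<in> carrier (free_algebra R G). free_eval R A x u = \<zero>\<^bsub>A\<^esub>}"
proof -
  interpret A: assoc_algebra R A by (rule A)
  interpret F: assoc_algebra R "free_algebra R G" by (rule A.R.free_algebra_assoc_algebra)
  note E = free_eval_alg_hom[OF A x]
  have "satisfies R A x rels \<longleftrightarrow> {l \<ominus>\<^bsub>free_algebra R G\<^esub> r | l r. (l, r) \<in> rels} \<subseteq>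
    {u \<in> carrier (free_algebra R G). free_eval R A x u = \<zero>\<^bsub>A\<^esub>}"
  proof -
    have "free_eval R A x l = free_eval R A x r \<longleftrightarrow> l \<ominus>\<^bsub>free_algebra R G\<^esub> r \<in>
        {u \<in> carrier (free_algebra R G). free_eval R A x u = \<zero>\<^bsub>A\<^esub>}" if "(l, r) \<in> rels" for l r
    proof -
      have lr: "l \<in> carrier (free_algebra R G)" "r \<in> carrier (free_algebra R G)" using rels that by auto
      then show ?thesis
        using module_map_minus[OF alg_hom_map[OF E] F.module_axioms A.module_axioms lr]
          module_map_closed[OF alg_hom_map[OF E]] A.minus_eq_zero_iff by simp
    qed
    then show ?thesis unfolding satisfies_def by blast
  qed
  also have "\<dots> \<longleftrightarrow> genideal (free_algebra R G) {l \<ominus>\<^bsub>free_algebra R G\<^esub> r | l r. (l, r) \<in> rels} \<subseteq>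
    {u \<in> carrier (free_algebra R G). free_eval R A x u = \<zero>\<^bsub>A\<^esub>}"
    by (rule F.A.Idl_subset_ideal[symmetric, OF alg_hom_kernel_ideal[OF F.assoc_algebra_axioms A E]
          relators_closed[OF A.R.is_cring]])
  finally show ?thesis .
qed

lemma presented_by_satisfies:
  assumes "assoc_algebra R A" "presented_by R A G x rels"
  shows "satisfies R A x rels"
  using satisfies_iff[OF assms(1) presented_byD(1)[OF assms(2)]] presented_byD(3)[OF assms(2)] by simp

text \<open>The kernel of evaluation in \<open>A\<close> is the ideal of relations, and
  \<open>sat\<close> places this ideal in the kernel of evaluation in \<open>B\<close>. Evaluation
  at \<open>y\<close> therefore factors through \<open>A\<close>.\<close>

lemma presented_by_universal:
  assumes A: "assoc_algebra R A" and pres: "presented_by R A G x rels"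
    and B: "assoc_algebra R B" and y: "y ` G \<subseteq> carrier B" and sat: "satisfies R B y rels"
  obtains f where "alg_hom R A B f"
    and "\<And>u. u \<in> carrier (free_algebra R G) \<Longrightarrow> f (free_eval R A x u) = free_eval R B y u"
    and "\<And>i. i \<in> G \<Longrightarrow> f (x i) = y i"
proof -
  interpret A: assoc_algebra R A by (rule A)
  interpret B: assoc_algebra R B by (rule B)
  let ?F = "free_algebra R G"
  interpret F: assoc_algebra R ?F by (rule A.R.free_algebra_assoc_algebra)
  note x = presented_byD(1)[OF pres]
  note EA = free_eval_alg_hom[OF A x] and EB = free_eval_alg_hom[OF B y]
  \<comment> \<open>An arbitrary preimage under evaluation is chosen; \<open>fe\<close> shows that
    the value is independent of the choice.\<close>
  define f where "f a = free_eval R B y (SOME u. u \<in> carrier ?F \<and> a = free_eval R A x u)" for a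
  have fe: "f (free_eval R A x u) = free_eval R B y u" if u: "u \<in> carrier ?F" for u
  proof -
    define v where "v = (SOME v. v \<in> carrier ?F \<and> free_eval R A x u = free_eval R A x v)"
    have "v \<in> carrier ?F \<and> free_eval R A x u = free_eval R A x v"
      unfolding v_def by (rule someI[of _ u]) (simp add: u)
    then have v: "v \<in> carrier ?F" "free_eval R A x u = free_eval R A x v" by auto
    then have "free_eval R A x (u \<ominus>\<^bsub>?F\<^esub> v) = \<zero>\<^bsub>A\<^esub>"
      using u module_map_minus[OF alg_hom_map[OF EA] F.module_axioms A.module_axioms]
        module_map_closed[OF alg_hom_map[OF EA]] A.minus_eq_zero_iff by simp
    moreover have "{u \<in> carrier ?F. free_eval R A x u = \<zero>\<^bsub>A\<^esub>} \<subseteq> {u \<in> carrier ?F. free_eval R B y u = \<zero>\<^bsub>B\<^esub>}"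
      using sat satisfies_iff[OF B y] presented_byD(3)[OF pres] by simp
    ultimately have "free_eval R B y (u \<ominus>\<^bsub>?F\<^esub> v) = \<zero>\<^bsub>B\<^esub>" using u v by blast
    then have "free_eval R B y u = free_eval R B y v"
      using u v module_map_minus[OF alg_hom_map[OF EB] F.module_axioms B.module_axioms]
        module_map_closed[OF alg_hom_map[OF EB]] B.minus_eq_zero_iff by simp
    then show ?thesis by (simp add: f_def v_def)
  qed
  have hom: "alg_hom R A B f"
  proof (rule alg_homI)
    show "module_map R A B f"
    proof (rule module_mapI)
      show "f a \<in> carrier B" if "a \<in> carrier A" for a
        using presented_byD(2)[OF pres that] fe module_map_closed[OF alg_hom_map[OF EB]] by auto
      show "f (a \<oplus>\<^bsub>A\<^esub> b) = f a \<oplus>\<^bsub>B\<^esub> f b" if ab: "a \<in> carrier A" "b \<in> carrier A" for a b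
      proof -
        obtain u v where "u \<in> carrier ?F" "a = free_eval R A x u" "v \<in> carrier ?F" "b = free_eval R A x v"
          using presented_byD(2)[OF pres] ab by blast
        then show ?thesis
          using fe[of "u \<oplus>\<^bsub>?F\<^esub> v"] by (simp add: fe module_map_add[OF alg_hom_map[OF EA]] module_map_add[OF alg_hom_map[OF EB]])
      qed
      show "f (r \<odot>\<^bsub>A\<^esub> a) = r \<odot>\<^bsub>B\<^esub> f a" if ra: "r \<in> carrier R" "a \<in> carrier A" for r a
      proof -
        obtain u where "u \<in> carrier ?F" "a = free_eval R A x u"
          using presented_byD(2)[OF pres] ra by blast
        then show ?thesis
          using ra(1) fe[of "r \<odot>\<^bsub>?F\<^esub> u"] by (simp add: fe module_map_smult[OF alg_hom_map[OF EA]] module_map_smult[OF alg_hom_map[OF EB]])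
      qed
    qed
    show "f \<one>\<^bsub>A\<^esub> = \<one>\<^bsub>B\<^esub>" using fe[of "\<one>\<^bsub>?F\<^esub>"] by (simp add: alg_hom_one[OF EA] alg_hom_one[OF EB])
    show "f (a \<otimes>\<^bsub>A\<^esub> b) = f a \<otimes>\<^bsub>B\<^esub> f b" if ab: "a \<in> carrier A" "b \<in> carrier A" for a b
    proof -
      obtain u v where "u \<in> carrier ?F" "a = free_eval R A x u" "v \<in> carrier ?F" "b = free_eval R A x v"
        using presented_byD(2)[OF pres] ab by blast
      then show ?thesis
        using fe[of "u \<otimes>\<^bsub>?F\<^esub> v"] by (simp add: fe alg_hom_mult[OF EA] alg_hom_mult[OF EB])
    qed
  qed
  have "f (x i) = y i" if "i \<in> G" for i
    using fe[of "basis_elt R [i]"] that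
    by (simp add: free_eval_gen[OF A x] free_eval_gen[OF B y] free_algebra_simps A.R.basis_elt_closed)
  then show ?thesis using that[OF hom fe] by blast
qed

end

text \<open>Every element is the value of some polynomial, and \<open>alg_hom_free_eval\<close>
  moves both maps inside the evaluation, where they meet only generators.\<close>

lemma alg_hom_eq_on_generators:
  assumes A: "assoc_algebra R A" and pres: "presented_by R A G x rels" and B: "assoc_algebra R B"
    and f: "alg_hom R A B f" and g: "alg_hom R A B g"
    and eq: "\<And>i. i \<in> G \<Longrightarrow> f (x i) = g (x i)" and a: "a \<in> carrier A"
  shows "f a = g a"
proof -
  interpret A: assoc_algebra R A by (rule A)
  interpret B: assoc_algebra R B by (rule B)
  note x = presented_byD(1)[OF pres]
  have fx: "(\<lambda>i. f (x i)) ` G \<subseteq> carrier B" and gx: "(\<lambda>i. g (x i)) ` G \<subseteq> carrier B"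
    using x module_map_closed[OF alg_hom_map[OF f]] module_map_closed[OF alg_hom_map[OF g]] by auto
  obtain u where u: "u \<in> carrier (free_algebra R G)" "a = free_eval R A x u"
    using presented_byD(2)[OF pres a] by blast
  have w: "foldr (\<lambda>i a. f (x i) \<otimes>\<^bsub>B\<^esub> a) w \<one>\<^bsub>B\<^esub> = foldr (\<lambda>i a. g (x i) \<otimes>\<^bsub>B\<^esub> a) w \<one>\<^bsub>B\<^esub>"
    if "w \<in> lists G" for w
    using that eq by (induction w) auto
  have "free_eval R B (\<lambda>i. f (x i)) u = free_eval R B (\<lambda>i. g (x i)) u"
    by (rule A.R.module_map_free_eq[OF free_eval_map[OF B fx] free_eval_map[OF B gx] B.module_axioms])
      (use u(1) w in \<open>simp_all add: free_eval_basis[OF B fx] free_eval_basis[OF B gx] free_algebra_simps\<close>)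
  then show ?thesis
    using alg_hom_free_eval[OF A x B f u(1)] alg_hom_free_eval[OF A x B g u(1)] u(2) by simp
qed

section \<open>Quotient superalgebras\<close>

text \<open>A scalar multiple of \<open>x\<close> is the product of \<open>r 1\<close> with
  \<open>x\<close>, so closure under ring multiplication covers scalars.\<close>

lemma (in assoc_algebra) ideal_submodule:
  assumes "ideal I A"
  shows "submodule I R A"
proof -
  interpret I: ideal I A by fact
  have "r \<odot>\<^bsub>A\<^esub> x \<in> I" if "r \<in> carrier R" "x \<in> I" for r x
  proof -
    have "(r \<odot>\<^bsub>A\<^esub> \<one>\<^bsub>A\<^esub>) \<otimes>\<^bsub>A\<^esub> x \<in> I" using that by (intro I.I_l_closed) auto
    then show ?thesis using that by (simp add: smult_mult_left I.Icarr)
  qed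
  then show ?thesis by (intro submoduleI') (auto simp: I.Icarr)
qed

section \<open>Ideals generated by homogeneous elements\<close>

context superalgebra
begin

lemma component_mult:
  assumes x: "x \<in> carrier A" and y: "y \<in> carrier A"
  shows "component A s (x \<otimes>\<^bsub>A\<^esub> y) =
    component A 0 x \<otimes>\<^bsub>A\<^esub> component A s y \<oplus>\<^bsub>A\<^esub> component A 1 x \<otimes>\<^bsub>A\<^esub> component A (s + 1) y"
proof -
  let ?x0 = "component A 0 x" and ?x1 = "component A 1 x"
    and ?ys = "component A s y" and ?yt = "component A (s + 1) y"
  have parts: "?x0 \<in> part A 0" "?x1 \<in> part A 1" "?ys \<in> part A s" "?yt \<in> part A (s + 1)"
    using x y component_part by auto
  have cl: "?x0 \<in> carrier A" "?x1 \<in> carrier A" "?ys \<in> carrier A" "?yt \<in> carrier A"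
    using parts part_closed by auto
  have xs: "x = ?x0 \<oplus>\<^bsub>A\<^esub> ?x1" using component_sum[OF x] by simp
  have ys: "y = ?ys \<oplus>\<^bsub>A\<^esub> ?yt"
    using component_sum[OF y] bit_cases[of s] M.a_comm cl by (metis add_0 bit_add_self)
  have "x \<otimes>\<^bsub>A\<^esub> y = (?x0 \<oplus>\<^bsub>A\<^esub> ?x1) \<otimes>\<^bsub>A\<^esub> (?ys \<oplus>\<^bsub>A\<^esub> ?yt)" using xs ys by simp
  also have "(?x0 \<oplus>\<^bsub>A\<^esub> ?x1) \<otimes>\<^bsub>A\<^esub> (?ys \<oplus>\<^bsub>A\<^esub> ?yt) = (?x0 \<otimes>\<^bsub>A\<^esub> ?ys \<oplus>\<^bsub>A\<^esub> ?x1 \<otimes>\<^bsub>A\<^esub> ?yt) \<oplus>\<^bsub>A\<^esub> (?x0 \<otimes>\<^bsub>A\<^esub> ?yt \<oplus>\<^bsub>A\<^esub> ?x1 \<otimes>\<^bsub>A\<^esub> ?ys)"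
    using cl by (simp add: A.l_distr A.r_distr M.a_ac)
  finally have xy: "x \<otimes>\<^bsub>A\<^esub> y = \<dots>" .
  show ?thesis
  proof (subst xy, rule component_eqI)
    have "(1::bit) + (s + 1) = s" by (simp add: add.commute[of s])
    then show "?x0 \<otimes>\<^bsub>A\<^esub> ?ys \<oplus>\<^bsub>A\<^esub> ?x1 \<otimes>\<^bsub>A\<^esub> ?yt \<in> part A s"
      using part_mult[OF parts(1,3)] part_mult[OF parts(2,4)] by (intro part_add) auto
    show "?x0 \<otimes>\<^bsub>A\<^esub> ?yt \<oplus>\<^bsub>A\<^esub> ?x1 \<otimes>\<^bsub>A\<^esub> ?ys \<in> part A (s + 1)"
      using part_mult[OF parts(1,4)] part_mult[OF parts(2,3)] by (intro part_add) (auto simp: add.commute)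
  qed
qed

lemma genideal_homogeneous:
  assumes S: "\<And>x. x \<in> S \<Longrightarrow> \<exists>s. x \<in> part A s" and x: "x \<in> genideal A S"
  shows "component A s x \<in> genideal A S"
proof -
  let ?I = "genideal A S"
  have Sc: "S \<subseteq> carrier A" using S part_closed by blast
  have I: "ideal ?I A" by (rule A.genideal_ideal[OF Sc])
  interpret I: ideal ?I A by (rule I)
  note Isub = assoc_algebra.ideal_submodule[OF assoc_algebra I]
  have cc: "component A s x \<in> carrier A" if "x \<in> carrier A" for s x
    using component_part part_closed that by blast
  \<comment> \<open>Elements all of whose components lie in the ideal. By
    \<open>component_mult\<close> they form an ideal, and a homogeneous generator belongs to it
    because its components are itself and zero.\<close>
  let ?J = "{x \<in> carrier A. \<forall>s. component A s x \<in> ?I}"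
  have J: "ideal ?J A"
  proof (rule idealI[OF A.ring_axioms])
    have "submodule ?J R A"
      using submoduleE(4,5)[OF Isub]
      by (intro submoduleI')
        (auto simp: module_map_add[OF component_map] module_map_smult[OF component_map]
          module_map_zero[OF component_map module_ax module_ax])
    then show "subgroup ?J (add_monoid A)" by (simp add: submodule_def)
    fix a x assume a: "a \<in> ?J" and x: "x \<in> carrier A"
    show "x \<otimes>\<^bsub>A\<^esub> a \<in> ?J"
      using a x cc by (auto simp: component_mult intro!: I.a_closed I.I_l_closed)
    show "a \<otimes>\<^bsub>A\<^esub> x \<in> ?J"
      using a x cc by (auto simp: component_mult intro!: I.a_closed I.I_r_closed)
  qed
  have "S \<subseteq> ?J"
  proof
    fix x assume x: "x \<in> S"
    then obtain t where t: "x \<in> part A t" using S by blast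
    have "component A s x \<in> ?I" for s
      using component_same[OF t] component_other[OF t, of s] A.genideal_self[OF Sc] x
      by (cases "s = t") auto
    then show "x \<in> ?J" using x Sc by blast
  qed
  then have "?I \<subseteq> ?J" by (rule A.genideal_minimal[OF J])
  then show ?thesis using x by blast
qed

end

text \<open>The coset product of a quotient ring combined with the scalar action of
  \<open>quot_module\<close>. The grading is the image of that of \<open>A\<close>; it is a direct
  sum only when \<open>I\<close> contains the components of its elements.\<close>

definition quot_superalg :: "('r, 'a, 'l) superalg_scheme \<Rightarrow> 'a set \<Rightarrow> ('r, 'a set) superalg" where
  "quot_superalg A I =
    \<lparr>carrier = a_rcosets\<^bsub>A\<^esub> I, monoid.mult = rcoset_mult A I, one = I +>\<^bsub>A\<^esub> \<one>\<^bsub>A\<^esub>,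
     ring.zero = I, add = set_add A,
     module.smult = (\<lambda>r U. \<Union>f\<in>U. I +>\<^bsub>A\<^esub> (r \<odot>\<^bsub>A\<^esub> f)),
     part = (\<lambda>s. (+>\<^bsub>A\<^esub>) I ` part A s)\<rparr>"

section \<open>Quotient by a homogeneous ideal\<close>

context
  fixes R :: "('r, 'm) ring_scheme" (structure) and A :: "('r, 'a, 'l) superalg_scheme" and I
  assumes A: "superalgebra R A" and I: "ideal I A"
    and hom: "\<And>x s. x \<in> I \<Longrightarrow> component A s x \<in> I"
begin

interpretation A: superalgebra R A by (rule A)
interpretation I: ideal I A by (rule I)

private abbreviation (input) "Q \<equiv> quot_superalg A I"

lemma ideal_is_submodule: "submodule I R A"
  by (rule assoc_algebra.ideal_submodule[OF A.assoc_algebra I])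

lemma quot_superalg_same_module: "same_module Q (quot_module A I)"
  by (simp add: same_module_def quot_superalg_def quot_module_def)

lemma quot_superalg_carrier: "carrier Q = (+>\<^bsub>A\<^esub>) I ` carrier A"
  using A.quot_module_carrier[OF ideal_is_submodule] by (simp add: quot_superalg_def quot_module_def)

lemma quot_superalg_map: "module_map R A Q ((+>\<^bsub>A\<^esub>) I)"
  using A.quot_module_map[OF ideal_is_submodule] quot_superalg_same_module
  by (simp add: module_map_def same_module_def)

lemma quot_superalg_alg_hom: "alg_hom R A Q ((+>\<^bsub>A\<^esub>) I)"
  by (rule alg_homI[OF quot_superalg_map]) (simp_all add: quot_superalg_def I.rcoset_mult_add)

lemma quot_superalg_kernel: "x \<in> carrier A \<Longrightarrow> I +>\<^bsub>A\<^esub> x = \<zero>\<^bsub>Q\<^esub> \<longleftrightarrow> x \<in> I"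
  using A.coset_eq_zero_iff[OF ideal_is_submodule] by (simp add: quot_superalg_def)

lemma quot_superalg_assoc_algebra: "assoc_algebra R Q"
proof -
  have mult: "monoid.mult Q = rcoset_mult A I" "\<one>\<^bsub>Q\<^esub> = I +>\<^bsub>A\<^esub> \<one>\<^bsub>A\<^esub>" by (simp_all add: quot_superalg_def)
  note [simp] = mult I.rcoset_mult_add
  note [symmetric, simp] = module_map_add[OF quot_superalg_map] module_map_smult[OF quot_superalg_map]
  have "module R Q"
    by (rule same_module_module[OF same_module_sym[OF quot_superalg_same_module]
          A.quot_module_module[OF ideal_is_submodule]])
  moreover have "bilinear_map R Q Q Q (\<lambda>(x, y). x \<otimes>\<^bsub>Q\<^esub> y)"
    by (intro bilinear_mapI module_mapI)
      (auto simp: quot_superalg_carrier A.A.l_distr A.A.r_distr A.smult_mult_left A.smult_mult_right)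
  ultimately show ?thesis
    by (rule assoc_algebraI) (auto simp: quot_superalg_carrier A.A.m_assoc)
qed

lemma quot_superalg_superalgebra: "superalgebra R Q"
proof (rule superalgebraI[OF quot_superalg_assoc_algebra])
  have part: "part Q s = (+>\<^bsub>A\<^esub>) I ` part A s" for s by (simp add: quot_superalg_def)
  interpret Q: assoc_algebra R Q by (rule quot_superalg_assoc_algebra)
  note qa = module_map_add[OF quot_superalg_map, symmetric]
    and qs = module_map_smult[OF quot_superalg_map, symmetric]
    and qm = alg_hom_mult[OF quot_superalg_alg_hom, symmetric]
  show "submodule (part Q s) R Q" for s
  proof (rule Q.submoduleI')
    show "part Q s \<subseteq> carrier Q" using A.part_closed by (auto simp: part quot_superalg_carrier)
    show "\<zero>\<^bsub>Q\<^esub> \<in> part Q s"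
      using A.part_zero quot_superalg_kernel[of "\<zero>\<^bsub>A\<^esub>"] by (force simp: part)
    show "a \<oplus>\<^bsub>Q\<^esub> b \<in> part Q s" if "a \<in> part Q s" "b \<in> part Q s" for a b
      using that A.part_add A.part_closed by (auto simp: part qa)
    show "r \<odot>\<^bsub>Q\<^esub> b \<in> part Q s" if "r \<in> carrier R" "b \<in> part Q s" for r b
      using that A.part_smult A.part_closed by (auto simp: part qs)
  qed
  show "\<exists>u\<in>part Q 0. \<exists>v\<in>part Q 1. x = u \<oplus>\<^bsub>Q\<^esub> v" if x: "x \<in> carrier Q" for x
  proof -
    obtain a where a: "a \<in> carrier A" "x = I +>\<^bsub>A\<^esub> a" using x by (auto simp: quot_superalg_carrier)
    then obtain u v where "u \<in> part A 0" "v \<in> part A (0 + 1)" "a = u \<oplus>\<^bsub>A\<^esub> v" using A.part_decomp by metis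
    then show ?thesis using a A.part_closed by (auto simp: part module_map_add[OF quot_superalg_map])
  qed
  show "part Q 0 \<inter> part Q 1 \<subseteq> {\<zero>\<^bsub>Q\<^esub>}"
  proof
    fix x assume "x \<in> part Q 0 \<inter> part Q 1"
    then obtain u v where uv: "u \<in> part A 0" "v \<in> part A 1" "x = I +>\<^bsub>A\<^esub> u" "x = I +>\<^bsub>A\<^esub> v"
      by (auto simp: part)
    then have "u \<ominus>\<^bsub>A\<^esub> v \<in> I"
      using A.coset_eq_iff[OF ideal_is_submodule, of u v] A.part_closed by simp
    \<comment> \<open>Homogeneity of the ideal enters here: the even component of
      \<open>u - v\<close> is \<open>u\<close>, which therefore lies in \<open>I\<close>.\<close>
    then have "component A 0 (u \<ominus>\<^bsub>A\<^esub> v) \<in> I" by (rule hom)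
    moreover have "component A 0 (u \<ominus>\<^bsub>A\<^esub> v) = u"
      using uv A.component_eqI[of u 0 "\<ominus>\<^bsub>A\<^esub> v"] A.submoduleE(3)[OF A.part_submodule]
      by (simp add: a_minus_def)
    ultimately show "x \<in> {\<zero>\<^bsub>Q\<^esub>}" using uv quot_superalg_kernel A.part_closed by simp
  qed
  show "\<one>\<^bsub>Q\<^esub> \<in> part Q 0" using A.part_one by (simp add: quot_superalg_def)
  show "x \<otimes>\<^bsub>Q\<^esub> y \<in> part Q (s + t)" if "x \<in> part Q s" "y \<in> part Q t" for x y s t
    using that A.part_mult A.part_closed by (auto simp: part qm)
qed

end

section \<open>Presented superalgebras\<close>

definition same_algebra ::
  "('r, 'a, 'l) module_scheme \<Rightarrow> ('r, 'a, 'k) module_scheme \<Rightarrow> bool" where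
  "same_algebra A B \<longleftrightarrow> same_module A B \<and> monoid.mult A = monoid.mult B \<and> \<one>\<^bsub>A\<^esub> = \<one>\<^bsub>B\<^esub>"

lemma same_algebra_sym: "same_algebra A B \<Longrightarrow> same_algebra B A"
  by (simp add: same_algebra_def same_module_sym)

lemma same_algebra_assoc_algebra:
  assumes "same_algebra A B" "assoc_algebra R A"
  shows "assoc_algebra R B"
proof -
  interpret A: assoc_algebra R A by fact
  have sm: "same_module A B" using assms(1) by (simp add: same_algebra_def)
  then have B: "carrier B = carrier A" "monoid.mult B = monoid.mult A" "\<one>\<^bsub>B\<^esub> = \<one>\<^bsub>A\<^esub>"
    using assms(1) by (auto simp: same_algebra_def same_module_def)
  show ?thesis
    using A.mult_bilinear sm
    by (intro assoc_algebraI same_module_module[OF sm A.module_ax])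
      (auto simp: B A.A.m_assoc bilinear_map_def module_map_def same_module_def)
qed

lemma same_algebra_ideal:
  assumes "same_algebra A B" "assoc_algebra R A" "ideal I A"
  shows "ideal I B"
proof -
  interpret B: assoc_algebra R B by (rule same_algebra_assoc_algebra[OF assms(1,2)])
  interpret I: ideal I A by fact
  have B: "carrier B = carrier A" "monoid.mult B = monoid.mult A"
    and sm: "same_module A B"
    using assms(1) by (auto simp: same_algebra_def same_module_def)
  have "submodule I R B"
    using assoc_algebra.ideal_submodule[OF assms(2,3)] same_module_submodule[OF sm] by blast
  then show ?thesis
    by (intro idealI[OF B.A.ring_axioms]) (auto simp: B I.I_l_closed I.I_r_closed submodule_def)
qed

lemma same_algebra_genideal:
  assumes "same_algebra A B" "assoc_algebra R A"
  shows "genideal A S = genideal B S"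
  unfolding genideal_def
  using same_algebra_ideal[OF assms]
    same_algebra_ideal[OF same_algebra_sym[OF assms(1)] same_algebra_assoc_algebra[OF assms]] by blast

definition free_superalg ::
  "('r, 'm) ring_scheme \<Rightarrow> 'x set \<Rightarrow> ('x \<Rightarrow> bit) \<Rightarrow> ('r, 'x list \<Rightarrow> 'r) superalg" where
  "free_superalg R G d = (let F = free_algebra R G in
    \<lparr>carrier = carrier F, monoid.mult = monoid.mult F, one = one F,
     ring.zero = ring.zero F, add = add F, module.smult = module.smult F,
     part = (\<lambda>s. {f \<in> carrier F. \<forall>w. f w \<noteq> \<zero>\<^bsub>R\<^esub> \<longrightarrow> sum_list (map d w) = s})\<rparr>)"

lemma free_superalg_same_algebra: "same_algebra (free_algebra R G) (free_superalg R G d)"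
  by (simp add: same_algebra_def same_module_def free_superalg_def Let_def)

lemma free_superalg_carrier: "carrier (free_superalg R G d) = carrier (free_algebra R G)"
  by (simp add: free_superalg_def Let_def)

lemma free_superalg_part:
  "part (free_superalg R G d) s =
    {f \<in> carrier (free_module R (lists G)). \<forall>w. f w \<noteq> \<zero>\<^bsub>R\<^esub> \<longrightarrow> sum_list (map d w) = s}"
  by (simp add: free_superalg_def Let_def free_algebra_simps)

section \<open>The free algebra graded by the parities of words\<close>

context cring
begin

lemma free_superalg_superalgebra: "superalgebra R (free_superalg R G d)"
proof (rule superalgebraI)
  let ?F = "free_superalg R G d"
  show alg: "assoc_algebra R ?F"
    by (rule same_algebra_assoc_algebra[OF free_superalg_same_algebra free_algebra_assoc_algebra])
  interpret F: assoc_algebra R ?F by (rule alg)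
  interpret FM: module R "free_module R (lists G)" by (rule free_module_module)
  have simps: "carrier ?F = carrier (free_module R (lists G))"
    "\<zero>\<^bsub>?F\<^esub> = \<zero>\<^bsub>free_module R (lists G)\<^esub>" "add ?F = add (free_module R (lists G))"
    "module.smult ?F = module.smult (free_module R (lists G))"
    "\<one>\<^bsub>?F\<^esub> = basis_elt R []" "monoid.mult ?F = monoid.mult (free_algebra R G)"
    by (simp_all add: free_superalg_def Let_def free_algebra_simps)
  show "submodule (part ?F s) R ?F" for s
  proof (rule F.submoduleI', unfold simps free_superalg_part)
    let ?M = "free_module R (lists G)"
    fix f g assume f: "f \<in> {f \<in> carrier ?M. \<forall>w. f w \<noteq> \<zero> \<longrightarrow> sum_list (map d w) = s}"
      and g: "g \<in> {f \<in> carrier ?M. \<forall>w. f w \<noteq> \<zero> \<longrightarrow> sum_list (map d w) = s}"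
    have "f w \<noteq> \<zero> \<or> g w \<noteq> \<zero>" if "(f \<oplus>\<^bsub>?M\<^esub> g) w \<noteq> \<zero>" for w
      using that f g by (auto simp: free_module_simps)
    then show "f \<oplus>\<^bsub>?M\<^esub> g \<in> {f \<in> carrier ?M. \<forall>w. f w \<noteq> \<zero> \<longrightarrow> sum_list (map d w) = s}"
      using f g by blast
  next
    let ?M = "free_module R (lists G)"
    fix r f assume r: "r \<in> carrier R" and f: "f \<in> {f \<in> carrier ?M. \<forall>w. f w \<noteq> \<zero> \<longrightarrow> sum_list (map d w) = s}"
    have "f w \<noteq> \<zero>" if "(r \<odot>\<^bsub>?M\<^esub> f) w \<noteq> \<zero>" for w
      using that f r by (auto simp: free_module_simps)
    then show "r \<odot>\<^bsub>?M\<^esub> f \<in> {f \<in> carrier ?M. \<forall>w. f w \<noteq> \<zero> \<longrightarrow> sum_list (map d w) = s}"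
      using f r by blast
  qed (auto simp: free_module_simps)
  show "\<exists>u\<in>part ?F 0. \<exists>v\<in>part ?F 1. f = u \<oplus>\<^bsub>?F\<^esub> v" if f: "f \<in> carrier ?F" for f
  proof -
    let ?f = "\<lambda>s w. if sum_list (map d w) = s then f w else \<zero>"
    have fM: "f \<in> carrier (free_module R (lists G))" using f by (simp add: simps)
    have part: "?f s \<in> part ?F s" for s
      using fM by (auto simp: free_superalg_part free_module_simps intro: finite_subset[of _ "{w. f w \<noteq> \<zero>}"])
    have "f w = ?f 0 w \<oplus> ?f 1 w" for w
      using free_module_value_closed[OF fM, of w] by auto
    then have "f = ?f 0 \<oplus>\<^bsub>?F\<^esub> ?f 1"
      by (simp add: simps free_module_simps fun_eq_iff)
    then show ?thesis using part by blast
  qed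
  show "part ?F 0 \<inter> part ?F 1 \<subseteq> {\<zero>\<^bsub>?F\<^esub>}"
  proof
    fix f assume f: "f \<in> part ?F 0 \<inter> part ?F 1"
    have "f w = \<zero>" for w
    proof (rule ccontr)
      assume "f w \<noteq> \<zero>"
      then have "sum_list (map d w) = 0" "sum_list (map d w) = 1" using f by (auto simp: free_superalg_part)
      then show False by simp
    qed
    then show "f \<in> {\<zero>\<^bsub>?F\<^esub>}" by (auto simp: simps free_module_simps)
  qed
  show "\<one>\<^bsub>?F\<^esub> \<in> part ?F 0"
    unfolding simps free_superalg_part using basis_elt_closed[of "[]" "lists G"]
    by (auto simp: basis_elt_def)
  show "f \<otimes>\<^bsub>?F\<^esub> g \<in> part ?F (s + t)" if f: "f \<in> part ?F s" and g: "g \<in> part ?F t" for f g s t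
  proof -
    have fg: "f \<in> carrier (free_module R (lists G))" "g \<in> carrier (free_module R (lists G))"
      using f g by (auto simp: free_superalg_part)
    have "sum_list (map d w) = s + t" if w: "(f \<otimes>\<^bsub>free_algebra R G\<^esub> g) w \<noteq> \<zero>" for w
    proof -
      \<comment> \<open>A nonzero coefficient at \<open>w\<close> forces some cut of
        \<open>w\<close> to have nonzero coefficients on both sides, hence pieces of known
        parity.\<close>
      have "\<exists>i. f (take i w) \<otimes> g (drop i w) \<noteq> \<zero>"
        using w unfolding free_algebra_mult by (metis (no_types, lifting) add.finprod_one_eqI)
      then obtain i where "f (take i w) \<noteq> \<zero>" "g (drop i w) \<noteq> \<zero>"
        using free_module_value_closed[OF fg(1)] free_module_value_closed[OF fg(2)] l_null r_null by metis
      then have "sum_list (map d (take i w)) = s" "sum_list (map d (drop i w)) = t"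
        using f g by (auto simp: free_superalg_part)
      moreover have "sum_list (map d w) = sum_list (map d (take i w)) + sum_list (map d (drop i w))"
        by (metis append_take_drop_id map_append sum_list_append)
      ultimately show ?thesis by simp
    qed
    then show ?thesis
      unfolding simps by (simp add: free_superalg_part free_algebra_mult_closed fg)
  qed
qed

lemma basis_elt_part: "w \<in> lists G \<Longrightarrow> basis_elt R w \<in> part (free_superalg R G d) (sum_list (map d w))"
  by (auto simp: free_superalg_part basis_elt_closed) (auto simp: basis_elt_def split: if_splits)

end

text \<open>Evaluation intertwines the projections to the homogeneous components, so a homogeneous
  element of an algebra with homogeneous generators has a homogeneous preimage.\<close>

lemma component_free_eval:
  assumes A: "superalgebra R A" and x: "\<And>i. i \<in> G \<Longrightarrow> x i \<in> part A (d i)"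
    and u: "u \<in> carrier (free_algebra R G)"
  shows "component A s (free_eval R A x u) = free_eval R A x (component (free_superalg R G d) s u)"
proof -
  interpret A: superalgebra R A by (rule A)
  let ?F = "free_superalg R G d"
  interpret F: superalgebra R ?F by (rule A.R.free_superalg_superalgebra)
  have xc: "x ` G \<subseteq> carrier A" using x A.part_closed by blast
  have sm: "same_module (free_module R (lists G)) ?F"
    by (simp add: same_module_def free_superalg_def Let_def free_algebra_simps)
  note E = free_eval_map[OF A.assoc_algebra xc]
  have cF: "module_map R (free_module R (lists G)) (free_module R (lists G)) (component ?F s)"
    using F.component_map same_module_map[OF sm sm] by blast
  have wp: "foldr (\<lambda>i a. x i \<otimes>\<^bsub>A\<^esub> a) w \<one>\<^bsub>A\<^esub> \<in> part A (sum_list (map d w))" if "w \<in> lists G" for w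
    using that by (induction w) (auto simp: A.part_one A.part_mult x)
  show ?thesis
  proof (rule A.R.module_map_free_eq[OF module_map_comp[OF E A.component_map] module_map_comp[OF cF E] A.module_ax])
    show "u \<in> carrier (free_module R (lists G))" using u by (simp add: free_algebra_simps)
    fix w assume w: "w \<in> lists G"
    show "component A s (free_eval R A x (basis_elt R w)) = free_eval R A x (component ?F s (basis_elt R w))"
    proof (cases "sum_list (map d w) = s")
      case True
      then show ?thesis
        using w A.component_same[OF wp[OF w]] F.component_same[OF A.R.basis_elt_part[OF w, of d]]
        by (simp add: free_eval_basis[OF A.assoc_algebra xc])
    next
      case False
      have "free_eval R A x \<zero>\<^bsub>?F\<^esub> = \<zero>\<^bsub>A\<^esub>"
        using module_map_zero[OF E A.R.free_module_module A.module_ax] sm by (simp add: same_module_def)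
      then show ?thesis
        using False w A.component_other[OF wp[OF w], of s] F.component_other[OF A.R.basis_elt_part[OF w, of d], of s]
        by (simp add: free_eval_basis[OF A.assoc_algebra xc])
    qed
  qed
qed

text \<open>A homogeneous \<open>a\<close> has a homogeneous preimage: passing from \<open>u\<close>
  to its component of parity \<open>s\<close> does not change the value. Evaluating that polynomial
  at elements of \<open>B\<close> with the same parities gives an element of parity
  \<open>s\<close>.\<close>

lemma alg_hom_superalg_hom:
  assumes A: "superalgebra R A" and pres: "presented_by R A G x rels" and B: "superalgebra R B"
    and f: "alg_hom R A B f" and x: "\<And>i. i \<in> G \<Longrightarrow> x i \<in> part A (d i)"
    and y: "\<And>i. i \<in> G \<Longrightarrow> f (x i) \<in> part B (d i)"
  shows "f \<in> superalg_hom R A B"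
proof (rule superalg_homI[OF f])
  interpret A: superalgebra R A by (rule A)
  interpret B: superalgebra R B by (rule B)
  interpret F: superalgebra R "free_superalg R G d" by (rule A.R.free_superalg_superalgebra)
  fix s a assume a: "a \<in> part A s"
  then obtain u where u: "u \<in> carrier (free_algebra R G)" "a = free_eval R A x u"
    using presented_byD(2)[OF pres] A.part_closed by blast
  let ?v = "component (free_superalg R G d) s u"
  have v: "?v \<in> carrier (free_algebra R G)"
    using module_map_closed[OF F.component_map] u(1) unfolding free_superalg_carrier by blast
  have vv: "component (free_superalg R G d) s ?v = ?v"
    by (rule F.component_same[OF F.component_part]) (simp add: free_superalg_carrier u(1))
  have av: "a = free_eval R A x ?v"
    using component_free_eval[OF A x u(1)] A.component_same[OF a] u(2) by simp
  have "f a = free_eval R B (\<lambda>i. f (x i)) ?v"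
    using alg_hom_free_eval[OF A.assoc_algebra presented_byD(1)[OF pres] B.assoc_algebra f v] av by simp
  moreover have "component B s (free_eval R B (\<lambda>i. f (x i)) ?v) = free_eval R B (\<lambda>i. f (x i)) ?v"
    using component_free_eval[OF B y v] vv by simp
  moreover have "f a \<in> carrier B" using module_map_closed[OF alg_hom_map[OF f]] a A.part_closed by blast
  ultimately show "f a \<in> part B s" using B.component_part by metis
qed

text \<open>Homogeneous relators generate an ideal closed under components, so the quotient of the
  graded free algebra is graded. The two sides of a relation share a parity in order that their
  difference be homogeneous.\<close>

lemma presented_superalgebra_exists:
  assumes R: "cring R"
    and rels: "\<And>l r. (l, r) \<in> rels \<Longrightarrow>
      \<exists>s. l \<in> part (free_superalg R G d) s \<and> r \<in> part (free_superalg R G d) s"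
  defines "I \<equiv> genideal (free_algebra R G) {l \<ominus>\<^bsub>free_algebra R G\<^esub> r | l r. (l, r) \<in> rels}"
  defines "Q \<equiv> quot_superalg (free_superalg R G d) I"
  defines "x \<equiv> (\<lambda>i. I +>\<^bsub>free_superalg R G d\<^esub> basis_elt R [i])"
  shows "superalgebra R Q" "presented_by R Q G x rels" "i \<in> G \<Longrightarrow> x i \<in> part Q (d i)"
proof -
  interpret R: cring R by (rule R)
  let ?F = "free_algebra R G" and ?S = "free_superalg R G d"
  interpret F: assoc_algebra R ?F by (rule R.free_algebra_assoc_algebra)
  interpret S: superalgebra R ?S by (rule R.free_superalg_superalgebra)
  note same = free_superalg_same_algebra[of R G d]
  have sc: "carrier ?S = carrier ?F" using same by (simp add: same_algebra_def same_module_def)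
  have smin: "l \<ominus>\<^bsub>?F\<^esub> r = l \<ominus>\<^bsub>?S\<^esub> r" for l r
    using same same_module_a_minus by (auto simp: same_algebra_def)
  have relsc: "rels \<subseteq> carrier ?F \<times> carrier ?F"
    using rels S.part_closed sc by fast
  have I: "ideal I ?F"
    unfolding I_def by (rule F.A.genideal_ideal[OF relators_closed[OF relsc R]])
  have IS: "ideal I ?S" by (rule same_algebra_ideal[OF same F.assoc_algebra_axioms I])
  have gens: "\<exists>s. z \<in> part ?S s" if "z \<in> {l \<ominus>\<^bsub>?F\<^esub> r | l r. (l, r) \<in> rels}" for z
  proof -
    from that obtain l r where lr: "z = l \<ominus>\<^bsub>?S\<^esub> r" "(l, r) \<in> rels" unfolding smin by blast
    then obtain s where "l \<in> part ?S s" "r \<in> part ?S s" using rels by blast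
    then show ?thesis
      using lr(1) S.submoduleE(3,5)[OF S.part_submodule] unfolding a_minus_def by blast
  qed
  have hom: "component ?S s z \<in> I" if "z \<in> I" for z s
    using that unfolding I_def same_algebra_genideal[OF same F.assoc_algebra_axioms]
    by (rule S.genideal_homogeneous[rotated]) (rule gens)
  note Q = quot_superalg_superalgebra[OF S.superalgebra_axioms IS hom, folded Q_def]
  then show "superalgebra R Q" .
  interpret Q: superalgebra R Q by (rule Q)
  note qh = quot_superalg_alg_hom[OF S.superalgebra_axioms IS hom, folded Q_def]
  have qhF: "alg_hom R ?F Q ((+>\<^bsub>?S\<^esub>) I)"
    using qh same by (simp add: alg_hom_def module_map_def same_algebra_def same_module_def)
  have part: "x i \<in> part Q (d i)" if "i \<in> G" for i
    using R.basis_elt_part[of "[i]" G d] that by (auto simp: Q_def quot_superalg_def x_def)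
  then show "i \<in> G \<Longrightarrow> x i \<in> part Q (d i)" .
  have gc: "(\<lambda>i. basis_elt R [i]) ` G \<subseteq> carrier ?F"
    by (auto simp: free_algebra_simps intro!: R.basis_elt_closed)
  \<comment> \<open>Evaluation at the classes of the generators is the projection, so its kernel is
    \<open>I\<close> by construction.\<close>
  have ev: "free_eval R Q x u = I +>\<^bsub>?S\<^esub> u" if "u \<in> carrier ?F" for u
    using alg_hom_free_eval[OF F.assoc_algebra_axioms gc Q.assoc_algebra qhF that] free_eval_gen_id[OF R that]
    by (simp add: x_def)
  show "presented_by R Q G x rels"
  proof (rule presented_byI)
    show xQ: "x ` G \<subseteq> carrier Q" using part Q.part_closed by blast
    show "free_eval R Q x u \<in> carrier Q" if "u \<in> carrier ?F" for u
      using that ev module_map_closed[OF alg_hom_map[OF qhF]] by simp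
    show "\<exists>u\<in>carrier ?F. a = free_eval R Q x u" if "a \<in> carrier Q" for a
      using that quot_superalg_carrier[OF S.superalgebra_axioms IS] ev sc hom by (auto simp: Q_def)
    have "{u \<in> carrier ?F. free_eval R Q x u = \<zero>\<^bsub>Q\<^esub>} = {u \<in> carrier ?F. u \<in> I}"
      using ev quot_superalg_kernel[OF S.superalgebra_axioms IS hom] sc by (auto simp: Q_def)
    also have "\<dots> = I" using ideal.Icarr[OF I] by blast
    finally show "{u \<in> carrier ?F. free_eval R Q x u = \<zero>\<^bsub>Q\<^esub>} =
      genideal ?F {l \<ominus>\<^bsub>?F\<^esub> r | l r. (l, r) \<in> rels}" by (simp add: I_def)
  qed
qed

section \<open>The scalar identities behind the coproduct\<close>

definition bsign :: "bit \<Rightarrow> 'r::comm_ring_1" where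
  "bsign s = (if s = 0 then 1 else - 1)"

text \<open>With \<open>q'\<close> inverse to \<open>q\<close> this is \<open>q^((-1)^s)\<close>. It
  replaces \<open>q_single\<close> as \<open>bsign\<close> replaces \<open>parity_sign\<close>: type
  class arithmetic then applies to the scalars.\<close>

definition bpow :: "bit \<Rightarrow> 'r \<Rightarrow> 'r \<Rightarrow> 'r" where
  "bpow s q q' = (if s = 0 then q else q')"

text \<open>The sign of \<open>x_{ia} x_{hb} \<otimes> x_{aj} x_{bk}\<close> in the product of the coproducts of
  \<open>x_{ij}\<close> and \<open>x_{hk}\<close>, in terms of the parities of the six indices.\<close>

definition msign :: "bit \<Rightarrow> bit \<Rightarrow> bit \<Rightarrow> bit \<Rightarrow> bit \<Rightarrow> bit \<Rightarrow> 'r::comm_ring_1" where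
  "msign i j h k a b = bsign ((i + a) * (a + j) + (h + b) * (b + k) + (a + j) * (h + b))"

section \<open>Coefficient identities, with letters for the parameters and their inverses\<close>

context
  fixes q q' A A' H H' J J' :: "'r::comm_ring_1"
  assumes inv: "q * q' = 1" "A * A' = 1" "H * H' = 1" "J * J' = 1"
begin

text \<open>In the off-diagonal applications \<open>A\<close>, \<open>H\<close>, \<open>J\<close>
  are \<open>Q a b\<close>, \<open>Q i h\<close>, \<open>Q j k\<close>; a prime marks the inverse,
  obtained by exchanging the two indices. These forms cancel inside the right-nested products left
  by \<open>algebra_simps\<close>.\<close>

lemma inv_cancel:
  "q * (q' * z) = z" "A * (A' * z) = z" "H * (H' * z) = z" "J * (J' * z) = z"
  using inv by (simp_all flip: mult.assoc)

lemmas scalar_defs = bsign_def bpow_def msign_def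
lemmas scalar_simps = bit_add_self add_0_left add_0_right mult_1_left mult_1_right mult_zero_left
  mult_zero_right if_True if_False one_neq_zero mult_minus_left mult_minus_right minus_minus
  HOL.refl simp_thms

text \<open>Coefficients, in this order, of \<open>u \<otimes> z\<close>,
  \<open>u \<otimes> w\<close>, \<open>v \<otimes> z\<close>, \<open>v \<otimes> w\<close> in the
  last relation, for the monomials fixed in \<open>cterm_relation5\<close>. The letters
  \<open>i\<close> to \<open>b\<close> denote parities here; once all six are assigned, only
  cancellation of inverses is left.\<close>

lemma scalars_off5:
  "msign i j h k a b * ((bsign ((i + a) * (i + b)) * (bpow i q q' - bpow i q' q) * A') *
      (bsign ((a + j) * (b + k)) * A * J')) =
    (bsign ((i + j) * (i + k)) * (bpow i q q' - bpow i q' q) * J') * (msign i k h j b a)"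
  "msign i j h k a b * ((bsign ((i + a) * (i + b)) * (bpow i q q' - bpow i q' q) * A') *
      (bsign ((a + j) * (a + k)) * (bpow a q q' - bpow a q' q) * J')) +
    msign i j h k b a * (bsign ((a + k) * (b + j)) * A' * J') =
    (bsign ((i + j) * (h + k)) * H * J') * (msign h k i j a b * (bsign ((i + b) * (h + a)) * H' * A')) +
    (bsign ((i + j) * (i + k)) * (bpow i q q' - bpow i q' q) * J') * (msign i k h j a b *
      (bsign ((i + a) * (i + b)) * (bpow i q q' - bpow i q' q) * A'))"
  "msign i j h k a b * ((bsign ((i + a) * (h + b)) * H * A') * (bsign ((a + j) * (b + k)) * A * J')) =
    (bsign ((i + j) * (h + k)) * H * J') * msign h k i j b a"
  "msign i j h k a b * ((bsign ((i + a) * (h + b)) * H * A') * (bsign ((a + j) * (a + k)) *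
      (bpow a q q' - bpow a q' q) * J')) =
    (bsign ((i + j) * (i + k)) * (bpow i q q' - bpow i q' q) * J') * (msign i k h j a b *
      (bsign ((i + a) * (h + b)) * H * A'))"
  unfolding scalar_defs
  by (cases i; cases j; cases h; cases k; cases a; cases b; simp only: scalar_simps;
      simp add: algebra_simps inv inv_cancel)+

text \<open>The first tensor factor lies in a single row and has one coordinate \<open>u\<close>, so
  only the coefficients of \<open>u \<otimes> z\<close> and \<open>u \<otimes> w\<close>
  occur.\<close>

lemma scalars_off2:
  "msign i j i k a b * ((bsign ((i + a) * (i + b)) * bpow i q q' * A') * (bsign ((a + j) *
      (b + k)) * A * J')) =
    (bsign ((i + j) * (i + k)) * bpow i q q' * J') * msign i k i j b a"
  "msign i j i k a b * ((bsign ((i + a) * (i + b)) * bpow i q q' * A') * (bsign ((a + j) * (a + k)) *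
      (bpow a q q' - bpow a q' q) * J')) +
    msign i j i k b a * (bsign ((a + k) * (b + j)) * A' * J') =
    (bsign ((i + j) * (i + k)) * bpow i q q' * J') * (msign i k i j a b * (bsign ((i + a) *
      (i + b)) * bpow i q q' * A'))"
  unfolding scalar_defs
  by (cases i; cases j; cases k; cases a; cases b; simp only: scalar_simps;
      simp add: algebra_simps inv inv_cancel)+

text \<open>The second tensor factor lies in a single column and has one coordinate
  \<open>w\<close>: these are the coefficients of \<open>u \<otimes> w\<close> and
  \<open>v \<otimes> w\<close>.\<close>

lemma scalars_off3:
  "msign i j h j a b * ((bsign ((i + a) * (i + b)) * (bpow i q q' - bpow i q' q) * A') *
      (bsign ((a + j) * (b + j)) * bpow j q q' * A)) +
    msign i j h j b a =
    (bsign ((i + j) * (h + j)) * bpow j q q' * H) * (msign h j i j a b * ((bsign ((i + b) *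
      (h + a)) * H' * A') * (bsign ((a + j) * (b + j)) * bpow j q q' * A)))"
  "msign i j h j a b * ((bsign ((i + a) * (h + b)) * H * A') * (bsign ((a + j) *
      (b + j)) * bpow j q q' * A)) =
    (bsign ((i + j) * (h + j)) * bpow j q q' * H) * msign h j i j b a"
  unfolding scalar_defs
  by (cases i; cases j; cases h; cases a; cases b; simp only: scalar_simps;
      simp add: algebra_simps inv inv_cancel)+

text \<open>The columns stay ordered as \<open>j < k\<close> while the relation concerns
  \<open>x_{ik} x_{hj}\<close>, whence \<open>J\<close> in place of \<open>J'\<close>. The
  coefficients are those of \<open>u \<otimes> z\<close>, \<open>u \<otimes> w\<close>,
  \<open>v \<otimes> w\<close>; the one of \<open>v \<otimes> z\<close> is zero on both
  sides.\<close>

lemma scalars_off4: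
  "msign i k h j b a =
    (bsign ((i + k) * (h + j)) * H * J) * (msign h j i k a b * ((bsign ((i + b) *
      (h + a)) * H' * A') * (bsign ((a + j) * (b + k)) * A * J')))"
  "msign i k h j a b * (bsign ((i + a) * (i + b)) * (bpow i q q' - bpow i q' q) * A') =
    (bsign ((i + k) * (h + j)) * H * J) * (msign h j i k a b * ((bsign ((i + b) *
      (h + a)) * H' * A') * (bsign ((a + j) * (a + k)) * (bpow a q q' - bpow a q' q) * J')))"
  "msign i k h j a b * (bsign ((i + a) * (h + b)) * H * A') =
    (bsign ((i + k) * (h + j)) * H * J) * (msign h j i k b a * (bsign ((a + k) * (b + j)) * A' * J'))"
  unfolding scalar_defs
  by (cases i; cases j; cases h; cases k; cases a; cases b; simp only: scalar_simps;
      simp add: algebra_simps inv inv_cancel)+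

text \<open>Opposite parities of \<open>i\<close> and \<open>j\<close> make
  \<open>bpow i q q'\<close> and \<open>bpow j q q'\<close> inverse to each other, so the two
  summands differ only by a sign and cancel.\<close>

lemma scalars_off1:
  "i + j =
    1 \<Longrightarrow> msign i j i j a b * ((bsign ((i + a) * (i + b)) * bpow i q q' * A') *
      (bsign ((a + j) * (b + j)) * bpow j q q' * A)) +
    msign i j i j b a =
    0"
  unfolding scalar_defs
  by (cases i; cases j; cases a; cases b; simp only: scalar_simps;
      simp add: algebra_simps inv inv_cancel)+

text \<open>Summands with \<open>a = b\<close>, for the second to fifth family of
  \<open>qmat_relations\<close> in this order. The parity hypotheses of the first two set aside the
  case where the square of an odd generator occurs.\<close>

lemma scalars_diag:
  "i + a =
    0 \<Longrightarrow> msign i j i k a a * (bsign ((a + j) * (a + k)) * bpow a q q' * J') =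
    (bsign ((i + j) * (i + k)) * bpow i q q' * J') * msign i k i j a a"
  "a + j =
    0 \<Longrightarrow> msign i j h j a a * (bsign ((i + a) * (h + a)) * bpow a q q' * H) =
    (bsign ((i + j) * (h + j)) * bpow j q q' * H) * msign h j i j a a"
  "msign i k h j a a * (bsign ((i + a) * (h + a)) * bpow a q q' * H) =
    (bsign ((i + k) * (h + j)) * H * J) * (msign h j i k a a * (bsign ((a + j) *
      (a + k)) * bpow a q q' * J'))"
  "msign i j h k a a * ((bsign ((i + a) * (h + a)) * bpow a q q' * H) * (bsign ((a + j) *
      (a + k)) * bpow a q q' * J')) =
    (bsign ((i + j) * (h + k)) * H * J') * msign h k i j a a +
    (bsign ((i + j) * (i + k)) * (bpow i q q' - bpow i q' q) * J') * (msign i k h j a a *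
      (bsign ((i + a) * (h + a)) * bpow a q q' * H))"
  unfolding scalar_defs
  by (cases i; cases j; cases h; cases k; cases a; simp only: scalar_simps;
      simp add: algebra_simps inv inv_cancel)+

end

section \<open>The relations of quantum supermatrices\<close>

text \<open>A record whose carrier is a whole type: results about records apply to it, while
  computations with scalars are done by type class simplification.\<close>

abbreviation rta :: "'r::comm_ring_1 ring" where
  "rta \<equiv> ring_of_type_algebra"

lemma rta_simps [simp]:
  "carrier (rta :: 'r::comm_ring_1 ring) = UNIV"
  "x \<otimes>\<^bsub>rta\<^esub> y = x * y" "x \<oplus>\<^bsub>rta\<^esub> y = x + y" "\<one>\<^bsub>rta\<^esub> = 1" "\<zero>\<^bsub>rta\<^esub> = 0"
  by (simp_all add: ring_of_type_algebra_def)

lemma cring_rta: "cring (rta :: 'r::comm_ring_1 ring)"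
  by (rule cring_from_type_algebra)

lemma rta_a_inv [simp]: "\<ominus>\<^bsub>rta\<^esub> (x :: 'r::comm_ring_1) = - x"
proof -
  interpret cring "rta :: 'r ring" by (rule cring_rta)
  show ?thesis by (rule minus_equality) simp_all
qed

lemma rta_minus [simp]: "x \<ominus>\<^bsub>rta\<^esub> y = x - (y :: 'r::comm_ring_1)"
  by (simp add: a_minus_def)

lemma rta_inv:
  assumes "x * y = (1 :: 'r::comm_ring_1)"
  shows "inv\<^bsub>rta\<^esub> x = y"
proof -
  interpret cring "rta :: 'r ring" by (rule cring_rta)
  show ?thesis
    using assms by (intro comm_inv_char) auto
qed

lemma rta_parity_sign [simp]: "parity_sign rta s = (bsign s :: 'r::comm_ring_1)"
  by (simp add: parity_sign_def bsign_def)

text \<open>A product of two coproducts of generators is a double sum over pairs \<open>(a, b)\<close>; the defining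
  relations mix the summand of \<open>(a, b)\<close> only with that of \<open>(b, a)\<close>.\<close>

lemma (in abelian_group) double_sum_eqI:
  assumes "finite S"
    and F: "\<And>a b. F a b \<in> carrier G" and H: "\<And>a b. H a b \<in> carrier G"
    and diag: "\<And>a. F a a = H a a"
    and off: "\<And>a b. a < (b::'i::linorder) \<Longrightarrow> F a b \<oplus> F b a = H a b \<oplus> H b a"
  shows "(\<Oplus>a\<in>S. \<Oplus>b\<in>S. F a b) = (\<Oplus>a\<in>S. \<Oplus>b\<in>S. H a b)"
  using assms(1)
proof (induction S)
  case (insert m S)
  have sym: "F m a \<oplus> F a m = H m a \<oplus> H a m" if "a \<noteq> m" for a
  proof (cases "a < m")
    case True
    then show ?thesis using off[of a m] F H by (simp add: a_comm)
  next
    case False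
    then show ?thesis using off[of m a] that by simp
  qed
  \<comment> \<open>For a new index \<open>m\<close> the diagonal term, the pairs of opposite
    entries involving \<open>m\<close>, and the remaining square are separated. The hypotheses match
    the first two groups and the induction hypothesis the third.\<close>
  have expand: "(\<Oplus>a\<in>insert m S. \<Oplus>b\<in>insert m S. f a b) =
      f m m \<oplus> ((\<Oplus>a\<in>S. f m a \<oplus> f a m) \<oplus> (\<Oplus>a\<in>S. \<Oplus>b\<in>S. f a b))"
    if f: "\<And>a b. f a b \<in> carrier G" for f
  proof -
    have row: "(\<Oplus>b\<in>insert m S. f a b) = f a m \<oplus> (\<Oplus>b\<in>S. f a b)" for a
      using insert.hyps f by (intro finsum_insert) auto
    have cl: "(\<Oplus>b\<in>S. f a b) \<in> carrier G" "(\<Oplus>b\<in>S. f b a) \<in> carrier G" for a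
      using f by (auto intro: finsum_closed)
    have cl2: "(\<Oplus>a\<in>S. \<Oplus>b\<in>S. f a b) \<in> carrier G" using cl by (auto intro: finsum_closed)
    have "(\<Oplus>a\<in>insert m S. \<Oplus>b\<in>insert m S. f a b) =
        (f m m \<oplus> (\<Oplus>b\<in>S. f m b)) \<oplus> (\<Oplus>a\<in>S. f a m \<oplus> (\<Oplus>b\<in>S. f a b))"
      unfolding row using insert.hyps f cl by (intro finsum_insert) auto
    also have "(\<Oplus>a\<in>S. f a m \<oplus> (\<Oplus>b\<in>S. f a b)) = (\<Oplus>a\<in>S. f a m) \<oplus> (\<Oplus>a\<in>S. \<Oplus>b\<in>S. f a b)"
      using f cl by (intro finsum_addf) auto
    also have "f m m \<oplus> (\<Oplus>b\<in>S. f m b) \<oplus> ((\<Oplus>a\<in>S. f a m) \<oplus> (\<Oplus>a\<in>S. \<Oplus>b\<in>S. f a b)) =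
        f m m \<oplus> (((\<Oplus>b\<in>S. f m b) \<oplus> (\<Oplus>a\<in>S. f a m)) \<oplus> (\<Oplus>a\<in>S. \<Oplus>b\<in>S. f a b))"
      using f cl cl2 by (simp add: a_assoc)
    also have "(\<Oplus>b\<in>S. f m b) \<oplus> (\<Oplus>a\<in>S. f a m) = (\<Oplus>a\<in>S. f m a \<oplus> f a m)"
      using f by (intro finsum_addf[symmetric]) auto
    finally show ?thesis .
  qed
  have "(\<Oplus>a\<in>S. F m a \<oplus> F a m) = (\<Oplus>a\<in>S. H m a \<oplus> H a m)"
    using insert.hyps(2) F H by (intro finsum_cong' refl sym) auto
  then show ?case
    using expand[of F] expand[of H] insert.IH diag F H by simp
qed simp

text \<open>Coordinates with respect to a possibly dependent family: equal coefficients give equal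
  elements, and only this direction is used.\<close>

definition lin2 :: "('r, 'a, 'l) module_scheme \<Rightarrow> 'a \<Rightarrow> 'a \<Rightarrow> 'r \<Rightarrow> 'r \<Rightarrow> 'a" where
  "lin2 M u v l m = l \<odot>\<^bsub>M\<^esub> u \<oplus>\<^bsub>M\<^esub> m \<odot>\<^bsub>M\<^esub> v"

definition lin4 :: "('r, 'a, 'l) module_scheme \<Rightarrow> 'a \<Rightarrow> 'a \<Rightarrow> 'a \<Rightarrow> 'a \<Rightarrow> 'r \<Rightarrow> 'r \<Rightarrow> 'r \<Rightarrow> 'r \<Rightarrow> 'a" where
  "lin4 M t1 t2 t3 t4 c1 c2 c3 c4 = lin2 M t1 t2 c1 c2 \<oplus>\<^bsub>M\<^esub> lin2 M t3 t4 c3 c4"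

lemma lin4_add_smult:
  fixes M :: "('r::comm_ring_1, 'a, 'l) module_scheme"
  assumes "module rta M" "t1 \<in> carrier M" "t2 \<in> carrier M" "t3 \<in> carrier M" "t4 \<in> carrier M"
  shows "lin4 M t1 t2 t3 t4 c1 c2 c3 c4 \<oplus>\<^bsub>M\<^esub> lin4 M t1 t2 t3 t4 d1 d2 d3 d4 =
      lin4 M t1 t2 t3 t4 (c1 + d1) (c2 + d2) (c3 + d3) (c4 + d4)"
    and "c \<odot>\<^bsub>M\<^esub> lin4 M t1 t2 t3 t4 c1 c2 c3 c4 = lin4 M t1 t2 t3 t4 (c * c1) (c * c2) (c * c3) (c * c4)"
    and "lin4 M t1 t2 t3 t4 0 0 0 0 = \<zero>\<^bsub>M\<^esub>"
proof -
  interpret M: module rta M by fact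
  note [simp] = assms(2-5) M.smult_l_distr[simplified] M.smult_assoc1[simplified]
    M.smult_r_distr[simplified] M.smult_closed[simplified] M.smult_l_null[simplified]
  show "lin4 M t1 t2 t3 t4 c1 c2 c3 c4 \<oplus>\<^bsub>M\<^esub> lin4 M t1 t2 t3 t4 d1 d2 d3 d4 =
      lin4 M t1 t2 t3 t4 (c1 + d1) (c2 + d2) (c3 + d3) (c4 + d4)"
    by (simp add: lin4_def lin2_def M.M.a_ac)
  show "c \<odot>\<^bsub>M\<^esub> lin4 M t1 t2 t3 t4 c1 c2 c3 c4 = lin4 M t1 t2 t3 t4 (c * c1) (c * c2) (c * c3) (c * c4)"
    by (simp add: lin4_def lin2_def)
  show "lin4 M t1 t2 t3 t4 0 0 0 0 = \<zero>\<^bsub>M\<^esub>"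
    by (simp add: lin4_def lin2_def)
qed

lemma tens_lin2:
  fixes A :: "('r::comm_ring_1, 'a, 'l) module_scheme"
  assumes "module rta A" "u1 \<in> carrier A" "u2 \<in> carrier A" "v1 \<in> carrier A" "v2 \<in> carrier A"
  shows "s \<odot>\<^bsub>tensor_module rta A A\<^esub> tens rta A A (lin2 A u1 u2 l1 l2) (lin2 A v1 v2 r1 r2) =
    lin4 (tensor_module rta A A) (tens rta A A u1 v1) (tens rta A A u1 v2) (tens rta A A u2 v1) (tens rta A A u2 v2)
      (s * (l1 * r1)) (s * (l1 * r2)) (s * (l2 * r1)) (s * (l2 * r2))"
proof -
  interpret A: module rta A by fact
  interpret T: module rta "tensor_module rta A A" by (rule tensor_module_module[OF assms(1,1)])
  note [simp] = assms(2-5) T.smult_assoc1[simplified, symmetric]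
    T.smult_r_distr[simplified] T.smult_closed[simplified] A.smult_closed[simplified]
    tens_closed[OF assms(1,1)] tens_add_smult[OF assms(1,1), simplified]
  show ?thesis by (simp add: lin4_def lin2_def mult_ac T.M.a_ac)
qed

lemma lin4_cong:
  "c1 = d1 \<Longrightarrow> c2 = d2 \<Longrightarrow> c3 = d3 \<Longrightarrow> c4 = d4 \<Longrightarrow>
    lin4 M t1 t2 t3 t4 c1 c2 c3 c4 = lin4 M t1 t2 t3 t4 d1 d2 d3 d4"
  by simp

text \<open>Records only the invertibility of the parameters, so the Laurent ring and its fraction
  field are both instances. Naming the inverses keeps the scalar identities free of
  \<open>inv\<close>.\<close>

locale qmat_parameters =
  fixes p :: "'n::{finite,linorder} \<Rightarrow> bit" and q q' :: "'r::comm_ring_1" and Q :: "'n \<Rightarrow> 'n \<Rightarrow> 'r"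
  assumes q_inv: "q * q' = 1" and Q_inv: "Q i j * Q j i = 1"
begin

text \<open>The relations read inside \<open>A\<close>, with record inverses eliminated: the inverse
  of \<open>Q j k\<close> is \<open>Q k j\<close>, and inverting \<open>q_i\<close> exchanges
  \<open>q\<close> and \<open>q'\<close>.\<close>

definition qmat_equations :: "('r, 'a, 'l) module_scheme \<Rightarrow> ('n \<times> 'n \<Rightarrow> 'a) \<Rightarrow> bool" where
  "qmat_equations A x \<longleftrightarrow>
    (\<forall>i j. p i + p j = 1 \<longrightarrow> x (i, j) \<otimes>\<^bsub>A\<^esub> x (i, j) = \<zero>\<^bsub>A\<^esub>) \<and>
    (\<forall>i j k. j < k \<longrightarrow> x (i, j) \<otimes>\<^bsub>A\<^esub> x (i, k) =
      (bsign ((p i + p j) * (p i + p k)) * bpow (p i) q q' * Q k j) \<odot>\<^bsub>A\<^esub> (x (i, k) \<otimes>\<^bsub>A\<^esub> x (i, j))) \<and>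
    (\<forall>i h j. i < h \<longrightarrow> x (i, j) \<otimes>\<^bsub>A\<^esub> x (h, j) =
      (bsign ((p i + p j) * (p h + p j)) * bpow (p j) q q' * Q i h) \<odot>\<^bsub>A\<^esub> (x (h, j) \<otimes>\<^bsub>A\<^esub> x (i, j))) \<and>
    (\<forall>i h j k. i < h \<and> k < j \<longrightarrow> x (i, j) \<otimes>\<^bsub>A\<^esub> x (h, k) =
      (bsign ((p i + p j) * (p h + p k)) * Q i h * Q k j) \<odot>\<^bsub>A\<^esub> (x (h, k) \<otimes>\<^bsub>A\<^esub> x (i, j))) \<and>
    (\<forall>i h j k. i < h \<and> j < k \<longrightarrow> x (i, j) \<otimes>\<^bsub>A\<^esub> x (h, k) =
      (bsign ((p i + p j) * (p h + p k)) * Q i h * Q k j) \<odot>\<^bsub>A\<^esub> (x (h, k) \<otimes>\<^bsub>A\<^esub> x (i, j)) \<oplus>\<^bsub>A\<^esub>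
      (bsign ((p i + p j) * (p i + p k)) * (bpow (p i) q q' - bpow (p i) q' q) * Q k j) \<odot>\<^bsub>A\<^esub>
        (x (i, k) \<otimes>\<^bsub>A\<^esub> x (h, j)))"

lemma q_single_rta: "q_single rta p q i = bpow (p i) q q'"
  using rta_inv[OF q_inv] by (simp add: q_single_def bpow_def)

lemma q_single_rta_inv: "inv\<^bsub>rta\<^esub> (bpow (p i) q q') = bpow (p i) q' q"
  using rta_inv[OF q_inv] rta_inv[of q' q] q_inv by (simp add: bpow_def mult.commute)

lemma qmat_relations_rta:
  "qmat_relations rta p q Q =
    (let F = free_algebra rta UNIV; g = (\<lambda>i j. basis_elt rta [(i, j)]) in
      {(g i j \<otimes>\<^bsub>F\<^esub> g i j, \<zero>\<^bsub>F\<^esub>) | i j. p i + p j = 1} \<union>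
      {(g i j \<otimes>\<^bsub>F\<^esub> g i k,
        (bsign ((p i + p j) * (p i + p k)) * bpow (p i) q q' * Q k j) \<odot>\<^bsub>F\<^esub> (g i k \<otimes>\<^bsub>F\<^esub> g i j))
        | i j k. j < k} \<union>
      {(g i j \<otimes>\<^bsub>F\<^esub> g h j,
        (bsign ((p i + p j) * (p h + p j)) * bpow (p j) q q' * Q i h) \<odot>\<^bsub>F\<^esub> (g h j \<otimes>\<^bsub>F\<^esub> g i j))
        | i h j. i < h} \<union>
      {(g i j \<otimes>\<^bsub>F\<^esub> g h k,
        (bsign ((p i + p j) * (p h + p k)) * Q i h * Q k j) \<odot>\<^bsub>F\<^esub> (g h k \<otimes>\<^bsub>F\<^esub> g i j))
        | i h j k. i < h \<and> k < j} \<union>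
      {(g i j \<otimes>\<^bsub>F\<^esub> g h k,
        (bsign ((p i + p j) * (p h + p k)) * Q i h * Q k j) \<odot>\<^bsub>F\<^esub> (g h k \<otimes>\<^bsub>F\<^esub> g i j) \<oplus>\<^bsub>F\<^esub>
        (bsign ((p i + p j) * (p i + p k)) * (bpow (p i) q q' - bpow (p i) q' q) * Q k j) \<odot>\<^bsub>F\<^esub>
          (g i k \<otimes>\<^bsub>F\<^esub> g h j))
        | i h j k. i < h \<and> j < k})"
  by (simp add: qmat_relations_def Let_def pdeg_def q_single_rta q_single_rta_inv rta_inv[OF Q_inv])

abbreviation deg :: "'n \<times> 'n \<Rightarrow> bit" where
  "deg \<equiv> \<lambda>(i, j). p i + p j"

text \<open>All monomials of one relation have the same row indices and the same column indices,
  hence the parity \<open>p i + p j + p h + p k\<close>.\<close>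

lemma qmat_relations_homogeneous:
  assumes "(l, r) \<in> qmat_relations rta p q Q"
  shows "\<exists>s. l \<in> part (free_superalg rta UNIV deg) s \<and> r \<in> part (free_superalg rta UNIV deg) s"
proof -
  let ?F = "free_algebra rta (UNIV :: ('n \<times> 'n) set)" and ?S = "free_superalg rta (UNIV :: ('n \<times> 'n) set) deg"
  interpret S: superalgebra rta ?S by (rule cring.free_superalg_superalgebra[OF cring_rta])
  have eq: "monoid.mult ?S = monoid.mult ?F" "add ?S = add ?F" "module.smult ?S = module.smult ?F" "\<zero>\<^bsub>?S\<^esub> = \<zero>\<^bsub>?F\<^esub>"
    by (simp_all add: free_superalg_def Let_def)
  have g: "basis_elt rta [(i, j)] \<in> part ?S (p i + p j)" for i j
    using cring.basis_elt_part[OF cring_rta, of "[(i, j)]" UNIV deg] by simp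
  have gg: "c \<odot>\<^bsub>?F\<^esub> (basis_elt rta [(i, j)] \<otimes>\<^bsub>?F\<^esub> basis_elt rta [(h, k)]) \<in> part ?S s"
    "basis_elt rta [(i, j)] \<otimes>\<^bsub>?F\<^esub> basis_elt rta [(h, k)] \<in> part ?S s"
    if "s = p i + p j + p h + p k" for i j h k c s
    using S.part_mult[OF g[of i j] g[of h k]] S.part_smult[of c] that by (simp_all add: eq add.assoc)
  \<comment> \<open>One pattern covering all five families, with zero, one or two terms on the
    right.\<close>
  have "\<exists>s. l \<in> part ?S s \<and> r \<in> part ?S s"
    if "(l, r) = (basis_elt rta [(i, j)] \<otimes>\<^bsub>?F\<^esub> basis_elt rta [(h, k)], r)"
      "r = \<zero>\<^bsub>?F\<^esub> \<or> (\<exists>c. r = c \<odot>\<^bsub>?F\<^esub> (basis_elt rta [(h, k)] \<otimes>\<^bsub>?F\<^esub> basis_elt rta [(i, j)])) \<or>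
       (\<exists>c d. r = c \<odot>\<^bsub>?F\<^esub> (basis_elt rta [(h, k)] \<otimes>\<^bsub>?F\<^esub> basis_elt rta [(i, j)]) \<oplus>\<^bsub>?F\<^esub>
         d \<odot>\<^bsub>?F\<^esub> (basis_elt rta [(i, k)] \<otimes>\<^bsub>?F\<^esub> basis_elt rta [(h, j)]))" for i j h k
  proof (intro exI conjI)
    show "l \<in> part ?S (p i + p j + p h + p k)" using that(1) gg(2)[OF refl] by simp
    show "r \<in> part ?S (p i + p j + p h + p k)"
      using that(2) S.part_zero gg(1)[of "p i + p j + p h + p k" h k i j]
        gg(1)[of "p i + p j + p h + p k" i k h j]
      by (auto simp: eq add_ac intro: S.part_add[unfolded eq])
  qed
  then show ?thesis
    using assms unfolding qmat_relations_rta Let_def by blast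
qed

lemma qmat_relations_closed:
  "qmat_relations rta p q Q \<subseteq> carrier (free_algebra rta UNIV) \<times> carrier (free_algebra rta UNIV)"
  using qmat_relations_homogeneous
    superalgebra.part_closed[OF cring.free_superalg_superalgebra[OF cring_rta], of _ UNIV deg]
  unfolding free_superalg_carrier by fast

text \<open>Evaluating each quadratic word turns the relations into equations among the
  \<open>x (i, j)\<close>, the form in which the computations are carried out.\<close>

lemma satisfies_qmat_relations_iff:
  fixes A :: "('r, 'a, 'l) module_scheme"
  assumes A: "assoc_algebra rta A" and x: "range x \<subseteq> carrier A"
  shows "satisfies rta A x (qmat_relations rta p q Q) \<longleftrightarrow> qmat_equations A x"
proof -
  let ?F = "free_algebra rta (UNIV :: ('n \<times> 'n) set)"
  interpret A: assoc_algebra rta A by (rule A)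
  interpret F: assoc_algebra rta ?F by (rule cring.free_algebra_assoc_algebra[OF cring_rta])
  note E = alg_hom_map[OF free_eval_alg_hom[OF A x]]
  have g: "basis_elt rta [i] \<in> carrier ?F" for i
    using cring.basis_elt_closed[OF cring_rta, of "[i]" "lists UNIV"] by (simp add: free_algebra_simps)
  note [simp] = g free_eval_mult_gen[OF A x UNIV_I UNIV_I]
    module_map_zero[OF E F.module_axioms A.module_axioms] F.A.m_closed
  have [simp]: "free_eval rta A x (c \<odot>\<^bsub>?F\<^esub> (basis_elt rta [i] \<otimes>\<^bsub>?F\<^esub> basis_elt rta [j])) = c \<odot>\<^bsub>A\<^esub> (x i \<otimes>\<^bsub>A\<^esub> x j)"
    "free_eval rta A x (c \<odot>\<^bsub>?F\<^esub> (basis_elt rta [i] \<otimes>\<^bsub>?F\<^esub> basis_elt rta [j]) \<oplus>\<^bsub>?F\<^esub>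
      d \<odot>\<^bsub>?F\<^esub> (basis_elt rta [h] \<otimes>\<^bsub>?F\<^esub> basis_elt rta [k])) = c \<odot>\<^bsub>A\<^esub> (x i \<otimes>\<^bsub>A\<^esub> x j) \<oplus>\<^bsub>A\<^esub> d \<odot>\<^bsub>A\<^esub> (x h \<otimes>\<^bsub>A\<^esub> x k)"
    for c d i j h k
    by (simp_all add: module_map_smult[OF E] module_map_add[OF E] F.smult_closed)
  have ball: "(\<forall>z\<in>{f i j | i j. P i j}. S z) \<longleftrightarrow> (\<forall>i j. P i j \<longrightarrow> S (f i j))"
    "(\<forall>z\<in>{f' i j k | i j k. P' i j k}. S z) \<longleftrightarrow> (\<forall>i j k. P' i j k \<longrightarrow> S (f' i j k))"
    "(\<forall>z\<in>{f'' i j h k | i j h k. P'' i j h k}. S z) \<longleftrightarrow> (\<forall>i j h k. P'' i j h k \<longrightarrow> S (f'' i j h k))"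
    for f f' f'' S and P :: "'n \<Rightarrow> 'n \<Rightarrow> bool" and P' :: "'n \<Rightarrow> 'n \<Rightarrow> 'n \<Rightarrow> bool"
      and P'' :: "'n \<Rightarrow> 'n \<Rightarrow> 'n \<Rightarrow> 'n \<Rightarrow> bool"
    by blast+
  show ?thesis
    unfolding satisfies_def qmat_relations_rta Let_def qmat_equations_def ball_Un ball prod.case
    by (simp add: conj_assoc)
qed

end

context qmat_parameters
begin

lemma qmat_equationsD:
  assumes "qmat_equations A x"
  shows "p i + p j = 1 \<Longrightarrow> x (i, j) \<otimes>\<^bsub>A\<^esub> x (i, j) = \<zero>\<^bsub>A\<^esub>"
    and "j < k \<Longrightarrow> x (i, j) \<otimes>\<^bsub>A\<^esub> x (i, k) =
      (bsign ((p i + p j) * (p i + p k)) * bpow (p i) q q' * Q k j) \<odot>\<^bsub>A\<^esub> (x (i, k) \<otimes>\<^bsub>A\<^esub> x (i, j))"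
    and "i < h \<Longrightarrow> x (i, j) \<otimes>\<^bsub>A\<^esub> x (h, j) =
      (bsign ((p i + p j) * (p h + p j)) * bpow (p j) q q' * Q i h) \<odot>\<^bsub>A\<^esub> (x (h, j) \<otimes>\<^bsub>A\<^esub> x (i, j))"
    and "i < h \<Longrightarrow> k < j \<Longrightarrow> x (i, j) \<otimes>\<^bsub>A\<^esub> x (h, k) =
      (bsign ((p i + p j) * (p h + p k)) * Q i h * Q k j) \<odot>\<^bsub>A\<^esub> (x (h, k) \<otimes>\<^bsub>A\<^esub> x (i, j))"
    and "i < h \<Longrightarrow> j < k \<Longrightarrow> x (i, j) \<otimes>\<^bsub>A\<^esub> x (h, k) =
      (bsign ((p i + p j) * (p h + p k)) * Q i h * Q k j) \<odot>\<^bsub>A\<^esub> (x (h, k) \<otimes>\<^bsub>A\<^esub> x (i, j)) \<oplus>\<^bsub>A\<^esub>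
      (bsign ((p i + p j) * (p i + p k)) * (bpow (p i) q q' - bpow (p i) q' q) * Q k j) \<odot>\<^bsub>A\<^esub>
        (x (i, k) \<otimes>\<^bsub>A\<^esub> x (h, j))"
  using assms unfolding qmat_equations_def by blast+

definition coproduct_gen ::
  "('r, 'a, 'l) superalg_scheme \<Rightarrow> ('n \<times> 'n \<Rightarrow> 'a) \<Rightarrow> 'n \<times> 'n \<Rightarrow> ('a \<times> 'a \<Rightarrow> 'r) set" where
  "coproduct_gen A x = (\<lambda>(i, j). \<Oplus>\<^bsub>tensor_module rta A A\<^esub>a\<in>UNIV.
     bsign ((p i + p a) * (p a + p j)) \<odot>\<^bsub>tensor_module rta A A\<^esub> tens rta A A (x (i, a)) (x (a, j)))"

section \<open>The candidate coproduct satisfies the relations\<close>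

context
  fixes A :: "('r, 'a, 'l) superalg_scheme" and x
  assumes A: "superalgebra rta A" and x: "\<And>i j. x (i, j) \<in> part A (p i + p j)"
    and eqs: "qmat_equations A x"
begin

interpretation A: superalgebra rta A by (rule A)
interpretation TS: superalgebra rta "tensor_superalg rta A A" by (rule tensor_superalg_superalgebra[OF A A])

private abbreviation (input) "TAA \<equiv> tensor_module rta A A"
private abbreviation (input) "SAA \<equiv> tensor_superalg rta A A"

interpretation T: module rta TAA by (rule tensor_module_module[OF A.module_ax A.module_ax])

lemma x_closed [simp]: "x ij \<in> carrier A"
  using x[of "fst ij" "snd ij"] A.part_closed by simp

lemmas A_smult [simp] = A.smult_closed[simplified]
lemmas T_smult [simp] = T.smult_closed[simplified]
lemmas T_tens [simp] = tens_closed[OF A.module_ax A.module_ax]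

lemma lin2_units:
  assumes "u \<in> carrier A" "v \<in> carrier A"
  shows "lin2 A u v 1 0 = u" "lin2 A u v 0 1 = v" "lin2 A u v c 0 = c \<odot>\<^bsub>A\<^esub> u" "lin2 A u v 0 c = c \<odot>\<^bsub>A\<^esub> v"
  using assms A.smult_one[simplified] A.smult_l_null[simplified] by (simp_all add: lin2_def)

lemma smult_inverse:
  assumes "u = c \<odot>\<^bsub>A\<^esub> v" "d * c = 1" "v \<in> carrier A"
  shows "v = d \<odot>\<^bsub>A\<^esub> u"
  using assms A.smult_assoc1[simplified, of v d c] A.smult_one[simplified, of v] by simp

lemma bsign_square: "bsign s * (bsign s * z) = (z :: 'r)"
  by (simp add: bsign_def)

text \<open>The four quadratic monomials of a two by two minor are written in the coordinates
  \<open>u = x_{ib} x_{ha}\<close> and \<open>v = x_{hb} x_{ia}\<close>.\<close>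

lemma minor_table:
  assumes "i < h" "a < b"
  obtains u v where "u \<in> carrier A" "v \<in> carrier A"
    and "x (i, a) \<otimes>\<^bsub>A\<^esub> x (h, b) = lin2 A u v
      (bsign ((p i + p a) * (p i + p b)) * (bpow (p i) q q' - bpow (p i) q' q) * Q b a)
      (bsign ((p i + p a) * (p h + p b)) * Q i h * Q b a)"
    and "x (i, b) \<otimes>\<^bsub>A\<^esub> x (h, a) = lin2 A u v 1 0"
    and "x (h, a) \<otimes>\<^bsub>A\<^esub> x (i, b) = lin2 A u v (bsign ((p i + p b) * (p h + p a)) * Q h i * Q b a) 0"
    and "x (h, b) \<otimes>\<^bsub>A\<^esub> x (i, a) = lin2 A u v 0 1"
proof
  let ?u = "x (i, b) \<otimes>\<^bsub>A\<^esub> x (h, a)" and ?v = "x (h, b) \<otimes>\<^bsub>A\<^esub> x (i, a)"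
  show u: "?u \<in> carrier A" and v: "?v \<in> carrier A" by simp_all
  show "?u = lin2 A ?u ?v 1 0" "?v = lin2 A ?u ?v 0 1"
    using lin2_units[OF u v] by simp_all
  show "x (i, a) \<otimes>\<^bsub>A\<^esub> x (h, b) = lin2 A ?u ?v
      (bsign ((p i + p a) * (p i + p b)) * (bpow (p i) q q' - bpow (p i) q' q) * Q b a)
      (bsign ((p i + p a) * (p h + p b)) * Q i h * Q b a)"
    unfolding lin2_def using qmat_equationsD(5)[OF eqs assms] by (simp add: A.M.a_comm)
  \<comment> \<open>The fourth relation writes \<open>x_{ib} x_{ha}\<close> as a multiple of
    \<open>x_{ha} x_{ib}\<close>; its coefficient has to be inverted.\<close>
  have "Q h i * Q b a * (Q i h * Q a b) = (Q h i * Q i h) * (Q b a * Q a b)" by (simp only: mult_ac)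
  then have inv: "Q h i * Q b a * (Q i h * Q a b) = 1" by (simp add: Q_inv)
  have "x (h, a) \<otimes>\<^bsub>A\<^esub> x (i, b) = (bsign ((p i + p b) * (p h + p a)) * Q h i * Q b a) \<odot>\<^bsub>A\<^esub> ?u"
    by (rule smult_inverse[OF qmat_equationsD(4)[OF eqs assms]])
      (use inv bsign_square[of _ 1] in \<open>simp_all add: mult_ac\<close>)
  then show "x (h, a) \<otimes>\<^bsub>A\<^esub> x (i, b) = lin2 A ?u ?v (bsign ((p i + p b) * (p h + p a)) * Q h i * Q b a) 0"
    using lin2_units[OF u v] by simp
qed

text \<open>The single coordinate is repeated with second coefficient zero, which gives products
  within a row the two-coordinate shape required by \<open>tens_lin2\<close>.\<close>

lemma row_table:
  assumes "a < b"
  obtains u where "u \<in> carrier A"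
    and "x (i, a) \<otimes>\<^bsub>A\<^esub> x (i, b) = lin2 A u u (bsign ((p i + p a) * (p i + p b)) * bpow (p i) q q' * Q b a) 0"
    and "x (i, b) \<otimes>\<^bsub>A\<^esub> x (i, a) = lin2 A u u 1 0"
  using qmat_equationsD(2)[OF eqs assms, of i] by (metis lin2_units(1,3) A.A.m_closed x_closed)

lemma column_table:
  assumes "i < h"
  obtains u where "u \<in> carrier A"
    and "x (i, a) \<otimes>\<^bsub>A\<^esub> x (h, a) = lin2 A u u (bsign ((p i + p a) * (p h + p a)) * bpow (p a) q q' * Q i h) 0"
    and "x (h, a) \<otimes>\<^bsub>A\<^esub> x (i, a) = lin2 A u u 1 0"
  using qmat_equationsD(3)[OF eqs assms, of a] by (metis lin2_units(1,3) A.A.m_closed x_closed)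

definition cterm :: "'n \<Rightarrow> 'n \<Rightarrow> 'n \<Rightarrow> 'n \<Rightarrow> 'n \<Rightarrow> 'n \<Rightarrow> ('a \<times> 'a \<Rightarrow> 'r) set" where
  "cterm i j h k a b = msign (p i) (p j) (p h) (p k) (p a) (p b) \<odot>\<^bsub>TAA\<^esub>
     tens rta A A (x (i, a) \<otimes>\<^bsub>A\<^esub> x (h, b)) (x (a, j) \<otimes>\<^bsub>A\<^esub> x (b, k))"

lemma cterm_closed [simp]: "cterm i j h k a b \<in> carrier TAA"
  by (simp add: cterm_def)

lemma coproduct_gen_closed [simp]: "coproduct_gen A x ij \<in> carrier TAA"
  by (auto simp: coproduct_gen_def split: prod.split intro!: T.finsum_closed)

lemma coproduct_gen_part: "coproduct_gen A x (i, j) \<in> part SAA (p i + p j)"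
proof -
  have "(\<Oplus>\<^bsub>TAA\<^esub>a\<in>S. bsign ((p i + p a) * (p a + p j)) \<odot>\<^bsub>TAA\<^esub> tens rta A A (x (i, a)) (x (a, j)))
      \<in> part SAA (p i + p j)" if "finite S" for S
    using that
  proof (induction S)
    case (insert a S)
    have "tens rta A A (x (i, a)) (x (a, j)) \<in> part SAA ((p i + p a) + (p a + p j))"
      by (rule tensor_part_tens[OF A A x x])
    then have "bsign ((p i + p a) * (p a + p j)) \<odot>\<^bsub>TAA\<^esub> tens rta A A (x (i, a)) (x (a, j)) \<in> part SAA (p i + p j)"
      using T.submoduleE(4)[OF tensor_part_submodule[OF A A]] by (simp add: add.assoc)
    then show ?case
      using insert T.submoduleE(5)[OF tensor_part_submodule[OF A A]] by (simp add: T.M.finsum_insert)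
  qed (simp add: T.submodule_zero[OF tensor_part_submodule[OF A A]])
  then show ?thesis by (simp add: coproduct_gen_def)
qed

text \<open>Three signs meet: one from each coproduct, and one from moving \<open>x_{aj}\<close>
  past \<open>x_{hb}\<close>. As \<open>bsign\<close> turns sums into products, they combine to
  \<open>msign\<close>.\<close>

lemma coproduct_gen_mult:
  "coproduct_gen A x (i, j) \<otimes>\<^bsub>SAA\<^esub> coproduct_gen A x (h, k) =
    (\<Oplus>\<^bsub>TAA\<^esub>a\<in>UNIV. \<Oplus>\<^bsub>TAA\<^esub>b\<in>UNIV. cterm i j h k a b)"
proof -
  let ?s = "\<lambda>i j a. bsign ((p i + p a) * (p a + p j)) \<odot>\<^bsub>TAA\<^esub> tens rta A A (x (i, a)) (x (a, j))"
  have summand: "?s i j a \<otimes>\<^bsub>SAA\<^esub> ?s h k b = cterm i j h k a b" for a b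
  proof -
    have "?s i j a \<otimes>\<^bsub>SAA\<^esub> ?s h k b = bsign ((p i + p a) * (p a + p j)) \<odot>\<^bsub>TAA\<^esub> (bsign ((p h + p b) * (p b + p k)) \<odot>\<^bsub>TAA\<^esub>
       (bsign ((p a + p j) * (p h + p b)) \<odot>\<^bsub>TAA\<^esub> tens rta A A (x (i, a) \<otimes>\<^bsub>A\<^esub> x (h, b)) (x (a, j) \<otimes>\<^bsub>A\<^esub> x (b, k))))"
      using tensor_mult_maps(2)[OF A A x_closed x x x_closed, of "(i, a)" a j h b "(b, k)"]
      by (simp add: tensor_mult_linear[OF A A] mult_ac flip: T.smult_assoc1[simplified])
    also have "\<dots> = cterm i j h k a b"
    proof -
      have "bsign (s + t) = (bsign s * bsign t :: 'r)" for s t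
        by (cases s; cases t) (simp_all add: bsign_def)
      then show ?thesis
        by (simp add: cterm_def msign_def mult.assoc flip: T.smult_assoc1[simplified])
    qed
    finally show ?thesis .
  qed
  have cl: "?s i j a \<in> carrier SAA" for i j a by (simp add: tensor_superalg_simps)
  have "coproduct_gen A x (i, j) \<otimes>\<^bsub>SAA\<^esub> coproduct_gen A x (h, k) =
      (\<Oplus>\<^bsub>SAA\<^esub>a\<in>UNIV. ?s i j a) \<otimes>\<^bsub>SAA\<^esub> (\<Oplus>\<^bsub>SAA\<^esub>b\<in>UNIV. ?s h k b)"
    by (simp add: coproduct_gen_def same_module_finsum[OF same_module_tensor_superalg])
  also have "\<dots> = (\<Oplus>\<^bsub>SAA\<^esub>a\<in>UNIV. ?s i j a \<otimes>\<^bsub>SAA\<^esub> (\<Oplus>\<^bsub>SAA\<^esub>b\<in>UNIV. ?s h k b))"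
    using cl by (intro TS.A.finsum_ldistr TS.M.finsum_closed) auto
  also have "\<dots> = (\<Oplus>\<^bsub>SAA\<^esub>a\<in>UNIV. \<Oplus>\<^bsub>SAA\<^esub>b\<in>UNIV. ?s i j a \<otimes>\<^bsub>SAA\<^esub> ?s h k b)"
    using cl by (intro TS.M.finsum_cong' TS.A.finsum_rdistr) (auto intro!: TS.M.finsum_closed)
  finally show ?thesis
    by (simp add: summand same_module_finsum[OF same_module_tensor_superalg])
qed

lemma double_sum_smult:
  fixes F :: "'n \<Rightarrow> 'n \<Rightarrow> ('a \<times> 'a \<Rightarrow> 'r) set"
  assumes "\<And>a b. F a b \<in> carrier TAA"
  shows "c \<odot>\<^bsub>TAA\<^esub> (\<Oplus>\<^bsub>TAA\<^esub>a\<in>UNIV. \<Oplus>\<^bsub>TAA\<^esub>b\<in>UNIV. F a b) = (\<Oplus>\<^bsub>TAA\<^esub>a\<in>UNIV. \<Oplus>\<^bsub>TAA\<^esub>b\<in>UNIV. c \<odot>\<^bsub>TAA\<^esub> F a b)"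
proof -
  have "c \<odot>\<^bsub>TAA\<^esub> (\<Oplus>\<^bsub>TAA\<^esub>a\<in>UNIV. \<Oplus>\<^bsub>TAA\<^esub>b\<in>UNIV. F a b) = (\<Oplus>\<^bsub>TAA\<^esub>a\<in>UNIV. c \<odot>\<^bsub>TAA\<^esub> (\<Oplus>\<^bsub>TAA\<^esub>b\<in>UNIV. F a b))"
    using assms by (intro T.finsum_smult_ldistr) (auto intro!: T.M.finsum_closed)
  also have "\<dots> = (\<Oplus>\<^bsub>TAA\<^esub>a\<in>UNIV. \<Oplus>\<^bsub>TAA\<^esub>b\<in>UNIV. c \<odot>\<^bsub>TAA\<^esub> F a b)"
    using assms by (intro T.M.finsum_cong' T.finsum_smult_ldistr) (auto intro!: T.M.finsum_closed)
  finally show ?thesis .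
qed

lemma double_sum_add:
  fixes F H :: "'n \<Rightarrow> 'n \<Rightarrow> ('a \<times> 'a \<Rightarrow> 'r) set"
  assumes "\<And>a b. F a b \<in> carrier TAA" "\<And>a b. H a b \<in> carrier TAA"
  shows "(\<Oplus>\<^bsub>TAA\<^esub>a\<in>UNIV. \<Oplus>\<^bsub>TAA\<^esub>b\<in>UNIV. F a b) \<oplus>\<^bsub>TAA\<^esub> (\<Oplus>\<^bsub>TAA\<^esub>a\<in>UNIV. \<Oplus>\<^bsub>TAA\<^esub>b\<in>UNIV. H a b) =
    (\<Oplus>\<^bsub>TAA\<^esub>a\<in>UNIV. \<Oplus>\<^bsub>TAA\<^esub>b\<in>UNIV. F a b \<oplus>\<^bsub>TAA\<^esub> H a b)"
  using assms by (simp add: T.M.finsum_addf Pi_iff T.M.finsum_closed)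

lemmas lin4_simps = lin4_add_smult[OF T.module_axioms T_tens T_tens T_tens T_tens]
lemmas zero_simps = add_0_left add_0_right mult_1_left mult_1_right mult_zero_left mult_zero_right

text \<open>For \<open>a < b\<close>, each product that occurs of entries in rows \<open>i\<close>,
  \<open>h\<close> and columns \<open>a\<close>, \<open>b\<close> is a combination of
  \<open>u\<close> and \<open>v\<close>; on the right tensor factor \<open>w\<close> and
  \<open>z\<close> play this part. Both sides become \<open>lin4\<close> expressions in the same
  four tensors, and coefficients are compared.\<close>

lemma cterm_relation5:
  assumes "i < h" "j < k"
  defines "c \<equiv> bsign ((p i + p j) * (p h + p k)) * Q i h * Q k j"
    and "d \<equiv> bsign ((p i + p j) * (p i + p k)) * (bpow (p i) q q' - bpow (p i) q' q) * Q k j"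
  shows "cterm i j h k a a = c \<odot>\<^bsub>TAA\<^esub> cterm h k i j a a \<oplus>\<^bsub>TAA\<^esub> d \<odot>\<^bsub>TAA\<^esub> cterm i k h j a a"
    and "a < b \<Longrightarrow> cterm i j h k a b \<oplus>\<^bsub>TAA\<^esub> cterm i j h k b a =
      (c \<odot>\<^bsub>TAA\<^esub> cterm h k i j a b \<oplus>\<^bsub>TAA\<^esub> d \<odot>\<^bsub>TAA\<^esub> cterm i k h j a b) \<oplus>\<^bsub>TAA\<^esub>
      (c \<odot>\<^bsub>TAA\<^esub> cterm h k i j b a \<oplus>\<^bsub>TAA\<^esub> d \<odot>\<^bsub>TAA\<^esub> cterm i k h j b a)"
proof -
  obtain u where u: "u \<in> carrier A"
    "x (i, a) \<otimes>\<^bsub>A\<^esub> x (h, a) = lin2 A u u (bsign ((p i + p a) * (p h + p a)) * bpow (p a) q q' * Q i h) 0"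
    "x (h, a) \<otimes>\<^bsub>A\<^esub> x (i, a) = lin2 A u u 1 0"
    by (rule column_table[OF assms(1)])
  obtain v where v: "v \<in> carrier A"
    "x (a, j) \<otimes>\<^bsub>A\<^esub> x (a, k) = lin2 A v v (bsign ((p a + p j) * (p a + p k)) * bpow (p a) q q' * Q k j) 0"
    "x (a, k) \<otimes>\<^bsub>A\<^esub> x (a, j) = lin2 A v v 1 0"
    by (rule row_table[OF assms(2)])
  note sc = scalars_diag(4)[OF q_inv Q_inv[of a a] Q_inv[of i h] Q_inv[of j k]]
  show "cterm i j h k a a = c \<odot>\<^bsub>TAA\<^esub> cterm h k i j a a \<oplus>\<^bsub>TAA\<^esub> d \<odot>\<^bsub>TAA\<^esub> cterm i k h j a a"
    unfolding cterm_def u v tens_lin2[OF A.module_ax u(1) u(1) v(1) v(1)] lin4_simps[OF u(1) v(1) u(1) v(1) u(1) v(1) u(1) v(1)]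
      c_def d_def
    \<comment> \<open>Of the four coefficient equations some become trivial once zeros and ones are
      removed; the others are instances of \<open>sc\<close>.\<close>
    by (rule lin4_cong; simp only: zero_simps; (rule sc)?)
next
  assume ab: "a < b"
  obtain u v where u: "u \<in> carrier A" "v \<in> carrier A"
    "x (i, a) \<otimes>\<^bsub>A\<^esub> x (h, b) = lin2 A u v
      (bsign ((p i + p a) * (p i + p b)) * (bpow (p i) q q' - bpow (p i) q' q) * Q b a)
      (bsign ((p i + p a) * (p h + p b)) * Q i h * Q b a)"
    "x (i, b) \<otimes>\<^bsub>A\<^esub> x (h, a) = lin2 A u v 1 0"
    "x (h, a) \<otimes>\<^bsub>A\<^esub> x (i, b) = lin2 A u v (bsign ((p i + p b) * (p h + p a)) * Q h i * Q b a) 0"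
    "x (h, b) \<otimes>\<^bsub>A\<^esub> x (i, a) = lin2 A u v 0 1"
    by (rule minor_table[OF assms(1) ab])
  obtain w z where w: "w \<in> carrier A" "z \<in> carrier A"
    "x (a, j) \<otimes>\<^bsub>A\<^esub> x (b, k) = lin2 A w z
      (bsign ((p a + p j) * (p a + p k)) * (bpow (p a) q q' - bpow (p a) q' q) * Q k j)
      (bsign ((p a + p j) * (p b + p k)) * Q a b * Q k j)"
    "x (a, k) \<otimes>\<^bsub>A\<^esub> x (b, j) = lin2 A w z 1 0"
    "x (b, j) \<otimes>\<^bsub>A\<^esub> x (a, k) = lin2 A w z (bsign ((p a + p k) * (p b + p j)) * Q b a * Q k j) 0"
    "x (b, k) \<otimes>\<^bsub>A\<^esub> x (a, j) = lin2 A w z 0 1"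
    by (rule minor_table[OF ab assms(2)])
  note sc = scalars_off5[OF q_inv Q_inv[of a b] Q_inv[of i h] Q_inv[of j k]]
  show "cterm i j h k a b \<oplus>\<^bsub>TAA\<^esub> cterm i j h k b a =
      (c \<odot>\<^bsub>TAA\<^esub> cterm h k i j a b \<oplus>\<^bsub>TAA\<^esub> d \<odot>\<^bsub>TAA\<^esub> cterm i k h j a b) \<oplus>\<^bsub>TAA\<^esub>
      (c \<odot>\<^bsub>TAA\<^esub> cterm h k i j b a \<oplus>\<^bsub>TAA\<^esub> d \<odot>\<^bsub>TAA\<^esub> cterm i k h j b a)"
    unfolding cterm_def u(3-) w(3-) tens_lin2[OF A.module_ax u(1,2) w(1,2)]
      lin4_simps[OF u(1) w(1) u(1) w(2) u(2) w(1) u(2) w(2)] c_def d_def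
    by (rule lin4_cong; simp only: zero_simps; (rule sc)?)
qed

lemma cterm_relation2:
  fixes i j k :: 'n
  assumes "j < k"
  defines "c \<equiv> bsign ((p i + p j) * (p i + p k)) * bpow (p i) q q' * Q k j"
  shows "cterm i j i k a a = c \<odot>\<^bsub>TAA\<^esub> cterm i k i j a a"
    and "a < b \<Longrightarrow> cterm i j i k a b \<oplus>\<^bsub>TAA\<^esub> cterm i j i k b a =
      c \<odot>\<^bsub>TAA\<^esub> cterm i k i j a b \<oplus>\<^bsub>TAA\<^esub> c \<odot>\<^bsub>TAA\<^esub> cterm i k i j b a"
proof -
  define u where "u = x (i, a) \<otimes>\<^bsub>A\<^esub> x (i, a)"
  have u: "u \<in> carrier A" "x (i, a) \<otimes>\<^bsub>A\<^esub> x (i, a) = lin2 A u u 1 0"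
    using lin2_units[of u u] by (simp_all add: u_def)
  obtain v where v: "v \<in> carrier A"
    "x (a, j) \<otimes>\<^bsub>A\<^esub> x (a, k) = lin2 A v v (bsign ((p a + p j) * (p a + p k)) * bpow (p a) q q' * Q k j) 0"
    "x (a, k) \<otimes>\<^bsub>A\<^esub> x (a, j) = lin2 A v v 1 0"
    by (rule row_table[OF assms(1)])
  show "cterm i j i k a a = c \<odot>\<^bsub>TAA\<^esub> cterm i k i j a a"
  \<comment> \<open>For odd \<open>x_{ia}\<close> its square is zero and so are both sides. For even
    \<open>x_{ia}\<close> the scalar identity applies.\<close>
  proof (cases "p i + p a = 0")
    case True
    note sc = scalars_diag(1)[OF q_inv Q_inv[of a a] Q_inv[of i i] Q_inv[of j k] True]
    show ?thesis
    unfolding cterm_def u(2) v(2-) tens_lin2[OF A.module_ax u(1) u(1) v(1) v(1)]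
      lin4_simps[OF u(1) v(1) u(1) v(1) u(1) v(1) u(1) v(1)] c_def
    by (rule lin4_cong; simp only: zero_simps; (rule sc)?)
  next
    case False
    then have "x (i, a) \<otimes>\<^bsub>A\<^esub> x (i, a) = \<zero>\<^bsub>A\<^esub>" using qmat_equationsD(1)[OF eqs] by simp
    then show ?thesis by (simp add: cterm_def tens_zero[OF A A])
  qed
next
  assume ab: "a < b"
  obtain u where u: "u \<in> carrier A"
    "x (i, a) \<otimes>\<^bsub>A\<^esub> x (i, b) = lin2 A u u (bsign ((p i + p a) * (p i + p b)) * bpow (p i) q q' * Q b a) 0"
    "x (i, b) \<otimes>\<^bsub>A\<^esub> x (i, a) = lin2 A u u 1 0"
    by (rule row_table[OF ab])
  obtain w z where w: "w \<in> carrier A" "z \<in> carrier A"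
    "x (a, j) \<otimes>\<^bsub>A\<^esub> x (b, k) = lin2 A w z
      (bsign ((p a + p j) * (p a + p k)) * (bpow (p a) q q' - bpow (p a) q' q) * Q k j)
      (bsign ((p a + p j) * (p b + p k)) * Q a b * Q k j)"
    "x (a, k) \<otimes>\<^bsub>A\<^esub> x (b, j) = lin2 A w z 1 0"
    "x (b, j) \<otimes>\<^bsub>A\<^esub> x (a, k) = lin2 A w z (bsign ((p a + p k) * (p b + p j)) * Q b a * Q k j) 0"
    "x (b, k) \<otimes>\<^bsub>A\<^esub> x (a, j) = lin2 A w z 0 1"
    by (rule minor_table[OF ab assms(1)])
  note sc = scalars_off2[OF q_inv Q_inv[of a b] Q_inv[of i i] Q_inv[of j k]]
  show "cterm i j i k a b \<oplus>\<^bsub>TAA\<^esub> cterm i j i k b a =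
      c \<odot>\<^bsub>TAA\<^esub> cterm i k i j a b \<oplus>\<^bsub>TAA\<^esub> c \<odot>\<^bsub>TAA\<^esub> cterm i k i j b a"
    unfolding cterm_def u(2-) w(3-) tens_lin2[OF A.module_ax u(1) u(1) w(1) w(2)]
      lin4_simps[OF u(1) w(1) u(1) w(2) u(1) w(1) u(1) w(2)] c_def
    by (rule lin4_cong; simp only: zero_simps; (rule sc)?)
qed

lemma cterm_relation3:
  fixes i h j :: 'n
  assumes "i < h"
  defines "c \<equiv> bsign ((p i + p j) * (p h + p j)) * bpow (p j) q q' * Q i h"
  shows "cterm i j h j a a = c \<odot>\<^bsub>TAA\<^esub> cterm h j i j a a"
    and "a < b \<Longrightarrow> cterm i j h j a b \<oplus>\<^bsub>TAA\<^esub> cterm i j h j b a =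
      c \<odot>\<^bsub>TAA\<^esub> cterm h j i j a b \<oplus>\<^bsub>TAA\<^esub> c \<odot>\<^bsub>TAA\<^esub> cterm h j i j b a"
proof -
  obtain u where u: "u \<in> carrier A"
    "x (i, a) \<otimes>\<^bsub>A\<^esub> x (h, a) = lin2 A u u (bsign ((p i + p a) * (p h + p a)) * bpow (p a) q q' * Q i h) 0"
    "x (h, a) \<otimes>\<^bsub>A\<^esub> x (i, a) = lin2 A u u 1 0"
    by (rule column_table[OF assms(1)])
  define v where "v = x (a, j) \<otimes>\<^bsub>A\<^esub> x (a, j)"
  have v: "v \<in> carrier A" "x (a, j) \<otimes>\<^bsub>A\<^esub> x (a, j) = lin2 A v v 1 0"
    using lin2_units[of v v] by (simp_all add: v_def)
  show "cterm i j h j a a = c \<odot>\<^bsub>TAA\<^esub> cterm h j i j a a"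
  proof (cases "p a + p j = 0")
    case True
    note sc = scalars_diag(2)[OF q_inv Q_inv[of a a] Q_inv[of i h] Q_inv[of j j] True]
    show ?thesis
    unfolding cterm_def u(2-) v(2) tens_lin2[OF A.module_ax u(1) u(1) v(1) v(1)]
      lin4_simps[OF u(1) v(1) u(1) v(1) u(1) v(1) u(1) v(1)] c_def
    by (rule lin4_cong; simp only: zero_simps; (rule sc)?)
  next
    case False
    then have "x (a, j) \<otimes>\<^bsub>A\<^esub> x (a, j) = \<zero>\<^bsub>A\<^esub>" using qmat_equationsD(1)[OF eqs] by simp
    then show ?thesis by (simp add: cterm_def tens_zero[OF A A])
  qed
next
  assume ab: "a < b"
  obtain u v where u: "u \<in> carrier A" "v \<in> carrier A"
    "x (i, a) \<otimes>\<^bsub>A\<^esub> x (h, b) = lin2 A u v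
      (bsign ((p i + p a) * (p i + p b)) * (bpow (p i) q q' - bpow (p i) q' q) * Q b a)
      (bsign ((p i + p a) * (p h + p b)) * Q i h * Q b a)"
    "x (i, b) \<otimes>\<^bsub>A\<^esub> x (h, a) = lin2 A u v 1 0"
    "x (h, a) \<otimes>\<^bsub>A\<^esub> x (i, b) = lin2 A u v (bsign ((p i + p b) * (p h + p a)) * Q h i * Q b a) 0"
    "x (h, b) \<otimes>\<^bsub>A\<^esub> x (i, a) = lin2 A u v 0 1"
    by (rule minor_table[OF assms(1) ab])
  obtain w where w: "w \<in> carrier A"
    "x (a, j) \<otimes>\<^bsub>A\<^esub> x (b, j) = lin2 A w w (bsign ((p a + p j) * (p b + p j)) * bpow (p j) q q' * Q a b) 0"
    "x (b, j) \<otimes>\<^bsub>A\<^esub> x (a, j) = lin2 A w w 1 0"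
    by (rule column_table[OF ab])
  note sc = scalars_off3[OF q_inv Q_inv[of a b] Q_inv[of i h] Q_inv[of j j]]
  show "cterm i j h j a b \<oplus>\<^bsub>TAA\<^esub> cterm i j h j b a =
      c \<odot>\<^bsub>TAA\<^esub> cterm h j i j a b \<oplus>\<^bsub>TAA\<^esub> c \<odot>\<^bsub>TAA\<^esub> cterm h j i j b a"
    unfolding cterm_def u(3-) w(2-) tens_lin2[OF A.module_ax u(1) u(2) w(1) w(1)]
      lin4_simps[OF u(1) w(1) u(1) w(1) u(2) w(1) u(2) w(1)] c_def
    by (rule lin4_cong; simp only: zero_simps; (rule sc)?)
qed

text \<open>The relation for \<open>k < j\<close> with the names \<open>j\<close> and
  \<open>k\<close> exchanged, so that the tables for increasing columns apply unchanged.\<close>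

lemma cterm_relation4:
  assumes "i < h" "j < k"
  defines "c \<equiv> bsign ((p i + p k) * (p h + p j)) * Q i h * Q j k"
  shows "cterm i k h j a a = c \<odot>\<^bsub>TAA\<^esub> cterm h j i k a a"
    and "a < b \<Longrightarrow> cterm i k h j a b \<oplus>\<^bsub>TAA\<^esub> cterm i k h j b a =
      c \<odot>\<^bsub>TAA\<^esub> cterm h j i k a b \<oplus>\<^bsub>TAA\<^esub> c \<odot>\<^bsub>TAA\<^esub> cterm h j i k b a"
proof -
  obtain u where u: "u \<in> carrier A"
    "x (i, a) \<otimes>\<^bsub>A\<^esub> x (h, a) = lin2 A u u (bsign ((p i + p a) * (p h + p a)) * bpow (p a) q q' * Q i h) 0"
    "x (h, a) \<otimes>\<^bsub>A\<^esub> x (i, a) = lin2 A u u 1 0"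
    by (rule column_table[OF assms(1)])
  obtain v where v: "v \<in> carrier A"
    "x (a, j) \<otimes>\<^bsub>A\<^esub> x (a, k) = lin2 A v v (bsign ((p a + p j) * (p a + p k)) * bpow (p a) q q' * Q k j) 0"
    "x (a, k) \<otimes>\<^bsub>A\<^esub> x (a, j) = lin2 A v v 1 0"
    by (rule row_table[OF assms(2)])
  note sc = scalars_diag(3)[OF q_inv Q_inv[of a a] Q_inv[of i h] Q_inv[of j k]]
  show "cterm i k h j a a = c \<odot>\<^bsub>TAA\<^esub> cterm h j i k a a"
    unfolding cterm_def u(2-) v(2-) tens_lin2[OF A.module_ax u(1) u(1) v(1) v(1)]
      lin4_simps[OF u(1) v(1) u(1) v(1) u(1) v(1) u(1) v(1)] c_def
    by (rule lin4_cong; simp only: zero_simps; (rule sc)?)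
next
  assume ab: "a < b"
  obtain u v where u: "u \<in> carrier A" "v \<in> carrier A"
    "x (i, a) \<otimes>\<^bsub>A\<^esub> x (h, b) = lin2 A u v
      (bsign ((p i + p a) * (p i + p b)) * (bpow (p i) q q' - bpow (p i) q' q) * Q b a)
      (bsign ((p i + p a) * (p h + p b)) * Q i h * Q b a)"
    "x (i, b) \<otimes>\<^bsub>A\<^esub> x (h, a) = lin2 A u v 1 0"
    "x (h, a) \<otimes>\<^bsub>A\<^esub> x (i, b) = lin2 A u v (bsign ((p i + p b) * (p h + p a)) * Q h i * Q b a) 0"
    "x (h, b) \<otimes>\<^bsub>A\<^esub> x (i, a) = lin2 A u v 0 1"
    by (rule minor_table[OF assms(1) ab])
  obtain w z where w: "w \<in> carrier A" "z \<in> carrier A"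
    "x (a, j) \<otimes>\<^bsub>A\<^esub> x (b, k) = lin2 A w z
      (bsign ((p a + p j) * (p a + p k)) * (bpow (p a) q q' - bpow (p a) q' q) * Q k j)
      (bsign ((p a + p j) * (p b + p k)) * Q a b * Q k j)"
    "x (a, k) \<otimes>\<^bsub>A\<^esub> x (b, j) = lin2 A w z 1 0"
    "x (b, j) \<otimes>\<^bsub>A\<^esub> x (a, k) = lin2 A w z (bsign ((p a + p k) * (p b + p j)) * Q b a * Q k j) 0"
    "x (b, k) \<otimes>\<^bsub>A\<^esub> x (a, j) = lin2 A w z 0 1"
    by (rule minor_table[OF ab assms(2)])
  note sc = scalars_off4[OF q_inv Q_inv[of a b] Q_inv[of i h] Q_inv[of j k]]
  show "cterm i k h j a b \<oplus>\<^bsub>TAA\<^esub> cterm i k h j b a =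
      c \<odot>\<^bsub>TAA\<^esub> cterm h j i k a b \<oplus>\<^bsub>TAA\<^esub> c \<odot>\<^bsub>TAA\<^esub> cterm h j i k b a"
    unfolding cterm_def u(3-) w(3-) tens_lin2[OF A.module_ax u(1) u(2) w(1) w(2)]
      lin4_simps[OF u(1) w(1) u(1) w(2) u(2) w(1) u(2) w(2)] c_def
    by (rule lin4_cong; simp only: zero_simps; (rule sc)?)
qed

lemma cterm_relation1:
  assumes "p i + p j = 1"
  shows "cterm i j i j a a = \<zero>\<^bsub>TAA\<^esub>"
    and "a < b \<Longrightarrow> cterm i j i j a b \<oplus>\<^bsub>TAA\<^esub> cterm i j i j b a = \<zero>\<^bsub>TAA\<^esub>"
proof -
  \<comment> \<open>An odd \<open>x_{ij}\<close> forces one of \<open>x_{ia}\<close>,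
    \<open>x_{aj}\<close> to be odd. Its square vanishes, and with it the diagonal summand.\<close>
  have "(p i + p a) + (p a + p j) = 1" using assms by (simp add: add.assoc)
  then have "p i + p a = 1 \<or> p a + p j = 1" by (cases "p i + p a"; cases "p a + p j") auto
  then show "cterm i j i j a a = \<zero>\<^bsub>TAA\<^esub>"
    using qmat_equationsD(1)[OF eqs] by (auto simp: cterm_def tens_zero[OF A A])
next
  assume ab: "a < b"
  obtain u where u: "u \<in> carrier A"
    "x (i, a) \<otimes>\<^bsub>A\<^esub> x (i, b) = lin2 A u u (bsign ((p i + p a) * (p i + p b)) * bpow (p i) q q' * Q b a) 0"
    "x (i, b) \<otimes>\<^bsub>A\<^esub> x (i, a) = lin2 A u u 1 0"
    by (rule row_table[OF ab])
  obtain w where w: "w \<in> carrier A"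
    "x (a, j) \<otimes>\<^bsub>A\<^esub> x (b, j) = lin2 A w w (bsign ((p a + p j) * (p b + p j)) * bpow (p j) q q' * Q a b) 0"
    "x (b, j) \<otimes>\<^bsub>A\<^esub> x (a, j) = lin2 A w w 1 0"
    by (rule column_table[OF ab])
  note sc = scalars_off1[OF q_inv Q_inv[of a b] Q_inv[of i i] Q_inv[of j j] assms]
  have "cterm i j i j a b \<oplus>\<^bsub>TAA\<^esub> cterm i j i j b a = lin4 TAA (tens rta A A u w) (tens rta A A u w)
      (tens rta A A u w) (tens rta A A u w) 0 0 0 0"
    unfolding cterm_def u(2-) w(2-) tens_lin2[OF A.module_ax u(1) u(1) w(1) w(1)]
      lin4_simps(1,2)[OF u(1) w(1) u(1) w(1) u(1) w(1) u(1) w(1)]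
    by (rule lin4_cong; simp only: zero_simps; (rule sc)?)
  then show "cterm i j i j a b \<oplus>\<^bsub>TAA\<^esub> cterm i j i j b a = \<zero>\<^bsub>TAA\<^esub>"
    using lin4_simps(3)[OF u(1) w(1) u(1) w(1) u(1) w(1) u(1) w(1)] by simp
qed

lemma coproduct_gen_equations: "qmat_equations SAA (coproduct_gen A x)"
proof -
  note sums = tensor_superalg_simps(2-4) coproduct_gen_mult double_sum_smult[OF cterm_closed]
    double_sum_add[OF T_smult[OF cterm_closed] T_smult[OF cterm_closed]]
  have zero: "(\<Oplus>\<^bsub>TAA\<^esub>a\<in>(UNIV::'n set). \<Oplus>\<^bsub>TAA\<^esub>b\<in>(UNIV::'n set). \<zero>\<^bsub>TAA\<^esub>) = \<zero>\<^bsub>TAA\<^esub>" by simp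
  show ?thesis
    unfolding qmat_equations_def
  proof (intro conjI allI impI; (elim conjE)?)
    fix i j assume "p i + p j = 1"
    then have "(\<Oplus>\<^bsub>TAA\<^esub>a\<in>UNIV. \<Oplus>\<^bsub>TAA\<^esub>b\<in>UNIV. cterm i j i j a b) = (\<Oplus>\<^bsub>TAA\<^esub>a\<in>(UNIV::'n set). \<Oplus>\<^bsub>TAA\<^esub>b\<in>(UNIV::'n set). \<zero>\<^bsub>TAA\<^esub>)"
      by (intro T.M.double_sum_eqI) (simp_all add: cterm_relation1)
    then show "coproduct_gen A x (i, j) \<otimes>\<^bsub>SAA\<^esub> coproduct_gen A x (i, j) = \<zero>\<^bsub>SAA\<^esub>"
      by (simp add: sums)
  next
    fix i j k :: 'n assume "j < k"
    then show "coproduct_gen A x (i, j) \<otimes>\<^bsub>SAA\<^esub> coproduct_gen A x (i, k) =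
      (bsign ((p i + p j) * (p i + p k)) * bpow (p i) q q' * Q k j) \<odot>\<^bsub>SAA\<^esub>
        (coproduct_gen A x (i, k) \<otimes>\<^bsub>SAA\<^esub> coproduct_gen A x (i, j))"
      unfolding sums
      by (intro T.M.double_sum_eqI cterm_relation2) simp_all
  next
    fix i h j :: 'n assume "i < h"
    then show "coproduct_gen A x (i, j) \<otimes>\<^bsub>SAA\<^esub> coproduct_gen A x (h, j) =
      (bsign ((p i + p j) * (p h + p j)) * bpow (p j) q q' * Q i h) \<odot>\<^bsub>SAA\<^esub>
        (coproduct_gen A x (h, j) \<otimes>\<^bsub>SAA\<^esub> coproduct_gen A x (i, j))"
      unfolding sums
      by (intro T.M.double_sum_eqI cterm_relation3) simp_all
  next
    fix i h j k :: 'n assume "i < h" "k < j"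
    then show "coproduct_gen A x (i, j) \<otimes>\<^bsub>SAA\<^esub> coproduct_gen A x (h, k) =
      (bsign ((p i + p j) * (p h + p k)) * Q i h * Q k j) \<odot>\<^bsub>SAA\<^esub>
        (coproduct_gen A x (h, k) \<otimes>\<^bsub>SAA\<^esub> coproduct_gen A x (i, j))"
      unfolding sums
      by (intro T.M.double_sum_eqI cterm_relation4) simp_all
  next
    fix i h j k :: 'n assume "i < h" "j < k"
    then show "coproduct_gen A x (i, j) \<otimes>\<^bsub>SAA\<^esub> coproduct_gen A x (h, k) =
      (bsign ((p i + p j) * (p h + p k)) * Q i h * Q k j) \<odot>\<^bsub>SAA\<^esub>
        (coproduct_gen A x (h, k) \<otimes>\<^bsub>SAA\<^esub> coproduct_gen A x (i, j)) \<oplus>\<^bsub>SAA\<^esub>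
      (bsign ((p i + p j) * (p i + p k)) * (bpow (p i) q q' - bpow (p i) q' q) * Q k j) \<odot>\<^bsub>SAA\<^esub>
        (coproduct_gen A x (i, k) \<otimes>\<^bsub>SAA\<^esub> coproduct_gen A x (h, j))"
      unfolding sums
      by (intro T.M.double_sum_eqI cterm_relation5) simp_all
  qed
qed

end

end

section \<open>Superbialgebras with the given presentation\<close>

lemma same_module_refl: "same_module M M"
  by (simp add: same_module_def)

lemma same_module_tens_map:
  assumes "same_module C C'" "same_module D D'"
  shows "tens_map R C D = tens_map R C' D'"
  unfolding tens_map_def using same_module_tensor_module[OF assms] same_module_tens[OF assms] by metis

lemma alg_hom_id: "alg_hom R A A (\<lambda>x. x)"
  by (simp add: alg_hom_def module_map_id)

lemma alg_hom_cong:
  assumes "assoc_algebra R A" "alg_hom R A B f" "\<And>x. x \<in> carrier A \<Longrightarrow> g x = f x"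
  shows "alg_hom R A B g"
proof -
  interpret A: assoc_algebra R A by fact
  show ?thesis
    using assms(2,3) module_map_cong[OF A.module_ax, where f = f and g = g and N = B] by (auto simp: alg_hom_def)
qed

context qmat_parameters
begin

text \<open>A case of \<open>double_sum_eqI\<close>, since transposition preserves the sum of two
  opposite entries.\<close>

lemma finsum_swap:
  assumes "abelian_group M" "\<And>a b. F a b \<in> carrier M"
  shows "(\<Oplus>\<^bsub>M\<^esub>a\<in>UNIV. \<Oplus>\<^bsub>M\<^esub>b\<in>UNIV. F a b) = (\<Oplus>\<^bsub>M\<^esub>a\<in>(UNIV::'n set). \<Oplus>\<^bsub>M\<^esub>b\<in>(UNIV::'n set). F b a)"
proof -
  interpret M: abelian_group M by fact
  show ?thesis
    by (rule M.double_sum_eqI) (simp_all add: assms(2) M.a_comm)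
qed

lemma coproduct_gen_image:
  fixes A :: "('r, 'a, 'l) superalg_scheme" and M :: "('r, 'c, 'k) module_scheme"
  assumes A: "module rta A" and x: "\<And>ij. x ij \<in> carrier A" and M: "module rta M"
    and f: "module_map rta (tensor_module rta A A) M f"
  shows "f (coproduct_gen A x (i, j)) =
    (\<Oplus>\<^bsub>M\<^esub>a\<in>UNIV. bsign ((p i + p a) * (p a + p j)) \<odot>\<^bsub>M\<^esub> f (tens rta A A (x (i, a)) (x (a, j))))"
proof -
  interpret T: module rta "tensor_module rta A A" by (rule tensor_module_module[OF A A])
  interpret M: module rta M by (rule M)
  note cl = tens_closed[OF A A x x]
  note sm = T.smult_closed[simplified]
  have "f (coproduct_gen A x (i, j)) = (\<Oplus>\<^bsub>M\<^esub>a\<in>UNIV.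
      f (bsign ((p i + p a) * (p a + p j)) \<odot>\<^bsub>tensor_module rta A A\<^esub> tens rta A A (x (i, a)) (x (a, j))))"
    unfolding coproduct_gen_def prod.case
    using cl sm by (intro module_map_finsum[OF f T.module_axioms M]) auto
  then show ?thesis
    using module_map_smult[OF f _ cl] by simp
qed

text \<open>With \<open>x = p i + p b\<close>, \<open>y = p b + p a\<close>,
  \<open>z = p a + p j\<close>, both exponents equal \<open>x * y + x * z + y * z\<close>. This
  cocycle condition is what makes the signed matrix coproduct coassociative.\<close>

lemma coproduct_sign:
  "bsign ((p i + p a) * (p a + p j)) * bsign ((p i + p b) * (p b + p a)) =
    (bsign ((p i + p b) * (p b + p j)) * bsign ((p b + p a) * (p a + p j)) :: 'r)"
  by (cases "p i"; cases "p j"; cases "p a"; cases "p b") (simp_all add: bsign_def)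

lemma qmat_superbialgebraI:
  fixes A :: "('r, 'a, 'l) superbialg_scheme"
  assumes A: "superalgebra rta A" and pres: "presented_by rta A UNIV x (qmat_relations rta p q Q)"
    and x: "\<And>i j. x (i, j) \<in> part A (p i + p j)"
    and D: "coproduct A \<in> superalg_hom rta A (tensor_superalg rta A A)"
    and e: "counit A \<in> superalg_hom rta A (ring_superalg id rta)"
    and Dx: "\<And>ij. coproduct A (x ij) = coproduct_gen A x ij"
    and ex: "\<And>i j. counit A (x (i, j)) = (if i = j then 1 else 0)"
  shows "qmat_superbialgebra rta p q Q A x"
proof -
  interpret A: superalgebra rta A by (rule A)
  let ?T = "tensor_superalg rta A A" and ?TM = "tensor_module rta A A"
  have T: "superalgebra rta ?T" by (rule tensor_superalg_superalgebra[OF A A])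
  interpret T: superalgebra rta ?T by (rule T)
  have AT: "superalgebra rta (tensor_superalg rta A ?T)" by (rule tensor_superalg_superalgebra[OF A T])
  interpret AT: superalgebra rta "tensor_superalg rta A ?T" by (rule AT)
  have xc: "x ij \<in> carrier A" for ij using x[of "fst ij" "snd ij"] A.part_closed by simp
  note mA = A.module_ax and mT = T.module_ax
  note sT = same_module_tensor_superalg[of rta A A]
  have TM: "module rta ?TM" by (rule tensor_module_module[OF mA mA])
  interpret TM: module rta ?TM by (rule TM)
  have Dm: "module_map rta A ?TM (coproduct A)"
    using superalg_hom_map[OF D] same_module_map[OF same_module_refl sT] by blast
  have idm: "id \<in> superalg_hom rta A A" using superalg_hom_id by (simp add: id_def)
  let ?L = "\<lambda>a. tens_assoc rta A A A (tens_map rta ?T A (coproduct A) id (coproduct A a))"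
  let ?R = "\<lambda>a. tens_map rta A ?T id (coproduct A) (coproduct A a)"
  have Lh: "?L \<in> superalg_hom rta A (tensor_superalg rta A ?T)"
    by (intro superalg_hom_comp[OF superalg_hom_comp[OF D tens_map_superalg_hom[OF A A T A D idm]]
          tens_assoc_superalg_hom[OF A A A]])
  have Rh: "?R \<in> superalg_hom rta A (tensor_superalg rta A ?T)"
    by (rule superalg_hom_comp[OF D tens_map_superalg_hom[OF A A A T idm D]])
  have coassoc_gen: "?L (x (i, j)) = ?R (x (i, j))" for i j
  proof -
    let ?M = "tensor_superalg rta A ?T"
    \<comment> \<open>The common summand \<open>x_{ib} \<otimes> (x_{ba} \<otimes> x_{aj})\<close>.
      On the left \<open>b\<close> arises from expanding the first tensor factor, on the right
      \<open>a\<close> from expanding the second; the outer index differs, hence the exchange of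
      sums.\<close>
    let ?F = "\<lambda>a b. (bsign ((p i + p a) * (p a + p j)) * bsign ((p i + p b) * (p b + p a))) \<odot>\<^bsub>?M\<^esub>
        tens rta A ?T (x (i, b)) (tens rta A A (x (b, a)) (x (a, j)))"
    have M: "module rta ?M" by (rule AT.module_ax)
    have cl: "tens rta A ?T (x (i, b)) (tens rta A A (x (b, a)) (x (a, j))) \<in> carrier ?M" for a b
      using tens_closed[OF mA mT xc, of "tens rta A A (x (b, a)) (x (a, j))"] tens_closed[OF mA mA xc xc]
      by (simp add: tensor_superalg_simps(1))
    have Lm: "module_map rta ?TM ?M (\<lambda>t. tens_assoc rta A A A (tens_map rta ?T A (coproduct A) id t))"
      by (rule module_map_comp)
        (use superalg_hom_map[OF tens_map_superalg_hom[OF A A T A D idm]] superalg_hom_map[OF tens_assoc_superalg_hom[OF A A A]]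
          in \<open>simp_all add: module_map_def tensor_superalg_simps\<close>)
    have Rm: "module_map rta ?TM ?M (tens_map rta A ?T id (coproduct A))"
      using superalg_hom_map[OF tens_map_superalg_hom[OF A A A T idm D]]
      by (simp add: module_map_def tensor_superalg_simps)
    have in1: "tens_assoc rta A A A (tens rta ?T A (coproduct A (x (i, a))) (x (a, j))) =
      (\<Oplus>\<^bsub>?M\<^esub>b\<in>UNIV. bsign ((p i + p b) * (p b + p a)) \<odot>\<^bsub>?M\<^esub>
        tens rta A ?T (x (i, b)) (tens rta A A (x (b, a)) (x (a, j))))" for a
    proof -
      have as: "module_map rta (tensor_module rta ?T A) ?M (tens_assoc rta A A A)"
        using superalg_hom_map[OF tens_assoc_superalg_hom[OF A A A]] by (simp add: module_map_def tensor_superalg_simps)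
      have "module_map rta ?T ?M (\<lambda>t. tens_assoc rta A A A (tens rta ?T A t (x (a, j))))"
        by (rule module_map_comp[OF tens_map_left[OF mT mA xc] as])
      then have m: "module_map rta ?TM ?M (\<lambda>t. tens_assoc rta A A A (tens rta ?T A t (x (a, j))))"
        using same_module_map[OF sT same_module_refl] by blast
      have "tens_assoc rta A A A (tens rta ?T A (tens rta A A u v) w) = tens rta A ?T u (tens rta A A v w)"
        if "u \<in> carrier A" "v \<in> carrier A" "w \<in> carrier A" for u v w
        using tens_assoc(2)[OF mA mA mA that] same_module_tens[OF sT same_module_refl] same_module_tens[OF same_module_refl sT]
        by metis
      then show ?thesis
        using coproduct_gen_image[OF mA xc M m, where i = i and j = a] by (simp add: Dx xc)
    qed
    have in2: "tens rta A ?T (x (i, b)) (coproduct A (x (b, j))) =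
      (\<Oplus>\<^bsub>?M\<^esub>a\<in>UNIV. bsign ((p b + p a) * (p a + p j)) \<odot>\<^bsub>?M\<^esub>
        tens rta A ?T (x (i, b)) (tens rta A A (x (b, a)) (x (a, j))))" for b
    proof -
      have "module_map rta ?TM ?M (tens rta A ?T (x (i, b)))"
        using tens_map_right[OF mA mT xc, of "(i, b)"] by (simp add: module_map_def tensor_superalg_simps)
      then show ?thesis using coproduct_gen_image[OF mA xc M, where i = b and j = j] by (simp add: Dx)
    qed
    have "?L (x (i, j)) = (\<Oplus>\<^bsub>?M\<^esub>a\<in>UNIV. bsign ((p i + p a) * (p a + p j)) \<odot>\<^bsub>?M\<^esub>
        tens_assoc rta A A A (tens rta ?T A (coproduct A (x (i, a))) (x (a, j))))"
      unfolding Dx[of "(i, j)"] coproduct_gen_image[OF mA xc M Lm, where i = i and j = j]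
      by (simp add: tens_map_tens[OF mA mA mT mA superalg_hom_map[OF D] superalg_hom_map[OF idm] xc xc])
    also have "\<dots> = (\<Oplus>\<^bsub>?M\<^esub>a\<in>UNIV. \<Oplus>\<^bsub>?M\<^esub>b\<in>UNIV. ?F a b)"
      unfolding in1 using cl AT.smult_closed[simplified] AT.smult_assoc1[simplified]
      by (intro AT.M.finsum_cong') (auto simp: AT.finsum_smult_ldistr intro!: AT.M.finsum_closed)
    also have "\<dots> = (\<Oplus>\<^bsub>?M\<^esub>b\<in>UNIV. \<Oplus>\<^bsub>?M\<^esub>a\<in>UNIV. ?F a b)"
      using cl AT.smult_closed[simplified] by (intro finsum_swap AT.M.abelian_group_axioms) auto
    also have "\<dots> = (\<Oplus>\<^bsub>?M\<^esub>b\<in>UNIV. bsign ((p i + p b) * (p b + p j)) \<odot>\<^bsub>?M\<^esub>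
        tens rta A ?T (x (i, b)) (coproduct A (x (b, j))))"
      unfolding in2 coproduct_sign using cl AT.smult_closed[simplified] AT.smult_assoc1[simplified]
      by (intro AT.M.finsum_cong') (auto simp: AT.finsum_smult_ldistr intro!: AT.M.finsum_closed)
    also have "\<dots> = ?R (x (i, j))"
      unfolding Dx[of "(i, j)"] coproduct_gen_image[OF mA xc M Rm, where i = i and j = j]
      by (simp add: tens_map_tens[OF mA mA mA mT superalg_hom_map[OF idm] superalg_hom_map[OF D] xc xc])
    finally show ?thesis .
  qed
  let ?l = "tens_lift rta A (\<lambda>(a, b). counit A a \<odot>\<^bsub>A\<^esub> b)" and ?r = "tens_lift rta A (\<lambda>(a, b). counit A b \<odot>\<^bsub>A\<^esub> a)"
  note cm = counit_maps[OF A e]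
  \<comment> \<open>Only \<open>a = i\<close> survives the counit, and its sign is trivial because
    \<open>p i + p i = 0\<close>.\<close>
  have l_gen: "?l (coproduct A (x (i, j))) = x (i, j)" for i j
  proof -
    have "?l (coproduct A (x (i, j))) = (\<Oplus>\<^bsub>A\<^esub>a\<in>UNIV. if i = a then x (a, j) else \<zero>\<^bsub>A\<^esub>)"
      unfolding Dx coproduct_gen_image[OF mA xc mA cm(5)]
      using A.smult_one[simplified] A.smult_l_null[simplified] A.smult_r_null[simplified] xc
      by (intro A.M.finsum_cong') (auto simp: cm(3) ex bsign_def)
    also have "\<dots> = x (i, j)" using xc by (intro A.M.finsum_singleton) auto
    finally show ?thesis .
  qed
  have r_gen: "?r (coproduct A (x (i, j))) = x (i, j)" for i j
  proof -
    have "?r (coproduct A (x (i, j))) = (\<Oplus>\<^bsub>A\<^esub>a\<in>UNIV. if j = a then x (i, a) else \<zero>\<^bsub>A\<^esub>)"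
      unfolding Dx coproduct_gen_image[OF mA xc mA cm(6)]
      using A.smult_one[simplified] A.smult_l_null[simplified] A.smult_r_null[simplified] xc
      by (intro A.M.finsum_cong') (auto simp: cm(4) ex bsign_def)
    also have "\<dots> = x (i, j)" using xc by (intro A.M.finsum_singleton) auto
    finally show ?thesis .
  qed
  show ?thesis
  proof (intro qmat_superbialgebra.intro superbialgebra.intro superbialgebra_axioms.intro
      qmat_superbialgebra_axioms.intro A D e pres)
    fix a assume a: "a \<in> carrier A"
    have "?L a = ?R a"
      by (rule alg_hom_eq_on_generators[OF A.assoc_algebra pres AT.assoc_algebra superalg_hom_alg[OF Lh] superalg_hom_alg[OF Rh] _ a])
        (use coassoc_gen in auto)
    then show "tens_assoc rta A A A (tens_map rta ?TM A (coproduct A) id (coproduct A a)) =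
        tens_map rta A ?TM id (coproduct A) (coproduct A a)"
      unfolding same_module_tens_map[OF sT same_module_refl] same_module_tens_map[OF same_module_refl sT] .
    show "?l (coproduct A a) = a"
      by (rule alg_hom_eq_on_generators[OF A.assoc_algebra pres A.assoc_algebra
            superalg_hom_alg[OF superalg_hom_comp[OF D cm(1)]] alg_hom_id _ a])
        (use l_gen in auto)
    show "?r (coproduct A a) = a"
      by (rule alg_hom_eq_on_generators[OF A.assoc_algebra pres A.assoc_algebra
            superalg_hom_alg[OF superalg_hom_comp[OF D cm(2)]] alg_hom_id _ a])
        (use r_gen in auto)
  next
    show "x (i, j) \<in> part A (pdeg p i j)" for i j using x by (simp add: pdeg_def)
    show "coproduct A (x (i, j)) = (\<Oplus>\<^bsub>?TM\<^esub>a\<in>UNIV. parity_sign rta (pdeg p i a * pdeg p a j) \<odot>\<^bsub>?TM\<^esub>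
        tens rta A A (x (i, a)) (x (a, j)))" for i j
      by (simp add: Dx coproduct_gen_def pdeg_def)
    show "counit A (x (i, j)) = (if i = j then \<one>\<^bsub>rta\<^esub> else \<zero>\<^bsub>rta\<^esub>)" for i j
      by (simp add: ex)
  qed
qed

lemma qmat_superbialgebraD:
  fixes A :: "('r, 'a, 'l) superbialg_scheme"
  assumes "qmat_superbialgebra rta p q Q A x"
  shows "superalgebra rta A" "presented_by rta A UNIV x (qmat_relations rta p q Q)"
    and "x (i, j) \<in> part A (p i + p j)"
    and "coproduct A \<in> superalg_hom rta A (tensor_superalg rta A A)"
    and "counit A \<in> superalg_hom rta A (ring_superalg id rta)"
    and "coproduct A (x ij) = coproduct_gen A x ij"
    and "counit A (x (i, j)) = (if i = j then 1 else 0)"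
    and "qmat_equations A x"
proof -
  interpret qmat_superbialgebra rta p q Q A x by fact
  show "superalgebra rta A" ..
  show pres: "presented_by rta A UNIV x (qmat_relations rta p q Q)" by (rule presentation)
  show "x (i, j) \<in> part A (p i + p j)" using gen_parity by (simp add: pdeg_def)
  show "coproduct A \<in> superalg_hom rta A (tensor_superalg rta A A)" by (rule coproduct_hom)
  show "counit A \<in> superalg_hom rta A (ring_superalg id rta)" by (rule counit_hom)
  show "coproduct A (x ij) = coproduct_gen A x ij"
    using gen_coproduct[of "fst ij" "snd ij"] by (simp add: coproduct_gen_def pdeg_def split_def)
  show "counit A (x (i, j)) = (if i = j then 1 else 0)" using gen_counit by simp
  show "qmat_equations A x"
    using satisfies_qmat_relations_iff[OF assoc_algebra presented_byD(1)[OF pres]]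
      presented_by_satisfies[OF qmat_relations_closed assoc_algebra pres] by blast
qed

text \<open>Universal maps in both directions are mutually inverse, since their composites fix the
  generators. Parity follows from that of the generators by
  \<open>alg_hom_superalg_hom\<close>.\<close>

lemma qmat_superbialgebra_iso_unique:
  fixes A :: "('r, 'a, 'l) superbialg_scheme" and B :: "('r, 'b, 'k) superbialg_scheme"
  assumes qA: "qmat_superbialgebra rta p q Q A x" and qB: "qmat_superbialgebra rta p q Q B y"
  shows "\<exists>!f. f \<in> superbialg_iso rta A B \<and> f \<in> extensional (carrier A) \<and> (\<forall>i j. f (x (i, j)) = y (i, j))"
proof -
  note DA = qmat_superbialgebraD[OF qA] and DB = qmat_superbialgebraD[OF qB]
  interpret A: superalgebra rta A by (rule DA(1))
  interpret B: superalgebra rta B by (rule DB(1))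
  note aA = A.assoc_algebra and aB = B.assoc_algebra
  note TB = tensor_superalg_superalgebra[OF DB(1,1)]
  interpret TB: superalgebra rta "tensor_superalg rta B B" by (rule TB)
  interpret I: superalgebra rta "ring_superalg id rta :: ('r, 'r) superalg"
    by (rule ring_superalg_superalgebra[OF cring_rta cring_rta]) (simp add: ring_hom_def)
  note satA = presented_by_satisfies[OF qmat_relations_closed aA DA(2)]
    and satB = presented_by_satisfies[OF qmat_relations_closed aB DB(2)]
  obtain f where f: "alg_hom rta A B f" "\<And>ij. f (x ij) = y ij"
    using presented_by_universal[OF qmat_relations_closed aA DA(2) aB presented_byD(1)[OF DB(2)] satB] by (metis UNIV_I)
  obtain g where g: "alg_hom rta B A g" "\<And>ij. g (y ij) = x ij"
    using presented_by_universal[OF qmat_relations_closed aB DB(2) aA presented_byD(1)[OF DA(2)] satA] by (metis UNIV_I)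
  have xc: "x ij \<in> carrier A" and yc: "y ij \<in> carrier B" for ij
    using presented_byD(1)[OF DA(2)] presented_byD(1)[OF DB(2)] by auto
  \<comment> \<open>Restriction fixes the values outside the carrier, as membership in
    \<open>extensional\<close> demands.\<close>
  define h where "h = restrict f (carrier A)"
  have hx: "h (x ij) = y ij" for ij using xc f(2) by (simp add: h_def)
  have h: "alg_hom rta A B h"
    by (rule alg_hom_cong[OF aA f(1)]) (simp add: h_def)
  have hs: "h \<in> superalg_hom rta A B"
    using DA(3) DB(3) hx by (intro alg_hom_superalg_hom[OF DA(1,2) DB(1) h, where d = deg]) auto
  have gh: "g (h a) = a" if "a \<in> carrier A" for a
    by (rule alg_hom_eq_on_generators[OF aA DA(2) aA alg_hom_comp[OF h g(1)] alg_hom_id _ that])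
      (simp add: hx g)
  have hg: "h (g b) = b" if "b \<in> carrier B" for b
    by (rule alg_hom_eq_on_generators[OF aB DB(2) aB alg_hom_comp[OF g(1) h] alg_hom_id _ that])
      (simp add: hx g)
  have bij: "bij_betw h (carrier A) (carrier B)"
    by (rule bij_betwI[where g = g])
      (use gh hg module_map_closed[OF alg_hom_map[OF h]] module_map_closed[OF alg_hom_map[OF g(1)]] in auto)
  \<comment> \<open>Both sides are algebra maps into the tensor square of \<open>B\<close>. On a
    generator, \<open>tens_map\<close> replaces each \<open>x\<close> in the coproduct sum by
    \<open>y\<close>.\<close>
  have cop: "coproduct B (h a) = tens_map rta B B h h (coproduct A a)" if "a \<in> carrier A" for a
  proof (rule alg_hom_eq_on_generators[OF aA DA(2) TB.assoc_algebra _ _ _ that])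
    show "alg_hom rta A (tensor_superalg rta B B) (\<lambda>a. coproduct B (h a))"
      by (rule alg_hom_comp[OF h superalg_hom_alg[OF DB(4)]])
    show "alg_hom rta A (tensor_superalg rta B B) (\<lambda>a. tens_map rta B B h h (coproduct A a))"
      by (rule alg_hom_comp[OF superalg_hom_alg[OF DA(4)]
            superalg_hom_alg[OF tens_map_superalg_hom[OF DA(1,1) DB(1,1) hs hs]]])
    note hm = A.module_ax A.module_ax B.module_ax B.module_ax superalg_hom_map[OF hs] superalg_hom_map[OF hs]
    show "coproduct B (h (x ij)) = tens_map rta B B h h (coproduct A (x ij))" for ij
    proof (cases ij)
      case (Pair i j)
      show ?thesis
        unfolding DA(6) hx DB(6) Pair
          coproduct_gen_image[OF A.module_ax xc tensor_module_module[OF B.module_ax B.module_ax] tens_map_map[OF hm]]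
        by (simp add: tens_map_tens[OF hm xc xc] hx coproduct_gen_def)
    qed
  qed
  have cou: "counit B (h a) = counit A a" if "a \<in> carrier A" for a
  proof (rule alg_hom_eq_on_generators[OF aA DA(2) I.assoc_algebra alg_hom_comp[OF h superalg_hom_alg[OF DB(5)]]
        superalg_hom_alg[OF DA(5)] _ that])
    show "counit B (h (x ij)) = counit A (x ij)" for ij
      using DA(7) DB(7) hx by (cases ij) simp
  qed
  show ?thesis
  proof (rule ex1I[of _ h])
    show "h \<in> superbialg_iso rta A B \<and> h \<in> extensional (carrier A) \<and> (\<forall>i j. h (x (i, j)) = y (i, j))"
      using hs bij cop cou hx by (simp add: superbialg_iso_def h_def)
    fix k assume k: "k \<in> superbialg_iso rta A B \<and> k \<in> extensional (carrier A) \<and> (\<forall>i j. k (x (i, j)) = y (i, j))"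
    then have kh: "alg_hom rta A B k" by (auto simp: superbialg_iso_def superalg_hom_alg)
    have "k a = h a" if "a \<in> carrier A" for a
      by (rule alg_hom_eq_on_generators[OF aA DA(2) aB kh h _ that]) (use k hx in auto)
    moreover have "h \<in> extensional (carrier A)" by (simp add: h_def)
    ultimately show "k = h" using k by (intro extensionalityI[of k "carrier A" h]) auto
  qed
qed

text \<open>An odd generator is off the diagonal, and the strict inequalities make most products of
  Kronecker symbols vanish. What remains is the last relation with \<open>i = j\<close> and
  \<open>h = k\<close>, which reads \<open>Q i h * Q h i = 1\<close>.\<close>

lemma counit_equations: "qmat_equations (ring_superalg id rta) (\<lambda>(i, j). if i = j then 1 else 0)"
  unfolding qmat_equations_def
  by (auto simp: ring_superalg_simps bsign_def Q_inv)

lemma qmat_coproduct_exists: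
  fixes A :: "('r, 'a, 'l) superalg_scheme"
  assumes A: "superalgebra rta A" and pres: "presented_by rta A UNIV x (qmat_relations rta p q Q)"
    and x: "\<And>i j. x (i, j) \<in> part A (p i + p j)"
  obtains D e where "D \<in> superalg_hom rta A (tensor_superalg rta A A)"
    and "e \<in> superalg_hom rta A (ring_superalg id rta)"
    and "\<And>ij. D (x ij) = coproduct_gen A x ij" "\<And>i j. e (x (i, j)) = (if i = j then 1 else 0)"
proof -
  interpret A: superalgebra rta A by (rule A)
  interpret T: superalgebra rta "tensor_superalg rta A A" by (rule tensor_superalg_superalgebra[OF A A])
  let ?I = "ring_superalg id rta :: ('r, 'r) superalg"
  interpret I: superalgebra rta ?I
    by (rule ring_superalg_superalgebra[OF cring_rta cring_rta]) (simp add: ring_hom_def)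
  have eqs: "qmat_equations A x"
    using satisfies_qmat_relations_iff[OF A.assoc_algebra presented_byD(1)[OF pres]]
      presented_by_satisfies[OF qmat_relations_closed A.assoc_algebra pres] by blast
  have gc: "range (coproduct_gen A x) \<subseteq> carrier (tensor_superalg rta A A)"
    using coproduct_gen_closed[OF A x eqs] by (auto simp: tensor_superalg_simps)
  obtain D where D: "alg_hom rta A (tensor_superalg rta A A) D" "\<And>ij. D (x ij) = coproduct_gen A x ij"
    using presented_by_universal[OF qmat_relations_closed A.assoc_algebra pres T.assoc_algebra gc]
      satisfies_qmat_relations_iff[OF T.assoc_algebra gc] coproduct_gen_equations[OF A x eqs] by (metis UNIV_I)
  let ?\<delta> = "\<lambda>(i, j). if i = j then 1 else (0::'r)"
  have dc: "range ?\<delta> \<subseteq> carrier ?I" by (simp add: ring_superalg_simps)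
  obtain e where e: "alg_hom rta A ?I e" "\<And>ij. e (x ij) = ?\<delta> ij"
    using presented_by_universal[OF qmat_relations_closed A.assoc_algebra pres I.assoc_algebra dc]
      satisfies_qmat_relations_iff[OF I.assoc_algebra dc] counit_equations by (metis UNIV_I)
  show ?thesis
  proof (rule that)
    show "D \<in> superalg_hom rta A (tensor_superalg rta A A)"
      using x coproduct_gen_part[OF A x eqs] D(2)
      by (intro alg_hom_superalg_hom[OF A pres T.superalgebra_axioms D(1), where d = deg]) auto
    show "e \<in> superalg_hom rta A ?I"
      using x e(2) by (intro alg_hom_superalg_hom[OF A pres I.superalgebra_axioms e(1), where d = deg])
        (auto simp: ring_superalg_simps)
  qed (use D e in auto)
qed

end

text \<open>Serves to replace a superalgebra by a record with coproduct and counit fields: tensor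
  products, presentations and gradings depend only on what is compared here.\<close>

definition same_superalg ::
  "('r, 'a, 'l) superalg_scheme \<Rightarrow> ('r, 'a, 'k) superalg_scheme \<Rightarrow> bool" where
  "same_superalg A B \<longleftrightarrow> same_algebra A B \<and> part A = part B"

lemma same_superalg_superalgebra:
  assumes "same_superalg A B" "superalgebra R A"
  shows "superalgebra R B"
proof -
  interpret A: superalgebra R A by fact
  have alg: "same_algebra A B" and sm: "same_module A B" and part: "part B = part A"
    using assms(1) by (auto simp: same_superalg_def same_algebra_def)
  have B: "carrier B = carrier A" "monoid.mult B = monoid.mult A" "\<one>\<^bsub>B\<^esub> = \<one>\<^bsub>A\<^esub>" "add B = add A" "\<zero>\<^bsub>B\<^esub> = \<zero>\<^bsub>A\<^esub>"
    using alg by (auto simp: same_algebra_def same_module_def)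
  show ?thesis
  proof (rule superalgebraI[OF same_algebra_assoc_algebra[OF alg A.assoc_algebra]])
    show "submodule (part B s) R B" for s
      using A.part_submodule[of s] same_module_submodule[OF sm, of "part A s" R] by (simp add: part)
    show "\<exists>u\<in>part B 0. \<exists>v\<in>part B 1. x = u \<oplus>\<^bsub>B\<^esub> v" if "x \<in> carrier B" for x
      using A.part_decomp[of x 0] that unfolding part B by (metis add_0)
    show "part B 0 \<inter> part B 1 \<subseteq> {\<zero>\<^bsub>B\<^esub>}"
    proof
      fix x assume "x \<in> part B 0 \<inter> part B 1"
      then have x: "x \<in> part A 0" "x \<in> part A 1" by (auto simp: part)
      have "x = \<zero>\<^bsub>A\<^esub>" using A.component_same[OF x(1)] A.component_other[OF x(2), of 0] by simp
      then show "x \<in> {\<zero>\<^bsub>B\<^esub>}" by (simp add: B)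
    qed
  qed (auto simp: part B A.part_one A.part_mult)
qed

lemma same_superalg_tensor:
  assumes "same_superalg A A'" "same_superalg B B'"
  shows "tensor_superalg R A B = tensor_superalg R A' B'"
proof -
  have sm: "same_module A A'" "same_module B B'"
    and eq: "monoid.mult A = monoid.mult A'" "monoid.mult B = monoid.mult B'" "part A = part A'" "part B = part B'"
      "\<one>\<^bsub>A\<^esub> = \<one>\<^bsub>A'\<^esub>" "\<one>\<^bsub>B\<^esub> = \<one>\<^bsub>B'\<^esub>"
    using assms by (auto simp: same_superalg_def same_algebra_def)
  have comp: "component A = component A'" "component B = component B'"
    using sm eq by (auto simp: component_def fun_eq_iff same_module_def)
  show ?thesis
    unfolding tensor_superalg_def Let_def same_module_tensor_module[OF sm] same_module_tens[OF sm] comp eq ..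
qed

lemma same_algebra_free_eval: "same_algebra A B \<Longrightarrow> free_eval R A x = free_eval R B x"
  by (auto simp: free_eval_def same_algebra_def dest: same_module_lin_ext)

lemma same_algebra_presented_by:
  assumes "same_algebra A B" "presented_by R A G x rels"
  shows "presented_by R B G x rels"
  using assms(2) same_algebra_free_eval[OF assms(1), of R x] assms(1)
  unfolding presented_by_def Let_def a_kernel_def' same_algebra_def same_module_def by simp

lemma same_superalg_hom:
  assumes "same_superalg A A'" "f \<in> superalg_hom R A B"
  shows "f \<in> superalg_hom R A' B"
  using assms unfolding same_superalg_def same_algebra_def same_module_def superalg_hom_iff alg_hom_def module_map_def
  by simp

section \<open>Existence of the presented superbialgebra\<close>

context qmat_parameters
begin

lemma qmat_superbialgebra_exists:
  "\<exists>(A :: ('r, (('n \<times> 'n) list \<Rightarrow> 'r) set) superbialg) x. qmat_superbialgebra rta p q Q A x"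
proof -
  obtain B :: "('r, (('n \<times> 'n) list \<Rightarrow> 'r) set) superalg" and x where
    B: "superalgebra rta B" "presented_by rta B UNIV x (qmat_relations rta p q Q)"
      "\<And>i j. x (i, j) \<in> part B (p i + p j)"
    using presented_superalgebra_exists[OF cring_rta qmat_relations_homogeneous] by fastforce
  obtain D e where De: "D \<in> superalg_hom rta B (tensor_superalg rta B B)"
    "e \<in> superalg_hom rta B (ring_superalg id rta)"
    "\<And>ij. D (x ij) = coproduct_gen B x ij" "\<And>i j. e (x (i, j)) = (if i = j then 1 else 0)"
    using qmat_coproduct_exists[OF B] by metis
  \<comment> \<open>The added fields leave the tensor square literally unchanged, so the
    homomorphisms \<open>D\<close> and \<open>e\<close> found for \<open>B\<close> serve for
    \<open>A\<close>.\<close>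
  define A where "A = \<lparr>carrier = carrier B, monoid.mult = monoid.mult B, one = one B,
     ring.zero = ring.zero B, add = add B, module.smult = module.smult B, part = part B,
     coproduct = D, counit = e\<rparr>"
  have same: "same_superalg B A"
    by (simp add: A_def same_superalg_def same_algebra_def same_module_def)
  then have sm: "same_algebra B A" "same_module B A" by (auto simp: same_superalg_def same_algebra_def)
  have A: "part A = part B" "coproduct A = D" "counit A = e" by (simp_all add: A_def)
  have gen: "coproduct_gen A x = coproduct_gen B x"
    by (simp add: coproduct_gen_def same_module_tensor_module[OF sm(2) sm(2)] same_module_tens[OF sm(2) sm(2)])
  have "qmat_superbialgebra rta p q Q A x"
    using De B(3) same_superalg_hom[OF same De(1)] same_superalg_hom[OF same De(2)]
    by (intro qmat_superbialgebraI same_superalg_superalgebra[OF same B(1)] same_algebra_presented_by[OF sm(1) B(2)])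
      (auto simp: A gen simp flip: same_superalg_tensor[OF same same])
  then show ?thesis by blast
qed

end

section \<open>Restriction and extension of scalars\<close>

lemma bilinear_map_cong:
  assumes "module R A" "module R EA" "\<And>a b. a \<in> carrier A \<Longrightarrow> b \<in> carrier EA \<Longrightarrow> h (a, b) = h' (a, b)"
  shows "bilinear_map R A EA M h \<longleftrightarrow> bilinear_map R A EA M h'"
proof -
  have "module_map R A M (\<lambda>a. h (a, b)) \<longleftrightarrow> module_map R A M (\<lambda>a. h' (a, b))" if "b \<in> carrier EA" for b
    by (rule module_map_cong[OF assms(1)]) (simp add: assms(3) that)
  moreover have "module_map R EA M (\<lambda>b. h (a, b)) \<longleftrightarrow> module_map R EA M (\<lambda>b. h' (a, b))" if "a \<in> carrier A" for a
    by (rule module_map_cong[OF assms(2)]) (simp add: assms(3) that)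
  ultimately show ?thesis by (simp add: bilinear_map_def)
qed

lemma restrict_scalars_simps:
  "carrier (restrict_scalars \<phi> M) = carrier M" "\<zero>\<^bsub>restrict_scalars \<phi> M\<^esub> = \<zero>\<^bsub>M\<^esub>"
  "add (restrict_scalars \<phi> M) = add M" "monoid.mult (restrict_scalars \<phi> M) = monoid.mult M"
  "\<one>\<^bsub>restrict_scalars \<phi> M\<^esub> = \<one>\<^bsub>M\<^esub>"
  "r \<odot>\<^bsub>restrict_scalars \<phi> M\<^esub> x = \<phi> r \<odot>\<^bsub>M\<^esub> x"
  by (simp_all add: restrict_scalars_def)

lemma restrict_scalars_finsum: "finsum (restrict_scalars \<phi> M) f I = finsum M f I"
  by (simp add: finsum_def finprod_def restrict_scalars_simps)

context
  fixes R :: "('r, 'm) ring_scheme" and S :: "('s, 'o) ring_scheme" and \<phi> :: "'r \<Rightarrow> 's"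
  assumes R: "cring R" and S: "cring S" and \<phi>: "\<phi> \<in> ring_hom R S"
begin

interpretation R: cring R by (rule R)
interpretation S: cring S by (rule S)

lemma ring_hom_simps [simp]:
  "r \<in> carrier R \<Longrightarrow> \<phi> r \<in> carrier S" "\<phi> \<one>\<^bsub>R\<^esub> = \<one>\<^bsub>S\<^esub>"
  "r \<in> carrier R \<Longrightarrow> r' \<in> carrier R \<Longrightarrow> \<phi> (r \<oplus>\<^bsub>R\<^esub> r') = \<phi> r \<oplus>\<^bsub>S\<^esub> \<phi> r'"
  "r \<in> carrier R \<Longrightarrow> r' \<in> carrier R \<Longrightarrow> \<phi> (r \<otimes>\<^bsub>R\<^esub> r') = \<phi> r \<otimes>\<^bsub>S\<^esub> \<phi> r'"
  using ring_hom_closed[OF \<phi>] ring_hom_one[OF \<phi>] ring_hom_add[OF \<phi>] ring_hom_mult[OF \<phi>] by auto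

lemma restrict_scalars_module:
  assumes "module S M"
  shows "module R (restrict_scalars \<phi> M)"
proof -
  interpret M: module S M by fact
  have "\<exists>y\<in>carrier M. y \<oplus>\<^bsub>M\<^esub> x = \<zero>\<^bsub>M\<^esub>" if "x \<in> carrier M" for x
    using that M.l_neg M.a_inv_closed by blast
  then have "abelian_group (restrict_scalars \<phi> M)"
    by (intro abelian_groupI) (auto simp: restrict_scalars_simps M.a_ac)
  then show ?thesis
    by (intro moduleI R)
      (auto simp: restrict_scalars_simps M.smult_l_distr M.smult_r_distr M.smult_assoc1)
qed

lemma restrict_scalars_map:
  "module_map S M N f \<Longrightarrow> module_map R (restrict_scalars \<phi> M) (restrict_scalars \<phi> N) f"
  by (auto simp: module_map_def restrict_scalars_simps)

lemma restrict_scalars_assoc_algebra: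
  assumes "assoc_algebra S M"
  shows "assoc_algebra R (restrict_scalars \<phi> M)"
proof -
  interpret M: assoc_algebra S M by fact
  show ?thesis
    by (rule assoc_algebraI[OF restrict_scalars_module[OF M.module_ax]])
      (auto simp: bilinear_map_def module_map_def restrict_scalars_simps M.A.m_assoc
        M.A.l_distr M.A.r_distr M.smult_mult_left M.smult_mult_right)
qed

lemma parity_sign_ring_hom: "\<phi> (parity_sign R s) = parity_sign S s"
proof -
  have "\<phi> (\<ominus>\<^bsub>R\<^esub> \<one>\<^bsub>R\<^esub>) \<oplus>\<^bsub>S\<^esub> \<one>\<^bsub>S\<^esub> = \<phi> (\<ominus>\<^bsub>R\<^esub> \<one>\<^bsub>R\<^esub> \<oplus>\<^bsub>R\<^esub> \<one>\<^bsub>R\<^esub>)" by simp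
  also have "\<dots> = \<phi> \<zero>\<^bsub>R\<^esub>" by (simp add: R.l_neg)
  also have "\<dots> = \<zero>\<^bsub>S\<^esub>" using ring_hom_zero[OF \<phi> R.ring_axioms S.ring_axioms] .
  finally have "\<phi> (\<ominus>\<^bsub>R\<^esub> \<one>\<^bsub>R\<^esub>) = \<ominus>\<^bsub>S\<^esub> \<one>\<^bsub>S\<^esub>" using S.minus_equality[of "\<phi> (\<ominus>\<^bsub>R\<^esub> \<one>\<^bsub>R\<^esub>)" "\<one>\<^bsub>S\<^esub>"] by simp
  then show ?thesis by (simp add: parity_sign_def)
qed

lemma scalars_superalgebra: "superalgebra R (ring_superalg \<phi> S)"
  by (rule ring_superalg_superalgebra[OF R S \<phi>])

section \<open>The superalgebra obtained by extension of scalars\<close>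

context
  fixes A :: "('r, 'a, 'l) superalg_scheme"
  assumes A: "superalgebra R A"
begin

interpretation A: superalgebra R A by (rule A)

private abbreviation (input) "S' \<equiv> ring_superalg \<phi> S"
private abbreviation (input) "TM \<equiv> tensor_module R S' A"
private abbreviation (input) "TS \<equiv> tensor_superalg R S' A"
private abbreviation (input) "EA \<equiv> ext_superalg R S \<phi> A"
private abbreviation (input) "ot \<equiv> tens R S' A"

interpretation S': superalgebra R S' by (rule scalars_superalgebra)
interpretation TS: superalgebra R TS by (rule tensor_superalg_superalgebra[OF scalars_superalgebra A])
interpretation TM: module R TM by (rule tensor_module_module[OF S'.module_ax A.module_ax])

lemma ext_superalg_simps:
  "carrier EA = carrier TM" "\<zero>\<^bsub>EA\<^esub> = \<zero>\<^bsub>TM\<^esub>" "add EA = add TM"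
  "monoid.mult EA = monoid.mult TS" "\<one>\<^bsub>EA\<^esub> = ot \<one>\<^bsub>S\<^esub> \<one>\<^bsub>A\<^esub>" "part EA = part TS"
  "s \<odot>\<^bsub>EA\<^esub> t = tens_lift R TM (\<lambda>(k, a). ot (s \<otimes>\<^bsub>S\<^esub> k) a) t"
  by (simp_all add: ext_superalg_def Let_def tensor_superalg_simps(1-5) ring_superalg_simps
      same_module_tens_lift[OF same_module_tensor_superalg])

lemma ot_closed [simp]: "k \<in> carrier S \<Longrightarrow> a \<in> carrier A \<Longrightarrow> ot k a \<in> carrier TM"
  using tens_closed[OF S'.module_ax A.module_ax, of k a] by (simp add: ring_superalg_simps)

lemma scalar_mult_bilinear:
  assumes "s \<in> carrier S"
  shows "bilinear_map R S' A TM (\<lambda>(k, a). ot (s \<otimes>\<^bsub>S\<^esub> k) a)"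
proof -
  have "module_map R S' S' (\<lambda>k. s \<otimes>\<^bsub>S\<^esub> k)"
    using assms by (intro module_mapI) (auto simp: ring_superalg_simps S.r_distr S.m_lcomm)
  then show ?thesis
    using bilinear_map_precomp[OF tens_bilinear[OF S'.module_ax A.module_ax] _ module_map_id] by fastforce
qed

lemma ext_smult_map: "s \<in> carrier S \<Longrightarrow> module_map R TM TM (\<lambda>t. s \<odot>\<^bsub>EA\<^esub> t)"
  unfolding ext_superalg_simps
  by (rule tens_lift_map[OF S'.module_ax A.module_ax TM.module_axioms scalar_mult_bilinear])

lemma ext_smult_ot [simp]:
  "s \<in> carrier S \<Longrightarrow> k \<in> carrier S \<Longrightarrow> a \<in> carrier A \<Longrightarrow> s \<odot>\<^bsub>EA\<^esub> ot k a = ot (s \<otimes>\<^bsub>S\<^esub> k) a"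
  unfolding ext_superalg_simps
  by (subst tens_lift_tens[OF S'.module_ax A.module_ax TM.module_axioms scalar_mult_bilinear])
    (simp_all add: ring_superalg_simps)

lemma ext_induct [consumes 1, case_names ot add]:
  assumes "t \<in> carrier TM"
    and "\<And>k a. k \<in> carrier S \<Longrightarrow> a \<in> carrier A \<Longrightarrow> P (ot k a)"
    and "\<And>t u. t \<in> carrier TM \<Longrightarrow> u \<in> carrier TM \<Longrightarrow> P t \<Longrightarrow> P u \<Longrightarrow> P (t \<oplus>\<^bsub>TM\<^esub> u)"
  shows "P t"
  using assms(1)
  by (rule tensor_induct[OF S'.module_ax A.module_ax]) (simp_all add: assms(2,3) ring_superalg_simps)

lemma ot_add:
  "k \<in> carrier S \<Longrightarrow> l \<in> carrier S \<Longrightarrow> a \<in> carrier A \<Longrightarrow> ot (k \<oplus>\<^bsub>S\<^esub> l) a = ot k a \<oplus>\<^bsub>TM\<^esub> ot l a"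
  "k \<in> carrier S \<Longrightarrow> a \<in> carrier A \<Longrightarrow> b \<in> carrier A \<Longrightarrow> ot k (a \<oplus>\<^bsub>A\<^esub> b) = ot k a \<oplus>\<^bsub>TM\<^esub> ot k b"
  using tens_add_smult(1)[OF S'.module_ax A.module_ax, of k l a]
    tens_add_smult(2)[OF S'.module_ax A.module_ax, of k a b] by (simp_all add: ring_superalg_simps)

lemma ot_smult:
  "r \<in> carrier R \<Longrightarrow> k \<in> carrier S \<Longrightarrow> a \<in> carrier A \<Longrightarrow> ot (\<phi> r \<otimes>\<^bsub>S\<^esub> k) a = r \<odot>\<^bsub>TM\<^esub> ot k a"
  "r \<in> carrier R \<Longrightarrow> k \<in> carrier S \<Longrightarrow> a \<in> carrier A \<Longrightarrow> ot k (r \<odot>\<^bsub>A\<^esub> a) = r \<odot>\<^bsub>TM\<^esub> ot k a"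
  using tens_add_smult(3)[OF S'.module_ax A.module_ax, of r k a]
    tens_add_smult(4)[OF S'.module_ax A.module_ax, of r k a] by (simp_all add: ring_superalg_simps)

text \<open>On pure tensors both actions multiply the left factor by \<open>\<phi> r\<close>. This
  ties the new \<open>S\<close>-module structure to the given \<open>R\<close>-module
  structure.\<close>

lemma ext_smult_restrict:
  assumes "r \<in> carrier R" "t \<in> carrier TM"
  shows "\<phi> r \<odot>\<^bsub>EA\<^esub> t = r \<odot>\<^bsub>TM\<^esub> t"
  using assms(2)
proof (induction rule: ext_induct)
  case (ot k a)
  then show ?case using assms(1) by (simp add: ot_smult)
next
  case (add t u)
  then show ?case using assms(1) by (simp add: module_map_add[OF ext_smult_map] TM.smult_r_distr)
qed

lemma ext_module: "module S EA"
proof (rule moduleI[OF S])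
  have "\<exists>y\<in>carrier TM. y \<oplus>\<^bsub>TM\<^esub> x = \<zero>\<^bsub>TM\<^esub>" if "x \<in> carrier TM" for x
    using that TM.l_neg TM.M.a_inv_closed by blast
  then show "abelian_group EA"
    by (intro abelian_groupI) (auto simp: ext_superalg_simps(1-3) TM.M.a_ac)
  note [simp] = ext_superalg_simps(1-3) module_map_closed[OF ext_smult_map] module_map_add[OF ext_smult_map]
  show "r \<odot>\<^bsub>EA\<^esub> x \<in> carrier EA" if "r \<in> carrier S" "x \<in> carrier EA" for r x
    using that by simp
  show "r \<odot>\<^bsub>EA\<^esub> (x \<oplus>\<^bsub>EA\<^esub> y) = r \<odot>\<^bsub>EA\<^esub> x \<oplus>\<^bsub>EA\<^esub> r \<odot>\<^bsub>EA\<^esub> y" if "r \<in> carrier S" "x \<in> carrier EA" "y \<in> carrier EA" for r x y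
    using that by simp
  show "(r \<oplus>\<^bsub>S\<^esub> s) \<odot>\<^bsub>EA\<^esub> x = r \<odot>\<^bsub>EA\<^esub> x \<oplus>\<^bsub>EA\<^esub> s \<odot>\<^bsub>EA\<^esub> x" if rs: "r \<in> carrier S" "s \<in> carrier S" and x: "x \<in> carrier EA" for r s x
    using x[unfolded ext_superalg_simps(1)]
  proof (induction rule: ext_induct)
    case (ot k a)
    then show ?case using rs by (simp add: S.l_distr ot_add)
  next
    case (add t u)
    then show ?case using rs by (simp add: TM.M.a_ac)
  qed
  show "(r \<otimes>\<^bsub>S\<^esub> s) \<odot>\<^bsub>EA\<^esub> x = r \<odot>\<^bsub>EA\<^esub> (s \<odot>\<^bsub>EA\<^esub> x)" if rs: "r \<in> carrier S" "s \<in> carrier S" and x: "x \<in> carrier EA" for r s x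
    using x[unfolded ext_superalg_simps(1)]
    by (induction rule: ext_induct) (use rs in \<open>simp_all add: S.m_assoc\<close>)
  show "\<one>\<^bsub>S\<^esub> \<odot>\<^bsub>EA\<^esub> x = x" if x: "x \<in> carrier EA" for x
    using x[unfolded ext_superalg_simps(1)] by (induction rule: ext_induct) simp_all
qed

text \<open>Scalars from \<open>S\<close> are even, so moving \<open>l\<close> past \<open>a\<close>
  costs no sign.\<close>

lemma ot_mult:
  assumes "k \<in> carrier S" "l \<in> carrier S" "a \<in> carrier A" "b \<in> carrier A"
  shows "ot k a \<otimes>\<^bsub>TS\<^esub> ot l b = ot (k \<otimes>\<^bsub>S\<^esub> l) (a \<otimes>\<^bsub>A\<^esub> b)"
  using assms(3)
proof (induction rule: A.homogeneous_induct)
  case (hom a s)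
  then show ?case
    using tensor_mult_maps(2)[OF scalars_superalgebra A, of k a s l 0 b] assms A.part_closed[OF hom]
    by (simp add: ring_superalg_simps TM.smult_one)
next
  case (add a a')
  then show ?case
    using assms tensor_mult_linear[OF scalars_superalgebra A] by (simp add: ot_add A.A.l_distr)
qed

text \<open>Associativity and unit are those of the tensor product over \<open>R\<close>. Only
  bilinearity over \<open>S\<close> is new, and on pure tensors it follows from commutativity of
  \<open>S\<close>.\<close>

lemma ext_assoc_algebra: "assoc_algebra S EA"
proof (rule assoc_algebraI[OF ext_module])
  interpret B: module S EA by (rule ext_module)
  note lin = tensor_mult_linear[OF scalars_superalgebra A]
  note [simp] = ext_superalg_simps(1-4) lin module_map_closed[OF ext_smult_map] module_map_add[OF ext_smult_map]
    ot_mult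
  have l: "(s \<odot>\<^bsub>EA\<^esub> t) \<otimes>\<^bsub>TS\<^esub> u = s \<odot>\<^bsub>EA\<^esub> (t \<otimes>\<^bsub>TS\<^esub> u)" and r: "t \<otimes>\<^bsub>TS\<^esub> (s \<odot>\<^bsub>EA\<^esub> u) = s \<odot>\<^bsub>EA\<^esub> (t \<otimes>\<^bsub>TS\<^esub> u)"
    if s: "s \<in> carrier S" and t: "t \<in> carrier TM" and u: "u \<in> carrier TM" for s t u
  proof -
    have "(s \<odot>\<^bsub>EA\<^esub> t) \<otimes>\<^bsub>TS\<^esub> u = s \<odot>\<^bsub>EA\<^esub> (t \<otimes>\<^bsub>TS\<^esub> u) \<and> t \<otimes>\<^bsub>TS\<^esub> (s \<odot>\<^bsub>EA\<^esub> u) = s \<odot>\<^bsub>EA\<^esub> (t \<otimes>\<^bsub>TS\<^esub> u)"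
      using t
    proof (induction rule: ext_induct)
      case (ot k a)
      note ka = this
      from u show ?case
      proof (induction rule: ext_induct)
        case (ot l b)
        then show ?case using ka s by (simp add: S.m_assoc S.m_lcomm)
      next
        case (add v w)
        then show ?case using ka s by simp
      qed
    next
      case (add v w)
      then show ?case using u s by simp
    qed
    then show "(s \<odot>\<^bsub>EA\<^esub> t) \<otimes>\<^bsub>TS\<^esub> u = s \<odot>\<^bsub>EA\<^esub> (t \<otimes>\<^bsub>TS\<^esub> u)" "t \<otimes>\<^bsub>TS\<^esub> (s \<odot>\<^bsub>EA\<^esub> u) = s \<odot>\<^bsub>EA\<^esub> (t \<otimes>\<^bsub>TS\<^esub> u)" by auto
  qed
  show "bilinear_map S EA EA EA (\<lambda>(x, y). x \<otimes>\<^bsub>EA\<^esub> y)"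
    by (intro bilinear_mapI module_mapI) (simp_all add: l r)
  note T = TS.A.m_assoc TS.A.l_one TS.A.r_one TS.A.one_closed
  show "x \<otimes>\<^bsub>EA\<^esub> y \<otimes>\<^bsub>EA\<^esub> z = x \<otimes>\<^bsub>EA\<^esub> (y \<otimes>\<^bsub>EA\<^esub> z)" if "x \<in> carrier EA" "y \<in> carrier EA" "z \<in> carrier EA" for x y z
    using that TS.A.m_assoc by (simp add: tensor_superalg_simps(1))
  have one: "\<one>\<^bsub>EA\<^esub> = \<one>\<^bsub>TS\<^esub>" by (simp add: ext_superalg_simps(5) tensor_superalg_simps(5) ring_superalg_simps)
  show "\<one>\<^bsub>EA\<^esub> \<in> carrier EA" "x \<in> carrier EA \<Longrightarrow> \<one>\<^bsub>EA\<^esub> \<otimes>\<^bsub>EA\<^esub> x = x" "x \<in> carrier EA \<Longrightarrow> x \<otimes>\<^bsub>EA\<^esub> \<one>\<^bsub>EA\<^esub> = x" for x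
    using TS.A.one_closed TS.A.l_one TS.A.r_one unfolding one by (simp_all add: tensor_superalg_simps(1))
qed

lemma ext_superalgebra: "superalgebra S EA"
proof (rule superalgebraI[OF ext_assoc_algebra])
  interpret B: assoc_algebra S EA by (rule ext_assoc_algebra)
  have pc: "x \<in> carrier TM" if "x \<in> part TS s" for x s
    using TS.part_closed[OF that] by (simp add: tensor_superalg_simps(1))
  show "submodule (part EA s) S EA" for s
  proof (rule B.submoduleI')
    show "part EA s \<subseteq> carrier EA" using pc by (auto simp: ext_superalg_simps(1,6))
    show "\<zero>\<^bsub>EA\<^esub> \<in> part EA s" using TS.part_zero by (simp add: ext_superalg_simps(2,6) tensor_superalg_simps(2))
    show "a \<oplus>\<^bsub>EA\<^esub> b \<in> part EA s" if "a \<in> part EA s" "b \<in> part EA s" for a b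
      using TS.part_add that by (simp add: ext_superalg_simps(3,6) tensor_superalg_simps(3))
    show "k \<odot>\<^bsub>EA\<^esub> x \<in> part EA s" if k: "k \<in> carrier S" and x: "x \<in> part EA s" for k x
    proof -
      have "part TS s \<subseteq> {x \<in> carrier TM. k \<odot>\<^bsub>EA\<^esub> x \<in> part TS s}"
      proof (rule tensor_part_subset[OF scalars_superalgebra A])
        show "submodule {x \<in> carrier TM. k \<odot>\<^bsub>EA\<^esub> x \<in> part TS s} R TM"
          by (rule submodule_module_map_vimage[OF ext_smult_map[OF k] TM.module_axioms TM.module_axioms
                tensor_part_submodule[OF scalars_superalgebra A]])
        fix l a t u assume la: "l \<in> part S' t" "a \<in> part A u" "t + u = s"
        \<comment> \<open>Multiplication by \<open>k\<close> preserves both parts of the scalar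
          ring, the odd part being zero.\<close>
        have "k \<otimes>\<^bsub>S\<^esub> l \<in> part S' t" using la(1) k by (cases t) (auto simp: ring_superalg_simps)
        moreover have "l \<in> carrier S" using S'.part_closed[OF la(1)] by (simp add: ring_superalg_simps)
        ultimately show "ot l a \<in> {x \<in> carrier TM. k \<odot>\<^bsub>EA\<^esub> x \<in> part TS s}"
          using tensor_part_tens[OF scalars_superalgebra A, of "k \<otimes>\<^bsub>S\<^esub> l" t a u] la k A.part_closed by auto
      qed
      then show ?thesis using x by (auto simp: ext_superalg_simps(6))
    qed
  qed
  show "\<exists>u\<in>part EA 0. \<exists>v\<in>part EA 1. x = u \<oplus>\<^bsub>EA\<^esub> v" if "x \<in> carrier EA" for x
    using TS.part_decomp[of x 0] that
    unfolding ext_superalg_simps(1,3,6) tensor_superalg_simps(1,3) by (metis add_0)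
  show "part EA 0 \<inter> part EA 1 \<subseteq> {\<zero>\<^bsub>EA\<^esub>}"
  proof
    fix x assume "x \<in> part EA 0 \<inter> part EA 1"
    then have x: "x \<in> part TS 0" "x \<in> part TS 1" by (auto simp: ext_superalg_simps(6))
    have "x = \<zero>\<^bsub>TS\<^esub>" using TS.component_same[OF x(1)] TS.component_other[OF x(2), of 0] by simp
    then show "x \<in> {\<zero>\<^bsub>EA\<^esub>}" by (simp add: ext_superalg_simps(2) tensor_superalg_simps(2))
  qed
  show "\<one>\<^bsub>EA\<^esub> \<in> part EA 0"
    using TS.part_one by (simp add: ext_superalg_simps(5,6) tensor_superalg_simps(5) ring_superalg_simps(6))
  show "x \<otimes>\<^bsub>EA\<^esub> y \<in> part EA (s + t)" if "x \<in> part EA s" "y \<in> part EA t" for x y s t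
    using TS.part_mult that by (simp add: ext_superalg_simps(4,6))
qed

lemma ext_embedding_alg_hom: "alg_hom R A (restrict_scalars \<phi> EA) (ot \<one>\<^bsub>S\<^esub>)"
proof (rule alg_homI)
  show "module_map R A (restrict_scalars \<phi> EA) (ot \<one>\<^bsub>S\<^esub>)"
    by (rule module_mapI)
      (simp_all add: restrict_scalars_simps ext_superalg_simps(1,3) ext_smult_restrict ot_add ot_smult
        del: ext_smult_ot)
qed (simp_all add: restrict_scalars_simps ext_superalg_simps(4,5) ot_mult)

lemma ext_embedding_part: "a \<in> part A s \<Longrightarrow> ot \<one>\<^bsub>S\<^esub> a \<in> part EA s"
  using tensor_part_tens[OF scalars_superalgebra A, of "\<one>\<^bsub>S\<^esub>" 0 a s]
  by (simp add: ext_superalg_simps(6) ring_superalg_simps)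

text \<open>The universal property of extension of scalars, for a map \<open>L\<close> that is already known to be
  the linear extension of \<open>k \<otimes> a \<mapsto> k \<psi>(a)\<close>.\<close>

lemma ext_alg_homI:
  assumes M: "assoc_algebra S M" and \<psi>: "alg_hom R A (restrict_scalars \<phi> M) \<psi>"
    and L: "module_map R TM (restrict_scalars \<phi> M) L"
    and L_ot: "\<And>k a. k \<in> carrier S \<Longrightarrow> a \<in> carrier A \<Longrightarrow> L (ot k a) = k \<odot>\<^bsub>M\<^esub> \<psi> a"
  shows "alg_hom S EA M L"
proof (rule alg_homI)
  interpret M: assoc_algebra S M by (rule M)
  interpret B: assoc_algebra S EA by (rule ext_assoc_algebra)
  have psi: "\<psi> a \<in> carrier M" if "a \<in> carrier A" for a
    using module_map_closed[OF alg_hom_map[OF \<psi>] that] by (simp add: restrict_scalars_simps)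
  have Lc: "L t \<in> carrier M" if "t \<in> carrier TM" for t
    using module_map_closed[OF L that] by (simp add: restrict_scalars_simps)
  have La: "L (t \<oplus>\<^bsub>TM\<^esub> u) = L t \<oplus>\<^bsub>M\<^esub> L u" if "t \<in> carrier TM" "u \<in> carrier TM" for t u
    using module_map_add[OF L that] by (simp add: restrict_scalars_simps)
  note [simp] = psi Lc La L_ot ext_superalg_simps(1,3,4) module_map_closed[OF ext_smult_map]
    module_map_add[OF ext_smult_map] ot_mult tensor_mult_linear[OF scalars_superalgebra A]
  show "module_map S EA M L"
  proof (rule module_mapI)
    show "L (s \<odot>\<^bsub>EA\<^esub> t) = s \<odot>\<^bsub>M\<^esub> L t" if s: "s \<in> carrier S" and t: "t \<in> carrier EA" for s t
      using t[unfolded ext_superalg_simps(1)]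
    proof (induction rule: ext_induct)
      case (ot k a)
      then show ?case using s by (simp add: M.smult_assoc1)
    next
      case (add t u)
      then show ?case using s by (simp add: M.smult_r_distr)
    qed
  qed simp_all
  show "L \<one>\<^bsub>EA\<^esub> = \<one>\<^bsub>M\<^esub>"
    using alg_hom_one[OF \<psi>] by (simp add: ext_superalg_simps(5) restrict_scalars_simps)
  show "L (x \<otimes>\<^bsub>EA\<^esub> y) = L x \<otimes>\<^bsub>M\<^esub> L y" if x: "x \<in> carrier EA" and y: "y \<in> carrier EA" for x y
    using x[unfolded ext_superalg_simps(1)]
  proof (induction rule: ext_induct)
    case (ot k a)
    note ka = this
    from y[unfolded ext_superalg_simps(1)] show ?case
    proof (induction rule: ext_induct)
      case (ot l b)
      have "\<psi> (a \<otimes>\<^bsub>A\<^esub> b) = \<psi> a \<otimes>\<^bsub>M\<^esub> \<psi> b"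
        using alg_hom_mult[OF \<psi>] ka ot by (simp add: restrict_scalars_simps)
      then show ?case
        using ka ot by (simp add: M.smult_mult_left M.smult_mult_right S.m_comm flip: M.smult_assoc1)
    next
      case (add t u)
      then show ?case using ka by (simp add: M.A.r_distr)
    qed
  next
    case (add t u)
    then show ?case using y by (simp add: M.A.l_distr)
  qed
qed

text \<open>A scalar \<open>r\<close> may act through \<open>k\<close> or through \<open>a\<close>:
  in both cases \<open>\<phi> r\<close> comes out, because \<open>\<psi>\<close> is linear into the
  restriction along \<open>\<phi>\<close>.\<close>

lemma ext_lift_bilinear:
  assumes M: "module S M" and \<psi>: "module_map R A (restrict_scalars \<phi> M) \<psi>"
  shows "bilinear_map R S' A (restrict_scalars \<phi> M) (\<lambda>(k, a). k \<odot>\<^bsub>M\<^esub> \<psi> a)"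
proof -
  interpret M: module S M by (rule M)
  have psi: "\<psi> a \<in> carrier M" if "a \<in> carrier A" for a
    using module_map_closed[OF \<psi> that] by (simp add: restrict_scalars_simps)
  have psi2: "\<psi> (a \<oplus>\<^bsub>A\<^esub> b) = \<psi> a \<oplus>\<^bsub>M\<^esub> \<psi> b" "\<psi> (r \<odot>\<^bsub>A\<^esub> a) = \<phi> r \<odot>\<^bsub>M\<^esub> \<psi> a"
    if "a \<in> carrier A" "b \<in> carrier A" "r \<in> carrier R" for a b r
    using module_map_add[OF \<psi> that(1,2)] module_map_smult[OF \<psi> that(3,1)] by (simp_all add: restrict_scalars_simps)
  show ?thesis
    by (intro bilinear_mapI module_mapI)
      (auto simp: psi psi2(1)[OF _ _ R.one_closed] psi2(2)[OF _ A.M.zero_closed] restrict_scalars_simps ring_superalg_simps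
        M.smult_l_distr M.smult_r_distr S.m_comm simp flip: M.smult_assoc1)
qed

lemma ext_alg_hom_exists:
  assumes M: "assoc_algebra S M" and \<psi>: "alg_hom R A (restrict_scalars \<phi> M) \<psi>"
  obtains L where "alg_hom S EA M L" "\<And>a. a \<in> carrier A \<Longrightarrow> L (ot \<one>\<^bsub>S\<^esub> a) = \<psi> a"
proof -
  interpret M: assoc_algebra S M by (rule M)
  note bil = ext_lift_bilinear[OF M.module_ax alg_hom_map[OF \<psi>]]
  note Rm = restrict_scalars_module[OF M.module_ax]
  let ?L = "tens_lift R (restrict_scalars \<phi> M) (\<lambda>(k, a). k \<odot>\<^bsub>M\<^esub> \<psi> a)"
  have L: "?L (ot k a) = k \<odot>\<^bsub>M\<^esub> \<psi> a" if "k \<in> carrier S" "a \<in> carrier A" for k a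
    using tens_lift_tens[OF S'.module_ax A.module_ax Rm bil, of k a] that by (simp add: ring_superalg_simps)
  have "alg_hom S EA M ?L"
    by (rule ext_alg_homI[OF M \<psi> tens_lift_map[OF S'.module_ax A.module_ax Rm bil] L])
  moreover have "?L (ot \<one>\<^bsub>S\<^esub> a) = \<psi> a" if "a \<in> carrier A" for a
    using L that module_map_closed[OF alg_hom_map[OF \<psi>] that] by (simp add: restrict_scalars_simps)
  ultimately show ?thesis using that by blast
qed

end

section \<open>Coproduct and counit after extension of scalars\<close>

context
  fixes A :: "('r, 'a, 'l) superbialg_scheme"
  assumes A: "superalgebra R A"
    and D: "coproduct A \<in> superalg_hom R A (tensor_superalg R A A)"
    and e: "counit A \<in> superalg_hom R A (ring_superalg id R)"
begin

interpretation A: superalgebra R A by (rule A)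

private abbreviation (input) "Sc \<equiv> ring_superalg \<phi> S"
private abbreviation (input) "E \<equiv> ext_superalg R S \<phi> A"
private abbreviation (input) "BB \<equiv> tensor_module S E E"
private abbreviation (input) "em \<equiv> tens R Sc A \<one>\<^bsub>S\<^esub>"

interpretation S': superalgebra R Sc by (rule scalars_superalgebra)
interpretation B: superalgebra S E by (rule ext_superalgebra[OF A])
interpretation TB: superalgebra S "tensor_superalg S E E"
  by (rule tensor_superalg_superalgebra[OF ext_superalgebra[OF A] ext_superalgebra[OF A]])

lemma embedding_map: "module_map R A (restrict_scalars \<phi> E) em"
  by (rule alg_hom_map[OF ext_embedding_alg_hom[OF A]])

lemma embedding_closed [simp]: "a \<in> carrier A \<Longrightarrow> em a \<in> carrier E"
  using module_map_closed[OF embedding_map] by (simp add: restrict_scalars_simps)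

lemma BB_module: "module S BB"
  by (rule tensor_module_module[OF B.module_ax B.module_ax])

text \<open>\<open>j\<close> is the canonical map from the tensor square over \<open>R\<close> to
  the one over \<open>S\<close>, and the extended coproduct sends \<open>k \<otimes> a\<close> to
  \<open>k\<close> times the image under \<open>j\<close> of the coproduct of \<open>a\<close>.
  Multiplicativity of \<open>j\<close> holds because the embedding preserves parity and
  \<open>\<phi>\<close> preserves signs.\<close>

lemma ext_coproduct_alg_hom:
  obtains j where "module_map R (tensor_module R A A) (restrict_scalars \<phi> BB) j"
    and "\<And>a b. a \<in> carrier A \<Longrightarrow> b \<in> carrier A \<Longrightarrow> j (tens R A A a b) = tens S E E (em a) (em b)"
    and "alg_hom S E (tensor_superalg S E E) (coproduct (ext_superbialg R S \<phi> A))"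
    and "\<And>a. a \<in> carrier A \<Longrightarrow> coproduct (ext_superbialg R S \<phi> A) (em a) = j (coproduct A a)"
proof -
  interpret BB: module S BB by (rule BB_module)
  note Rm = restrict_scalars_module[OF BB_module]
  let ?RB = "restrict_scalars \<phi> BB"
  let ?h = "\<lambda>k. (\<lambda>(c, d). k \<odot>\<^bsub>BB\<^esub> tens S E E (em c) (em d))"
  have bil: "bilinear_map R A A ?RB (?h k)" if k: "k \<in> carrier S" for k
  proof -
    have "module_map S E BB (\<lambda>b. k \<odot>\<^bsub>BB\<^esub> tens S E E b c)" "module_map S E BB (\<lambda>b. k \<odot>\<^bsub>BB\<^esub> tens S E E c b)"
      if "c \<in> carrier E" for c
      using k that by (auto intro!: module_map_scale BB_module tens_map_left tens_map_right B.module_ax)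
    then show ?thesis
      by (auto intro!: bilinear_mapI module_map_comp[OF embedding_map restrict_scalars_map])
  qed
  define j where "j = tens_lift R ?RB (?h \<one>\<^bsub>S\<^esub>)"
  note h1 = bil[OF S.one_closed]
  have jm: "module_map R (tensor_module R A A) ?RB j"
    unfolding j_def by (rule tens_lift_map[OF A.module_ax A.module_ax Rm h1])
  have jt: "j (tens R A A a b) = tens S E E (em a) (em b)" if "a \<in> carrier A" "b \<in> carrier A" for a b
    using tens_lift_tens[OF A.module_ax A.module_ax Rm h1 that] that tens_closed[OF B.module_ax B.module_ax]
    by (simp add: j_def)
  \<comment> \<open>The inner lift in the definition of the extended coproduct already contains the
    scalar \<open>k\<close>; it equals \<open>k\<close> times the lift for
    \<open>k = 1\<close>.\<close>
  have jk: "tens_lift R ?RB (?h k) t = k \<odot>\<^bsub>BB\<^esub> j t" if k: "k \<in> carrier S" and t: "t \<in> carrier (tensor_module R A A)" for k t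
  proof (rule tensor_map_eq[OF A.module_ax A.module_ax tens_lift_map[OF A.module_ax A.module_ax Rm bil[OF k]] _ _ t])
    have "module_map S BB BB (\<lambda>x. k \<odot>\<^bsub>BB\<^esub> x)" by (rule module_map_scale[OF module_map_id BB_module k])
    then show "module_map R (tensor_module R A A) ?RB (\<lambda>t. k \<odot>\<^bsub>BB\<^esub> j t)"
      by (rule module_map_comp[OF jm restrict_scalars_map])
    show "tens_lift R ?RB (?h k) (tens R A A a b) = k \<odot>\<^bsub>BB\<^esub> j (tens R A A a b)"
      if "a \<in> carrier A" "b \<in> carrier A" for a b
      using tens_lift_tens[OF A.module_ax A.module_ax Rm bil[OF k] that] that by (simp add: jt)
  qed
  note RT = restrict_scalars_assoc_algebra[OF TB.assoc_algebra]
  have jh: "alg_hom R (tensor_superalg R A A) (restrict_scalars \<phi> (tensor_superalg S E E)) j"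
  proof (rule tensor_alg_homI[OF A A RT])
    show "module_map R (tensor_module R A A) (restrict_scalars \<phi> (tensor_superalg S E E)) j"
      using jm by (simp add: module_map_def restrict_scalars_simps tensor_superalg_simps(1-4))
    show "j (tens R A A \<one>\<^bsub>A\<^esub> \<one>\<^bsub>A\<^esub>) = \<one>\<^bsub>restrict_scalars \<phi> (tensor_superalg S E E)\<^esub>"
      using alg_hom_one[OF ext_embedding_alg_hom[OF A]]
      by (simp add: jt restrict_scalars_simps tensor_superalg_simps(5))
    fix a b c d s t u v
    assume ab: "a \<in> part A s" "b \<in> part A t" "c \<in> part A u" "d \<in> part A v"
    note cl = ab[THEN A.part_closed]
    have im: "em (x \<otimes>\<^bsub>A\<^esub> y) = em x \<otimes>\<^bsub>E\<^esub> em y" if "x \<in> carrier A" "y \<in> carrier A" for x y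
      using alg_hom_mult[OF ext_embedding_alg_hom[OF A] that] by (simp add: restrict_scalars_simps)
    show "j (tens R A A a b) \<otimes>\<^bsub>restrict_scalars \<phi> (tensor_superalg S E E)\<^esub> j (tens R A A c d) =
        parity_sign R (t * u) \<odot>\<^bsub>restrict_scalars \<phi> (tensor_superalg S E E)\<^esub>
          j (tens R A A (a \<otimes>\<^bsub>A\<^esub> c) (b \<otimes>\<^bsub>A\<^esub> d))"
      using cl tensor_mult_maps(2)[OF B.superalgebra_axioms B.superalgebra_axioms embedding_closed
          ext_embedding_part[OF A ab(2)] ext_embedding_part[OF A ab(3)] embedding_closed, of a d]
      by (simp add: jt restrict_scalars_simps im parity_sign_ring_hom tensor_superalg_simps(4))
  qed
  let ?C = "coproduct (ext_superbialg R S \<phi> A)"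
  let ?\<psi> = "\<lambda>a. j (coproduct A a)"
  have \<psi>: "alg_hom R A (restrict_scalars \<phi> (tensor_superalg S E E)) ?\<psi>"
    by (rule alg_hom_comp[OF superalg_hom_alg[OF D] jh])
  have psim: "module_map R A ?RB ?\<psi>"
    using alg_hom_map[OF \<psi>] by (simp add: module_map_def restrict_scalars_simps tensor_superalg_simps(1-4))
  have Dc: "coproduct A a \<in> carrier (tensor_module R A A)" if "a \<in> carrier A" for a
    using module_map_closed[OF superalg_hom_map[OF D] that] by (simp add: tensor_superalg_simps(1))
  let ?H = "\<lambda>(k, a). tens_lift R ?RB (?h k) (coproduct A a)"
  have C: "?C = tens_lift R ?RB ?H"
    by (simp add: ext_superbialg_def Let_def)
  have H: "bilinear_map R Sc A ?RB ?H"
  proof -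
    have "bilinear_map R Sc A ?RB (\<lambda>(k, a). k \<odot>\<^bsub>BB\<^esub> ?\<psi> a)"
      by (rule ext_lift_bilinear[OF A BB_module psim])
    moreover have "?H (k, a) = k \<odot>\<^bsub>BB\<^esub> ?\<psi> a" if "k \<in> carrier Sc" "a \<in> carrier A" for k a
      using that Dc by (simp add: jk ring_superalg_simps(1))
    ultimately show ?thesis
      by (subst bilinear_map_cong[OF S'.module_ax A.module_ax]) auto
  qed
  have Cot: "?C (tens R Sc A k a) = k \<odot>\<^bsub>BB\<^esub> ?\<psi> a" if "k \<in> carrier S" "a \<in> carrier A" for k a
    using tens_lift_tens[OF S'.module_ax A.module_ax Rm H, of k a] that Dc
    by (simp add: C jk ring_superalg_simps(1))
  have "alg_hom S E (tensor_superalg S E E) ?C"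
  proof (rule ext_alg_homI[OF A TB.assoc_algebra \<psi>])
    show "module_map R (tensor_module R Sc A) (restrict_scalars \<phi> (tensor_superalg S E E)) ?C"
      using tens_lift_map[OF S'.module_ax A.module_ax Rm H]
      by (simp add: C module_map_def restrict_scalars_simps tensor_superalg_simps(1-4))
    show "?C (tens R Sc A k a) = k \<odot>\<^bsub>tensor_superalg S E E\<^esub> ?\<psi> a" if "k \<in> carrier S" "a \<in> carrier A" for k a
      using Cot that by (simp add: tensor_superalg_simps(4))
  qed
  moreover have "?C (em a) = j (coproduct A a)" if "a \<in> carrier A" for a
    using Cot[of "\<one>\<^bsub>S\<^esub>" a] that module_map_closed[OF psim that] by (simp add: restrict_scalars_simps)
  ultimately show ?thesis using that[OF jm jt] by blast
qed

lemma ext_counit_alg_hom: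
  "alg_hom S E (ring_superalg id S) (counit (ext_superbialg R S \<phi> A))"
  "a \<in> carrier A \<Longrightarrow> counit (ext_superbialg R S \<phi> A) (em a) = \<phi> (counit A a)"
proof -
  let ?M = "ring_superalg id S :: ('s, 's) superalg"
  have id: "id \<in> ring_hom S S" by (simp add: ring_hom_def)
  interpret M: superalgebra S ?M by (rule ring_superalg_superalgebra[OF S S id])
  let ?\<psi> = "\<lambda>a. \<phi> (counit A a)"
  have ec: "counit A a \<in> carrier R" if "a \<in> carrier A" for a
    using module_map_closed[OF superalg_hom_map[OF e] that] by (simp add: ring_superalg_simps(1))
  have \<psi>: "alg_hom R A (restrict_scalars \<phi> ?M) ?\<psi>"
    using superalg_hom_alg[OF e] ec
    by (simp add: alg_hom_def module_map_def restrict_scalars_simps ring_superalg_simps Pi_iff)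
  note bil = ext_lift_bilinear[OF A M.module_ax alg_hom_map[OF \<psi>]]
  note Rm = restrict_scalars_module[OF M.module_ax]
  let ?C = "counit (ext_superbialg R S \<phi> A)"
  \<comment> \<open>\<open>ring_superalg \<phi> S\<close> and the restriction along
    \<open>\<phi>\<close> of \<open>S\<close> over itself are the same \<open>R\<close>-module, so
    the lift in the definition of the counit has the form required by
    \<open>ext_alg_homI\<close>.\<close>
  have same: "same_module (restrict_scalars \<phi> ?M) Sc"
    by (simp add: same_module_def restrict_scalars_simps ring_superalg_simps fun_eq_iff)
  have C: "?C = tens_lift R (restrict_scalars \<phi> ?M) (\<lambda>(k, a). k \<odot>\<^bsub>?M\<^esub> ?\<psi> a)"
    unfolding same_module_tens_lift[OF same] by (simp add: ext_superbialg_def Let_def ring_superalg_simps)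
  have Cot: "?C (tens R Sc A k a) = k \<odot>\<^bsub>?M\<^esub> ?\<psi> a" if "k \<in> carrier S" "a \<in> carrier A" for k a
    using tens_lift_tens[OF S'.module_ax A.module_ax Rm bil, of k a] that
    by (simp add: C ring_superalg_simps(1))
  show "alg_hom S E ?M ?C"
    by (rule ext_alg_homI[OF A M.assoc_algebra \<psi> tens_lift_map[OF S'.module_ax A.module_ax Rm bil, folded C] Cot])
  show "a \<in> carrier A \<Longrightarrow> ?C (em a) = \<phi> (counit A a)"
    using Cot[of "\<one>\<^bsub>S\<^esub>" a] ec by (simp add: ring_superalg_simps)
qed

end

end

section \<open>Base change for quantum supermatrices\<close>

locale qmat_base_change = qmat_parameters p q q' Q
  for p :: "'n::{finite,linorder} \<Rightarrow> bit" and q q' :: "'r::comm_ring_1" and Q :: "'n \<Rightarrow> 'n \<Rightarrow> 'r" +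
  fixes \<phi> :: "'r \<Rightarrow> 's::comm_ring_1"
  assumes hom: "\<phi> \<in> ring_hom rta rta"
begin

lemma hom_simps [simp]:
  "\<phi> (r + s) = \<phi> r + \<phi> s" "\<phi> (r * s) = \<phi> r * \<phi> s" "\<phi> 1 = 1" "\<phi> 0 = 0"
  "\<phi> (- r) = - \<phi> r" "\<phi> (r - s) = \<phi> r - \<phi> s"
proof -
  show add: "\<phi> (r + s) = \<phi> r + \<phi> s" for r s using ring_hom_add[OF hom, of r s] by simp
  show "\<phi> (r * s) = \<phi> r * \<phi> s" using ring_hom_mult[OF hom, of r s] by simp
  show "\<phi> 1 = 1" using ring_hom_one[OF hom] by simp
  show zero: "\<phi> 0 = 0" using add[of 0 0] by simp
  show minus: "\<phi> (- r) = - \<phi> r" for r using add[of r "- r"] zero by (simp add: eq_neg_iff_add_eq_0 add.commute)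
  show "\<phi> (r - s) = \<phi> r - \<phi> s" using add[of r "- s"] minus by simp
qed

lemma hom_bsign [simp]: "\<phi> (bsign s) = bsign s"
  by (simp add: bsign_def)

lemma hom_bpow [simp]: "\<phi> (bpow s r t) = bpow s (\<phi> r) (\<phi> t)"
  by (simp add: bpow_def)

sublocale ext: qmat_parameters p "\<phi> q" "\<phi> q'" "\<lambda>i j. \<phi> (Q i j)"
  by unfold_locales (simp_all add: q_inv Q_inv flip: hom_simps(2))

text \<open>Scalars act on the restriction through \<open>\<phi>\<close>, which turns the
  coefficients into their images; the same equations are thus read over either ring.\<close>

lemma qmat_equations_restrict:
  "qmat_equations (restrict_scalars \<phi> M) y \<longleftrightarrow> ext.qmat_equations M y"
  by (simp add: qmat_equations_def ext.qmat_equations_def restrict_scalars_simps)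

section \<open>The extension is presented by the images of the parameters\<close>

context
  fixes A :: "('r, 'a, 'l) superbialg_scheme" and x
  assumes A: "qmat_superbialgebra rta p q Q A x"
begin

interpretation A: superalgebra rta A by (rule qmat_superbialgebraD(1)[OF A])

private abbreviation (input) "B \<equiv> ext_superalg rta rta \<phi> A"
private abbreviation (input) "C \<equiv> ext_superbialg rta rta \<phi> A"
private abbreviation (input) "i \<equiv> tens rta (ring_superalg \<phi> rta) A 1"
private abbreviation (input) "y \<equiv> \<lambda>ij. tens rta (ring_superalg \<phi> rta) A 1 (x ij)"

lemmas scalars = cring_rta cring_rta hom

interpretation B: superalgebra rta B
  by (rule ext_superalgebra[OF scalars A.superalgebra_axioms])

lemma x_mem [simp]: "x ij \<in> carrier A"
  using presented_byD(1)[OF qmat_superbialgebraD(2)[OF A]] by blast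

lemma i_hom: "alg_hom rta A (restrict_scalars \<phi> B) i"
  using ext_embedding_alg_hom[OF scalars A.superalgebra_axioms] by simp

lemma restrict_B: "assoc_algebra rta (restrict_scalars \<phi> B)"
  by (rule restrict_scalars_assoc_algebra[OF scalars B.assoc_algebra])

lemma i_mem: "a \<in> carrier A \<Longrightarrow> i a \<in> carrier B"
  using module_map_closed[OF alg_hom_map[OF i_hom]] by (simp add: restrict_scalars_simps)

lemma y_range: "range y \<subseteq> carrier B"
  using i_mem by auto

text \<open>Applying \<open>\<phi>\<close> to the coefficients gives such a \<open>v\<close>. Its
  existence is what surjectivity of evaluation at \<open>y\<close> requires.\<close>

lemma i_free_eval:
  assumes u: "u \<in> carrier (free_algebra rta UNIV)"
  shows "\<exists>v\<in>carrier (free_algebra rta UNIV). i (free_eval rta A x u) = free_eval rta B y v"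
proof -
  have u: "u \<in> carrier (free_module rta (lists UNIV))" using u by (simp add: free_algebra_simps)
  interpret F: assoc_algebra rta "free_algebra rta UNIV :: ('s, ('n \<times> 'n) list \<Rightarrow> 's) module"
    by (rule cring.free_algebra_assoc_algebra[OF cring_rta])
  interpret RB: assoc_algebra rta "restrict_scalars \<phi> B" by (rule restrict_B)
  have xr: "range x \<subseteq> carrier A" by auto
  have yr: "range y \<subseteq> carrier (restrict_scalars \<phi> B)" using y_range by (simp add: restrict_scalars_simps)
  note EA = free_eval_map[OF A.assoc_algebra xr]
  note EB = alg_hom_map[OF free_eval_alg_hom[OF B.assoc_algebra y_range]]
  note im = module_map_comp[OF EA alg_hom_map[OF i_hom]]
  have ic: "i (free_eval rta A x w) \<in> carrier B" if "w \<in> carrier (free_module rta (lists UNIV))" for w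
    using module_map_closed[OF im that] by (simp add: restrict_scalars_simps)
  from u show ?thesis
  proof (induction rule: cring.free_module_induct[OF cring_rta, consumes 1, case_names zero add smult])
    case zero
    have "i (free_eval rta A x \<zero>\<^bsub>free_module rta (lists UNIV)\<^esub>) = \<zero>\<^bsub>B\<^esub>"
      using module_map_zero[OF im cring.free_module_module[OF cring_rta] RB.module_ax]
      by (simp add: restrict_scalars_simps)
    also have "\<dots> = free_eval rta B y \<zero>\<^bsub>free_algebra rta UNIV\<^esub>"
      using module_map_zero[OF EB F.module_ax B.module_ax] by simp
    finally show ?case by blast
  next
    case (add f g)
    then obtain v w where vw: "v \<in> carrier (free_algebra rta UNIV)" "i (free_eval rta A x f) = free_eval rta B y v"
      "w \<in> carrier (free_algebra rta UNIV)" "i (free_eval rta A x g) = free_eval rta B y w" by blast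
    have "i (free_eval rta A x (f \<oplus>\<^bsub>free_module rta (lists UNIV)\<^esub> g)) =
        i (free_eval rta A x f) \<oplus>\<^bsub>B\<^esub> i (free_eval rta A x g)"
      using module_map_add[OF im add(1,2)] by (simp add: restrict_scalars_simps)
    also have "\<dots> = free_eval rta B y (v \<oplus>\<^bsub>free_algebra rta UNIV\<^esub> w)"
      using vw by (simp add: module_map_add[OF EB])
    finally show ?case using vw F.M.a_closed by blast
  next
    case (smult r w)
    have b: "basis_elt rta w \<in> carrier (free_algebra rta (UNIV :: ('n \<times> 'n) set))"
      for w :: "('n \<times> 'n) list"
      using cring.basis_elt_closed[OF cring_rta, of w "lists UNIV"] by (simp add: free_algebra_simps)
    have b': "basis_elt rta w \<in> carrier (free_module rta (lists UNIV))"
      by (rule cring.basis_elt_closed[OF cring_rta]) simp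
    have "i (free_eval rta A x (basis_elt rta w)) = free_eval rta (restrict_scalars \<phi> B) y (basis_elt rta w)"
      using alg_hom_free_eval[OF A.assoc_algebra xr restrict_B i_hom] b' by (simp add: free_algebra_simps)
    also have "\<dots> = free_eval rta B y (basis_elt rta w)"
      using free_eval_basis[OF restrict_B yr, of w] free_eval_basis[OF B.assoc_algebra y_range, of w]
      by (simp add: restrict_scalars_simps)
    finally have w: "i (free_eval rta A x (basis_elt rta w)) = free_eval rta B y (basis_elt rta w)" .
    have "i (free_eval rta A x (r \<odot>\<^bsub>free_module rta (lists UNIV)\<^esub> basis_elt rta w)) =
        \<phi> r \<odot>\<^bsub>B\<^esub> i (free_eval rta A x (basis_elt rta w))"
      using module_map_smult[OF im smult(1) b'] by (simp add: restrict_scalars_simps)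
    also have "\<dots> = free_eval rta B y (\<phi> r \<odot>\<^bsub>free_algebra rta UNIV\<^esub> basis_elt rta w)"
      unfolding w using module_map_smult[OF EB _ b] by simp
    finally show ?case using F.smult_closed[OF _ b] by (metis UNIV_I rta_simps(1))
  qed
qed

lemma ext_equations: "ext.qmat_equations B y"
proof -
  note eqs = qmat_superbialgebraD(8)[OF A]
  note h = i_hom and m = alg_hom_map[OF i_hom]
  have "qmat_equations (restrict_scalars \<phi> B) y"
    unfolding qmat_equations_def
    using qmat_equationsD[OF eqs] module_map_zero[OF m A.module_ax assoc_algebra.module_ax[OF restrict_B]]
    by (auto simp: A.smult_closed module_map_smult[OF m, symmetric] module_map_add[OF m, symmetric]
        alg_hom_mult[OF h, symmetric])
  then show ?thesis by (simp add: qmat_equations_restrict)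
qed

lemma ext_presented: "presented_by rta B UNIV y (qmat_relations rta p (\<phi> q) (\<lambda>i j. \<phi> (Q i j)))"
proof (rule presented_byI[OF y_range])
  let ?rels = "qmat_relations rta p (\<phi> q) (\<lambda>i j. \<phi> (Q i j))"
  let ?F = "free_algebra rta UNIV :: ('s, ('n \<times> 'n) list \<Rightarrow> 's) module"
  interpret F: assoc_algebra rta ?F by (rule cring.free_algebra_assoc_algebra[OF cring_rta])
  note EB = alg_hom_map[OF free_eval_alg_hom[OF B.assoc_algebra y_range]]
  show "free_eval rta B y u \<in> carrier B" if "u \<in> carrier ?F" for u
    by (rule module_map_closed[OF EB that])
  show "\<exists>u\<in>carrier ?F. b = free_eval rta B y u" if b: "b \<in> carrier B" for b
    using b[unfolded ext_superalg_simps(1)[OF scalars A.superalgebra_axioms]]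
  proof (induction rule: ext_induct[OF scalars A.superalgebra_axioms, consumes 1, case_names ot add])
    \<comment> \<open>\<open>k \<otimes> a\<close> is \<open>k\<close> times the image of
      \<open>a\<close>, and a polynomial representing \<open>a\<close> over the small ring is
      transported by \<open>i_free_eval\<close>.\<close>
    case (ot k a)
    obtain u where u: "u \<in> carrier (free_algebra rta UNIV)" "a = free_eval rta A x u"
      using presented_byD(2)[OF qmat_superbialgebraD(2)[OF A] ot(2)] by blast
    obtain v where v: "v \<in> carrier ?F" "i a = free_eval rta B y v" using i_free_eval[OF u(1)] u(2) by blast
    have "tens rta (ring_superalg \<phi> rta) A k a = k \<odot>\<^bsub>B\<^esub> i a"
      using ext_smult_ot[OF scalars A.superalgebra_axioms, of k 1 a] ot(2) by simp
    also have "\<dots> = free_eval rta B y (k \<odot>\<^bsub>?F\<^esub> v)"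
      using v module_map_smult[OF EB, of k v] by simp
    finally show ?case using v F.smult_closed[of k v] by auto
  next
    case (add t u)
    then obtain v w where vw: "v \<in> carrier ?F" "t = free_eval rta B y v"
      "w \<in> carrier ?F" "u = free_eval rta B y w" by blast
    then have "t \<oplus>\<^bsub>B\<^esub> u = free_eval rta B y (v \<oplus>\<^bsub>?F\<^esub> w)" by (simp add: module_map_add[OF EB])
    then show ?case
      using vw F.M.a_closed[of v w] ext_superalg_simps(3)[OF scalars A.superalgebra_axioms] by auto
  qed
  let ?K = "{u \<in> carrier ?F. free_eval rta B y u = \<zero>\<^bsub>B\<^esub>}"
  let ?I = "genideal ?F {l \<ominus>\<^bsub>?F\<^esub> r | l r. (l, r) \<in> ?rels}"
  show "?K = ?I"
  proof
    show "?I \<subseteq> ?K"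
      using satisfies_iff[OF ext.qmat_relations_closed B.assoc_algebra y_range]
        ext.satisfies_qmat_relations_iff[OF B.assoc_algebra y_range] ext_equations by blast
    obtain M :: "('s, (('n \<times> 'n) list \<Rightarrow> 's) set) superalg" and z where
      M: "superalgebra rta M" "presented_by rta M UNIV z ?rels"
      using presented_superalgebra_exists[OF cring_rta ext.qmat_relations_homogeneous] by fastforce
    interpret M: superalgebra rta M by (rule M(1))
    note RM = restrict_scalars_assoc_algebra[OF scalars M.assoc_algebra]
    note zr = presented_byD(1)[OF M(2)]
    have zr': "range z \<subseteq> carrier (restrict_scalars \<phi> M)" using zr by (simp add: restrict_scalars_simps)
    have "ext.qmat_equations M z"
      using ext.satisfies_qmat_relations_iff[OF M.assoc_algebra zr]
        presented_by_satisfies[OF ext.qmat_relations_closed M.assoc_algebra M(2)] by blast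
    then have "satisfies rta (restrict_scalars \<phi> M) z (qmat_relations rta p q Q)"
      using satisfies_qmat_relations_iff[OF RM zr'] qmat_equations_restrict by blast
    then obtain \<psi> where \<psi>: "alg_hom rta A (restrict_scalars \<phi> M) \<psi>" "\<And>ij. \<psi> (x ij) = z ij"
      using presented_by_universal[OF qmat_relations_closed A.assoc_algebra qmat_superbialgebraD(2)[OF A] RM zr']
      by (metis UNIV_I)
    obtain L where L: "alg_hom rta B M L" "\<And>a. a \<in> carrier A \<Longrightarrow> L (i a) = \<psi> a"
      using ext_alg_hom_exists[OF scalars A.superalgebra_axioms M.assoc_algebra \<psi>(1)] by (metis rta_simps(4))
    show "?K \<subseteq> ?I"
    proof
      fix u assume u: "u \<in> ?K"
      \<comment> \<open>\<open>L\<close> carries evaluation at \<open>y\<close> to evaluation at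
        \<open>z\<close>, and the kernel of the latter is the ideal of relations by the choice of
        \<open>M\<close>.\<close>
      then have uc: "u \<in> carrier ?F" and "L (free_eval rta B y u) = \<zero>\<^bsub>M\<^esub>"
        using module_map_zero[OF alg_hom_map[OF L(1)] B.module_ax M.module_ax] by auto
      moreover have "L (free_eval rta B y u) = free_eval rta M z u"
        using alg_hom_free_eval[OF B.assoc_algebra y_range M.assoc_algebra L(1) uc] by (simp add: L(2) \<psi>(2))
      ultimately show "u \<in> ?I" using presented_byD(3)[OF M(2)] u by auto
    qed
  qed
qed

lemma ext_qmat_superbialgebra:
  "qmat_superbialgebra rta p (\<phi> q) (\<lambda>i j. \<phi> (Q i j)) C y"
proof -
  have same: "same_superalg B C"
    by (simp add: same_superalg_def same_algebra_def same_module_def ext_superbialg_def Let_def)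
  then have sm: "same_algebra B C" "same_module B C" by (auto simp: same_superalg_def same_algebra_def)
  have C: "superalgebra rta C" by (rule same_superalg_superalgebra[OF same B.superalgebra_axioms])
  have pres: "presented_by rta C UNIV y (qmat_relations rta p (\<phi> q) (\<lambda>i j. \<phi> (Q i j)))"
    by (rule same_algebra_presented_by[OF sm(1) ext_presented])
  have yB: "y (i, j) \<in> part B (p i + p j)" for i j
    using ext_embedding_part[OF scalars A.superalgebra_axioms qmat_superbialgebraD(3)[OF A]] by simp
  have parts: "part C = part B" using same by (simp add: same_superalg_def)
  have T: "tensor_superalg rta C C = tensor_superalg rta B B"
    using same_superalg_tensor[OF same same] by metis
  have toC: "alg_hom rta C M f" if "alg_hom rta B M f" for M :: "('s, 'z1, 'z2) superalg_scheme" and f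
    using that sm by (simp add: alg_hom_def module_map_def same_algebra_def same_module_def)
  note D = qmat_superbialgebraD(4)[OF A] and e = qmat_superbialgebraD(5)[OF A]
  note TB = tensor_superalg_superalgebra[OF B.superalgebra_axioms B.superalgebra_axioms]
  interpret TB: superalgebra rta "tensor_superalg rta B B" by (rule TB)
  have gen: "ext.coproduct_gen C y = ext.coproduct_gen B y"
    by (simp add: ext.coproduct_gen_def same_module_tensor_module[OF same_module_sym[OF sm(2)] same_module_sym[OF sm(2)]]
        same_module_tens[OF same_module_sym[OF sm(2)] same_module_sym[OF sm(2)]])
  have yeq: "ext.qmat_equations B y" by (rule ext_equations)
  let ?BB = "tensor_module rta B B"
  have BB: "module rta ?BB" by (rule tensor_module_module[OF B.module_ax B.module_ax])
  obtain j where j: "module_map rta (tensor_module rta A A) (restrict_scalars \<phi> ?BB) j"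
    "\<And>a b. a \<in> carrier A \<Longrightarrow> b \<in> carrier A \<Longrightarrow> j (tens rta A A a b) = tens rta B B (i a) (i b)"
    "alg_hom rta B (tensor_superalg rta B B) (coproduct C)"
    "\<And>a. a \<in> carrier A \<Longrightarrow> coproduct C (i a) = j (coproduct A a)"
    using ext_coproduct_alg_hom[OF scalars A.superalgebra_axioms D e] by (metis rta_simps(4))
  \<comment> \<open>\<open>j\<close> sends the coproduct sum over the small ring to the
    corresponding sum over the large one, since \<open>\<phi>\<close> fixes the signs.\<close>
  have Dy: "coproduct C (y (h, k)) = ext.coproduct_gen C y (h, k)" for h k
  proof -
    have "coproduct C (y (h, k)) = j (coproduct_gen A x (h, k))"
      by (simp add: j(4) qmat_superbialgebraD(6)[OF A])
    also have "\<dots> = ext.coproduct_gen B y (h, k)"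
      unfolding coproduct_gen_image[OF A.module_ax x_mem restrict_scalars_module[OF scalars BB] j(1)]
      by (simp add: j(2) restrict_scalars_finsum restrict_scalars_simps ext.coproduct_gen_def)
    finally show ?thesis by (simp add: gen)
  qed
  note ce = ext_counit_alg_hom[OF scalars A.superalgebra_axioms D e]
  have I: "superalgebra rta (ring_superalg id rta :: ('s, 's) superalg)"
    by (rule ring_superalg_superalgebra[OF cring_rta cring_rta]) (simp add: ring_hom_def)
  have ey: "counit C (y (h, k)) = (if h = k then 1 else 0)" for h k
    using ce(2)[OF x_mem] qmat_superbialgebraD(7)[OF A] by simp
  show ?thesis
  proof (rule ext.qmat_superbialgebraI[OF C pres])
    show yC: "y (i, j) \<in> part C (p i + p j)" for i j using yB by (simp add: parts)
    show "coproduct C \<in> superalg_hom rta C (tensor_superalg rta C C)"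
      unfolding T
    proof (rule alg_hom_superalg_hom[OF C pres TB toC[OF j(3)], where d = deg])
      show "y ij \<in> part C (deg ij)" for ij using yC by (cases ij) simp
      show "coproduct C (y ij) \<in> part (tensor_superalg rta B B) (deg ij)" for ij
        using ext.coproduct_gen_part[OF B.superalgebra_axioms yB yeq] by (cases ij) (simp add: Dy gen)
    qed
    show "counit C \<in> superalg_hom rta C (ring_superalg id rta)"
    proof (rule alg_hom_superalg_hom[OF C pres I toC[OF ce(1)], where d = deg])
      show "y ij \<in> part C (deg ij)" for ij using yC by (cases ij) simp
      show "counit C (y ij) \<in> part (ring_superalg id rta) (deg ij)" for ij
        by (cases ij) (auto simp: ey ring_superalg_simps)
    qed
    show "coproduct C (y ij) = ext.coproduct_gen C y ij" for ij using Dy by (cases ij) simp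
  qed (rule ey)
qed

end

end

section \<open>The multiparameters\<close>

lemma laurent_var_mult: "laurent_var v d * laurent_var v e = (laurent_var v (d + e) :: ('n::linorder, 'k::field) laurent)"
  by (simp add: laurent_var_def mult_single single_add)

lemma laurent_var_zero: "laurent_var v 0 = (1 :: ('n::linorder, 'k::field) laurent)"
  by (simp add: laurent_var_def)

lemma qij_par_inverse: "qij_par i j * qij_par j i = (1 :: ('n::linorder, 'k::field) laurent)"
  by (auto simp: qij_par_def laurent_var_mult laurent_var_zero)

lemma laurent_incl_hom: "laurent_incl \<in> ring_hom rta rta"
  by (intro ring_hom_memI) (simp_all add: laurent_incl_def One_fract_def)

text \<open>Uniqueness of the superbialgebra means one isomorphism matching the generators;
  \<open>extensional\<close> makes it unique as a function. The second half starts from an arbitrary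
  model \<open>A\<close>, so it does not depend on the one constructed in the first.\<close>

theorem theorem4p3p1:
  fixes p :: "'n::{finite,linorder} \<Rightarrow> bit"
    and q :: "('n, 'k::field_char_0) laurent"
    and Q :: "'n \<Rightarrow> 'n \<Rightarrow> ('n, 'k) laurent"
    and R :: "('n, 'k) laurent ring"
    and K :: "('n, 'k) laurent fract ring"
    and \<iota> :: "('n, 'k) laurent \<Rightarrow> ('n, 'k) laurent fract"
  assumes n: "CARD('n) \<ge> 2"
    and q: "q = q_par"
    and Q: "Q = qij_par"
    and R: "R = laurent_ring"
    and K: "K = laurent_field"
    and \<iota>: "\<iota> = laurent_incl"
  shows
    "(\<exists>(A :: (('n, 'k) laurent, (('n \<times> 'n) list \<Rightarrow> ('n, 'k) laurent) set) superbialg) x.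
        qmat_superbialgebra R p q Q A x \<and>
        (\<forall>(B :: (('n, 'k) laurent, 'b) superbialg) y.
           qmat_superbialgebra R p q Q B y \<longrightarrow>
           (\<exists>!f. f \<in> superbialg_iso R A B \<and> f \<in> extensional (carrier A) \<and>
                 (\<forall>i j. f (x (i, j)) = y (i, j)))))
     \<and>
     (\<forall>(A :: (('n, 'k) laurent, 'a) superbialg) x.
        qmat_superbialgebra R p q Q A x \<longrightarrow>
        (let A\<^sub>K = ext_superbialg R K \<iota> A;
             x\<^sub>K = (\<lambda>ij. tens R (ring_superalg \<iota> K) A \<one>\<^bsub>K\<^esub> (x ij))
         in qmat_superbialgebra K p (\<iota> q) (\<lambda>i j. \<iota> (Q i j)) A\<^sub>K x\<^sub>K \<and>
            (\<forall>(B :: (('n, 'k) laurent fract, 'b) superbialg) y.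
               qmat_superbialgebra K p (\<iota> q) (\<lambda>i j. \<iota> (Q i j)) B y \<longrightarrow>
               (\<exists>!f. f \<in> superbialg_iso K A\<^sub>K B \<and> f \<in> extensional (carrier A\<^sub>K) \<and>
                     (\<forall>i j. f (x\<^sub>K (i, j)) = y (i, j))))))"
proof -
  \<comment> \<open>The monomial of exponent -1, inverse to \<open>q_par\<close>. Its image under
    \<open>\<iota>\<close> is the inverse over the fraction field.\<close>
  define q' :: "('n, 'k) laurent" where "q' = laurent_var (Abs_qvar None) (- 1)"
  have rings: "R = rta" "K = rta" by (simp_all add: R K laurent_ring_def laurent_field_def)
  interpret qmat_base_change p q q' Q \<iota>
  proof
    show "q * q' = 1" by (simp add: q q_par_def q'_def laurent_var_mult laurent_var_zero)
    show "Q i j * Q j i = 1" for i j by (simp add: Q qij_par_inverse)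
    show "\<iota> \<in> ring_hom rta rta" unfolding \<iota> by (rule laurent_incl_hom)
  qed
  show ?thesis
    unfolding rings Let_def rta_simps
  proof (intro conjI allI impI)
    obtain A :: "(('n, 'k) laurent, (('n \<times> 'n) list \<Rightarrow> ('n, 'k) laurent) set) superbialg" and x
      where A: "qmat_superbialgebra rta p q Q A x"
      using qmat_superbialgebra_exists by blast
    show "\<exists>(A :: (('n, 'k) laurent, (('n \<times> 'n) list \<Rightarrow> ('n, 'k) laurent) set) superbialg) x.
        qmat_superbialgebra rta p q Q A x \<and>
        (\<forall>(B :: (('n, 'k) laurent, 'b) superbialg) y.
           qmat_superbialgebra rta p q Q B y \<longrightarrow>
           (\<exists>!f. f \<in> superbialg_iso rta A B \<and> f \<in> extensional (carrier A) \<and>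
                 (\<forall>i j. f (x (i, j)) = y (i, j))))"
      by (intro exI conjI allI impI) (rule A, rule qmat_superbialgebra_iso_unique[OF A])
  qed (rule ext_qmat_superbialgebra, assumption,
      rule ext.qmat_superbialgebra_iso_unique[OF ext_qmat_superbialgebra])
qed

end
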